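(* Let $K$ be a simplicial complex, let $\varepsilon\ge 0$, and let $\mathcal D,\mathcal L$ be two regularly filtered regular diagrams of CW-complexes over $K$. Suppose that there are $(\varepsilon,K)$-acyclic carriers $F^\varepsilon:\mathcal D\rightrightarrows\mathcal L$ and $G^\varepsilon:\mathcal L\rightrightarrows\mathcal D$, together with shift $(2\varepsilon,K)$-acyclic carriers $I^{2\varepsilon}_{\mathcal D}:\mathcal D\rightrightarrows\mathcal D$ and $I^{2\varepsilon}_{\mathcal L}:\mathcal L\rightrightarrows\mathcal L$, such that $$G^\varepsilon_\tau\circ F^\varepsilon_\tau\subseteq (I^{2\varepsilon}_{\mathcal D})_\tau\quad\text{and}\quad F^\varepsilon_\tau\circ G^\varepsilon_\tau\subseteq (I^{2\varepsilon}_{\mathcal L})_\tau$$ for every simplex $\tau\in K$. Then $$d_I^1\big(E(\mathcal D,K),E(\mathcal L,K)\big)\le\varepsilon .$$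
   Context: Conventions. CW-complexes are finite and regular, with the cell structure part of the data; cells are open cells; homology is cellular homology with coefficients in a fixed field. A regular morphism $f:X\to Y$ is a cellular map such that $\overline{f(a)}$ is a subcomplex of $Y$ for each cell $a$ of $X$. A regularly filtered CW-complex is a functor $X$ from $(\mathbb R,\le)$ to finite regular CW-complexes and regular morphisms, $r\mapsto X_r$, with structure maps $X(r\le s)$. $X[\varepsilon]_r=X_{r+\varepsilon}$, and $\Sigma^\varepsilon X:X\to X[\varepsilon]$ is the shift. $\mathrm{PH}_n(X)$ is the persistence module $r\mapsto H_n(X_r)$. Carriers. A carrier $F:\Phi\rightrightarrows\Gamma$ assigns to each cell $\sigma$ of $\Phi$ a subcomplex $F(\sigma)$ of $\Gamma$ with $F(\tau)\subseteq F(\sigma)$ whenever $\tau$ is a face of $\sigma$; it is acyclic if each $F(\sigma)$ is nonempty and acyclic (homology of a point). A chain map $w:C_*(\Phi)\to C_*(\Gamma)$ is carried by $F$ if all cells occurring in $w(\sigma)$ lie in $F(\sigma)$, for each cell $\sigma$. $F\subseteq G$ means $F(\sigma)\subseteq G(\sigma)$ for all $\sigma$; $(H\circ F)(\sigma)=\bigcup_{\tau\in F(\sigma)}H(\tau)$; for a regular morphism $f$, $F(f(\sigma))=\bigcup_{\tau\in\overline{f(\sigma)}}F(\tau)$. An $\varepsilon$-acyclic carrier $F^\varepsilon:X\rightrightarrows Y$ between regularly filtered CW-complexes is a family of acyclic carriers $F^\varepsilon_a:X_a\rightrightarrows Y_{a+\varepsilon}$ such that for all $a\le b$ and cells $c$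 of $X_a$: $Y(a+\varepsilon\le b+\varepsilon)(F^\varepsilon_a(c))\subseteq F^\varepsilon_b(X(a\le b)(c))$ and $F^\varepsilon_b(X(a\le b)(c))$ is acyclic. A shift carrier $I_X^\varepsilon:X\rightrightarrows X$ is an $\varepsilon$-acyclic carrier carrying the chain map of $\Sigma^\varepsilon X$. Diagrams. $K$ is viewed as the poset category of its simplices ($\tau\preceq\sigma$ for faces). A regularly filtered regular diagram over $K$ is a contravariant functor $\mathcal D$ from $K$ to regularly filtered CW-complexes, with maps $\mathcal D(\tau\preceq\sigma):\mathcal D(\sigma)\to\mathcal D(\tau)$. An $(\varepsilon,K)$-acyclic carrier $F^\varepsilon:\mathcal D\rightrightarrows\mathcal L$ is a family of $\varepsilon$-acyclic carriers $F_\sigma^\varepsilon:\mathcal D(\sigma)\rightrightarrows\mathcal L(\sigma)$, $\sigma\in K$, such that for all $\tau\preceq\sigma$ and cells $c\in\mathcal D(\sigma)$: $\mathcal L(\tau\preceq\sigma)(F^\varepsilon_\sigma(c))\subseteq F^\varepsilon_\tau(\mathcal D(\tau\preceq\sigma)(c))$, and $F^\varepsilon_\tau(\mathcal D(\tau\preceq\sigma)\Sigma^r\mathcal D(\sigma)(c))$ is acyclic for all $r\ge0$. A shift $(2\varepsilon,K)$-acyclic carrier $I:\mathcal D\rightrightarrows\mathcal D$ is a $(2\varepsilon,K)$-acyclic carrier all of whose components $I_\sigma$ are shift carriers (carry $\Sigma^{2\varepsilon}\mathcal D(\sigma)$). Spectral sequences. $E(\mathcal D,K)=E^*_{*,*}(\mathcal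 D)$ is the functor from $(\mathbb R,\le)$ to spectral sequences sending $r$ to the spectral sequence of the double complex $C_{p,q}(\mathcal D_r)=\bigoplus_{\sigma\in K^p}C^{\rm cell}_q(\mathcal D(\sigma)_r)$ ($K^p$ = set of $p$-simplices) with vertical differential $(-1)^p$ times the cellular differentials and horizontal differential $c\mapsto\sum_i(-1)^i\mathcal D(\sigma_i\prec\sigma)_*(c)$ for $c\in C_q^{\rm cell}(\mathcal D(\sigma)_r)$, $\sigma_i$ the codimension-one faces of $\sigma$; the total complex is filtered by $p$, so $E^1_{p,q}(\mathcal D)=\bigoplus_{\sigma\in K^p}\mathrm{PH}_q(\mathcal D(\sigma))$. For functors $\mathcal A,\mathcal B$ from $(\mathbb R,\le)$ to spectral sequences, an $n$-morphism is a morphism defined on pages $\ge n$ (bigraded maps commuting with differentials and with the structure maps in $\mathbb R$, each page's map being induced in homology by the previous one). $\mathcal A,\mathcal B$ are $(\varepsilon,n)$-interleaved if there are $n$-morphisms $\psi:\mathcal A\to\mathcal B[\varepsilon]$, $\varphi:\mathcal B\to\mathcal A[\varepsilon]$ with $\varphi[\varepsilon]\circ\psi=\Sigma^{2\varepsilon}\mathcal A$ and $\psi[\varepsilon]\circ\varphi=\Sigma^{2\varepsilon}\mathcal B$ on all pages $\ge n$; $d_I^n(\mathcal A,\mathcal B)$ is the infimum of such $\varepsilon$. *)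

theory Defs
  imports
    "HOL-Homology.Homology"
    "HOL-Library.Poly_Mapping"
    "HOL-Library.Extended_Real"
begin

section \<open>Linear algebra over the coefficient field\<close>

text \<open>
  The coefficient field is a type \<open>'k\<close> of class \<open>field\<close>. Vector spaces are modules in the sense of
  \<^locale>\<open>Module.module\<close> over \<open>field_ring\<close>; the record type of modules extends that of rings, and
  its multiplicative components are left unspecified here. The space with basis \<open>S\<close> is the
  space of finitely supported functions \<open>'c \<Rightarrow>\<^sub>0 'k\<close> with support in \<open>S\<close>.
\<close>

definition field_ring :: "'k::field ring" where
  "field_ring = \<lparr>carrier = UNIV, monoid.mult = (*), one = 1, zero = 0, add = (+)\<rparr>"

definition lin_scale :: "'k \<Rightarrow> ('c \<Rightarrow>\<^sub>0 'k) \<Rightarrow> ('c \<Rightarrow>\<^sub>0 'k::field)" where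
  "lin_scale k x = Poly_Mapping.map ((*) k) x"

definition lin_extend :: "('c \<Rightarrow> ('d \<Rightarrow>\<^sub>0 'k)) \<Rightarrow> ('c \<Rightarrow>\<^sub>0 'k) \<Rightarrow> ('d \<Rightarrow>\<^sub>0 'k::field)" where
  "lin_extend \<phi> x =
    (\<Sum>b\<in>Poly_Mapping.keys x. lin_scale (Poly_Mapping.lookup x b) (\<phi> b))"

definition span_on :: "'c set \<Rightarrow> ('c \<Rightarrow>\<^sub>0 'k::field) set" where
  "span_on S = {x. Poly_Mapping.keys x \<subseteq> S}"

definition free_module :: "'c set \<Rightarrow> ('k::field, 'c \<Rightarrow>\<^sub>0 'k) module" where
  "free_module S =
    \<lparr>carrier = span_on S, monoid.mult = undefined, one = undefined,
     zero = 0, add = (+), smult = lin_scale\<rparr>"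

definition field_module :: "('k::field, 'k) module" where
  "field_module =
    \<lparr>carrier = UNIV, monoid.mult = undefined, one = undefined,
     zero = 0, add = (+), smult = (*)\<rparr>"

text \<open>The subquotient \<open>Z / B\<close> of \<open>M\<close>, for subspaces \<open>B \<subseteq> Z\<close>; its elements are cosets of \<open>B\<close>.\<close>

definition subquotient :: "('k, 'e) module \<Rightarrow> 'e set \<Rightarrow> 'e set \<Rightarrow> ('k, 'e set) module" where
  "subquotient M Z B =
    \<lparr>carrier = (\<lambda>x. B +>\<^bsub>M\<^esub> x) ` Z, monoid.mult = undefined, one = undefined,
     zero = B, add = set_add M,
     smult = (\<lambda>k X. \<Union>x\<in>X. B +>\<^bsub>M\<^esub> (k \<odot>\<^bsub>M\<^esub> x))\<rparr>"

text \<open>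
  The map into a quotient of \<open>N\<close> by \<open>B\<close> induced by \<open>f\<close>: whenever it is well defined, all the cosets
  in the union coincide.
\<close>

definition coset_map :: "('k, 'e) module \<Rightarrow> 'e set \<Rightarrow> ('d \<Rightarrow> 'e) \<Rightarrow> 'd set \<Rightarrow> 'e set" where
  "coset_map N B f X = (\<Union>x\<in>X. B +>\<^bsub>N\<^esub> f x)"

definition linear_map :: "('k, 'd) module \<Rightarrow> ('k, 'e) module \<Rightarrow> ('d \<Rightarrow> 'e) \<Rightarrow> bool" where
  "linear_map M N f \<longleftrightarrow>
    f \<in> carrier M \<rightarrow> carrier N \<and>
    (\<forall>x\<in>carrier M. \<forall>y\<in>carrier M. f (x \<oplus>\<^bsub>M\<^esub> y) = f x \<oplus>\<^bsub>N\<^esub> f y) \<and>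
    (\<forall>k. \<forall>x\<in>carrier M. f (k \<odot>\<^bsub>M\<^esub> x) = k \<odot>\<^bsub>N\<^esub> f x)"

definition linear_iso :: "('k, 'd) module \<Rightarrow> ('k, 'e) module \<Rightarrow> ('d \<Rightarrow> 'e) \<Rightarrow> bool" where
  "linear_iso M N f \<longleftrightarrow> linear_map M N f \<and> bij_betw f (carrier M) (carrier N)"


section \<open>Finite regular CW-complexes\<close>

record 'a cw =
  space :: "'a topology"
  cells :: "'a set set"
  cell_dim :: "'a set \<Rightarrow> nat"

definition closed_ball :: "nat \<Rightarrow> (nat \<Rightarrow> real) topology" where
  "closed_ball n = subtopology (Euclidean_space n) {x. (\<Sum>i<n. (x i)\<^sup>2) \<le> 1}"

definition open_ball :: "nat \<Rightarrow> (nat \<Rightarrow> real) set" where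
  "open_ball n = {x \<in> topspace (Euclidean_space n). (\<Sum>i<n. (x i)\<^sup>2) < 1}"

definition skeleton :: "'a cw \<Rightarrow> int \<Rightarrow> 'a set" where
  "skeleton X p = \<Union>{e \<in> cells X. int (cell_dim X e) \<le> p}"

definition cells_of_dim :: "'a cw \<Rightarrow> int \<Rightarrow> 'a set set" where
  "cells_of_dim X p = {e \<in> cells X. int (cell_dim X e) = p}"

abbreviation cell_closure :: "'a cw \<Rightarrow> 'a set \<Rightarrow> 'a set" where
  "cell_closure X e \<equiv> space X closure_of e"

text \<open>
  Regularity is the requirement that the characteristic map \<open>h\<close> be a homeomorphism onto the closed
  cell. For finitely many cells the weak topology condition is automatic.
\<close>

definition regular_cw :: "'a cw \<Rightarrow> bool" where
  "regular_cw X \<longleftrightarrow>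
    Hausdorff_space (space X) \<and> finite (cells X) \<and> pairwise disjnt (cells X) \<and>
    \<Union>(cells X) = topspace (space X) \<and>
    (\<forall>e\<in>cells X.
      (\<exists>h. homeomorphic_map (closed_ball (cell_dim X e))
              (subtopology (space X) (cell_closure X e)) h \<and>
           h ` open_ball (cell_dim X e) = e) \<and>
      cell_closure X e - e \<subseteq> skeleton X (int (cell_dim X e) - 1))"

text \<open>A subcomplex is given by its set of cells; the second condition says that it is closed.\<close>

definition subcomplex :: "'a cw \<Rightarrow> 'a set set \<Rightarrow> bool" where
  "subcomplex X S \<longleftrightarrow> S \<subseteq> cells X \<and> (\<forall>e\<in>S. cell_closure X e \<subseteq> \<Union>S)"

definition regular_morphism :: "'a cw \<Rightarrow> 'b cw \<Rightarrow> ('a \<Rightarrow> 'b) \<Rightarrow> bool" where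
  "regular_morphism X Y f \<longleftrightarrow>
    continuous_map (space X) (space Y) f \<and>
    (\<forall>p. f ` skeleton X p \<subseteq> skeleton Y p) \<and>
    (\<forall>a\<in>cells X. \<exists>S. subcomplex Y S \<and> space Y closure_of (f ` a) = \<Union>S)"

text \<open>The subcomplex \<open>closure (f a)\<close>, and the image of a subcomplex, as sets of cells of \<open>Y\<close>.\<close>

definition cell_image :: "'b cw \<Rightarrow> ('a \<Rightarrow> 'b) \<Rightarrow> 'a set \<Rightarrow> 'b set set" where
  "cell_image Y f a = {t \<in> cells Y. t \<subseteq> space Y closure_of (f ` a)}"

definition subcomplex_image :: "'b cw \<Rightarrow> ('a \<Rightarrow> 'b) \<Rightarrow> 'a set set \<Rightarrow> 'b set set" where
  "subcomplex_image Y f S = (\<Union>a\<in>S. cell_image Y f a)"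


section \<open>Cellular chains\<close>

text \<open>
  The integral cellular chain group \<open>H\<^sub>p(X\<^sup>p, X\<^sup>p\<^sup>-\<^sup>1)\<close> (singular homology) is free on the classes of the
  \<open>p\<close>-cells once every cell \<open>e\<close> is given an orientation, a generator of \<open>H\<^sub>n(closure e, closure e - e)\<close>.
  The cellular chain complex over \<open>'k\<close> is its tensor product with \<open>'k\<close>: chains are linear
  combinations of cells, and boundaries and induced maps are given by the integral matrices with
  respect to these bases. Orientations are arbitrary, except that a point is oriented by the class of
  the constant singular simplex.
\<close>

abbreviation skeleton_top :: "'a cw \<Rightarrow> int \<Rightarrow> 'a topology" where
  "skeleton_top X p \<equiv> subtopology (space X) (skeleton X p)"

abbreviation cell_homology :: "'a cw \<Rightarrow> 'a set \<Rightarrow> 'a chain set monoid" where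
  "cell_homology X e \<equiv>
    relative_homology_group (int (cell_dim X e))
      (subtopology (space X) (cell_closure X e)) (cell_closure X e - e)"

definition cell_group :: "'a cw \<Rightarrow> int \<Rightarrow> 'a chain set monoid" where
  "cell_group X p = relative_homology_group p (skeleton_top X p) (skeleton X (p - 1))"

definition orientation :: "'a cw \<Rightarrow> 'a set \<Rightarrow> 'a chain set" where
  "orientation X e =
    (SOME g. g \<in> carrier (cell_homology X e) \<and>
       carrier (subgroup_generated (cell_homology X e) {g}) = carrier (cell_homology X e) \<and>
       (cell_dim X e = 0 \<longrightarrow>
         (\<exists>x\<in>e. g = homologous_rel_set 0
                       (subtopology (space X) (cell_closure X e)) (cell_closure X e - e)
                       (frag_of (restrict (\<lambda>_. x) (standard_simplex 0))))))"

definition cell_class :: "'a cw \<Rightarrow> 'a set \<Rightarrow> 'a chain set" where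
  "cell_class X e =
    hom_induced (int (cell_dim X e))
      (subtopology (space X) (cell_closure X e)) (cell_closure X e - e)
      (skeleton_top X (int (cell_dim X e))) (skeleton X (int (cell_dim X e) - 1))
      id (orientation X e)"

text \<open>Coordinates with respect to the basis of cell classes.\<close>

definition cell_coord :: "'a cw \<Rightarrow> int \<Rightarrow> 'a chain set \<Rightarrow> 'a set \<Rightarrow> int" where
  "cell_coord X p z =
    (THE m. (\<forall>e. e \<notin> cells_of_dim X p \<longrightarrow> m e = 0) \<and>
       z = finprod (cell_group X p)
             (\<lambda>e. cell_class X e [^]\<^bsub>cell_group X p\<^esub> m e) (cells_of_dim X p))"

text \<open>\<^const>\<open>hom_relboundary\<close> is the connecting map of the triple \<open>(X\<^sup>n, X\<^sup>n\<^sup>-\<^sup>1, X\<^sup>n\<^sup>-\<^sup>2)\<close>.\<close>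

definition incidence :: "'a cw \<Rightarrow> 'a set \<Rightarrow> 'a set \<Rightarrow> int" where
  "incidence X e t =
    (let n = int (cell_dim X e) in
     cell_coord X (n - 1)
       (hom_relboundary n (skeleton_top X n) (skeleton X (n - 1)) (skeleton X (n - 2))
         (cell_class X e)) t)"

definition map_degree :: "'a cw \<Rightarrow> 'b cw \<Rightarrow> ('a \<Rightarrow> 'b) \<Rightarrow> 'a set \<Rightarrow> 'b set \<Rightarrow> int" where
  "map_degree X Y f e t =
    (let n = int (cell_dim X e) in
     cell_coord Y n
       (hom_induced n (skeleton_top X n) (skeleton X (n - 1))
                      (skeleton_top Y n) (skeleton Y (n - 1)) f (cell_class X e)) t)"

definition cell_boundary :: "'a cw \<Rightarrow> 'a set \<Rightarrow> ('a set \<Rightarrow>\<^sub>0 'k::field)" where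
  "cell_boundary X e =
    (\<Sum>t\<in>cells_of_dim X (int (cell_dim X e) - 1).
       Poly_Mapping.single t (of_int (incidence X e t)))"

definition cell_push :: "'a cw \<Rightarrow> 'b cw \<Rightarrow> ('a \<Rightarrow> 'b) \<Rightarrow> 'a set \<Rightarrow> ('b set \<Rightarrow>\<^sub>0 'k::field)" where
  "cell_push X Y f e =
    (\<Sum>t\<in>cells_of_dim Y (int (cell_dim X e)).
       Poly_Mapping.single t (of_int (map_degree X Y f e t)))"

definition cellular_boundary :: "'a cw \<Rightarrow> ('a set \<Rightarrow>\<^sub>0 'k) \<Rightarrow> ('a set \<Rightarrow>\<^sub>0 'k::field)" where
  "cellular_boundary X = lin_extend (cell_boundary X)"

definition cellular_map ::
  "'a cw \<Rightarrow> 'b cw \<Rightarrow> ('a \<Rightarrow> 'b) \<Rightarrow> ('a set \<Rightarrow>\<^sub>0 'k) \<Rightarrow> ('b set \<Rightarrow>\<^sub>0 'k::field)" where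
  "cellular_map X Y f = lin_extend (cell_push X Y f)"

text \<open>Cellular homology of a subcomplex \<open>S\<close> of \<open>X\<close>, in degree \<open>n\<close>.\<close>

definition subcomplex_homology ::
  "'a cw \<Rightarrow> 'a set set \<Rightarrow> int \<Rightarrow> ('k::field, ('a set \<Rightarrow>\<^sub>0 'k) set) module" where
  "subcomplex_homology X S n =
    subquotient (free_module (S \<inter> cells_of_dim X n))
      {x \<in> span_on (S \<inter> cells_of_dim X n). cellular_boundary X x = 0}
      (cellular_boundary X ` span_on (S \<inter> cells_of_dim X (n + 1)))"


section \<open>Carriers\<close>

text \<open>
  Acyclicity depends on the coefficient field, which is passed as the type argument \<open>TYPE('k)\<close>.
\<close>

definition acyclic_subcomplex :: "'k::field itself \<Rightarrow> 'a cw \<Rightarrow> 'a set set \<Rightarrow> bool" where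
  "acyclic_subcomplex _ X S \<longleftrightarrow>
    subcomplex X S \<and> S \<noteq> {} \<and>
    (\<exists>h. linear_iso (subcomplex_homology X S 0 :: ('k, ('a set \<Rightarrow>\<^sub>0 'k) set) module)
            (field_module :: ('k, 'k) module) h) \<and>
    (\<forall>n\<ge>1. carrier (subcomplex_homology X S n :: ('k, ('a set \<Rightarrow>\<^sub>0 'k) set) module) =
      {zero (subcomplex_homology X S n)})"

definition cw_carrier :: "'a cw \<Rightarrow> 'b cw \<Rightarrow> ('a set \<Rightarrow> 'b set set) \<Rightarrow> bool" where
  "cw_carrier X Y F \<longleftrightarrow>
    (\<forall>s\<in>cells X. subcomplex Y (F s)) \<and>
    (\<forall>s\<in>cells X. \<forall>t\<in>cells X. t \<subseteq> cell_closure X s \<longrightarrow> F t \<subseteq> F s)"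

definition acyclic_carrier ::
  "'k::field itself \<Rightarrow> 'a cw \<Rightarrow> 'b cw \<Rightarrow> ('a set \<Rightarrow> 'b set set) \<Rightarrow> bool" where
  "acyclic_carrier k X Y F \<longleftrightarrow>
    cw_carrier X Y F \<and> (\<forall>s\<in>cells X. acyclic_subcomplex k Y (F s))"

definition carried_by ::
  "'a cw \<Rightarrow> (('a set \<Rightarrow>\<^sub>0 'k) \<Rightarrow> ('b set \<Rightarrow>\<^sub>0 'k::field)) \<Rightarrow> ('a set \<Rightarrow> 'b set set) \<Rightarrow> bool" where
  "carried_by X w F \<longleftrightarrow>
    (\<forall>s\<in>cells X. Poly_Mapping.keys (w (Poly_Mapping.single s 1)) \<subseteq> F s)"

text \<open>\<open>F(S)\<close> for a set of cells \<open>S\<close>; thus \<open>F(f(\<sigma>))\<close> is \<open>carrier_apply F (cell_image Y f \<sigma>)\<close>.\<close>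

definition carrier_apply :: "('a set \<Rightarrow> 'b set set) \<Rightarrow> 'a set set \<Rightarrow> 'b set set" where
  "carrier_apply F S = (\<Union>t\<in>S. F t)"

definition carrier_comp ::
  "('b set \<Rightarrow> 'c set set) \<Rightarrow> ('a set \<Rightarrow> 'b set set) \<Rightarrow> 'a set \<Rightarrow> 'c set set" where
  "carrier_comp H F s = carrier_apply H (F s)"


section \<open>Regularly filtered CW-complexes and their carriers\<close>

record 'a filt_cw =
  at_level :: "real \<Rightarrow> 'a cw"
  step :: "real \<Rightarrow> real \<Rightarrow> 'a \<Rightarrow> 'a"

definition regularly_filtered_cw :: "'a filt_cw \<Rightarrow> bool" where
  "regularly_filtered_cw X \<longleftrightarrow>
    (\<forall>r. regular_cw (at_level X r)) \<and>
    (\<forall>r s. r \<le> s \<longrightarrow> regular_morphism (at_level X r) (at_level X s) (step X r s)) \<and>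
    (\<forall>r. \<forall>x\<in>topspace (space (at_level X r)). step X r r x = x) \<and>
    (\<forall>r s t. r \<le> s \<longrightarrow> s \<le> t \<longrightarrow>
      (\<forall>x\<in>topspace (space (at_level X r)). step X s t (step X r s x) = step X r t x))"

definition filt_morphism ::
  "'a filt_cw \<Rightarrow> 'b filt_cw \<Rightarrow> (real \<Rightarrow> 'a \<Rightarrow> 'b) \<Rightarrow> bool" where
  "filt_morphism X Y f \<longleftrightarrow>
    (\<forall>r. regular_morphism (at_level X r) (at_level Y r) (f r)) \<and>
    (\<forall>r s. r \<le> s \<longrightarrow>
      (\<forall>x\<in>topspace (space (at_level X r)). f s (step X r s x) = step Y r s (f r x)))"

definition eps_acyclic_carrier ::
  "'k::field itself \<Rightarrow> real \<Rightarrow> 'a filt_cw \<Rightarrow> 'b filt_cw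
    \<Rightarrow> (real \<Rightarrow> 'a set \<Rightarrow> 'b set set) \<Rightarrow> bool" where
  "eps_acyclic_carrier k \<epsilon> X Y F \<longleftrightarrow>
    (\<forall>a. acyclic_carrier k (at_level X a) (at_level Y (a + \<epsilon>)) (F a)) \<and>
    (\<forall>a b. a \<le> b \<longrightarrow> (\<forall>c\<in>cells (at_level X a).
      (let Fb = carrier_apply (F b) (cell_image (at_level X b) (step X a b) c) in
        subcomplex_image (at_level Y (b + \<epsilon>)) (step Y (a + \<epsilon>) (b + \<epsilon>)) (F a c) \<subseteq> Fb \<and>
        acyclic_subcomplex k (at_level Y (b + \<epsilon>)) Fb)))"

definition shift_carrier ::
  "'k::field itself \<Rightarrow> real \<Rightarrow> 'a filt_cw \<Rightarrow> (real \<Rightarrow> 'a set \<Rightarrow> 'a set set) \<Rightarrow> bool" where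
  "shift_carrier k \<epsilon> X I \<longleftrightarrow>
    eps_acyclic_carrier k \<epsilon> X X I \<and>
    (\<forall>a. carried_by (at_level X a)
      (cellular_map (at_level X a) (at_level X (a + \<epsilon>)) (step X a (a + \<epsilon>))
         :: ('a set \<Rightarrow>\<^sub>0 'k) \<Rightarrow> ('a set \<Rightarrow>\<^sub>0 'k))
      (I a))"


section \<open>Diagrams over a simplicial complex\<close>

text \<open>
  Simplices are finite nonempty sets of vertices. The linear order on the vertex type fixes the
  numbering of the codimension-one faces.
\<close>

definition simplicial_complex :: "'v set set \<Rightarrow> bool" where
  "simplicial_complex K \<longleftrightarrow>
    (\<forall>\<sigma>\<in>K. finite \<sigma> \<and> \<sigma> \<noteq> {} \<and> (\<forall>\<tau>. \<tau> \<noteq> {} \<longrightarrow> \<tau> \<subseteq> \<sigma> \<longrightarrow> \<tau> \<in> K))"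

text \<open>\<open>dmap D \<tau> \<sigma> r\<close> is the component at \<open>r\<close> of the map from \<open>dobj D \<sigma>\<close> to \<open>dobj D \<tau>\<close>, for \<open>\<tau> \<subseteq> \<sigma>\<close>.\<close>

record ('v, 'a) diagram =
  dobj :: "'v set \<Rightarrow> 'a filt_cw"
  dmap :: "'v set \<Rightarrow> 'v set \<Rightarrow> real \<Rightarrow> 'a \<Rightarrow> 'a"

abbreviation dlevel :: "('v, 'a) diagram \<Rightarrow> 'v set \<Rightarrow> real \<Rightarrow> 'a cw" where
  "dlevel D \<sigma> r \<equiv> at_level (dobj D \<sigma>) r"

definition regular_diagram :: "'v set set \<Rightarrow> ('v, 'a) diagram \<Rightarrow> bool" where
  "regular_diagram K D \<longleftrightarrow>
    (\<forall>\<sigma>\<in>K. regularly_filtered_cw (dobj D \<sigma>)) \<and>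
    (\<forall>\<sigma>\<in>K. \<forall>\<tau>\<in>K. \<tau> \<subseteq> \<sigma> \<longrightarrow> filt_morphism (dobj D \<sigma>) (dobj D \<tau>) (dmap D \<tau> \<sigma>)) \<and>
    (\<forall>\<sigma>\<in>K. \<forall>r. \<forall>x\<in>topspace (space (dlevel D \<sigma> r)). dmap D \<sigma> \<sigma> r x = x) \<and>
    (\<forall>\<sigma>\<in>K. \<forall>\<tau>\<in>K. \<forall>\<rho>\<in>K. \<rho> \<subseteq> \<tau> \<longrightarrow> \<tau> \<subseteq> \<sigma> \<longrightarrow>
      (\<forall>r. \<forall>x\<in>topspace (space (dlevel D \<sigma> r)).
        dmap D \<rho> \<tau> r (dmap D \<tau> \<sigma> r x) = dmap D \<rho> \<sigma> r x))"

definition eps_K_acyclic_carrier ::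
  "'k::field itself \<Rightarrow> real \<Rightarrow> 'v set set \<Rightarrow> ('v, 'a) diagram \<Rightarrow> ('v, 'b) diagram
    \<Rightarrow> ('v set \<Rightarrow> real \<Rightarrow> 'a set \<Rightarrow> 'b set set) \<Rightarrow> bool" where
  "eps_K_acyclic_carrier k \<epsilon> K D L F \<longleftrightarrow>
    (\<forall>\<sigma>\<in>K. eps_acyclic_carrier k \<epsilon> (dobj D \<sigma>) (dobj L \<sigma>) (F \<sigma>)) \<and>
    (\<forall>\<sigma>\<in>K. \<forall>\<tau>\<in>K. \<tau> \<subseteq> \<sigma> \<longrightarrow> (\<forall>a. \<forall>c\<in>cells (dlevel D \<sigma> a).
      subcomplex_image (dlevel L \<tau> (a + \<epsilon>)) (dmap L \<tau> \<sigma> (a + \<epsilon>)) (F \<sigma> a c)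
        \<subseteq> carrier_apply (F \<tau> a) (cell_image (dlevel D \<tau> a) (dmap D \<tau> \<sigma> a) c) \<and>
      (\<forall>r\<ge>0. acyclic_subcomplex k (dlevel L \<tau> (a + r + \<epsilon>))
        (carrier_apply (F \<tau> (a + r))
          (cell_image (dlevel D \<tau> (a + r))
             (dmap D \<tau> \<sigma> (a + r) \<circ> step (dobj D \<sigma>) a (a + r)) c)))))"

definition shift_K_acyclic_carrier ::
  "'k::field itself \<Rightarrow> real \<Rightarrow> 'v set set \<Rightarrow> ('v, 'a) diagram
    \<Rightarrow> ('v set \<Rightarrow> real \<Rightarrow> 'a set \<Rightarrow> 'a set set) \<Rightarrow> bool" where
  "shift_K_acyclic_carrier k \<epsilon> K D I \<longleftrightarrow>
    eps_K_acyclic_carrier k \<epsilon> K D D I \<and> (\<forall>\<sigma>\<in>K. shift_carrier k \<epsilon> (dobj D \<sigma>) (I \<sigma>))"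


section \<open>Spectral sequences and interleavings\<close>

text \<open>
  The component \<open>hiso E r p q\<close> is the identification of the homology of the page \<open>E\<^sup>r\<close> at \<open>(p,q)\<close>,
  whose elements are cosets in that page, with \<open>E\<^sup>r\<^sup>+\<^sup>1\<close> at \<open>(p,q)\<close>. The differential \<open>diff E r p q\<close> is
  the one leaving \<open>(p,q)\<close>.
\<close>

record ('k, 'e) spec_seq =
  page :: "nat \<Rightarrow> int \<Rightarrow> int \<Rightarrow> ('k, 'e) module"
  diff :: "nat \<Rightarrow> int \<Rightarrow> int \<Rightarrow> 'e \<Rightarrow> 'e"
  hiso :: "nat \<Rightarrow> int \<Rightarrow> int \<Rightarrow> 'e set \<Rightarrow> 'e"

definition page_cycles :: "('k, 'e) spec_seq \<Rightarrow> nat \<Rightarrow> int \<Rightarrow> int \<Rightarrow> 'e set" where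
  "page_cycles E r p q =
    {x \<in> carrier (page E r p q). diff E r p q x = zero (page E r (p - int r) (q + int r - 1))}"

definition page_boundaries :: "('k, 'e) spec_seq \<Rightarrow> nat \<Rightarrow> int \<Rightarrow> int \<Rightarrow> 'e set" where
  "page_boundaries E r p q =
    diff E r (p + int r) (q - int r + 1) ` carrier (page E r (p + int r) (q - int r + 1))"

definition page_homology ::
  "('k, 'e) spec_seq \<Rightarrow> nat \<Rightarrow> int \<Rightarrow> int \<Rightarrow> ('k, 'e set) module" where
  "page_homology E r p q =
    subquotient (page E r p q) (page_cycles E r p q) (page_boundaries E r p q)"

definition spectral_sequence :: "('k::field, 'e) spec_seq \<Rightarrow> bool" where
  "spectral_sequence E \<longleftrightarrow>
    (\<forall>r p q.
      Module.module (field_ring :: 'k ring) (page E r p q) \<and>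
      linear_map (page E r p q) (page E r (p - int r) (q + int r - 1)) (diff E r p q) \<and>
      (\<forall>x\<in>carrier (page E r p q).
        diff E r (p - int r) (q + int r - 1) (diff E r p q x) =
          zero (page E r (p - 2 * int r) (q + 2 * int r - 2))) \<and>
      linear_iso (page_homology E r p q) (page E (Suc r) p q) (hiso E r p q))"

definition ss_morphism ::
  "nat \<Rightarrow> ('k, 'd) spec_seq \<Rightarrow> ('k, 'e) spec_seq
    \<Rightarrow> (nat \<Rightarrow> int \<Rightarrow> int \<Rightarrow> 'd \<Rightarrow> 'e) \<Rightarrow> bool" where
  "ss_morphism n A B f \<longleftrightarrow>
    (\<forall>r\<ge>n. \<forall>p q.
      linear_map (page A r p q) (page B r p q) (f r p q) \<and>
      (\<forall>x\<in>carrier (page A r p q).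
        f r (p - int r) (q + int r - 1) (diff A r p q x) = diff B r p q (f r p q x)) \<and>
      (\<forall>x\<in>carrier (page_homology A r p q).
        f (Suc r) p q (hiso A r p q x) =
          hiso B r p q (coset_map (page B r p q) (page_boundaries B r p q) (f r p q) x)))"

text \<open>Functors from the reals to spectral sequences; \<open>ss_step A a b r p q\<close> acts on the page \<open>r\<close>.\<close>

record ('k, 'e) pers_spec_seq =
  ss_at :: "real \<Rightarrow> ('k, 'e) spec_seq"
  ss_step :: "real \<Rightarrow> real \<Rightarrow> nat \<Rightarrow> int \<Rightarrow> int \<Rightarrow> 'e \<Rightarrow> 'e"

definition persistent_spectral_sequence :: "('k::field, 'e) pers_spec_seq \<Rightarrow> bool" where
  "persistent_spectral_sequence A \<longleftrightarrow>
    (\<forall>a. spectral_sequence (ss_at A a)) \<and>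
    (\<forall>a b. a \<le> b \<longrightarrow> ss_morphism 0 (ss_at A a) (ss_at A b) (ss_step A a b)) \<and>
    (\<forall>a r p q. \<forall>x\<in>carrier (page (ss_at A a) r p q). ss_step A a a r p q x = x) \<and>
    (\<forall>a b c. a \<le> b \<longrightarrow> b \<le> c \<longrightarrow>
      (\<forall>r p q. \<forall>x\<in>carrier (page (ss_at A a) r p q).
        ss_step A b c r p q (ss_step A a b r p q x) = ss_step A a c r p q x))"

definition pss_shift :: "real \<Rightarrow> ('k, 'e) pers_spec_seq \<Rightarrow> ('k, 'e) pers_spec_seq" where
  "pss_shift \<epsilon> A =
    \<lparr>ss_at = (\<lambda>a. ss_at A (a + \<epsilon>)), ss_step = (\<lambda>a b. ss_step A (a + \<epsilon>) (b + \<epsilon>))\<rparr>"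

definition pss_morphism ::
  "nat \<Rightarrow> ('k, 'd) pers_spec_seq \<Rightarrow> ('k, 'e) pers_spec_seq
    \<Rightarrow> (real \<Rightarrow> nat \<Rightarrow> int \<Rightarrow> int \<Rightarrow> 'd \<Rightarrow> 'e) \<Rightarrow> bool" where
  "pss_morphism n A B f \<longleftrightarrow>
    (\<forall>a. ss_morphism n (ss_at A a) (ss_at B a) (f a)) \<and>
    (\<forall>a b. a \<le> b \<longrightarrow>
      (\<forall>r\<ge>n. \<forall>p q. \<forall>x\<in>carrier (page (ss_at A a) r p q).
        f b r p q (ss_step A a b r p q x) = ss_step B a b r p q (f a r p q x)))"

definition interleaved ::
  "real \<Rightarrow> nat \<Rightarrow> ('k::field, 'd) pers_spec_seq \<Rightarrow> ('k, 'e) pers_spec_seq \<Rightarrow> bool" where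
  "interleaved \<epsilon> n A B \<longleftrightarrow>
    persistent_spectral_sequence A \<and> persistent_spectral_sequence B \<and>
    (\<exists>\<psi> \<phi>. pss_morphism n A (pss_shift \<epsilon> B) \<psi> \<and> pss_morphism n B (pss_shift \<epsilon> A) \<phi> \<and>
      (\<forall>a. \<forall>r\<ge>n. \<forall>p q.
        (\<forall>x\<in>carrier (page (ss_at A a) r p q).
          \<phi> (a + \<epsilon>) r p q (\<psi> a r p q x) = ss_step A a (a + 2 * \<epsilon>) r p q x) \<and>
        (\<forall>y\<in>carrier (page (ss_at B a) r p q).
          \<psi> (a + \<epsilon>) r p q (\<phi> a r p q y) = ss_step B a (a + 2 * \<epsilon>) r p q y)))"

definition interleaving_distance ::
  "nat \<Rightarrow> ('k::field, 'd) pers_spec_seq \<Rightarrow> ('k, 'e) pers_spec_seq \<Rightarrow> ereal" where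
  "interleaving_distance n A B = Inf {ereal \<epsilon> | \<epsilon>. 0 \<le> \<epsilon> \<and> interleaved \<epsilon> n A B}"


section \<open>The spectral sequence of a filtered complex\<close>

text \<open>
  The complex has basis \<open>S\<close>; a basis element \<open>b\<close> has degree \<open>dg b\<close> and filtration index \<open>fil b\<close>, and
  \<open>F\<^sub>p\<close> is spanned by the basis elements of filtration index at most \<open>p\<close>. As usual,
  \<open>E\<^sup>r\<^sub>p\<^sub>q = Z\<^sup>r\<^sub>p\<^sub>q / (Z\<^sup>r\<^sup>-\<^sup>1\<^sub>p\<^sub>-\<^sub>1\<^sub>,\<^sub>q\<^sub>+\<^sub>1 + d Z\<^sup>r\<^sup>-\<^sup>1\<^sub>p\<^sub>+\<^sub>r\<^sub>-\<^sub>1\<^sub>,\<^sub>q\<^sub>-\<^sub>r\<^sub>+\<^sub>2)\<close> where \<open>Z\<^sup>r\<^sub>p\<^sub>q\<close> consists of the \<open>x\<close> in \<open>F\<^sub>p\<close> of degree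
  \<open>p + q\<close> with \<open>d x\<close> in \<open>F\<^sub>p\<^sub>-\<^sub>r\<close>; \<open>E\<^sup>0\<close> is the associated graded \<open>F\<^sub>p / F\<^sub>p\<^sub>-\<^sub>1\<close>.
\<close>

definition filt_part ::
  "'c set \<Rightarrow> ('c \<Rightarrow> int) \<Rightarrow> ('c \<Rightarrow> int) \<Rightarrow> int \<Rightarrow> int \<Rightarrow> ('c \<Rightarrow>\<^sub>0 'k::field) set" where
  "filt_part S dg fil p n = span_on {b \<in> S. dg b = n \<and> fil b \<le> p}"

definition ss_Z ::
  "'c set \<Rightarrow> ('c \<Rightarrow> int) \<Rightarrow> ('c \<Rightarrow> int) \<Rightarrow> (('c \<Rightarrow>\<^sub>0 'k) \<Rightarrow> ('c \<Rightarrow>\<^sub>0 'k))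
    \<Rightarrow> int \<Rightarrow> int \<Rightarrow> int \<Rightarrow> ('c \<Rightarrow>\<^sub>0 'k::field) set" where
  "ss_Z S dg fil d r p q =
    {x \<in> filt_part S dg fil p (p + q). d x \<in> filt_part S dg fil (p - r) (p + q - 1)}"

definition ss_B ::
  "'c set \<Rightarrow> ('c \<Rightarrow> int) \<Rightarrow> ('c \<Rightarrow> int) \<Rightarrow> (('c \<Rightarrow>\<^sub>0 'k) \<Rightarrow> ('c \<Rightarrow>\<^sub>0 'k))
    \<Rightarrow> int \<Rightarrow> int \<Rightarrow> int \<Rightarrow> ('c \<Rightarrow>\<^sub>0 'k::field) set" where
  "ss_B S dg fil d r p q =
    {y + d z | y z. y \<in> ss_Z S dg fil d (r - 1) (p - 1) (q + 1) \<and>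
                    z \<in> ss_Z S dg fil d (r - 1) (p + r - 1) (q - r + 2)}"

text \<open>
  The identification \<open>hiso\<close> sends the homology class of the class of \<open>x \<in> Z\<^sup>r\<^sup>+\<^sup>1\<close> to the class of \<open>x\<close>; every
  homology class contains the class of such an \<open>x\<close>.
\<close>

definition filtered_spec_seq ::
  "'c set \<Rightarrow> ('c \<Rightarrow> int) \<Rightarrow> ('c \<Rightarrow> int) \<Rightarrow> (('c \<Rightarrow>\<^sub>0 'k) \<Rightarrow> ('c \<Rightarrow>\<^sub>0 'k))
    \<Rightarrow> ('k::field, ('c \<Rightarrow>\<^sub>0 'k) set) spec_seq" where
  "filtered_spec_seq S dg fil d =
    \<lparr>page = (\<lambda>r p q. subquotient (free_module S)
               (ss_Z S dg fil d (int r) p q) (ss_B S dg fil d (int r) p q)),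
     diff = (\<lambda>r p q. coset_map (free_module S)
               (ss_B S dg fil d (int r) (p - int r) (q + int r - 1)) d),
     hiso = (\<lambda>r p q X. coset_map (free_module S)
               (ss_B S dg fil d (int r + 1) p q) id
               (\<Union>X \<inter> ss_Z S dg fil d (int r + 1) p q))\<rparr>"


section \<open>The spectral sequence of a diagram\<close>

text \<open>
  The pair \<open>(\<sigma>, c)\<close> of a simplex and a cell of \<open>dlevel D \<sigma> r\<close> is a basis element of bidegree
  \<open>(dim \<sigma>, dim c)\<close> of the double complex, \<open>dim \<sigma>\<close> being \<open>card \<sigma> - 1\<close>.
\<close>

definition double_basis ::
  "'v set set \<Rightarrow> ('v, 'a) diagram \<Rightarrow> real \<Rightarrow> ('v set \<times> 'a set) set" where
  "double_basis K D r = {(\<sigma>, c). \<sigma> \<in> K \<and> c \<in> cells (dlevel D \<sigma> r)}"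

definition simplex_deg :: "'v set \<times> 'a set \<Rightarrow> int" where
  "simplex_deg = (\<lambda>(\<sigma>, c). int (card \<sigma>) - 1)"

definition total_deg :: "('v, 'a) diagram \<Rightarrow> real \<Rightarrow> 'v set \<times> 'a set \<Rightarrow> int" where
  "total_deg D r = (\<lambda>(\<sigma>, c). int (card \<sigma>) - 1 + int (cell_dim (dlevel D \<sigma> r) c))"

definition at_simplex :: "'v set \<Rightarrow> ('a set \<Rightarrow>\<^sub>0 'k) \<Rightarrow> ('v set \<times> 'a set \<Rightarrow>\<^sub>0 'k::field)" where
  "at_simplex \<sigma> = lin_extend (\<lambda>t. Poly_Mapping.single (\<sigma>, t) 1)"

text \<open>The face omitting the vertex \<open>v\<close> is \<open>\<sigma>\<^sub>i\<close>, where \<open>i\<close> is the number of vertices of \<open>\<sigma>\<close> below \<open>v\<close>.\<close>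

definition total_boundary_on ::
  "('v::linorder, 'a) diagram \<Rightarrow> real \<Rightarrow> 'v set \<times> 'a set
    \<Rightarrow> ('v set \<times> 'a set \<Rightarrow>\<^sub>0 'k::field)" where
  "total_boundary_on D r = (\<lambda>(\<sigma>, c).
    lin_scale ((-1) ^ (card \<sigma> - 1)) (at_simplex \<sigma> (cell_boundary (dlevel D \<sigma> r) c)) +
    (\<Sum>v | v \<in> \<sigma> \<and> \<sigma> - {v} \<noteq> {}.
      lin_scale ((-1) ^ card {w \<in> \<sigma>. w < v})
        (at_simplex (\<sigma> - {v})
          (cell_push (dlevel D \<sigma> r) (dlevel D (\<sigma> - {v}) r) (dmap D (\<sigma> - {v}) \<sigma> r) c))))"

definition total_boundary ::
  "('v::linorder, 'a) diagram \<Rightarrow> real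
    \<Rightarrow> ('v set \<times> 'a set \<Rightarrow>\<^sub>0 'k) \<Rightarrow> ('v set \<times> 'a set \<Rightarrow>\<^sub>0 'k::field)" where
  "total_boundary D r = lin_extend (total_boundary_on D r)"

definition total_step ::
  "('v, 'a) diagram \<Rightarrow> real \<Rightarrow> real
    \<Rightarrow> ('v set \<times> 'a set \<Rightarrow>\<^sub>0 'k) \<Rightarrow> ('v set \<times> 'a set \<Rightarrow>\<^sub>0 'k::field)" where
  "total_step D a b = lin_extend (\<lambda>(\<sigma>, c).
    at_simplex \<sigma> (cell_push (dlevel D \<sigma> a) (dlevel D \<sigma> b) (step (dobj D \<sigma>) a b) c))"

definition diagram_spec_seq ::
  "'v::linorder set set \<Rightarrow> ('v, 'a) diagram
    \<Rightarrow> ('k::field, ('v set \<times> 'a set \<Rightarrow>\<^sub>0 'k) set) pers_spec_seq" where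
  "diagram_spec_seq K D =
    \<lparr>ss_at = (\<lambda>r. filtered_spec_seq (double_basis K D r) (total_deg D r) simplex_deg
                    (total_boundary D r)),
     ss_step = (\<lambda>a b r p q. coset_map (free_module (double_basis K D b))
                    (ss_B (double_basis K D b) (total_deg D b) simplex_deg (total_boundary D b)
                       (int r) p q)
                    (total_step D a b))\<rparr>"

end

theory Submission
  imports Defs
begin

text \<open>
  The argument takes place on the total complexes. The carriers \<open>F\<^sub>\<tau>\<close> assemble into one carrier from
  the total complex of \<open>\<D>\<^sub>a\<close> to that of \<open>\<L>\<^bsub>a+\<epsilon>\<^esub>\<close>, which sends a cell \<open>c\<close> of \<open>\<D>(\<sigma>)\<close> to all cells of
  \<open>F\<^sub>\<tau>(\<D>(\<tau> \<preceq> \<sigma>)(c))\<close> with \<open>\<tau> \<preceq> \<sigma>\<close>. Its values are acyclic: such a value is a double complex whose columns are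
  acyclic, so it has the homology of its bottom row, the augmented simplicial chain complex of the
  simplex \<open>\<sigma>\<close>, which is contractible. The acyclic carrier theorem thus gives chain maps and chain
  homotopies carried by the total carrier, and since \<open>\<tau> \<preceq> \<sigma>\<close> they all preserve the filtration by
  simplicial degree. A homotopy of this kind does not affect the pages from \<open>E\<^sup>1\<close> on, so on those pages
  two chain maps with the same total carrier agree. Applied to the two sides of each naturality square,
  and to \<open>G \<circ> F\<close> and the shift, which are both carried by \<open>I\<close>, this gives the interleaving.
\<close>

section \<open>Attaching a cell\<close>

subsection \<open>Balls\<close>

text \<open>Chains are defined through singular homology: \<open>cell_coord\<close> is a definite
  description, so incidence numbers and degrees say nothing until the cell classes are known to form
  a basis of \<open>cell_group\<close>. Supports are then read off by localising at a single cell.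
  Two features of the definitions are decisive. Points are oriented by constant simplices, so
  vertices go to vertices with coefficient 1 and the sum of coefficients is an augmentation;
  \<open>acyclic_subcomplex\<close> asks only for some isomorphism of H_0 with the field, and the
  augmentation turns it into exactness. And acyclicity is demanded for all shifts r \<ge> 0, which
  is what naturality in the real parameter needs: chain maps are chosen independently at each level,
  so a square from level a to level b commutes only up to a homotopy, and this homotopy needs a
  carrier along the composite structure map. Hence the carriers below have two levels a \<le> b. The
  delicate point of the total acyclicity is vertical degree 0, where a column still has homology and
  augmentations must be removed first.\<close>

definition nrm :: "nat \<Rightarrow> (nat \<Rightarrow> real) \<Rightarrow> real" where
  "nrm n x = sqrt (\<Sum>i<n. (x i)\<^sup>2)"

definition unit_ball :: "nat \<Rightarrow> (nat \<Rightarrow> real) set" where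
  "unit_ball n = {x. (\<forall>i\<ge>n. x i = 0) \<and> nrm n x \<le> 1}"

lemma nrm_nonneg [simp]: "0 \<le> nrm n x"
  by (simp add: nrm_def sum_nonneg)

lemma nrm_scale: "nrm n (\<lambda>i. c * x i) = \<bar>c\<bar> * nrm n x"
  by (simp add: nrm_def power_mult_distrib sum_distrib_left[symmetric] real_sqrt_mult)

lemma closed_ball_eq: "closed_ball n = top_of_set (unit_ball n)"
proof -
  have "{x. \<forall>i\<ge>n. x i = (0::real)} \<inter> {x. (\<Sum>i<n. (x i)\<^sup>2) \<le> 1} = unit_ball n"
    by (auto simp: unit_ball_def nrm_def)
  then show ?thesis
    by (simp add: closed_ball_def Euclidean_space_def subtopology_subtopology euclidean_product_topology)
qed

lemma open_ball_eq: "open_ball n = {x. (\<forall>i\<ge>n. x i = 0) \<and> nrm n x < 1}"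
  by (auto simp: open_ball_def topspace_Euclidean_space nrm_def)

lemma topspace_closed_ball [simp]: "topspace (closed_ball n) = unit_ball n"
  by (simp add: closed_ball_eq)

lemma open_ball_subset: "open_ball n \<subseteq> unit_ball n"
  by (auto simp: open_ball_eq unit_ball_def)

lemma continuous_on_nrm: "continuous_on A f \<Longrightarrow> continuous_on A (\<lambda>p. nrm n (f p))"
  unfolding nrm_def
  by (intro continuous_on_real_sqrt continuous_on_sum continuous_on_power)
    (rule continuous_on_product_then_coordinatewise[where f = f])

text \<open>Functions on the naturals carry the product topology, so the ball is a closed subset of
  a compact box: the product of [-1,1] in the coordinates below \<open>n\<close> and of {0} in the
  others.\<close>

lemma compact_unit_ball: "compact (unit_ball n)"
proof -
  define P :: "(nat \<Rightarrow> real) set" where "P = Pi\<^sub>E UNIV (\<lambda>i. if i < n then {-1..1} else {0})"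
  have "compactin (product_topology (\<lambda>i. euclidean) UNIV) P"
    unfolding P_def by (rule compactin_PiE[THEN iffD2]) auto
  then have "compact P" by (simp add: euclidean_product_topology)
  moreover have "closed (unit_ball n)"
  proof -
    have "unit_ball n = (\<Inter>i\<in>{n..}. {x. x i = 0}) \<inter> {x. nrm n x \<le> 1}"
      by (auto simp: unit_ball_def)
    moreover have "closed {x. nrm n x \<le> 1}"
      by (intro closed_Collect_le continuous_on_nrm continuous_on_const continuous_on_id)
    moreover have "closed {x. x i = (0::real)}" for i :: nat
      by (intro closed_Collect_eq continuous_on_const
          continuous_on_product_then_coordinatewise[where f = "\<lambda>x. x"] continuous_on_id)
    ultimately show ?thesis by (simp add: closed_Int closed_INT)
  qed
  moreover have "unit_ball n \<subseteq> P"
  proof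
    fix x assume x: "x \<in> unit_ball n"
    have "x i \<in> {-1..1}" if "i < n" for i
    proof -
      have "(x i)\<^sup>2 \<le> (\<Sum>i<n. (x i)\<^sup>2)"
        by (rule member_le_sum) (use that in auto)
      also have "\<dots> \<le> 1" using x by (simp add: unit_ball_def nrm_def)
      finally have "\<bar>x i\<bar> \<le> 1" by (simp add: abs_square_le_1)
      then show ?thesis by auto
    qed
    then show "x \<in> P" using x by (auto simp: P_def unit_ball_def)
  qed
  ultimately show ?thesis by (metis closed_Int_compact inf.absorb_iff1)
qed

text \<open>Radial stretching by \<open>s\<close>, stopped at the unit sphere. On the unit ball, for
  \<open>s\<close> running from 1 to 2, it is a homotopy that starts at the identity, fixes the
  sphere and ends by sending every point of norm at least 1/2 to the sphere.\<close>

definition clip :: "nat \<Rightarrow> real \<Rightarrow> (nat \<Rightarrow> real) \<Rightarrow> nat \<Rightarrow> real" where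
  "clip n s x = (\<lambda>i. (s / max 1 (s * nrm n x)) * x i)"

lemma nrm_clip: "0 \<le> s \<Longrightarrow> nrm n (clip n s x) = min 1 (s * nrm n x)"
  unfolding clip_def nrm_scale by (auto simp: max_def min_def)

lemma clip_unit_ball: "0 \<le> s \<Longrightarrow> x \<in> unit_ball n \<Longrightarrow> clip n s x \<in> unit_ball n"
  using nrm_clip[of s n x] by (simp add: unit_ball_def) (simp add: clip_def)

lemma clip_one: "x \<in> unit_ball n \<Longrightarrow> clip n 1 x = x"
  by (auto simp: unit_ball_def clip_def max_def fun_eq_iff)

lemma clip_sphere: "1 \<le> s \<Longrightarrow> nrm n x = 1 \<Longrightarrow> clip n s x = x"
  by (auto simp: clip_def max_def fun_eq_iff)

lemma continuous_on_clip: "continuous_on A (\<lambda>p. clip n (1 + fst p) (snd p))"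
  unfolding clip_def
proof (rule continuous_on_coordinatewise_then_product)
  fix i
  have "continuous_on A snd" by (intro continuous_intros)
  note [continuous_intros] = continuous_on_nrm[OF this]
    continuous_on_product_then_coordinatewise[where f = snd, OF this, of i]
  show "continuous_on A (\<lambda>p. (1 + fst p) / max 1 ((1 + fst p) * nrm n (snd p)) * snd p i)"
    by (intro continuous_intros) auto
qed

lemma continuous_map_clip:
  "continuous_map (prod_topology (top_of_set {0..1}) (closed_ball n)) (closed_ball n)
    (\<lambda>p. clip n (1 + fst p) (snd p))"
  unfolding closed_ball_eq subtopology_Times[symmetric] prod_topology_euclidean
  by (auto intro!: continuous_on_clip clip_unit_ball)

subsection \<open>Relative homology of an attached cell\<close>

text \<open>Two out of three for bijections. The comparison of the closed cell with the whole space
  goes through a zigzag of isomorphisms and uses both forms.\<close>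

lemma bij_betw_right_factor:
  assumes "bij_betw f A B" "bij_betw k A C" "\<And>x. x \<in> A \<Longrightarrow> k x = g (f x)"
  shows "bij_betw g B C"
proof -
  have "bij_betw (g \<circ> f) A C"
    using assms(2) by (rule bij_betw_cong[THEN iffD1, rotated]) (simp add: assms(3))
  with bij_betw_comp_iff[OF assms(1), of g C] show ?thesis by blast
qed

lemma bij_betw_left_factor:
  assumes "bij_betw g B C" "bij_betw k A C" "\<And>x. x \<in> A \<Longrightarrow> k x = g (f x)" "\<And>x. x \<in> A \<Longrightarrow> f x \<in> B"
  shows "bij_betw f A B"
proof -
  have "bij_betw (g \<circ> f) A C"
    using assms(2) by (rule bij_betw_cong[THEN iffD1, rotated]) (simp add: assms(3))
  with bij_betw_comp_iff2[OF assms(1), of f A] assms(4) show ?thesis by blast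
qed

lemma hom_inclusion_comp:
  assumes "continuous_map X Y id" "continuous_map Y Z id" "S \<subseteq> T" "T \<subseteq> W"
  shows "hom_induced p Y T Z W id (hom_induced p X S Y T id x) = hom_induced p X S Z W id x"
proof -
  have "id \<in> S \<rightarrow> T" "id \<in> T \<rightarrow> W" using assms(3,4) by auto
  from hom_induced_compose'[OF assms(1) this(1) assms(2) this(2), of p x] show ?thesis by simp
qed

text \<open>Models a space to which the cell \<open>e\<close> has been attached along its boundary
  sphere; it will be used for the (p-1)-skeleton together with some of the p-cells. Openness of
  \<open>e\<close> makes the remainder of the space closed.\<close>

locale attached_cell =
  fixes Y :: "'a topology" and e :: "'a set" and n :: nat and h :: "(nat \<Rightarrow> real) \<Rightarrow> 'a"
  assumes Hausdorff: "Hausdorff_space Y"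
    and open_e: "openin Y e"
    and h: "homeomorphic_map (closed_ball n) (subtopology Y (Y closure_of e)) h"
    and h_open: "h ` open_ball n = e"
begin

definition "C = Y closure_of e"
definition "B = topspace Y - e"
text \<open>The ball of half the radius. Excision needs a neighbourhood of the closed set
  \<open>B\<close>; taking away only \<open>U\<close> instead of all of \<open>e\<close> leaves an
  open set \<open>V\<close> that can still be pushed into \<open>B\<close>.\<close>

definition "U = h ` {x \<in> unit_ball n. nrm n x \<le> 1/2}"
definition "V = topspace Y - U"
definition "k = (SOME k. homeomorphic_maps (closed_ball n) (subtopology Y C) h k)"

lemma hk: "homeomorphic_maps (closed_ball n) (subtopology Y C) h k"
  unfolding k_def using h unfolding C_def homeomorphic_map_maps by (rule someI_ex)

lemma C_subset: "C \<subseteq> topspace Y"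
  by (simp add: C_def closure_of_subset_topspace)

lemma e_subset_C: "e \<subseteq> C"
  unfolding C_def using open_e by (simp add: closure_of_subset openin_subset)

lemma h_in: "x \<in> unit_ball n \<Longrightarrow> h x \<in> C" and k_in: "y \<in> C \<Longrightarrow> k y \<in> unit_ball n"
  and kh: "x \<in> unit_ball n \<Longrightarrow> k (h x) = x" and hk': "y \<in> C \<Longrightarrow> h (k y) = y"
  and cont_h: "continuous_map (closed_ball n) (subtopology Y C) h"
  and cont_k: "continuous_map (subtopology Y C) (closed_ball n) k"
  using hk C_subset by (auto simp: homeomorphic_maps_def continuous_map_def Pi_iff)

lemma in_e_iff: "y \<in> C \<Longrightarrow> y \<in> e \<longleftrightarrow> nrm n (k y) < 1"
proof -
  assume y: "y \<in> C"
  have "y \<in> e \<longleftrightarrow> k y \<in> open_ball n"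
  proof
    assume "y \<in> e"
    then obtain x where x: "x \<in> open_ball n" "y = h x" unfolding h_open[symmetric] by blast
    then show "k y \<in> open_ball n" using kh[OF subsetD[OF open_ball_subset x(1)]] by simp
  next
    assume "k y \<in> open_ball n"
    then have "h (k y) \<in> e" unfolding h_open[symmetric] by (rule imageI)
    then show "y \<in> e" using hk'[OF y] by simp
  qed
  then show ?thesis using k_in[OF y] by (simp add: open_ball_eq unit_ball_def)
qed

lemma nrm_k_B: "y \<in> C \<Longrightarrow> y \<in> B \<Longrightarrow> nrm n (k y) = 1"
  using in_e_iff[of y] k_in[of y] by (auto simp: B_def unit_ball_def)

lemma in_U_iff: "y \<in> U \<longleftrightarrow> y \<in> C \<and> nrm n (k y) \<le> 1/2"
proof
  assume "y \<in> U"
  then obtain x where "x \<in> unit_ball n" "nrm n x \<le> 1/2" "y = h x" unfolding U_def by blast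
  then show "y \<in> C \<and> nrm n (k y) \<le> 1/2" using h_in kh by simp
next
  assume y: "y \<in> C \<and> nrm n (k y) \<le> 1/2"
  then have "h (k y) \<in> U" unfolding U_def using k_in by blast
  then show "y \<in> U" using y hk' by simp
qed

lemma U_subset_e: "U \<subseteq> e"
  using in_U_iff in_e_iff by fastforce

lemma B_subset_V: "B \<subseteq> V"
  using U_subset_e by (auto simp: B_def V_def)

lemma closedin_B: "closedin Y B"
  unfolding B_def using open_e by blast

lemma closedin_C: "closedin Y C"
  by (simp add: C_def)

text \<open>\<open>U\<close> is the image of a compact set in a Hausdorff space, hence
  closed.\<close>

lemma openin_V: "openin Y V"
proof -
  have "closed {x. nrm n x \<le> 1/2}"
    by (intro closed_Collect_le continuous_on_nrm continuous_on_const continuous_on_id)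
  then have "compact ({x \<in> unit_ball n. nrm n x \<le> 1/2})"
    using compact_Int_closed[OF compact_unit_ball] by (metis Collect_conj_eq Collect_mem_eq)
  then have "compactin (closed_ball n) {x \<in> unit_ball n. nrm n x \<le> 1/2}"
    by (simp add: closed_ball_eq compactin_subtopology)
  then have "compactin Y U"
    unfolding U_def
    by (rule image_compactin) (use cont_h in \<open>simp add: continuous_map_in_subtopology\<close>)
  then show ?thesis
    unfolding V_def using Hausdorff by (simp add: compactin_imp_closedin openin_diff)
qed

section \<open>The radial stretch of an attached cell, and excision for it\<close>

definition "H p = (if snd p \<in> C then h (clip n (1 + fst p) (k (snd p))) else snd p)"

lemma H_B: "0 \<le> t \<Longrightarrow> y \<in> B \<Longrightarrow> H (t, y) = y"
  using nrm_k_B[of y] hk'[of y] by (auto simp: H_def clip_sphere)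

lemma H_C: "0 \<le> t \<Longrightarrow> y \<in> C \<Longrightarrow> H (t, y) \<in> C \<and> nrm n (k (H (t, y))) = min 1 ((1 + t) * nrm n (k y))"
  by (simp add: H_def h_in kh clip_unit_ball k_in nrm_clip)

text \<open>Pasting on the closed sets \<open>C\<close> and \<open>B\<close>, which cover the space.
  A point in both has norm 1 in the ball, where the stretch is the identity, so the two formulas
  agree there.\<close>

lemma continuous_H: "continuous_map (prod_topology (top_of_set {0..1::real}) Y) Y H"
proof (rule pasting_lemma_closed[where I = "{True, False}"
    and T = "\<lambda>b. {0..1} \<times> (if b then C else B)"
    and f = "\<lambda>b p. if b then h (clip n (1 + fst p) (k (snd p))) else snd p"])
  fix b assume "b \<in> {True, False}"
  show "closedin (prod_topology (top_of_set {0..1::real}) Y) ({0..1} \<times> (if b then C else B))"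
    using closedin_B closedin_C
    by (auto simp: closedin_prod_Times_iff)
  have sub: "subtopology (prod_topology (top_of_set {0..1::real}) Y) ({0..1} \<times> A)
      = prod_topology (top_of_set {0..1}) (subtopology Y A)" for A
    by (simp add: subtopology_Times subtopology_subtopology)
  have 1: "continuous_map (prod_topology (top_of_set {0..1}) (subtopology Y C))
      (prod_topology (top_of_set {0..1::real}) (closed_ball n)) (\<lambda>p. (fst p, k (snd p)))"
    by (intro continuous_map_pairedI continuous_map_fst
        continuous_map_compose[OF continuous_map_snd cont_k, unfolded o_def])
  have 2: "continuous_map (closed_ball n) Y h"
    using cont_h by (simp add: continuous_map_in_subtopology)
  have "continuous_map (prod_topology (top_of_set {0..1::real}) (subtopology Y C)) Y
      (\<lambda>p. h (clip n (1 + fst p) (k (snd p))))"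
    using continuous_map_compose[OF continuous_map_compose[OF 1 continuous_map_clip] 2]
    by (simp add: o_def)
  moreover have "continuous_map (prod_topology (top_of_set {0..1::real}) (subtopology Y B)) Y snd"
    by (rule continuous_map_into_fulltopology[OF continuous_map_snd])
  ultimately show "continuous_map (subtopology (prod_topology (top_of_set {0..1::real}) Y)
      ({0..1} \<times> (if b then C else B))) Y (\<lambda>p. if b then h (clip n (1 + fst p) (k (snd p))) else snd p)"
    unfolding sub by (cases b) simp_all
next
  fix i j p assume "p \<in> topspace (prod_topology (top_of_set {0..1::real}) Y)
      \<inter> {0..1} \<times> (if i then C else B) \<inter> {0..1} \<times> (if j then C else B)"
  then show "(if i then h (clip n (1 + fst p) (k (snd p))) else snd p)
      = (if j then h (clip n (1 + fst p) (k (snd p))) else snd p)"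
    using nrm_k_B[of "snd p"] hk'[of "snd p"] by (auto split: if_splits simp: clip_sphere)
next
  fix p assume "p \<in> topspace (prod_topology (top_of_set {0..1::real}) Y)"
  then show "\<exists>j. j \<in> {True, False} \<and> p \<in> {0..1} \<times> (if j then C else B) \<and>
      H p = (if j then h (clip n (1 + fst p) (k (snd p))) else snd p)"
    using e_subset_C by (intro exI[of _ "snd p \<in> C"]) (auto simp: H_def B_def)
qed simp

lemma H_0: "H (0, y) = y"
  by (auto simp: H_def clip_one k_in hk')

lemma homotopic_H:
  assumes "\<And>t. 0 \<le> t \<Longrightarrow> t \<le> 1 \<Longrightarrow> P (\<lambda>y. H (t, y))"
  shows "homotopic_with P Y Y id (\<lambda>y. H (1, y))"
  unfolding homotopic_with_def
  by (rule exI[of _ H]) (use assms continuous_H H_0 in auto)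

text \<open>The stretch is a deformation that fixes \<open>B\<close> and never leaves
  \<open>V\<close>. At time 1 it doubles norms, so points of the cell outside \<open>U\<close>,
  having norm above 1/2, end on the sphere: all of \<open>V\<close> lands in
  \<open>B\<close>.\<close>

lemma iso_B_V:
  "bij_betw (hom_induced p Y B Y V id) (carrier (relative_homology_group p Y B))
    (carrier (relative_homology_group p Y V))"
proof -
  have V: "(\<lambda>y. H (t, y)) \<in> V \<rightarrow> V" if "0 \<le> t" for t
  proof
    fix y assume y: "y \<in> V"
    show "H (t, y) \<in> V"
    proof (cases "y \<in> C")
      case True
      then have "nrm n (k y) > 1/2" using y in_U_iff[of y] by (auto simp: V_def)
      moreover have "nrm n (k y) \<le> (1 + t) * nrm n (k y)"
        using mult_right_mono[of 1 "1 + t" "nrm n (k y)"] that by simp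
      ultimately have "nrm n (k (H (t, y))) > 1/2"
        unfolding conjunct2[OF H_C[OF that True]] by linarith
      then have "H (t, y) \<notin> U" by (simp add: in_U_iff)
      then show ?thesis using H_C[OF that True] C_subset by (auto simp: V_def)
    next
      case False
      then show ?thesis using y by (simp add: H_def)
    qed
  qed
  have V1: "(\<lambda>y. H (1, y)) \<in> V \<rightarrow> B"
  proof
    fix y assume y: "y \<in> V"
    show "H (1, y) \<in> B"
    proof (cases "y \<in> C")
      case True
      then have "nrm n (k y) > 1/2" using y in_U_iff[of y] by (auto simp: V_def)
      then have "H (1, y) \<notin> e"
        using H_C[of 1, OF _ True] in_e_iff[of "H (1, y)"] by (simp add: min_def)
      then show ?thesis using H_C[of 1, OF _ True] C_subset by (auto simp: B_def)
    next
      case False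
      then show ?thesis using y e_subset_C by (auto simp: H_def B_def V_def)
    qed
  qed
  have cont: "continuous_map Y Y (\<lambda>y. H (1, y))"
    using homotopic_with_imp_continuous_maps[OF homotopic_H[of "\<lambda>_. True"]] by simp
  have "hom_induced p Y B Y V id \<in> iso (relative_homology_group p Y B) (relative_homology_group p Y V)"
  proof (rule homotopy_equivalence_relative_homology_group_isomorphism[OF _ _ cont V1])
    show "homotopic_with (\<lambda>h. h \<in> B \<rightarrow> B) Y Y ((\<lambda>y. H (1, y)) \<circ> id) id"
      unfolding comp_id by (rule homotopic_with_symD[OF homotopic_H]) (auto simp: H_B)
    show "homotopic_with (\<lambda>k. k \<in> V \<rightarrow> V) Y Y (id \<circ> (\<lambda>y. H (1, y))) id"
      unfolding id_comp by (rule homotopic_with_symD[OF homotopic_H]) (use V in auto)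
  qed (use B_subset_V in auto)
  then show ?thesis by (simp add: iso_def)
qed

text \<open>The set cut out is \<open>B\<close> itself, which is allowed because \<open>B\<close> is
  closed and lies in the open set \<open>V\<close>.\<close>

lemma iso_excision:
  "bij_betw (hom_induced p (subtopology Y e) (e - U) Y V id)
    (carrier (relative_homology_group p (subtopology Y e) (e - U)))
    (carrier (relative_homology_group p Y V))"
proof -
  have "Y closure_of B \<subseteq> Y interior_of V"
    using closedin_B openin_V B_subset_V by (simp add: closure_of_closedin interior_of_openin)
  moreover have "V \<subseteq> topspace Y" by (auto simp: V_def)
  ultimately have "hom_induced p (subtopology Y (topspace Y - B)) (V - B) (subtopology Y (topspace Y)) V id
    \<in> iso (relative_homology_group p (subtopology Y (topspace Y - B)) (V - B))
          (relative_homology_group p (subtopology Y (topspace Y)) V)"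
    by (rule homology_excision_axiom)
  moreover have "topspace Y - B = e" "V - B = e - U"
    using openin_subset[OF open_e] by (auto simp: B_def V_def)
  ultimately show ?thesis by (simp add: iso_def)
qed

text \<open>The closed cell alone is again an instance, with the same open pair (e, e - U); this
  common pair links it to the whole space.\<close>

lemma attached_cell_closure: "attached_cell (subtopology Y C) e n h"
proof
  show "Hausdorff_space (subtopology Y C)" using Hausdorff by (rule Hausdorff_space_subtopology)
  show "openin (subtopology Y C) e"
    using open_e e_subset_C by (metis inf.absorb1 openin_subtopology_Int)
  have "subtopology Y C closure_of e = C"
    using e_subset_C closure_of_subtopology_subset[of Y C e] C_subset
    by (simp add: closure_of_subtopology inf.absorb2 C_def)
  then show "homeomorphic_map (closed_ball n) (subtopology (subtopology Y C) (subtopology Y C closure_of e)) h"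
    using h by (simp add: subtopology_subtopology C_def)
  show "h ` open_ball n = e" by (rule h_open)
qed

text \<open>All maps are induced by inclusions. The pair (e, e - U) maps isomorphically to (C, C -
  U) and to (Y, V) by excision, so these two agree; pushing outwards replaces C - U by C - e and
  \<open>V\<close> by \<open>B\<close>.\<close>

theorem cell_iso:
  "bij_betw (hom_induced p (subtopology Y C) (C - e) Y B id)
    (carrier (relative_homology_group p (subtopology Y C) (C - e)))
    (carrier (relative_homology_group p Y B))"
proof -
  interpret Y1: attached_cell "subtopology Y C" e n h by (rule attached_cell_closure)
  have top: "topspace (subtopology Y C) = C" using C_subset by auto
  have V1: "Y1.V = C - U" by (simp only: Y1.V_def top)
  have B1: "Y1.B = C - e" by (simp only: Y1.B_def top)
  have sub: "subtopology (subtopology Y C) e = subtopology Y e"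
    using e_subset_C by (simp add: subtopology_subtopology inf.absorb2)
  have Ue: "U \<subseteq> C" using U_subset_e e_subset_C by blast
  have cid: "continuous_map (subtopology Y A) (subtopology Y A') id" if "A \<subseteq> A'" for A A'
    using that by (auto simp: continuous_map_in_subtopology)
  have cidY: "continuous_map (subtopology Y A) Y id" for A by simp
  have eU: "e - U \<subseteq> C - U" using e_subset_C by blast
  have CU: "C - U \<subseteq> V" unfolding V_def using C_subset by blast
  have Ce: "C - e \<subseteq> C - U" using U_subset_e by blast
  have CB: "C - e \<subseteq> B" unfolding B_def using C_subset by blast
  have CV: "bij_betw (hom_induced p (subtopology Y C) (C - U) Y V id)
      (carrier (relative_homology_group p (subtopology Y C) (C - U))) (carrier (relative_homology_group p Y V))"
  proof (rule bij_betw_right_factor[OF Y1.iso_excision[unfolded sub V1] iso_excision])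
    fix x
    show "hom_induced p (subtopology Y e) (e - U) Y V id x =
        hom_induced p (subtopology Y C) (C - U) Y V id
          (hom_induced p (subtopology Y e) (e - U) (subtopology Y C) (C - U) id x)"
      by (rule hom_inclusion_comp[OF cid[OF e_subset_C] cidY eU CU, symmetric])
  qed
  show ?thesis
  proof (rule bij_betw_left_factor[OF iso_B_V bij_betw_trans[OF Y1.iso_B_V[unfolded V1 B1] CV]])
    fix x
    show "(hom_induced p (subtopology Y C) (C - U) Y V id \<circ>
        hom_induced p (subtopology Y C) (C - e) (subtopology Y C) (C - U) id) x =
        hom_induced p Y B Y V id (hom_induced p (subtopology Y C) (C - e) Y B id x)"
      unfolding o_apply
      unfolding hom_inclusion_comp[OF continuous_map_id cidY Ce CU]
        hom_inclusion_comp[OF cidY continuous_map_id CB B_subset_V] ..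
    show "hom_induced p (subtopology Y C) (C - e) Y B id x \<in> carrier (relative_homology_group p Y B)"
      by (rule hom_induced_carrier)
  qed
qed

end

subsection \<open>The homology of a closed cell\<close>

lemma contractible_closed_ball: "contractible_space (closed_ball n)"
proof -
  define H :: "real \<times> (nat \<Rightarrow> real) \<Rightarrow> nat \<Rightarrow> real" where "H = (\<lambda>p i. (1 - fst p) * snd p i)"
  have "continuous_on A H" for A
    unfolding H_def
  proof (rule continuous_on_coordinatewise_then_product)
    fix i
    have "continuous_on A (snd :: real \<times> (nat \<Rightarrow> real) \<Rightarrow> _)" by (intro continuous_intros)
    note [continuous_intros] = continuous_on_product_then_coordinatewise[where f = snd, OF this, of i]
    show "continuous_on A (\<lambda>p. (1 - fst p) * (snd p i :: real))"
      by (intro continuous_intros)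
  qed
  moreover have "H (t, x) \<in> unit_ball n" if "t \<in> {0..1}" "x \<in> unit_ball n" for t x
    using that by (auto simp: H_def unit_ball_def nrm_scale mult_le_one)
  ultimately have "homotopic_with_canon (\<lambda>_. True) (unit_ball n) (unit_ball n) id (\<lambda>_ _. 0)"
    unfolding homotopic_with_def
    by (intro exI[of _ H]) (auto simp: H_def image_subset_iff simp flip: subtopology_Times)
  then show ?thesis
    unfolding closed_ball_eq contractible_space_top_of_set contractible_def by blast
qed

text \<open>The ball is contractible, so its homology relative to the boundary is the reduced
  homology of the sphere one degree lower. For n = 0 the boundary is empty and the claim is the
  homology of a point.\<close>

lemma ball_homology:
  "relative_homology_group (int n) (closed_ball n) (unit_ball n - open_ball n) \<cong> integer_group"
proof (cases n)
  case 0
  have [simp]: "unit_ball 0 = {\<lambda>_. 0}" "open_ball 0 = {\<lambda>_. 0}"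
    by (auto simp: unit_ball_def open_ball_eq nrm_def)
  show ?thesis
    unfolding 0 using homology_coefficients[of "closed_ball 0" "\<lambda>_. 0"] by simp
next
  case (Suc m)
  define Sp where "Sp = unit_ball n - open_ball n"
  have Sp: "Sp = {x. (\<Sum>i\<le>m. (x i)\<^sup>2) = 1 \<and> (\<forall>i>m. x i = 0)}"
  proof -
    have "nrm n x = 1 \<longleftrightarrow> (\<Sum>i\<le>m. (x i)\<^sup>2) = 1" for x
      by (simp add: nrm_def Suc lessThan_Suc_atMost)
    moreover have "Sp = {x. nrm n x = 1 \<and> (\<forall>i\<ge>n. x i = 0)}"
      by (auto simp: Sp_def unit_ball_def open_ball_eq)
    ultimately show ?thesis by (simp add: Suc Suc_le_eq)
  qed
  have "subtopology (closed_ball n) Sp = top_of_set Sp"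
    by (simp add: closed_ball_eq subtopology_subtopology Sp_def inf.absorb2)
  also have "\<dots> = nsphere m"
    unfolding Sp nsphere by (simp add: euclidean_product_topology)
  finally have sub: "subtopology (closed_ball n) Sp = nsphere m" .
  have "(\<lambda>i. if i = 0 then 1 else 0) \<in> topspace (subtopology (closed_ball n) Sp)"
    unfolding sub by (rule in_topspace_nsphere)
  then have ne: "topspace (closed_ball n) \<inter> Sp \<noteq> {}" by auto
  have "relative_homology_group (int n) (closed_ball n) Sp
      \<cong> reduced_homology_group (int n - 1) (subtopology (closed_ball n) Sp)"
    by (rule isomorphic_group_relative_homology_of_contractible[OF contractible_closed_ball ne])
  also have "reduced_homology_group (int n - 1) (subtopology (closed_ball n) Sp) = reduced_homology_group m (nsphere m)"
    unfolding sub using Suc by simp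
  also have "reduced_homology_group m (nsphere m) \<cong> integer_group"
    by (rule reduced_homology_group_nsphere(1))
  finally show ?thesis unfolding Sp_def .
qed

subsection \<open>Infinite cyclic groups\<close>

text \<open>The generator is part of the notion, because coordinates of chains are exponents of
  specific classes and must be transported together with them.\<close>

definition infinite_cyclic :: "('a, 'b) monoid_scheme \<Rightarrow> 'a \<Rightarrow> bool" where
  "infinite_cyclic G g \<longleftrightarrow> g \<in> carrier G \<and> (\<forall>x\<in>carrier G. \<exists>m::int. x = g [^]\<^bsub>G\<^esub> m) \<and>
    (\<forall>m::int. g [^]\<^bsub>G\<^esub> m = \<one>\<^bsub>G\<^esub> \<longrightarrow> m = 0)"

lemma infinite_cyclic_carrier: "infinite_cyclic G g \<Longrightarrow> g \<in> carrier G"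
  and infinite_cyclic_pow: "infinite_cyclic G g \<Longrightarrow> x \<in> carrier G \<Longrightarrow> \<exists>m::int. x = g [^]\<^bsub>G\<^esub> m"
  and infinite_cyclic_order: "infinite_cyclic G g \<Longrightarrow> g [^]\<^bsub>G\<^esub> (m::int) = \<one>\<^bsub>G\<^esub> \<Longrightarrow> m = 0"
  by (simp_all add: infinite_cyclic_def)

lemma infinite_cyclic_inj:
  assumes "group G" "infinite_cyclic G g" "g [^]\<^bsub>G\<^esub> m = g [^]\<^bsub>G\<^esub> (m'::int)"
  shows "m = m'"
proof -
  interpret group G by fact
  have g: "g \<in> carrier G" using assms(2) by (simp add: infinite_cyclic_def)
  have "g [^]\<^bsub>G\<^esub> (m - m') = g [^]\<^bsub>G\<^esub> m \<otimes>\<^bsub>G\<^esub> inv\<^bsub>G\<^esub> (g [^]\<^bsub>G\<^esub> m')" by (rule int_pow_diff[OF g])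
  also have "\<dots> = \<one>\<^bsub>G\<^esub>" using g assms(3) by simp
  finally have "m - m' = 0" by (rule infinite_cyclic_order[OF assms(2)])
  then show ?thesis by simp
qed

text \<open>Under an isomorphism \<phi> with the integers g^m goes to m times \<phi> g, and \<phi> g
  cannot be 0, since then \<phi> would vanish and miss 1.\<close>

lemma infinite_cyclic_generator:
  assumes G: "group G" and iso: "G \<cong> integer_group" and g: "g \<in> carrier G"
    and gen: "carrier (subgroup_generated G {g}) = carrier G"
  shows "infinite_cyclic G g"
proof -
  interpret group G by fact
  have pow: "\<exists>m::int. x = g [^]\<^bsub>G\<^esub> m" if "x \<in> carrier G" for x
    using that carrier_subgroup_generated_by_singleton[OF g] gen by auto
  obtain \<phi> where \<phi>: "\<phi> \<in> hom G integer_group" "bij_betw \<phi> (carrier G) UNIV"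
    using iso by (auto simp: is_iso_def iso_def integer_group_def)
  have \<phi>_pow: "\<phi> (g [^]\<^bsub>G\<^esub> m) = m * \<phi> g" for m :: int
    using hom_int_pow[OF \<phi>(1) g G group_integer_group, of m] by simp
  have "\<phi> g \<noteq> 0"
  proof
    assume "\<phi> g = 0"
    then have 0: "\<phi> x = 0" if x: "x \<in> carrier G" for x
      using pow[OF x] \<phi>_pow by fastforce
    have "1 \<in> \<phi> ` carrier G" using bij_betw_imp_surj_on[OF \<phi>(2)] by simp
    then obtain x where "1 = \<phi> x" "x \<in> carrier G" by (rule imageE)
    then show False using 0 by simp
  qed
  moreover have "\<phi> \<one>\<^bsub>G\<^esub> = 0"
    using hom_one[OF \<phi>(1) G group_integer_group] by (simp add: integer_group_def)
  ultimately have "m = 0" if "g [^]\<^bsub>G\<^esub> m = \<one>\<^bsub>G\<^esub>" for m :: int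
    using \<phi>_pow[of m] that by simp
  then show ?thesis unfolding infinite_cyclic_def by (intro conjI ballI allI impI g pow) auto
qed

lemma infinite_cyclic_image:
  assumes "group G" "group H" and f: "f \<in> hom G H" "bij_betw f (carrier G) (carrier H)"
    and g: "infinite_cyclic G g"
  shows "infinite_cyclic H (f g)"
proof -
  interpret group_hom G H f using assms by (simp add: group_hom_def group_hom_axioms_def)
  have gc: "g \<in> carrier G" using g by (simp add: infinite_cyclic_def)
  have pow: "f g [^]\<^bsub>H\<^esub> m = f (g [^]\<^bsub>G\<^esub> m)" for m :: int using gc by (simp add: hom_int_pow)
  have "\<exists>m::int. y = f g [^]\<^bsub>H\<^esub> m" if y: "y \<in> carrier H" for y
  proof -
    have "y \<in> f ` carrier G" using y bij_betw_imp_surj_on[OF f(2)] by simp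
    then obtain x where x: "y = f x" "x \<in> carrier G" by (rule imageE)
    from infinite_cyclic_pow[OF g x(2)] obtain m :: int where "x = g [^]\<^bsub>G\<^esub> m" ..
    then have "y = f g [^]\<^bsub>H\<^esub> m" using x(1) pow by simp
    then show ?thesis ..
  qed
  moreover have "m = 0" if "f g [^]\<^bsub>H\<^esub> m = \<one>\<^bsub>H\<^esub>" for m :: int
  proof -
    have "f (g [^]\<^bsub>G\<^esub> m) = f \<one>\<^bsub>G\<^esub>" using that pow by simp
    then have "g [^]\<^bsub>G\<^esub> m = \<one>\<^bsub>G\<^esub>"
      using gc by (intro inj_onD[OF bij_betw_imp_inj_on[OF f(2)]]) simp_all
    then show ?thesis by (rule infinite_cyclic_order[OF g])
  qed
  ultimately show ?thesis using gc unfolding infinite_cyclic_def by simp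
qed

lemma hom_finprod:
  assumes "comm_group G" "comm_group H" "f \<in> hom G H" "finite A" "g \<in> A \<rightarrow> carrier G"
  shows "f (finprod G g A) = finprod H (\<lambda>a. f (g a)) A"
  using assms(4,5)
proof (induction A rule: finite_induct)
  case empty
  interpret G: comm_group G by fact
  interpret H: comm_group H by fact
  show ?case using hom_one[OF assms(3)] G.group_axioms H.group_axioms by simp
next
  case (insert a A)
  interpret G: comm_group G by fact
  interpret H: comm_group H by fact
  have "(\<lambda>a. f (g a)) \<in> insert a A \<rightarrow> carrier H"
    using insert(4) hom_in_carrier[OF assms(3)] by auto
  then show ?case
    using insert hom_mult[OF assms(3), of "g a" "finprod G g A"] by (simp add: Pi_iff)
qed

text \<open>A map of pairs \<open>(X, S) \<rightarrow> (Y, T)\<close> that sends all of \<open>X\<close> into \<open>T\<close> factors through \<open>(X, X)\<close>.\<close>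

lemma hom_induced_into_subspace:
  assumes f: "continuous_map X Y f" "f ` topspace X \<subseteq> T"
  shows "hom_induced p X S Y T f c = \<one>\<^bsub>relative_homology_group p Y T\<^esub>"
proof -
  let ?G = "relative_homology_group p X (topspace X)" and ?H = "relative_homology_group p Y T"
  \<comment> \<open>Factoring through the pair (X, X) requires a subspace contained in the space, so
    \<open>S\<close> is first cut down to \<open>topspace X\<close>; this does not change the
    induced map, as the end of the proof records.\<close>
  have "hom_induced p X (topspace X \<inter> S) Y T f c
      = hom_induced p X (topspace X) Y T (f \<circ> id) c'"
    if "c' = hom_induced p X (topspace X \<inter> S) X (topspace X) id c" "f \<circ> id = f" for c'
    unfolding that(1)
    using hom_induced_compose'[of X X id "topspace X \<inter> S" "topspace X" Y f T p c] f
    by (auto simp: o_def image_subset_iff)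
  then have eq: "hom_induced p X (topspace X \<inter> S) Y T f c = hom_induced p X (topspace X) Y T f
      (hom_induced p X (topspace X \<inter> S) X (topspace X) id c)"
    by simp
  have "hom_induced p X (topspace X \<inter> S) X (topspace X) id c = \<one>\<^bsub>?G\<^esub>"
    using trivial_relative_homology_group_topspace[of p X]
      hom_induced_carrier[of p X "topspace X \<inter> S" X "topspace X" id c]
    by (simp add: trivial_group_def)
  then have "hom_induced p X (topspace X \<inter> S) Y T f c = \<one>\<^bsub>?H\<^esub>"
    unfolding eq using hom_one[OF hom_induced_hom] by simp
  moreover have "hom_induced p X (topspace X \<inter> S) Y T f = hom_induced p X S Y T f"
    using hom_induced_restrict[of p X S Y T] hom_induced_restrict[of p X "topspace X \<inter> S" Y T] by simp
  ultimately show ?thesis by simp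
qed

section \<open>Cellular homology of regular CW-complexes\<close>

locale regular_complex =
  fixes X :: "'a cw"
  assumes regular: "regular_cw X"
begin

abbreviation "T \<equiv> space X"

lemma Hausdorff: "Hausdorff_space T" and finite_cells: "finite (cells X)"
  and disjoint: "e \<in> cells X \<Longrightarrow> e' \<in> cells X \<Longrightarrow> e \<noteq> e' \<Longrightarrow> e \<inter> e' = {}"
  and Union_cells: "\<Union>(cells X) = topspace T"
  and cell_map: "e \<in> cells X \<Longrightarrow> \<exists>h. homeomorphic_map (closed_ball (cell_dim X e))
      (subtopology T (cell_closure X e)) h \<and> h ` open_ball (cell_dim X e) = e"
  and cell_frontier: "e \<in> cells X \<Longrightarrow> cell_closure X e - e \<subseteq> skeleton X (int (cell_dim X e) - 1)"
  using regular by (simp_all add: regular_cw_def pairwise_def disjnt_def)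

lemma cell_subset: "e \<in> cells X \<Longrightarrow> e \<subseteq> topspace T"
  using Union_cells by blast

lemma cell_subset_closure: "e \<in> cells X \<Longrightarrow> e \<subseteq> cell_closure X e"
  by (simp add: closure_of_subset cell_subset)

lemma closure_subset: "cell_closure X e \<subseteq> topspace T"
  by (simp add: closure_of_subset_topspace)

lemma cell_nonempty: "e \<in> cells X \<Longrightarrow> e \<noteq> {}"
proof -
  assume "e \<in> cells X"
  from cell_map[OF this] obtain h where "h ` open_ball (cell_dim X e) = e" by blast
  moreover have "(\<lambda>_. 0) \<in> open_ball (cell_dim X e)" by (simp add: open_ball_eq nrm_def)
  ultimately show ?thesis by blast
qed

lemma skeleton_mono: "p \<le> p' \<Longrightarrow> skeleton X p \<subseteq> skeleton X p'"
  unfolding skeleton_def by fastforce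

lemma cell_in_skeleton: "e \<in> cells X \<Longrightarrow> int (cell_dim X e) \<le> p \<Longrightarrow> e \<subseteq> skeleton X p"
  unfolding skeleton_def by blast

lemma closure_in_skeleton: "e \<in> cells X \<Longrightarrow> int (cell_dim X e) \<le> p \<Longrightarrow> cell_closure X e \<subseteq> skeleton X p"
  using cell_frontier[of e] skeleton_mono[of "int (cell_dim X e) - 1" p] cell_in_skeleton[of e p] by auto

lemma skeleton_subset: "skeleton X p \<subseteq> topspace T"
  unfolding skeleton_def using cell_subset by blast

lemma closedin_skeleton: "closedin T (skeleton X p)"
proof -
  let ?E = "{e \<in> cells X. int (cell_dim X e) \<le> p}"
  have "skeleton X p = (\<Union>e\<in>?E. cell_closure X e)"
    using closure_in_skeleton cell_subset_closure unfolding skeleton_def by fastforce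
  moreover have "closedin T (\<Union>e\<in>?E. cell_closure X e)"
    using finite_cells by (intro closedin_Union) auto
  ultimately show ?thesis by simp
qed

lemma skeleton_inter_cell: "e \<in> cells X \<Longrightarrow> p < int (cell_dim X e) \<Longrightarrow> skeleton X p \<inter> e = {}"
  unfolding skeleton_def using disjoint by fastforce

section \<open>Building the p-skeleton from the (p-1)-skeleton cell by cell\<close>

definition E where "E p = cells_of_dim X p"

definition Y where "Y p A = skeleton X (p - 1) \<union> \<Union>A"

lemma finite_E: "finite (E p)"
  using finite_cells by (simp add: E_def cells_of_dim_def)

lemma E_cells: "e \<in> E p \<Longrightarrow> e \<in> cells X" "e \<in> E p \<Longrightarrow> int (cell_dim X e) = p"
  by (auto simp: E_def cells_of_dim_def)

lemma Y_E: "Y p (E p) = skeleton X p"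
  unfolding Y_def E_def cells_of_dim_def skeleton_def by force

lemma Y_subset: "A \<subseteq> E p \<Longrightarrow> Y p A \<subseteq> topspace T"
  unfolding Y_def using skeleton_subset cell_subset E_cells by blast

lemma closure_in_Y: "A \<subseteq> E p \<Longrightarrow> e \<in> A \<Longrightarrow> cell_closure X e \<subseteq> Y p A"
  using cell_frontier[of e] E_cells[of e p] unfolding Y_def by blast

lemma closedin_Y: "A \<subseteq> E p \<Longrightarrow> closedin T (Y p A)"
proof -
  assume A: "A \<subseteq> E p"
  have "Y p A = skeleton X (p - 1) \<union> (\<Union>e\<in>A. cell_closure X e)"
  proof (rule subset_antisym)
    have "a \<subseteq> cell_closure X a" if "a \<in> A" for a
      by (rule cell_subset_closure[OF E_cells(1)]) (use that A in auto)
    then show "Y p A \<subseteq> skeleton X (p - 1) \<union> (\<Union>e\<in>A. cell_closure X e)"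
      unfolding Y_def by blast
    have "skeleton X (p - 1) \<subseteq> Y p A" by (simp add: Y_def)
    moreover have "(\<Union>e\<in>A. cell_closure X e) \<subseteq> Y p A"
      by (rule UN_least) (rule closure_in_Y[OF A])
    ultimately show "skeleton X (p - 1) \<union> (\<Union>e\<in>A. cell_closure X e) \<subseteq> Y p A"
      by (rule Un_least)
  qed
  moreover have "finite A" using A finite_E finite_subset by blast
  moreover from this have "closedin T (\<Union>e\<in>A. cell_closure X e)"
    by (intro closedin_Union) auto
  ultimately show ?thesis using closedin_skeleton by (simp add: closedin_Un)
qed

lemma Y_minus:
  assumes "A \<subseteq> E p" "e \<in> A" shows "Y p A - e = Y p (A - {e})"
proof -
  have e: "e \<in> E p" using assms by blast
  have "skeleton X (p - 1) \<inter> e = {}"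
    by (rule skeleton_inter_cell) (simp_all add: E_cells[OF e])
  moreover have "a \<inter> e = {}" if "a \<in> A - {e}" for a
    by (rule disjoint) (use that assms E_cells(1) in auto)
  ultimately show ?thesis unfolding Y_def by blast
qed

text \<open>The complement of \<open>e\<close> is \<open>Y p (A - {e})\<close>, a finite union of
  closed sets, so \<open>e\<close> is open in \<open>Y p A\<close>. This fails in the whole space
  when \<open>e\<close> lies in the closure of other cells, hence the detour through
  skeleta.\<close>

lemma attached_cell_Y:
  assumes A: "A \<subseteq> E p" and e: "e \<in> A"
  shows "\<exists>h. attached_cell (subtopology T (Y p A)) e (cell_dim X e) h"
    and "subtopology T (Y p A) closure_of e = cell_closure X e"
proof -
  have ec: "e \<in> cells X" using A e E_cells by blast
  have eY: "e \<subseteq> Y p A" using e by (auto simp: Y_def)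
  show cl: "subtopology T (Y p A) closure_of e = cell_closure X e"
    using closure_in_Y[OF A e] eY by (simp add: closure_of_subtopology inf.absorb2 inf.absorb1)
  obtain h where h: "homeomorphic_map (closed_ball (cell_dim X e)) (subtopology T (cell_closure X e)) h"
    "h ` open_ball (cell_dim X e) = e" using cell_map[OF ec] by blast
  have "attached_cell (subtopology T (Y p A)) e (cell_dim X e) h"
  proof
    show "Hausdorff_space (subtopology T (Y p A))" using Hausdorff by (rule Hausdorff_space_subtopology)
    have "closedin (subtopology T (Y p A)) (Y p (A - {e}))"
      using closedin_Y[of "A - {e}" p] A Y_minus[OF A e]
      by (intro closedin_subset_topspace) auto
    moreover have "topspace (subtopology T (Y p A)) - Y p (A - {e}) = e"
      using Y_minus[OF A e] Y_subset[OF A] eY by auto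
    ultimately show "openin (subtopology T (Y p A)) e"
      by (metis openin_diff openin_topspace)
    show "homeomorphic_map (closed_ball (cell_dim X e))
        (subtopology (subtopology T (Y p A)) (subtopology T (Y p A) closure_of e)) h"
      unfolding cl using h(1) closure_in_Y[OF A e] by (simp add: subtopology_subtopology inf.absorb2)
    show "h ` open_ball (cell_dim X e) = e" by (rule h(2))
  qed
  then show "\<exists>h. attached_cell (subtopology T (Y p A)) e (cell_dim X e) h" by blast
qed

lemma cell_iso_Y:
  assumes A: "A \<subseteq> E p" and e: "e \<in> A"
  shows "bij_betw (hom_induced q (subtopology T (cell_closure X e)) (cell_closure X e - e)
      (subtopology T (Y p A)) (Y p A - e) id)
    (carrier (relative_homology_group q (subtopology T (cell_closure X e)) (cell_closure X e - e)))
    (carrier (relative_homology_group q (subtopology T (Y p A)) (Y p A - e)))"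
proof -
  obtain h where "attached_cell (subtopology T (Y p A)) e (cell_dim X e) h"
    using attached_cell_Y(1)[OF A e] by blast
  then interpret a: attached_cell "subtopology T (Y p A)" e "cell_dim X e" h .
  have C: "a.C = cell_closure X e" unfolding a.C_def by (rule attached_cell_Y(2)[OF A e])
  have B: "a.B = Y p A - e" using Y_subset[OF A] by (auto simp: a.B_def)
  have "subtopology (subtopology T (Y p A)) (cell_closure X e) = subtopology T (cell_closure X e)"
    using closure_in_Y[OF A e] by (simp add: subtopology_subtopology inf.absorb2)
  then show ?thesis using a.cell_iso[of q] unfolding C B by simp
qed

lemma cell_homology_integer: "e \<in> cells X \<Longrightarrow> cell_homology X e \<cong> integer_group"
proof -
  assume e: "e \<in> cells X"
  let ?n = "cell_dim X e"
  obtain h where h: "homeomorphic_map (closed_ball ?n) (subtopology T (cell_closure X e)) h"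
    "h ` open_ball ?n = e" using cell_map[OF e] by blast
  have surj: "h ` unit_ball ?n = cell_closure X e"
    using homeomorphic_imp_surjective_map[OF h(1)] closure_subset[of e] by (simp add: inf.absorb2)
  have inj: "inj_on h (unit_ball ?n)"
    using homeomorphic_imp_injective_map[OF h(1)] by simp
  have "h ` (unit_ball ?n - open_ball ?n) = cell_closure X e - e"
    using inj_on_image_set_diff[OF inj _ open_ball_subset, of "unit_ball ?n"] surj h(2) by simp
  then have "relative_homology_group (int ?n) (closed_ball ?n) (unit_ball ?n - open_ball ?n) \<cong> cell_homology X e"
    by (intro is_isoI[OF homeomorphic_map_relative_homology_iso[OF h(1)]]) auto
  then have "cell_homology X e \<cong> relative_homology_group (int ?n) (closed_ball ?n) (unit_ball ?n - open_ball ?n)"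
    by (simp add: group.iso_sym)
  from iso_trans[OF this ball_homology] show ?thesis .
qed

text \<open>The skeleton in dimension -1 is empty, so a 0-cell has no frontier.\<close>

lemma zero_cell:
  assumes e: "e \<in> cells X" "cell_dim X e = 0"
  shows "\<exists>x\<in>topspace T. e = {x} \<and> cell_closure X e = {x}"
proof -
  obtain h where h: "h ` open_ball (cell_dim X e) = e" using cell_map[OF e(1)] by blast
  have "open_ball 0 = {\<lambda>_. 0}" by (auto simp: open_ball_eq nrm_def)
  then have x: "e = {h (\<lambda>_. 0)}" using h e(2) by simp
  have "skeleton X (- 1) = {}" by (auto simp: skeleton_def)
  then have "cell_closure X e = e"
    using cell_frontier[OF e(1)] e(2) cell_subset_closure[OF e(1)] by auto
  then show ?thesis using x cell_subset[OF e(1)] by auto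
qed

text \<open>Shows that the choice in \<open>orientation\<close> has a witness. In dimension 0 the
  witness must moreover be the class of a constant simplex, which generates H_0 of a point.\<close>

lemma orientation_spec:
  assumes e: "e \<in> cells X"
  shows "infinite_cyclic (cell_homology X e) (orientation X e)"
    and "cell_dim X e = 0 \<Longrightarrow> \<exists>x\<in>e. orientation X e = homologous_rel_set 0
      (subtopology T (cell_closure X e)) (cell_closure X e - e)
      (frag_of (restrict (\<lambda>_. x) (standard_simplex 0)))"
proof -
  let ?G = "cell_homology X e"
  define P where "P g \<longleftrightarrow> g \<in> carrier ?G \<and> carrier (subgroup_generated ?G {g}) = carrier ?G \<and>
       (cell_dim X e = 0 \<longrightarrow>
         (\<exists>x\<in>e. g = homologous_rel_set 0 (subtopology T (cell_closure X e)) (cell_closure X e - e)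
                       (frag_of (restrict (\<lambda>_. x) (standard_simplex 0)))))" for g
  interpret G: group ?G by simp
  have "\<exists>g. P g"
  proof (cases "cell_dim X e = 0")
    case False
    have "cyclic_group ?G"
      using isomorphic_group_cyclicity[OF cell_homology_integer[OF e]] by simp
    then obtain g where "g \<in> carrier ?G" "subgroup_generated ?G {g} = ?G" unfolding cyclic_group_def by blast
    then show ?thesis using False by (auto simp: P_def)
  next
    case True
    then obtain x where x: "x \<in> topspace T" "e = {x}" "cell_closure X e = {x}" using zero_cell[OF e] by blast
    let ?f = "restrict (\<lambda>_. x) (standard_simplex 0)" and ?W = "subtopology T {x}"
    have G: "?G = homology_group 0 ?W" using True x by simp
    have top: "topspace ?W = {x}" using x by simp
    have f: "singular_simplex 0 ?W ?f"
      using x by (auto simp: singular_simplex_def)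
    have "path_connected_space ?W"
      using top by (metis path_connectedin_singleton path_connectedin_def x(1))
    from iso_integer_zeroth_homology_group[OF this f]
    have bij: "bij_betw (pow ?G (homologous_rel_set 0 ?W {} (frag_of ?f))) (UNIV :: int set) (carrier ?G)"
      unfolding G by (simp add: iso_def)
    let ?q = "homologous_rel_set 0 ?W {} (frag_of ?f)"
    have "?q [^]\<^bsub>?G\<^esub> (1::int) \<in> carrier ?G" using bij by (auto simp: bij_betw_def)
    moreover have "singular_relcycle 0 ?W {} (frag_of ?f)"
      by (simp add: chain_boundary_def f singular_chain_of singular_cycle)
    then have q: "?q \<in> carrier ?G" unfolding G by (simp add: carrier_relative_homology_group_0)
    have "carrier (subgroup_generated ?G {?q}) = carrier ?G"
      using G.carrier_subgroup_generated_by_singleton[OF q] bij by (auto simp: bij_betw_def)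
    then have "P ?q" unfolding P_def using q x by auto
    then show ?thesis by blast
  qed
  from someI_ex[OF this] have P: "P (orientation X e)"
    unfolding orientation_def P_def .
  show "infinite_cyclic ?G (orientation X e)"
    by (rule infinite_cyclic_generator[OF _ cell_homology_integer[OF e]]) (use P in \<open>simp_all add: P_def\<close>)
  show "cell_dim X e = 0 \<Longrightarrow> \<exists>x\<in>e. orientation X e = homologous_rel_set 0
      (subtopology T (cell_closure X e)) (cell_closure X e - e)
      (frag_of (restrict (\<lambda>_. x) (standard_simplex 0)))"
    using P unfolding P_def by blast
qed

lemma continuous_inclusion: "A \<subseteq> A' \<Longrightarrow> continuous_map (subtopology T A) (subtopology T A') id"
  by (auto simp: continuous_map_in_subtopology)

text \<open>The class of a cell when only the p-cells in \<open>A\<close> have been attached; for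
  \<open>A = E p\<close> it is \<open>cell_class\<close>. The intermediate groups are needed for the
  induction over \<open>A\<close>.\<close>

definition cls where
  "cls p A e = hom_induced p (subtopology T (cell_closure X e)) (cell_closure X e - e)
    (subtopology T (Y p A)) (skeleton X (p - 1)) id (orientation X e)"

abbreviation "H p A \<equiv> relative_homology_group p (subtopology T (Y p A)) (skeleton X (p - 1))"

lemma cls_carrier: "cls p A e \<in> carrier (H p A)"
  unfolding cls_def by (rule hom_induced_carrier)

lemma cls_inclusion:
  assumes "A \<subseteq> A'" "A' \<subseteq> E p" "e \<in> A"
  shows "hom_induced p (subtopology T (Y p A)) (skeleton X (p - 1)) (subtopology T (Y p A')) (skeleton X (p - 1)) id
    (cls p A e) = cls p A' e"
proof -
  have e: "e \<in> E p" using assms by blast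
  have "cell_closure X e \<subseteq> Y p A" using assms closure_in_Y by blast
  moreover have "Y p A \<subseteq> Y p A'" using assms by (auto simp: Y_def)
  moreover have "cell_closure X e - e \<subseteq> skeleton X (p - 1)"
    using cell_frontier[of e] E_cells[OF e] by simp
  ultimately show ?thesis
    unfolding cls_def by (intro hom_inclusion_comp continuous_inclusion) auto
qed

text \<open>Attach \<open>e\<close> last and use exactness of the triple of
  \<open>Y p (insert e A)\<close>, \<open>Y p A\<close> and the lower skeleton. The quotient term is
  infinite cyclic on the image of the class of \<open>e\<close>, so subtracting a multiple of that
  class leaves an element coming from \<open>Y p A\<close>. With no cells attached the pair is
  trivial. Independence of the classes is a separate matter, settled by \<open>loc\<close>.\<close>

lemma span_cls:
  assumes "finite A" "A \<subseteq> E p" "z \<in> carrier (H p A)"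
  shows "\<exists>m::'a set \<Rightarrow> int. z = finprod (H p A) (\<lambda>e. cls p A e [^]\<^bsub>H p A\<^esub> m e) A"
  using assms
proof (induction A arbitrary: z rule: finite_induct)
  case empty
  have "topspace (subtopology T (Y p {})) = skeleton X (p - 1)"
    using skeleton_subset[of "p - 1"] by (auto simp: Y_def)
  then have "trivial_group (H p {})"
    using trivial_relative_homology_group_topspace[of p "subtopology T (Y p {})"] by simp
  then have "z = \<one>\<^bsub>H p {}\<^esub>" using empty by (simp add: trivial_group_def)
  moreover interpret comm_group "H p {}" by simp
  show ?case using calculation by simp
next
  case (insert e A)
  let ?A = "insert e A" and ?S = "skeleton X (p - 1)"
  let ?W = "subtopology T (Y p ?A)" and ?V = "subtopology T (Y p A)"
  have e: "e \<in> E p" "?A \<subseteq> E p" "A \<subseteq> E p" using insert by auto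
  have Ye: "Y p ?A - e = Y p A"
    using Y_minus[OF e(2), of e] insert(2) by simp
  have YA: "Y p A \<subseteq> Y p ?A" by (auto simp: Y_def)
  have S: "?S \<subseteq> Y p A" by (auto simp: Y_def)
  define q where "q = hom_induced p ?W ?S ?W (Y p A) id"
  define \<iota> where "\<iota> = hom_induced p ?V ?S ?W ?S id"
  have sub: "subtopology ?W (Y p A) = ?V" using YA by (simp add: subtopology_subtopology inf.absorb2)
  interpret HA: comm_group "H p A" by simp
  interpret HI: comm_group "H p ?A" by simp
  interpret K: group "relative_homology_group p ?W (Y p A)" by simp
  have exact: "kernel (H p ?A) (relative_homology_group p ?W (Y p A)) q = \<iota> ` carrier (H p A)"
    using homology_exactness_triple_3[OF S, of p ?W] unfolding sub q_def \<iota>_def by simp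
  have q_hom: "q \<in> hom (H p ?A) (relative_homology_group p ?W (Y p A))"
    unfolding q_def by (rule hom_induced_hom)
  have \<iota>_hom: "\<iota> \<in> hom (H p A) (H p ?A)" unfolding \<iota>_def by (rule hom_induced_hom)
  have ec: "e \<in> cells X" using e E_cells by blast
  let ?j = "hom_induced p (subtopology T (cell_closure X e)) (cell_closure X e - e) ?W (Y p A) id"
  have bij: "bij_betw ?j (carrier (cell_homology X e)) (carrier (relative_homology_group p ?W (Y p A)))"
    using cell_iso_Y[OF e(2), of e p] Ye E_cells(2)[OF e(1)] by simp
  have "infinite_cyclic (relative_homology_group p ?W (Y p A)) (?j (orientation X e))"
    using infinite_cyclic_image[OF _ _ _ bij orientation_spec(1)[OF ec]] E_cells(2)[OF e(1)]
    by (simp add: hom_induced_hom)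
  moreover have qcls: "q (cls p ?A e) = ?j (orientation X e)"
    unfolding q_def cls_def
    using closure_in_Y[OF e(2), of e] cell_frontier[OF ec] E_cells(2)[OF e(1)] S
    by (intro hom_inclusion_comp continuous_inclusion continuous_map_id) auto
  moreover have "q z \<in> carrier (relative_homology_group p ?W (Y p A))"
    unfolding q_def by (rule hom_induced_carrier)
  ultimately obtain k :: int where k: "q z = q (cls p ?A e) [^]\<^bsub>relative_homology_group p ?W (Y p A)\<^esub> k"
    using infinite_cyclic_pow by metis
  let ?c = "cls p ?A e [^]\<^bsub>H p ?A\<^esub> k"
  have c: "?c \<in> carrier (H p ?A)" using cls_carrier by simp
  have z: "z \<in> carrier (H p ?A)" by (rule insert.prems(2))
  have qc: "q ?c = q z"
    unfolding k using hom_int_pow[OF q_hom cls_carrier] by simp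
  interpret Q: group_hom "H p ?A" "relative_homology_group p ?W (Y p A)" q
    by (simp add: group_hom_def group_hom_axioms_def q_hom)
  have "q (z \<otimes>\<^bsub>H p ?A\<^esub> inv\<^bsub>H p ?A\<^esub> ?c) = \<one>\<^bsub>relative_homology_group p ?W (Y p A)\<^esub>"
    using z c qc by simp
  then have "z \<otimes>\<^bsub>H p ?A\<^esub> inv\<^bsub>H p ?A\<^esub> ?c \<in> kernel (H p ?A) (relative_homology_group p ?W (Y p A)) q"
    using z c by (simp add: kernel_def)
  then obtain w where w: "w \<in> carrier (H p A)" "z \<otimes>\<^bsub>H p ?A\<^esub> inv\<^bsub>H p ?A\<^esub> ?c = \<iota> w"
    unfolding exact by blast
  have "\<iota> w \<otimes>\<^bsub>H p ?A\<^esub> ?c = z"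
    unfolding w(2)[symmetric] using z c by (simp add: HI.m_assoc)
  then have zw: "z = \<iota> w \<otimes>\<^bsub>H p ?A\<^esub> ?c" by simp
  obtain m where m: "w = finprod (H p A) (\<lambda>e. cls p A e [^]\<^bsub>H p A\<^esub> (m e :: int)) A"
    using insert.IH[OF e(3) w(1)] by blast
  have "\<iota> w = finprod (H p ?A) (\<lambda>e. \<iota> (cls p A e [^]\<^bsub>H p A\<^esub> m e)) A"
    unfolding m by (rule hom_finprod) (use \<iota>_hom insert(1) cls_carrier in auto)
  also have "\<dots> = finprod (H p ?A) (\<lambda>a. cls p ?A a [^]\<^bsub>H p ?A\<^esub> (m(e := k)) a) A"
  proof (rule HI.finprod_cong')
    fix a assume a: "a \<in> A"
    have "\<iota> (cls p A a [^]\<^bsub>H p A\<^esub> m a) = \<iota> (cls p A a) [^]\<^bsub>H p ?A\<^esub> m a"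
      by (rule hom_int_pow[OF \<iota>_hom cls_carrier]) simp_all
    also have "\<iota> (cls p A a) = cls p ?A a" unfolding \<iota>_def by (rule cls_inclusion) (use a e in auto)
    finally show "\<iota> (cls p A a [^]\<^bsub>H p A\<^esub> m a) = cls p ?A a [^]\<^bsub>H p ?A\<^esub> (m(e := k)) a"
      using a insert(2) by auto
  qed (use cls_carrier in auto)
  finally have "z = finprod (H p ?A) (\<lambda>a. cls p ?A a [^]\<^bsub>H p ?A\<^esub> (m(e := k)) a) A \<otimes>\<^bsub>H p ?A\<^esub> ?c"
    using zw by simp
  also have "\<dots> = finprod (H p ?A) (\<lambda>a. cls p ?A a [^]\<^bsub>H p ?A\<^esub> (m(e := k)) a) ?A"
    using insert(1,2) cls_carrier
    by (subst HI.finprod_insert) (auto simp: HI.m_comm)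
  finally show ?case by blast
qed

subsection \<open>Coordinates\<close>

text \<open>Localisation at \<open>e\<close>: enlarging the subspace to everything but
  \<open>e\<close> kills the other p-cells and leaves an infinite cyclic group in which the
  coordinate at \<open>e\<close> can be read.\<close>

definition loc where
  "loc p e = hom_induced p (skeleton_top X p) (skeleton X (p - 1)) (skeleton_top X p) (skeleton X p - e) id"

abbreviation "L p e \<equiv> relative_homology_group p (skeleton_top X p) (skeleton X p - e)"

lemma cell_group_eq: "cell_group X p = H p (E p)"
  by (simp add: cell_group_def Y_E)

lemma cell_class_eq: "e \<in> E p \<Longrightarrow> cell_class X e = cls p (E p) e"
  by (simp add: cell_class_def cls_def E_cells Y_E)

lemma cell_class_carrier: "e \<in> E p \<Longrightarrow> cell_class X e \<in> carrier (cell_group X p)"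
  by (simp add: cell_class_eq cell_group_eq cls_carrier)

lemma loc_hom: "loc p e \<in> hom (cell_group X p) (L p e)"
  unfolding loc_def cell_group_def by (rule hom_induced_hom)

lemma skeleton_minus: "e \<in> E p \<Longrightarrow> skeleton X (p - 1) \<subseteq> skeleton X p - e"
  using skeleton_mono[of "p - 1" p] skeleton_inter_cell[of e "p - 1"] E_cells[of e p] by fastforce

text \<open>After localisation the target subspace contains the whole image of \<open>f\<close>, so
  the induced map is trivial. All statements about supports of boundaries and of maps come down to
  this.\<close>

lemma loc_hom_induced:
  assumes e: "e \<in> E p" and f: "continuous_map Z (skeleton_top X p) f"
    "f \<in> S \<rightarrow> skeleton X (p - 1)" "f ` topspace Z \<inter> e = {}"
  shows "loc p e (hom_induced p Z S (skeleton_top X p) (skeleton X (p - 1)) f c) = \<one>\<^bsub>L p e\<^esub>"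
proof -
  have "loc p e (hom_induced p Z S (skeleton_top X p) (skeleton X (p - 1)) f c)
      = hom_induced p Z S (skeleton_top X p) (skeleton X p - e) (id \<circ> f) c"
    unfolding loc_def
    by (rule hom_induced_compose'[OF f(1,2)]) (use skeleton_minus[OF e] in auto)
  also have "\<dots> = \<one>\<^bsub>L p e\<^esub>"
  proof (rule hom_induced_into_subspace)
    show "continuous_map Z (skeleton_top X p) (id \<circ> f)" using f(1) by simp
    have "f ` topspace Z \<subseteq> skeleton X p"
      using f(1) by (auto simp: continuous_map_in_subtopology)
    then show "(id \<circ> f) ` topspace Z \<subseteq> skeleton X p - e" using f(3) by auto
  qed
  finally show ?thesis .
qed

lemma loc_class: "e \<in> E p \<Longrightarrow> infinite_cyclic (L p e) (loc p e (cell_class X e))"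
proof -
  assume e: "e \<in> E p"
  let ?j = "hom_induced p (subtopology T (cell_closure X e)) (cell_closure X e - e)
    (skeleton_top X p) (skeleton X p - e) id"
  have bij: "bij_betw ?j (carrier (cell_homology X e)) (carrier (L p e))"
    using cell_iso_Y[OF order_refl e, of p] E_cells(2)[OF e] unfolding Y_E by simp
  have "infinite_cyclic (L p e) (?j (orientation X e))"
    using infinite_cyclic_image[OF _ _ _ bij orientation_spec(1)] E_cells[OF e]
    by (simp add: hom_induced_hom)
  also have "?j (orientation X e) = loc p e (cell_class X e)"
    unfolding loc_def cell_class_eq[OF e] cls_def Y_E
    using closure_in_Y[OF order_refl e] cell_frontier[of e] E_cells[OF e] skeleton_minus[OF e]
    by (intro hom_inclusion_comp[symmetric] continuous_inclusion continuous_map_id) (auto simp: Y_E)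
  finally show ?thesis .
qed

text \<open>The closed cell of \<open>e'\<close> consists of \<open>e'\<close> and points of the
  lower skeleton, both disjoint from \<open>e\<close>.\<close>

lemma loc_class_other:
  assumes e: "e \<in> E p" "e' \<in> E p" "e \<noteq> e'"
  shows "loc p e (cell_class X e') = \<one>\<^bsub>L p e\<^esub>"
  unfolding cell_class_eq[OF e(2)] cls_def Y_E
proof (rule loc_hom_induced[OF e(1)])
  show "continuous_map (subtopology T (cell_closure X e')) (skeleton_top X p) id"
    using closure_in_Y[OF order_refl e(2)] by (intro continuous_inclusion) (simp add: Y_E)
  have fr: "cell_closure X e' - e' \<subseteq> skeleton X (p - 1)"
    using cell_frontier[of e'] E_cells[OF e(2)] by simp
  then show "id \<in> cell_closure X e' - e' \<rightarrow> skeleton X (p - 1)" by auto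
  have "skeleton X (p - 1) \<inter> e = {}" using skeleton_minus[OF e(1)] by blast
  moreover have "e' \<inter> e = {}" using disjoint E_cells e by metis
  ultimately show "id ` topspace (subtopology T (cell_closure X e')) \<inter> e = {}" using fr by auto
qed

lemma loc_finprod:
  fixes m :: "'a set \<Rightarrow> int"
  assumes e: "e \<in> E p"
  shows "loc p e (finprod (cell_group X p) (\<lambda>e. cell_class X e [^]\<^bsub>cell_group X p\<^esub> m e) (E p))
    = loc p e (cell_class X e) [^]\<^bsub>L p e\<^esub> m e"
proof -
  have G: "comm_group (cell_group X p)" "group (cell_group X p)" by (simp_all add: cell_group_def)
  interpret G: comm_group "cell_group X p" by (rule G)
  interpret L: comm_group "L p e" by simp
  have lc: "loc p e (cell_class X e') \<in> carrier (L p e)" if "e' \<in> E p" for e'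
    using hom_in_carrier[OF loc_hom cell_class_carrier[OF that]] .
  have "loc p e (finprod (cell_group X p) (\<lambda>e. cell_class X e [^]\<^bsub>cell_group X p\<^esub> m e) (E p))
      = finprod (L p e) (\<lambda>e'. loc p e (cell_class X e' [^]\<^bsub>cell_group X p\<^esub> m e')) (E p)"
    by (rule hom_finprod[OF G(1) _ loc_hom finite_E]) (auto simp: cell_class_carrier)
  also have "\<dots> = finprod (L p e) (\<lambda>e'. if e = e' then loc p e (cell_class X e') [^]\<^bsub>L p e\<^esub> m e' else \<one>\<^bsub>L p e\<^esub>) (E p)"
  proof (rule L.finprod_cong')
    fix e' assume e': "e' \<in> E p"
    have "loc p e (cell_class X e' [^]\<^bsub>cell_group X p\<^esub> m e') = loc p e (cell_class X e') [^]\<^bsub>L p e\<^esub> m e'"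
      by (rule hom_int_pow[OF loc_hom cell_class_carrier[OF e'] G(2)]) simp
    then show "loc p e (cell_class X e' [^]\<^bsub>cell_group X p\<^esub> m e')
        = (if e = e' then loc p e (cell_class X e') [^]\<^bsub>L p e\<^esub> m e' else \<one>\<^bsub>L p e\<^esub>)"
      using loc_class_other[OF e e'] by simp
  qed (use lc in auto)
  also have "\<dots> = loc p e (cell_class X e) [^]\<^bsub>L p e\<^esub> m e"
    by (rule L.finprod_singleton[OF e finite_E]) (use lc in auto)
  finally show ?thesis .
qed

text \<open>Makes the description in \<open>cell_coord\<close> definite. Existence is
  \<open>span_cls\<close>, with exponents set to 0 away from the p-cells; uniqueness holds because
  localising at \<open>e\<close> isolates the exponent of \<open>e\<close> on a class of infinite
  order.\<close>

lemma coord_spec: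
  assumes z: "z \<in> carrier (cell_group X p)"
  shows "z = finprod (cell_group X p) (\<lambda>e. cell_class X e [^]\<^bsub>cell_group X p\<^esub> cell_coord X p z e) (E p)"
    and "e \<notin> E p \<Longrightarrow> cell_coord X p z e = 0"
proof -
  define P where "P m \<longleftrightarrow> (\<forall>e. e \<notin> cells_of_dim X p \<longrightarrow> m e = 0) \<and>
       z = finprod (cell_group X p)
             (\<lambda>e. cell_class X e [^]\<^bsub>cell_group X p\<^esub> (m e :: int)) (cells_of_dim X p)" for m
  interpret G: comm_group "cell_group X p" by (simp add: cell_group_def)
  obtain m where m: "z = finprod (H p (E p)) (\<lambda>e. cls p (E p) e [^]\<^bsub>H p (E p)\<^esub> (m e :: int)) (E p)"
    using span_cls[OF finite_E order_refl, of z p] z unfolding cell_group_eq by blast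
  have "z = finprod (cell_group X p) (\<lambda>e. cell_class X e [^]\<^bsub>cell_group X p\<^esub> (if e \<in> E p then m e else 0)) (E p)"
    unfolding m cell_group_eq[symmetric]
    by (rule G.finprod_cong') (auto simp: cell_class_carrier simp flip: cell_class_eq)
  then have ex: "P (\<lambda>e. if e \<in> E p then m e else 0)"
    unfolding P_def E_def by simp
  have uniq: "m1 = m2" if "P m1" "P m2" for m1 m2
  proof
    fix e show "m1 e = m2 e"
    proof (cases "e \<in> E p")
      case True
      have "loc p e z = loc p e (cell_class X e) [^]\<^bsub>L p e\<^esub> m e" if "P m" for m
        using loc_finprod[OF True, of m] that unfolding P_def E_def by simp
      from this[OF that(1)] this[OF that(2)] show ?thesis
        using infinite_cyclic_inj[OF _ loc_class[OF True]] by simp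
    qed (use that in \<open>auto simp: P_def E_def\<close>)
  qed
  have "P (cell_coord X p z)"
    unfolding cell_coord_def using theI[of P, OF ex] uniq[OF _ ex] unfolding P_def by blast
  then show "z = finprod (cell_group X p) (\<lambda>e. cell_class X e [^]\<^bsub>cell_group X p\<^esub> cell_coord X p z e) (E p)"
    "e \<notin> E p \<Longrightarrow> cell_coord X p z e = 0"
    by (simp_all add: P_def E_def)
qed

lemma loc_coord:
  "z \<in> carrier (cell_group X p) \<Longrightarrow> e \<in> E p \<Longrightarrow>
    loc p e z = loc p e (cell_class X e) [^]\<^bsub>L p e\<^esub> cell_coord X p z e"
  using loc_finprod[of e p "cell_coord X p z"] coord_spec(1)[of z p] by simp

lemma coord_eqI:
  assumes "z \<in> carrier (cell_group X p)" "e \<in> E p"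
    "loc p e z = loc p e (cell_class X e) [^]\<^bsub>L p e\<^esub> (k::int)"
  shows "cell_coord X p z e = k"
  using infinite_cyclic_inj[OF _ loc_class[OF assms(2)]] loc_coord[OF assms(1,2)] assms(3) by simp

lemma coord_hom: "(\<lambda>z. cell_coord X p z e) \<in> hom (cell_group X p) integer_group"
proof (rule homI)
  fix z z' assume z: "z \<in> carrier (cell_group X p)" "z' \<in> carrier (cell_group X p)"
  interpret G: comm_group "cell_group X p" by (simp add: cell_group_def)
  interpret L: group "L p e" by simp
  show "cell_coord X p (z \<otimes>\<^bsub>cell_group X p\<^esub> z') e
      = cell_coord X p z e \<otimes>\<^bsub>integer_group\<^esub> cell_coord X p z' e"
  proof (cases "e \<in> E p")
    case True
    have c: "loc p e (cell_class X e) \<in> carrier (L p e)"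
      using loc_class[OF True] by (rule infinite_cyclic_carrier)
    have "loc p e (z \<otimes>\<^bsub>cell_group X p\<^esub> z') = loc p e z \<otimes>\<^bsub>L p e\<^esub> loc p e z'"
      by (rule hom_mult[OF loc_hom z])
    also have "\<dots> = loc p e (cell_class X e) [^]\<^bsub>L p e\<^esub> (cell_coord X p z e + cell_coord X p z' e)"
      unfolding loc_coord[OF z(1) True] loc_coord[OF z(2) True] by (rule L.int_pow_mult[OF c, symmetric])
    finally have "cell_coord X p (z \<otimes>\<^bsub>cell_group X p\<^esub> z') e = cell_coord X p z e + cell_coord X p z' e"
      by (intro coord_eqI[OF _ True] G.m_closed z)
    then show ?thesis by simp
  next
    case False
    then show ?thesis using z coord_spec(2) by simp
  qed
qed simp

lemma coord_one: "cell_coord X p \<one>\<^bsub>cell_group X p\<^esub> e = 0"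
  using hom_one[OF coord_hom _ group_integer_group, of p e] by (simp add: cell_group_def)

lemma coord_eq_zero:
  assumes "z \<in> carrier (cell_group X p)" "e \<in> E p \<Longrightarrow> loc p e z = \<one>\<^bsub>L p e\<^esub>"
  shows "cell_coord X p z e = 0"
proof (cases "e \<in> E p")
  case True
  then show ?thesis by (intro coord_eqI[OF assms(1)]) (simp_all add: assms(2))
qed (simp add: coord_spec(2)[OF assms(1)])

lemma coord_class:
  assumes "e' \<in> E p" shows "cell_coord X p (cell_class X e') e = (if e = e' then 1 else 0)"
proof (cases "e \<in> E p")
  case True
  interpret L: group "L p e" by simp
  have c: "loc p e (cell_class X e) \<in> carrier (L p e)"
    using loc_class[OF True] by (rule infinite_cyclic_carrier)
  show ?thesis
  proof (rule coord_eqI[OF cell_class_carrier[OF assms] True])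
    show "loc p e (cell_class X e') = loc p e (cell_class X e) [^]\<^bsub>L p e\<^esub> (if e = e' then 1 else 0 :: int)"
      using loc_class_other[OF True assms] L.int_pow_1[OF c] by (cases "e = e'") simp_all
  qed
next
  case False
  then show ?thesis using coord_spec(2)[OF cell_class_carrier[OF assms]] assms by auto
qed

end

lemma finprod_integer_group: "finite A \<Longrightarrow> finprod integer_group f A = sum f A"
proof (induction A rule: finite_induct)
  case empty
  interpret comm_group integer_group by (rule abelian_integer_group)
  show ?case by simp
next
  case (insert a A)
  interpret comm_group integer_group by (rule abelian_integer_group)
  show ?case using insert by simp
qed

text \<open>Applied to a coordinate of a boundary or of an image, this is the step from
  homomorphisms to integer matrices.\<close>

lemma coord_hom_expansion:
  assumes X: "regular_cw X" and \<kappa>: "\<kappa> \<in> hom (cell_group X p) integer_group"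
    and z: "z \<in> carrier (cell_group X p)"
  shows "\<kappa> z = (\<Sum>e\<in>cells_of_dim X p. cell_coord X p z e * \<kappa> (cell_class X e))"
proof -
  interpret X: regular_complex X by (unfold_locales) (rule X)
  interpret G: comm_group "cell_group X p" by (simp add: cell_group_def)
  have "\<kappa> z = \<kappa> (finprod (cell_group X p) (\<lambda>e. cell_class X e [^]\<^bsub>cell_group X p\<^esub> cell_coord X p z e) (X.E p))"
    using X.coord_spec(1)[OF z] by simp
  also have "\<dots> = finprod integer_group (\<lambda>e. \<kappa> (cell_class X e [^]\<^bsub>cell_group X p\<^esub> cell_coord X p z e)) (X.E p)"
    by (rule hom_finprod[OF G.comm_group_axioms abelian_integer_group \<kappa> X.finite_E])
      (auto simp: X.cell_class_carrier)
  also have "\<dots> = (\<Sum>e\<in>X.E p. \<kappa> (cell_class X e [^]\<^bsub>cell_group X p\<^esub> cell_coord X p z e))"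
    by (rule finprod_integer_group[OF X.finite_E])
  also have "\<dots> = (\<Sum>e\<in>X.E p. cell_coord X p z e * \<kappa> (cell_class X e))"
    by (rule sum.cong[OF refl])
      (simp add: hom_int_pow[OF \<kappa> X.cell_class_carrier G.group_axioms group_integer_group])
  finally show ?thesis by (simp add: X.E_def)
qed

section \<open>Finitely supported functions\<close>

lemma lookup_lin_scale [simp]: "Poly_Mapping.lookup (lin_scale k x) c = k * Poly_Mapping.lookup x c"
  by (simp add: lin_scale_def Poly_Mapping.map.rep_eq when_def)

interpretation free: vector_space lin_scale
  by unfold_locales
    (auto intro!: poly_mapping_eqI simp: Poly_Mapping.lookup_add algebra_simps)

abbreviation lin :: "(('c \<Rightarrow>\<^sub>0 'k::field) \<Rightarrow> ('d \<Rightarrow>\<^sub>0 'k)) \<Rightarrow> bool" where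
  "lin f \<equiv> module_hom lin_scale lin_scale f"

abbreviation basis_vec :: "'c \<Rightarrow> ('c \<Rightarrow>\<^sub>0 'k::field)" where
  "basis_vec b \<equiv> Poly_Mapping.single b 1"

lemma linI:
  assumes "\<And>x y. f (x + y) = f x + f y" "\<And>k x. f (lin_scale k x) = lin_scale k (f x)"
  shows "lin f"
  using assms by (intro module_hom.intro free.module_axioms module_hom_axioms.intro) auto

lemmas lin_add = module_hom.add and lin_scale = module_hom.scale and lin_zero = module_hom.zero
  and lin_neg = module_hom.neg and lin_diff = module_hom.diff and lin_sum = module_hom.sum

lemma lin_compose: "lin f \<Longrightarrow> lin g \<Longrightarrow> lin (\<lambda>x. g (f x))"
  by (rule linI) (simp_all add: lin_add lin_scale)

lemma lin_extend_superset:
  assumes "finite A" "Poly_Mapping.keys x \<subseteq> A"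
  shows "lin_extend \<phi> x = (\<Sum>b\<in>A. lin_scale (Poly_Mapping.lookup x b) (\<phi> b))"
  unfolding lin_extend_def
  by (rule sum.mono_neutral_left) (use assms in \<open>auto simp: in_keys_iff\<close>)

lemma lin_extend_lin [simp]:
  fixes \<phi> :: "'c \<Rightarrow> ('d \<Rightarrow>\<^sub>0 'k::field)"
  shows "lin (lin_extend \<phi>)"
proof (rule linI)
  fix x y :: "'c \<Rightarrow>\<^sub>0 'k"
  let ?A = "Poly_Mapping.keys x \<union> Poly_Mapping.keys y"
  show "lin_extend \<phi> (x + y) = lin_extend \<phi> x + lin_extend \<phi> y"
    using Poly_Mapping.keys_add[of x y]
    by (simp add: lin_extend_superset[of ?A] Poly_Mapping.lookup_add free.scale_left_distrib sum.distrib)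
next
  fix k and x :: "'c \<Rightarrow>\<^sub>0 'k"
  have "Poly_Mapping.keys (lin_scale k x) \<subseteq> Poly_Mapping.keys x"
    by (auto simp: in_keys_iff)
  then show "lin_extend \<phi> (lin_scale k x) = lin_scale k (lin_extend \<phi> x)"
    by (simp add: lin_extend_superset[of "Poly_Mapping.keys x"] free.scale_sum_right)
qed

lemma lin_extend_single [simp]: "lin_extend \<phi> (Poly_Mapping.single b k) = lin_scale k (\<phi> b)"
  by (simp add: lin_extend_superset[of "{b}"])

lemma scale_basis: "lin_scale k (basis_vec b) = Poly_Mapping.single b k"
  by (rule poly_mapping_eqI) (simp add: Poly_Mapping.lookup_single when_def)

lemma basis_expansion: "lin_extend basis_vec x = x"
proof (rule poly_mapping_eqI)
  fix c
  have "Poly_Mapping.lookup (lin_extend basis_vec x) c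
      = (\<Sum>b\<in>Poly_Mapping.keys x. if b = c then Poly_Mapping.lookup x b else 0)"
    unfolding lin_extend_def Poly_Mapping.lookup_sum
    by (rule sum.cong) (simp_all add: Poly_Mapping.lookup_single when_def)
  also have "\<dots> = Poly_Mapping.lookup x c"
    by (simp add: in_keys_iff)
  finally show "Poly_Mapping.lookup (lin_extend basis_vec x) c = Poly_Mapping.lookup x c" .
qed

lemma lin_eq_lin_extend:
  assumes "lin f" shows "f x = lin_extend (\<lambda>b. f (basis_vec b)) x"
proof -
  have "f x = f (lin_extend basis_vec x)"
    by (simp add: basis_expansion)
  also have "\<dots> = lin_extend (\<lambda>b. f (basis_vec b)) x"
    by (simp add: lin_sum[OF assms] lin_scale[OF assms] lin_extend_def)
  finally show ?thesis .
qed

lemma lin_extend_cong: "(\<And>b. b \<in> Poly_Mapping.keys x \<Longrightarrow> \<phi> b = \<psi> b) \<Longrightarrow> lin_extend \<phi> x = lin_extend \<psi> x"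
  by (simp add: lin_extend_def)

lemma lin_eqI:
  assumes "lin f" "lin g" "\<And>b. b \<in> Poly_Mapping.keys x \<Longrightarrow> f (basis_vec b) = g (basis_vec b)"
  shows "f x = g x"
  unfolding lin_eq_lin_extend[OF assms(1), of x] lin_eq_lin_extend[OF assms(2), of x]
  by (rule lin_extend_cong) (rule assms(3))

lemma lin_lin_extend: "lin f \<Longrightarrow> f (lin_extend \<phi> x) = lin_extend (\<lambda>b. f (\<phi> b)) x"
  by (simp add: lin_extend_def lin_sum lin_scale)

lemma span_on_iff: "x \<in> span_on S \<longleftrightarrow> Poly_Mapping.keys x \<subseteq> S"
  by (simp add: span_on_def)

lemma subspace_span_on [simp]:
  fixes S :: "'c set" shows "free.subspace (span_on S :: ('c \<Rightarrow>\<^sub>0 'k::field) set)"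
proof (rule free.subspaceI)
  show "x + y \<in> span_on S" if "x \<in> span_on S" "y \<in> span_on S" for x y :: "'c \<Rightarrow>\<^sub>0 'k"
    using that Poly_Mapping.keys_add[of x y] by (auto simp: span_on_iff)
qed (auto simp: span_on_iff in_keys_iff)

lemma basis_in_span_on [simp]: "basis_vec b \<in> span_on S \<longleftrightarrow> b \<in> S"
  by (simp add: span_on_iff)

lemma single_in_span_on: "b \<in> S \<Longrightarrow> Poly_Mapping.single b k \<in> span_on S"
  by (simp add: span_on_iff)

lemma span_on_mono: "S \<subseteq> T \<Longrightarrow> x \<in> span_on S \<Longrightarrow> x \<in> span_on T"
  by (auto simp: span_on_iff)

lemma span_on_empty: "x \<in> span_on {} \<longleftrightarrow> x = 0"
  by (auto simp: span_on_iff)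

lemma lin_extend_in_subspace:
  assumes "free.subspace V" "\<And>b. b \<in> Poly_Mapping.keys x \<Longrightarrow> \<phi> b \<in> V"
  shows "lin_extend \<phi> x \<in> V"
  unfolding lin_extend_def using assms by (auto intro!: free.subspace_sum free.subspace_scale)

lemma lin_in_subspace:
  assumes "lin f" "free.subspace V" "x \<in> span_on S" "\<And>b. b \<in> S \<Longrightarrow> f (basis_vec b) \<in> V"
  shows "f x \<in> V"
  unfolding lin_eq_lin_extend[OF assms(1), of x]
  by (rule lin_extend_in_subspace) (use assms in \<open>auto simp: span_on_iff\<close>)

lemma lin_zero_on: "lin f \<Longrightarrow> x \<in> span_on S \<Longrightarrow> (\<And>b. b \<in> S \<Longrightarrow> f (basis_vec b) = 0) \<Longrightarrow> f x = 0"
  using lin_in_subspace[of f "{0}" x S] by simp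

text \<open>On 0-chains this is the augmentation. It is defined for all chains so that it can also
  be applied to column components of a double complex, whose total degree is not 0.\<close>

definition coeff_sum :: "('c \<Rightarrow>\<^sub>0 'k::field) \<Rightarrow> 'k" where
  "coeff_sum x = (\<Sum>b\<in>Poly_Mapping.keys x. Poly_Mapping.lookup x b)"

lemma coeff_sum_superset:
  assumes "finite A" "Poly_Mapping.keys x \<subseteq> A"
  shows "coeff_sum x = (\<Sum>b\<in>A. Poly_Mapping.lookup x b)"
  unfolding coeff_sum_def
  by (rule sum.mono_neutral_left) (use assms in \<open>auto simp: in_keys_iff\<close>)

lemma coeff_sum_add: "coeff_sum (x + y) = coeff_sum x + coeff_sum y"
  using Poly_Mapping.keys_add[of x y]
  by (simp add: coeff_sum_superset[of "Poly_Mapping.keys x \<union> Poly_Mapping.keys y"]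
      Poly_Mapping.lookup_add sum.distrib)

lemma coeff_sum_scale: "coeff_sum (lin_scale k x) = k * coeff_sum x"
proof -
  have "Poly_Mapping.keys (lin_scale k x) \<subseteq> Poly_Mapping.keys x"
    by (auto simp: in_keys_iff)
  then show ?thesis
    by (simp add: coeff_sum_superset[of "Poly_Mapping.keys x"] sum_distrib_left)
qed

lemma coeff_sum_zero [simp]: "coeff_sum 0 = 0"
  by (simp add: coeff_sum_def)

lemma coeff_sum_single [simp]: "coeff_sum (Poly_Mapping.single b k) = k"
  by (simp add: coeff_sum_superset[of "{b}"])

lemma coeff_sum_diff: "coeff_sum (x - y) = coeff_sum x - coeff_sum y"
  using coeff_sum_add[of "x - y" y] by simp

lemma coeff_sum_sum: "coeff_sum (sum f A) = (\<Sum>a\<in>A. coeff_sum (f a))"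
  by (induction A rule: infinite_finite_induct) (simp_all add: coeff_sum_add)

lemma coeff_sum_lin_extend:
  assumes "\<And>b. b \<in> Poly_Mapping.keys x \<Longrightarrow> coeff_sum (\<phi> b) = c"
  shows "coeff_sum (lin_extend \<phi> x) = coeff_sum x * c"
  by (simp add: lin_extend_def coeff_sum_sum coeff_sum_scale assms sum_distrib_right coeff_sum_def[of x])

lemma coeff_sum_lin:
  assumes "lin f" "\<And>b. b \<in> Poly_Mapping.keys x \<Longrightarrow> coeff_sum (f (basis_vec b)) = c"
  shows "coeff_sum (f x) = coeff_sum x * c"
  unfolding lin_eq_lin_extend[OF assms(1), of x] using assms(2) by (rule coeff_sum_lin_extend)

text \<open>A row of an integer matrix read in the field; both \<open>cell_boundary\<close> and
  \<open>cell_push\<close> are of this form.\<close>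

definition int_chain :: "'c set \<Rightarrow> ('c \<Rightarrow> int) \<Rightarrow> ('c \<Rightarrow>\<^sub>0 'k::field)" where
  "int_chain S a = (\<Sum>t\<in>S. Poly_Mapping.single t (of_int (a t)))"

lemma lookup_int_chain:
  assumes "finite S"
  shows "Poly_Mapping.lookup (int_chain S a) t = (if t \<in> S then of_int (a t) else 0)"
  unfolding int_chain_def Poly_Mapping.lookup_sum Poly_Mapping.lookup_single when_def
  using assms by (simp add: sum.delta')

lemma keys_int_chain: "finite S \<Longrightarrow> Poly_Mapping.keys (int_chain S a :: 'c \<Rightarrow>\<^sub>0 'k::field) \<subseteq> {t \<in> S. a t \<noteq> 0}"
  by (auto simp: in_keys_iff lookup_int_chain split: if_splits)

lemma int_chain_cong: "(\<And>t. t \<in> S \<Longrightarrow> a t = b t) \<Longrightarrow> int_chain S a = int_chain S b"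
  unfolding int_chain_def by (rule sum.cong) auto

lemma int_chain_zero: "(\<And>t. t \<in> S \<Longrightarrow> a t = 0) \<Longrightarrow> int_chain S a = 0"
  unfolding int_chain_def by (rule sum.neutral) auto

lemma int_chain_delta: "finite S \<Longrightarrow> s \<in> S \<Longrightarrow> int_chain S (\<lambda>t. if t = s then 1 else 0) = basis_vec s"
  by (rule poly_mapping_eqI) (auto simp: lookup_int_chain Poly_Mapping.lookup_single when_def)

lemma coeff_sum_int_chain: "coeff_sum (int_chain S a) = of_int (sum a S)"
  unfolding int_chain_def by (simp add: coeff_sum_sum)

text \<open>The product of integer matrices. Through it, identities proved for integral homology
  classes pass to chains over any field.\<close>

lemma lin_extend_int_chain:
  assumes "finite S" "finite S'" "\<And>t. t \<in> S \<Longrightarrow> \<phi> t = int_chain S' (b t)"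
  shows "lin_extend \<phi> (int_chain S a :: 'c \<Rightarrow>\<^sub>0 'k::field) = int_chain S' (\<lambda>s. \<Sum>t\<in>S. a t * b t s)"
proof (rule poly_mapping_eqI)
  fix s
  have "lin_extend \<phi> (int_chain S a :: 'c \<Rightarrow>\<^sub>0 'k) = (\<Sum>t\<in>S. lin_scale (of_int (a t)) (\<phi> t))"
    using keys_int_chain[OF assms(1), of a, where 'k = 'k] assms(1)
    by (subst lin_extend_superset[of S]) (auto simp: lookup_int_chain intro!: sum.cong)
  also have "\<dots> = (\<Sum>t\<in>S. lin_scale (of_int (a t)) (int_chain S' (b t)))"
    by (rule sum.cong) (simp_all add: assms(3))
  finally show "Poly_Mapping.lookup (lin_extend \<phi> (int_chain S a :: 'c \<Rightarrow>\<^sub>0 'k)) s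
      = Poly_Mapping.lookup (int_chain S' (\<lambda>s. \<Sum>t\<in>S. a t * b t s)) s"
    by (simp add: Poly_Mapping.lookup_sum lookup_int_chain[OF assms(2)])
qed

section \<open>Cellular chains\<close>

lemma cell_boundary_eq: "cell_boundary X e = int_chain (cells_of_dim X (int (cell_dim X e) - 1)) (incidence X e)"
  by (simp add: cell_boundary_def int_chain_def)

lemma cell_push_eq: "cell_push X Y f e = int_chain (cells_of_dim Y (int (cell_dim X e))) (map_degree X Y f e)"
  by (simp add: cell_push_def int_chain_def)

lemma cell_boundary_of_dim:
  "t \<in> cells_of_dim X m \<Longrightarrow> cell_boundary X t = int_chain (cells_of_dim X (m - 1)) (incidence X t)"
  by (auto simp: cell_boundary_eq cells_of_dim_def)

lemma cell_push_of_dim: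
  "t \<in> cells_of_dim X m \<Longrightarrow> cell_push X Y f t = int_chain (cells_of_dim Y m) (map_degree X Y f t)"
  by (auto simp: cell_push_eq cells_of_dim_def)

definition bdry :: "'a cw \<Rightarrow> int \<Rightarrow> 'a chain set \<Rightarrow> 'a chain set" where
  "bdry X n = hom_relboundary n (skeleton_top X n) (skeleton X (n - 1)) (skeleton X (n - 2))"

definition push :: "'a cw \<Rightarrow> 'b cw \<Rightarrow> ('a \<Rightarrow> 'b) \<Rightarrow> int \<Rightarrow> 'a chain set \<Rightarrow> 'b chain set" where
  "push X Y f n = hom_induced n (skeleton_top X n) (skeleton X (n - 1))
    (skeleton_top Y n) (skeleton Y (n - 1)) f"

lemma incidence_eq: "int (cell_dim X e) = n \<Longrightarrow> incidence X e t = cell_coord X (n - 1) (bdry X n (cell_class X e)) t"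
  by (auto simp: incidence_def bdry_def Let_def)

lemma map_degree_eq: "int (cell_dim X e) = n \<Longrightarrow> map_degree X Y f e t = cell_coord Y n (push X Y f n (cell_class X e)) t"
  by (auto simp: map_degree_def push_def Let_def)

lemma (in regular_complex) skeleton_top_skeleton:
  "p \<le> q \<Longrightarrow> subtopology (skeleton_top X q) (skeleton X p) = skeleton_top X p"
  using skeleton_mono[of p q] by (simp add: subtopology_subtopology inf.absorb2)

lemma (in regular_complex) bdry_hom: "bdry X n \<in> hom (cell_group X n) (cell_group X (n - 1))"
  using group_homomorphism_hom_relboundary[of n "skeleton_top X n" "skeleton X (n - 1)" "skeleton X (n - 2)"]
    skeleton_top_skeleton[of "n - 1" n]
  by (simp add: bdry_def cell_group_def)

lemma push_hom: "push X Y f n \<in> hom (cell_group X n) (cell_group Y n)"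
  unfolding push_def cell_group_def by (rule hom_induced_hom)

text \<open>The connecting map of a triple factors through the absolute group of X^(n-1). In the
  composite, the map from that group to (X^(n-1), X^(n-2)) is followed by the boundary of the same
  pair, and two consecutive maps of an exact sequence compose to zero.\<close>

lemma (in regular_complex) bdry_bdry:
  "bdry X (n - 1) (bdry X n z) = \<one>\<^bsub>cell_group X (n - 2)\<^esub>"
proof -
  let ?W = "skeleton_top X (n - 1)" and ?S = "skeleton X (n - 2)" and ?R = "skeleton X (n - 3)"
  let ?y = "hom_boundary n (skeleton_top X n) (skeleton X (n - 1)) z"
  have sub: "subtopology (skeleton_top X n) (skeleton X (n - 1)) = ?W" by (rule skeleton_top_skeleton) simp
  have sub2: "subtopology ?W ?S = skeleton_top X (n - 2)" by (rule skeleton_top_skeleton) simp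
  have y: "?y \<in> carrier (homology_group (n - 1) ?W)"
    using hom_boundary_carrier[of n "skeleton_top X n" "skeleton X (n - 1)" z] unfolding sub .
  let ?w = "hom_induced (n - 1) ?W {} ?W ?S id ?y"
  have "?w \<in> kernel (relative_homology_group (n - 1) ?W ?S)
      (homology_group (n - 1 - 1) (subtopology ?W ?S)) (hom_boundary (n - 1) ?W ?S)"
    using homology_exactness_axiom_1[of "n - 1" ?W ?S] y by auto
  then have w: "hom_boundary (n - 1) ?W ?S ?w = \<one>\<^bsub>homology_group (n - 2) (skeleton_top X (n - 2))\<^esub>"
    by (simp add: kernel_def sub2)
  have "bdry X n z = ?w" by (simp add: bdry_def hom_relboundary_def sub)
  then have "bdry X (n - 1) (bdry X n z) =
      hom_induced (n - 2) (skeleton_top X (n - 2)) {} (skeleton_top X (n - 2)) ?R id (hom_boundary (n - 1) ?W ?S ?w)"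
    by (simp add: bdry_def hom_relboundary_def sub2)
  also have "\<dots> = \<one>\<^bsub>cell_group X (n - 2)\<^esub>"
    unfolding w cell_group_def using hom_one[OF hom_induced_hom] by simp
  finally show ?thesis .
qed

lemma (in regular_complex) finite_cells_of_dim [simp]: "finite (cells_of_dim X p)"
  using finite_E by (simp add: E_def)

lemma (in regular_complex) bdry_coord_expansion:
  assumes "z \<in> carrier (cell_group X n)"
  shows "cell_coord X (n - 1) (bdry X n z) s = (\<Sum>t\<in>cells_of_dim X n. cell_coord X n z t * incidence X t s)"
proof -
  have "(\<lambda>z. cell_coord X (n - 1) (bdry X n z) s) \<in> hom (cell_group X n) integer_group"
    by (rule hom_compose[OF bdry_hom coord_hom, unfolded o_def])
  from coord_hom_expansion[OF regular this assms] show ?thesis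
    by (simp add: incidence_eq[of X _ n] cells_of_dim_def)
qed

lemma push_coord_expansion:
  assumes "regular_cw X" "regular_cw Y" "z \<in> carrier (cell_group X n)"
  shows "cell_coord Y n (push X Y f n z) s = (\<Sum>t\<in>cells_of_dim X n. cell_coord X n z t * map_degree X Y f t s)"
proof -
  interpret Y: regular_complex Y by unfold_locales (rule assms)
  have "(\<lambda>z. cell_coord Y n (push X Y f n z) s) \<in> hom (cell_group X n) integer_group"
    by (rule hom_compose[OF push_hom Y.coord_hom, unfolded o_def])
  from coord_hom_expansion[OF assms(1) this assms(3)] show ?thesis
    by (simp add: map_degree_eq[of X _ n] cells_of_dim_def)
qed

lemma (in regular_complex) cell_class_carrier':
  "e \<in> cells X \<Longrightarrow> int (cell_dim X e) = n \<Longrightarrow> cell_class X e \<in> carrier (cell_group X n)"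
  by (rule cell_class_carrier) (simp add: E_def cells_of_dim_def)

lemma cellular_boundary_boundary:
  assumes "regular_cw X" "e \<in> cells X"
  shows "cellular_boundary X (cell_boundary X e) = 0"
proof -
  interpret regular_complex X by unfold_locales (rule assms)
  define n where "n = int (cell_dim X e)"
  have z: "bdry X n (cell_class X e) \<in> carrier (cell_group X (n - 1))"
    by (rule hom_in_carrier[OF bdry_hom cell_class_carrier'[OF assms(2)]]) (simp add: n_def)
  have "cellular_boundary X (cell_boundary X e)
      = int_chain (cells_of_dim X (n - 1 - 1)) (\<lambda>s. \<Sum>t\<in>cells_of_dim X (n - 1). incidence X e t * incidence X t s)"
    unfolding cellular_boundary_def cell_boundary_eq[of X e] n_def[symmetric]
    by (rule lin_extend_int_chain) (simp_all add: cell_boundary_of_dim)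
  also have "\<dots> = 0"
  proof (rule int_chain_zero)
    fix s
    have "(\<Sum>t\<in>cells_of_dim X (n - 1). incidence X e t * incidence X t s)
        = cell_coord X (n - 1 - 1) (bdry X (n - 1) (bdry X n (cell_class X e))) s"
      unfolding bdry_coord_expansion[OF z] by (simp add: incidence_eq[of X e n] n_def)
    also have "\<dots> = 0" unfolding bdry_bdry using coord_one[of "n - 2" s] by simp
    finally show "(\<Sum>t\<in>cells_of_dim X (n - 1). incidence X e t * incidence X t s) = 0" .
  qed
  finally show ?thesis .
qed

subsection \<open>Cellular maps\<close>

text \<open>The part of \<open>regular_morphism\<close> on which functoriality of chains rests; the
  condition on closures of images enters only for supports.\<close>

definition skeletal :: "'a cw \<Rightarrow> 'b cw \<Rightarrow> ('a \<Rightarrow> 'b) \<Rightarrow> bool" where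
  "skeletal X Y f \<longleftrightarrow> continuous_map (space X) (space Y) f \<and> (\<forall>p. f ` skeleton X p \<subseteq> skeleton Y p)"

lemma regular_morphism_skeletal: "regular_morphism X Y f \<Longrightarrow> skeletal X Y f"
  by (simp add: regular_morphism_def skeletal_def)

lemma skeletal_Pi: "skeletal X Y f \<Longrightarrow> f \<in> skeleton X p \<rightarrow> skeleton Y p"
  unfolding skeletal_def by blast

lemma skeletal_continuous: "skeletal X Y f \<Longrightarrow> continuous_map (skeleton_top X p) (skeleton_top Y p) f"
  using skeletal_Pi[of X Y f p] unfolding skeletal_def
  by (auto simp: continuous_map_in_subtopology intro: continuous_map_from_subtopology)

lemma push_comp:
  assumes "skeletal X Y f" "skeletal Y Z g"
  shows "push Y Z g n (push X Y f n z) = push X Z (g \<circ> f) n z"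
  unfolding push_def using assms by (intro hom_induced_compose' skeletal_continuous skeletal_Pi)

lemma push_bdry:
  assumes X: "regular_cw X" and Y: "regular_cw Y" and f: "skeletal X Y f"
  shows "bdry Y n (push X Y f n z) = push X Y f (n - 1) (bdry X n z)"
proof -
  interpret X: regular_complex X by unfold_locales (rule X)
  interpret Y: regular_complex Y by unfold_locales (rule Y)
  have "(hom_relboundary n (skeleton_top Y n) (skeleton Y (n - 1)) (skeleton Y (n - 2)) \<circ>
      hom_induced n (skeleton_top X n) (skeleton X (n - 1)) (skeleton_top Y n) (skeleton Y (n - 1)) f) z =
      (hom_induced (n - 1) (subtopology (skeleton_top X n) (skeleton X (n - 1))) (skeleton X (n - 2))
        (subtopology (skeleton_top Y n) (skeleton Y (n - 1))) (skeleton Y (n - 2)) f \<circ>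
      hom_relboundary n (skeleton_top X n) (skeleton X (n - 1)) (skeleton X (n - 2))) z"
    using f by (intro fun_cong[OF naturality_hom_induced_relboundary] skeletal_continuous skeletal_Pi)
  then show ?thesis
    by (simp add: push_def bdry_def X.skeleton_top_skeleton Y.skeleton_top_skeleton)
qed

lemma cellular_map_push:
  assumes X: "regular_cw X" "regular_cw Y" "regular_cw Z" and f: "skeletal X Y f" "skeletal Y Z g"
    and e: "e \<in> cells X"
  shows "cellular_map Y Z g (cell_push X Y f e) = cell_push X Z (g \<circ> f) e"
proof -
  interpret X: regular_complex X by unfold_locales (rule X)
  interpret Y: regular_complex Y by unfold_locales (rule X)
  interpret Z: regular_complex Z by unfold_locales (rule X)
  define n where "n = int (cell_dim X e)"
  have z: "push X Y f n (cell_class X e) \<in> carrier (cell_group Y n)"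
    by (rule hom_in_carrier[OF push_hom X.cell_class_carrier'[OF e]]) (simp add: n_def)
  have "cellular_map Y Z g (cell_push X Y f e)
      = int_chain (cells_of_dim Z n) (\<lambda>s. \<Sum>t\<in>cells_of_dim Y n. map_degree X Y f e t * map_degree Y Z g t s)"
    unfolding cellular_map_def cell_push_eq[of X Y f e] n_def[symmetric]
    by (rule lin_extend_int_chain) (simp_all add: cell_push_of_dim)
  also have "\<dots> = cell_push X Z (g \<circ> f) e"
    unfolding cell_push_eq[of X Z] n_def[symmetric]
  proof (rule int_chain_cong)
    fix s
    have "(\<Sum>t\<in>cells_of_dim Y n. map_degree X Y f e t * map_degree Y Z g t s)
        = cell_coord Z n (push Y Z g n (push X Y f n (cell_class X e))) s"
      unfolding push_coord_expansion[OF X(2,3) z] by (simp add: map_degree_eq[of X e n] n_def)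
    then show "(\<Sum>t\<in>cells_of_dim Y n. map_degree X Y f e t * map_degree Y Z g t s) = map_degree X Z (g \<circ> f) e s"
      unfolding push_comp[OF f] by (simp add: map_degree_eq[of X e n] n_def)
  qed
  finally show ?thesis .
qed

lemma cellular_boundary_push:
  assumes X: "regular_cw X" "regular_cw Y" and f: "skeletal X Y f" and e: "e \<in> cells X"
  shows "cellular_boundary Y (cell_push X Y f e) = cellular_map X Y f (cell_boundary X e)"
proof -
  interpret X: regular_complex X by unfold_locales (rule X)
  interpret Y: regular_complex Y by unfold_locales (rule X)
  define n where "n = int (cell_dim X e)"
  note c = X.cell_class_carrier'[OF e, of n, unfolded n_def, OF refl, folded n_def]
  have z: "push X Y f n (cell_class X e) \<in> carrier (cell_group Y n)"
    by (rule hom_in_carrier[OF push_hom c])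
  have w: "bdry X n (cell_class X e) \<in> carrier (cell_group X (n - 1))"
    by (rule hom_in_carrier[OF X.bdry_hom c])
  have "cellular_boundary Y (cell_push X Y f e)
      = int_chain (cells_of_dim Y (n - 1)) (\<lambda>s. \<Sum>t\<in>cells_of_dim Y n. map_degree X Y f e t * incidence Y t s)"
    unfolding cellular_boundary_def cell_push_eq[of X Y f e] n_def[symmetric]
    by (rule lin_extend_int_chain) (simp_all add: cell_boundary_of_dim)
  also have "\<dots> = int_chain (cells_of_dim Y (n - 1))
      (\<lambda>s. \<Sum>t\<in>cells_of_dim X (n - 1). incidence X e t * map_degree X Y f t s)"
  proof (rule int_chain_cong)
    fix s
    have "(\<Sum>t\<in>cells_of_dim Y n. map_degree X Y f e t * incidence Y t s)
        = cell_coord Y (n - 1) (bdry Y n (push X Y f n (cell_class X e))) s"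
      unfolding Y.bdry_coord_expansion[OF z] by (simp add: map_degree_eq[of X e n] n_def)
    also have "\<dots> = (\<Sum>t\<in>cells_of_dim X (n - 1). incidence X e t * map_degree X Y f t s)"
      unfolding push_bdry[OF X f] push_coord_expansion[OF X w] by (simp add: incidence_eq[of X e n] n_def)
    finally show "(\<Sum>t\<in>cells_of_dim Y n. map_degree X Y f e t * incidence Y t s)
        = (\<Sum>t\<in>cells_of_dim X (n - 1). incidence X e t * map_degree X Y f t s)" .
  qed
  also have "\<dots> = cellular_map X Y f (cell_boundary X e)"
    unfolding cellular_map_def cell_boundary_eq[of X e] n_def[symmetric]
    by (rule lin_extend_int_chain[symmetric]) (simp_all add: cell_push_of_dim)
  finally show ?thesis .
qed

text \<open>The laws of filtered complexes and diagrams hold only on points of the spaces, not as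
  equations between functions, so each use of them passes through this lemma.\<close>

lemma cell_push_cong:
  assumes "\<And>x. x \<in> topspace (space X) \<Longrightarrow> f x = g x"
  shows "cell_push X Y f e = cell_push X Y g e"
proof -
  have "push X Y f n = push X Y g n" for n
    unfolding push_def by (rule hom_induced_eq) (use assms in auto)
  then have "map_degree X Y f e = map_degree X Y g e"
    by (intro ext) (simp add: map_degree_eq)
  then show ?thesis by (simp add: cell_push_eq)
qed

lemma cell_push_id:
  assumes X: "regular_cw X" and e: "e \<in> cells X" and f: "\<And>x. x \<in> topspace (space X) \<Longrightarrow> f x = x"
  shows "cell_push X X f e = basis_vec e"
proof -
  interpret X: regular_complex X by unfold_locales (rule X)
  define n where "n = int (cell_dim X e)"
  have en: "e \<in> cells_of_dim X n" using e by (simp add: cells_of_dim_def n_def)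
  have "continuous_map (skeleton_top X n) (skeleton_top X n) f"
    by (rule continuous_map_eq[OF continuous_map_id]) (use f in auto)
  then have "push X X f n (cell_class X e) = cell_class X e"
    unfolding push_def
    by (rule hom_induced_id_gen) (use f X.cell_class_carrier'[OF e, of n] in \<open>auto simp: cell_group_def n_def\<close>)
  then have "map_degree X X f e t = (if t = e then 1 else 0)" for t
    using X.coord_class[of e n t] en by (simp add: map_degree_eq[of X e n] n_def X.E_def)
  then have "cell_push X X f e = int_chain (cells_of_dim X n) (\<lambda>t. if t = e then 1 else 0)"
    unfolding cell_push_eq n_def[symmetric] by presburger
  then show ?thesis using en by (simp add: int_chain_delta)
qed

subsection \<open>Supports\<close>

text \<open>\<open>regular_cw\<close> only places the frontier of a cell in the lower skeleton; here
  closed cells are also unions of cells. Every level of a filtered complex has this property,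
  because its identity structure map is a regular morphism.\<close>

definition normal_cw :: "'a cw \<Rightarrow> bool" where
  "normal_cw X \<longleftrightarrow> regular_cw X \<and> (\<forall>e\<in>cells X. \<exists>S. subcomplex X S \<and> cell_closure X e = \<Union>S)"

lemma regular_morphism_id_normal:
  assumes X: "regular_cw X" and f: "regular_morphism X X f" "\<And>x. x \<in> topspace (space X) \<Longrightarrow> f x = x"
  shows "normal_cw X"
proof -
  interpret X: regular_complex X by unfold_locales (rule X)
  have "f ` e = e" if e: "e \<in> cells X" for e
    using X.cell_subset[OF e] f(2) by force
  then show ?thesis using X f(1) by (auto simp: normal_cw_def regular_morphism_def)
qed

lemma normal_cw_closure: "normal_cw X \<Longrightarrow> e \<in> cells X \<Longrightarrow> \<exists>S. subcomplex X S \<and> cell_closure X e = \<Union>S"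
  by (simp add: normal_cw_def)

lemma regular_morphism_closure: "regular_morphism X Y f \<Longrightarrow> e \<in> cells X \<Longrightarrow>
    \<exists>S. subcomplex Y S \<and> space Y closure_of (f ` e) = \<Union>S"
  by (simp add: regular_morphism_def)

lemma (in regular_complex) cell_disjoint_subcomplex:
  assumes "subcomplex X S" "t \<in> cells X" "\<not> t \<subseteq> \<Union>S"
  shows "t \<inter> \<Union>S = {}"
proof -
  have "t \<notin> S" using assms(3) by blast
  then have "t \<inter> s = {}" if "s \<in> S" for s
    using assms(1) \<open>s \<in> S\<close> disjoint[of t s] assms(2) unfolding subcomplex_def by blast
  then show ?thesis by blast
qed

text \<open>The boundary class comes from the frontier of \<open>e\<close>. A cell not contained in
  the closed cell is disjoint from it, since the closed cell is a union of cells; localised at such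
  a cell the boundary is therefore trivial.\<close>

lemma keys_cell_boundary:
  assumes X: "normal_cw X" and e: "e \<in> cells X"
  shows "Poly_Mapping.keys (cell_boundary X e :: 'a set \<Rightarrow>\<^sub>0 'k::field)
    \<subseteq> {t \<in> cells_of_dim X (int (cell_dim X e) - 1). t \<subseteq> cell_closure X e}"
proof -
  interpret X: regular_complex X by unfold_locales (use X normal_cw_def in blast)
  define n where "n = int (cell_dim X e)"
  have "incidence X e t = 0" if t: "t \<in> cells_of_dim X (n - 1)" and nt: "\<not> t \<subseteq> cell_closure X e" for t
  proof -
    let ?C = "subtopology (space X) (cell_closure X e)" and ?F = "cell_closure X e - e"
    let ?W = "subtopology ?C ?F"
    have C: "cell_closure X e \<subseteq> skeleton X n" "?F \<subseteq> skeleton X (n - 1)"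
      using X.closure_in_skeleton[OF e] X.cell_frontier[OF e] by (auto simp: n_def)
    have cid: "continuous_map ?C (skeleton_top X n) id" by (rule X.continuous_inclusion[OF C(1)])
    have sub: "subtopology (skeleton_top X n) (skeleton X (n - 1)) = skeleton_top X (n - 1)"
      by (rule X.skeleton_top_skeleton) simp
    have cc: "cell_class X e = hom_induced n ?C ?F (skeleton_top X n) (skeleton X (n - 1)) id (orientation X e)"
      by (simp only: cell_class_def n_def)
    have nn: "n - 1 - 1 = n - 2" by simp
    have nat: "(hom_relboundary n (skeleton_top X n) (skeleton X (n - 1)) (skeleton X (n - 2)) \<circ>
        hom_induced n ?C ?F (skeleton_top X n) (skeleton X (n - 1)) id) (orientation X e) =
        (hom_induced (n - 1) ?W {} (subtopology (skeleton_top X n) (skeleton X (n - 1))) (skeleton X (n - 2)) id \<circ>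
        hom_relboundary n ?C ?F {}) (orientation X e)"
      by (intro fun_cong[OF naturality_hom_induced_relboundary] cid) (use C in auto)
    \<comment> \<open>Naturality of the connecting map for the inclusion of the closed cell, taken
      as a triple with empty third space: the boundary is the image of a class of the frontier
      alone.\<close>
    have eq: "bdry X n (cell_class X e) = hom_induced (n - 1) ?W {} (skeleton_top X (n - 1))
        (skeleton X (n - 1 - 1)) id (hom_relboundary n ?C ?F {} (orientation X e))"
      unfolding bdry_def cc nn using nat[unfolded sub o_apply] .
    from normal_cw_closure[OF X e]
    obtain S where S': "subcomplex X S \<and> cell_closure X e = \<Union>S" ..
    note S = conjunct1[OF S'] conjunct2[OF S']
    have tE: "t \<in> X.E (n - 1)" using t by (simp add: X.E_def)
    have dis: "t \<inter> cell_closure X e = {}"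
      using X.cell_disjoint_subcomplex[OF S(1) X.E_cells(1)[OF tE]] nt S(2) by simp
    have top: "topspace ?W \<subseteq> cell_closure X e" by auto
    have W: "continuous_map ?W (skeleton_top X (n - 1)) id"
      unfolding subtopology_subtopology by (rule X.continuous_inclusion) (use C(2) in auto)
    show ?thesis
      unfolding incidence_eq[OF n_def[symmetric]]
    proof (rule X.coord_eq_zero)
      show "bdry X n (cell_class X e) \<in> carrier (cell_group X (n - 1))"
        by (rule hom_in_carrier[OF X.bdry_hom X.cell_class_carrier'[OF e]]) (simp add: n_def)
      show "X.loc (n - 1) t (bdry X n (cell_class X e)) = \<one>\<^bsub>X.L (n - 1) t\<^esub>"
        unfolding eq by (rule X.loc_hom_induced[OF tE W]) (use dis top in auto)
    qed
  qed
  then show ?thesis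
    using keys_int_chain[OF X.finite_cells_of_dim, of "n - 1" "incidence X e", where 'k = 'k]
    unfolding cell_boundary_eq n_def[symmetric] by blast
qed

text \<open>The same localisation argument as for boundaries. That the closure of the image is a
  union of cells is now part of being a regular morphism.\<close>

lemma keys_cell_push:
  assumes X: "regular_cw X" "regular_cw Y" and f: "regular_morphism X Y f" and e: "e \<in> cells X"
  shows "Poly_Mapping.keys (cell_push X Y f e :: 'b set \<Rightarrow>\<^sub>0 'k::field)
    \<subseteq> cells_of_dim Y (int (cell_dim X e)) \<inter> cell_image Y f e"
proof -
  interpret X: regular_complex X by unfold_locales (rule X)
  interpret Y: regular_complex Y by unfold_locales (rule X)
  note sk = regular_morphism_skeletal[OF f]
  define n where "n = int (cell_dim X e)"
  have "map_degree X Y f e t = 0" if t: "t \<in> cells_of_dim Y n" and nt: "\<not> t \<subseteq> space Y closure_of (f ` e)" for t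
  proof -
    let ?C = "subtopology (space X) (cell_closure X e)" and ?F = "cell_closure X e - e"
    have C: "cell_closure X e \<subseteq> skeleton X n" "?F \<subseteq> skeleton X (n - 1)"
      using X.closure_in_skeleton[OF e] X.cell_frontier[OF e] by (auto simp: n_def)
    have cid: "continuous_map ?C (skeleton_top X n) id" by (rule X.continuous_inclusion[OF C(1)])
    have tE: "t \<in> Y.E n" using t by (simp add: Y.E_def)
    from regular_morphism_closure[OF f e]
    obtain S where S': "subcomplex Y S \<and> space Y closure_of (f ` e) = \<Union>S" ..
    note S = conjunct1[OF S'] conjunct2[OF S']
    have "t \<inter> space Y closure_of (f ` e) = {}"
      using Y.cell_disjoint_subcomplex[OF S(1) Y.E_cells(1)[OF tE]] nt S(2) by simp
    moreover have "f ` cell_closure X e \<subseteq> space Y closure_of (f ` e)"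
      by (rule continuous_map_image_closure_subset) (use sk in \<open>simp add: skeletal_def\<close>)
    ultimately have dis: "f ` topspace ?C \<inter> t = {}" by auto
    have eq: "push X Y f n (cell_class X e)
        = hom_induced n ?C ?F (skeleton_top Y n) (skeleton Y (n - 1)) (f \<circ> id) (orientation X e)"
      unfolding push_def cell_class_def n_def[symmetric]
      by (rule hom_induced_compose'[OF cid _ skeletal_continuous[OF sk] skeletal_Pi[OF sk]])
        (use C(2) in auto)
    show ?thesis
      unfolding map_degree_eq[OF n_def[symmetric]]
    proof (rule Y.coord_eq_zero)
      show "push X Y f n (cell_class X e) \<in> carrier (cell_group Y n)"
        by (rule hom_in_carrier[OF push_hom X.cell_class_carrier'[OF e]]) (simp add: n_def)
      show "Y.loc n t (push X Y f n (cell_class X e)) = \<one>\<^bsub>Y.L n t\<^esub>"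
        unfolding eq
      proof (rule Y.loc_hom_induced[OF tE])
        show "continuous_map ?C (skeleton_top Y n) (f \<circ> id)"
          by (rule continuous_map_compose[OF cid skeletal_continuous[OF sk]])
        show "f \<circ> id \<in> ?F \<rightarrow> skeleton Y (n - 1)"
          using skeletal_Pi[OF sk, of "n - 1"] C(2) by auto
        show "(f \<circ> id) ` topspace ?C \<inter> t = {}" using dis by simp
      qed
    qed
  qed
  then show ?thesis
    using keys_int_chain[OF Y.finite_cells_of_dim, of n "map_degree X Y f e", where 'k = 'k]
    unfolding cell_push_eq n_def[symmetric] cell_image_def by (auto simp: cells_of_dim_def)
qed

section \<open>Acyclic carriers\<close>

text \<open>A nonnegatively graded complex with a distinguished basis, augmented by
  \<open>coeff_sum\<close>; the clause in degree 1 says that the augmentation kills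
  boundaries.\<close>

definition based_complex :: "'c set \<Rightarrow> ('c \<Rightarrow> int) \<Rightarrow> (('c \<Rightarrow>\<^sub>0 'k::field) \<Rightarrow> ('c \<Rightarrow>\<^sub>0 'k)) \<Rightarrow> bool" where
  "based_complex S dg d \<longleftrightarrow> lin d \<and>
    (\<forall>b\<in>S. 0 \<le> dg b \<and> d (basis_vec b) \<in> span_on {b'\<in>S. dg b' = dg b - 1} \<and>
      d (d (basis_vec b)) = 0 \<and> (dg b = 1 \<longrightarrow> coeff_sum (d (basis_vec b)) = 0))"

text \<open>Exactness of the augmented complex spanned by \<open>A\<close>. In degree 0 only chains
  of augmentation zero are asked to bound, and the existence of a vertex makes the augmentation
  surjective.\<close>

definition aug_acyclic :: "('d \<Rightarrow> int) \<Rightarrow> (('d \<Rightarrow>\<^sub>0 'k::field) \<Rightarrow> ('d \<Rightarrow>\<^sub>0 'k)) \<Rightarrow> 'd set \<Rightarrow> bool" where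
  "aug_acyclic dg d A \<longleftrightarrow> (\<exists>v\<in>A. dg v = 0) \<and>
    (\<forall>n\<ge>0. \<forall>x\<in>span_on {b\<in>A. dg b = n}. d x = 0 \<longrightarrow> (n = 0 \<longrightarrow> coeff_sum x = 0) \<longrightarrow>
      (\<exists>y\<in>span_on {b\<in>A. dg b = n + 1}. d y = x))"

lemma aug_acyclicD:
  assumes "aug_acyclic dg d A" "x \<in> span_on {b\<in>A. dg b = n}" "d x = 0" "n = 0 \<Longrightarrow> coeff_sum x = 0" "0 \<le> n"
  shows "\<exists>y. y \<in> span_on {b\<in>A. dg b = n + 1} \<and> d y = x"
  using assms unfolding aug_acyclic_def by blast

lemma based_complexD:
  assumes "based_complex S dg d"
  shows "lin d" and "b \<in> S \<Longrightarrow> 0 \<le> dg b"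
    and "b \<in> S \<Longrightarrow> d (basis_vec b) \<in> span_on {b'\<in>S. dg b' = dg b - 1}"
    and "b \<in> S \<Longrightarrow> d (d (basis_vec b)) = 0"
    and "b \<in> S \<Longrightarrow> dg b = 1 \<Longrightarrow> coeff_sum (d (basis_vec b)) = 0"
  using assms unfolding based_complex_def by auto

lemma based_complex_boundary_zero:
  assumes "based_complex S dg d" "x \<in> span_on {b\<in>S. dg b = 0}"
  shows "d x = 0"
proof (rule lin_zero_on[OF _ assms(2)])
  fix b assume b: "b \<in> {b\<in>S. dg b = 0}"
  then have "d (basis_vec b) \<in> span_on {b'\<in>S. dg b' = - 1}"
    using based_complexD(3)[OF assms(1), of b] by simp
  moreover have "{b'\<in>S. dg b' = - 1} = {}"
    using based_complexD(2)[OF assms(1)] by force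
  ultimately show "d (basis_vec b) = 0"
    by (simp add: span_on_empty)
qed (use based_complexD[OF assms(1)] in auto)

text \<open>Recursion over the degree. In degree 0 a basis element goes to a vertex of its carrier.
  In higher degrees the image of the boundary of \<open>b\<close> is a cycle lying in
  \<open>\<Phi> b\<close> by \<open>mono\<close>, so it bounds there; in degree 1 this also uses
  that its augmentation is zero.\<close>

lemma acyclic_carrier_chain_map:
  fixes d :: "('c \<Rightarrow>\<^sub>0 'k::field) \<Rightarrow> ('c \<Rightarrow>\<^sub>0 'k)" and d' :: "('d \<Rightarrow>\<^sub>0 'k) \<Rightarrow> ('d \<Rightarrow>\<^sub>0 'k)"
  assumes S: "based_complex S dg d" and S': "based_complex S' dg' d'"
    and sub: "\<And>b. b \<in> S \<Longrightarrow> \<Phi> b \<subseteq> S'"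
    and acyc: "\<And>b. b \<in> S \<Longrightarrow> aug_acyclic dg' d' (\<Phi> b)"
    and mono: "\<And>b b'. b \<in> S \<Longrightarrow> b' \<in> Poly_Mapping.keys (d (basis_vec b)) \<Longrightarrow> \<Phi> b' \<subseteq> \<Phi> b"
  shows "\<exists>f. lin f \<and> (\<forall>b\<in>S. f (basis_vec b) \<in> span_on {b'\<in>\<Phi> b. dg' b' = dg b} \<and>
    d' (f (basis_vec b)) = f (d (basis_vec b)) \<and> (dg b = 0 \<longrightarrow> coeff_sum (f (basis_vec b)) = 1))"
proof -
  \<comment> \<open>\<open>\<phi>\<close> holds the values in degree n, and \<open>y\<close> is an
    admissible value at an element \<open>b\<close> of degree n + 1.\<close>
  define P where "P n \<phi> b y \<longleftrightarrow> y \<in> span_on {b'\<in>\<Phi> b. dg' b' = int (Suc n)} \<and>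
    d' y = lin_extend \<phi> (d (basis_vec b))" for n \<phi> b y
  define \<psi> where "\<psi> = rec_nat (\<lambda>b. basis_vec (SOME v. v \<in> \<Phi> b \<and> dg' v = 0))
    (\<lambda>n \<phi> b. SOME y. P n \<phi> b y)"
  have \<psi>0: "\<psi> 0 b = basis_vec (SOME v. v \<in> \<Phi> b \<and> dg' v = 0)"
    and \<psi>Suc: "\<psi> (Suc n) b = (SOME y. P n (\<psi> n) b y)" for n b
    by (simp_all add: \<psi>_def)
  have 0: "\<exists>v. \<psi> 0 b = basis_vec v \<and> v \<in> \<Phi> b \<and> dg' v = 0" if "b \<in> S" for b
  proof -
    have "\<exists>v. v \<in> \<Phi> b \<and> dg' v = 0" using acyc[OF that] unfolding aug_acyclic_def by blast
    from someI_ex[OF this] show ?thesis unfolding \<psi>0 by blast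
  qed
  note lin' = based_complexD(1)[OF S']
  have step: "b \<in> S \<Longrightarrow> dg b = int (Suc n) \<Longrightarrow> P n (\<psi> n) b (\<psi> (Suc n) b)" for n b
  proof (induction n arbitrary: b)
    case 0
    let ?z = "lin_extend (\<psi> 0) (d (basis_vec b))"
    have keys: "b' \<in> S \<and> dg b' = 0 \<and> \<Phi> b' \<subseteq> \<Phi> b" if "b' \<in> Poly_Mapping.keys (d (basis_vec b))" for b'
      using that 0 based_complexD(3)[OF S 0(1)] mono[OF 0(1) that] by (auto simp: span_on_iff)
    have z: "?z \<in> span_on {b'\<in>\<Phi> b. dg' b' = 0}"
      by (rule lin_extend_in_subspace[OF subspace_span_on]) (use keys \<open>\<And>b. b \<in> S \<Longrightarrow> \<exists>v. _ b v\<close> in fastforce)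
    have "d' ?z = 0"
      by (rule based_complex_boundary_zero[OF S' span_on_mono[OF _ z]]) (use sub[OF 0(1)] in auto)
    moreover have "coeff_sum ?z = coeff_sum (d (basis_vec b)) * 1"
      by (rule coeff_sum_lin_extend) (use keys \<open>\<And>b. b \<in> S \<Longrightarrow> \<exists>v. _ b v\<close> in force)
    then have "coeff_sum ?z = 0"
      using based_complexD(5)[OF S 0(1)] 0 by simp
    ultimately have "\<exists>y. y \<in> span_on {b'\<in>\<Phi> b. dg' b' = 0 + 1} \<and> d' y = ?z"
      by (intro aug_acyclicD[OF acyc[OF 0(1)] z]) auto
    then have "\<exists>y. P 0 (\<psi> 0) b y" unfolding P_def by simp
    from someI_ex[OF this] show ?case unfolding \<psi>Suc .
  next
    case (Suc n)
    note b = Suc.prems(1)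
    let ?z = "lin_extend (\<psi> (Suc n)) (d (basis_vec b))"
    have keys: "b' \<in> S \<and> dg b' = int (Suc n) \<and> \<Phi> b' \<subseteq> \<Phi> b" if "b' \<in> Poly_Mapping.keys (d (basis_vec b))" for b'
      using that Suc.prems(2) based_complexD(3)[OF S b] mono[OF b that] by (auto simp: span_on_iff)
    have z: "?z \<in> span_on {b'\<in>\<Phi> b. dg' b' = int (Suc n)}"
    proof (rule lin_extend_in_subspace[OF subspace_span_on])
      fix b' assume b': "b' \<in> Poly_Mapping.keys (d (basis_vec b))"
      then show "\<psi> (Suc n) b' \<in> span_on {b' \<in> \<Phi> b. dg' b' = int (Suc n)}"
        using Suc.IH[of b'] keys[OF b'] unfolding P_def by (blast intro: span_on_mono[rotated])
    qed
    have "d' ?z = lin_extend (\<lambda>b'. lin_extend (\<psi> n) (d (basis_vec b'))) (d (basis_vec b))"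
      unfolding lin_lin_extend[OF lin']
      by (rule lin_extend_cong) (use Suc.IH keys in \<open>auto simp: P_def\<close>)
    also have "\<dots> = lin_extend (\<psi> n) (lin_extend (\<lambda>b'. d (basis_vec b')) (d (basis_vec b)))"
      by (simp add: lin_lin_extend)
    also have "\<dots> = lin_extend (\<psi> n) (d (d (basis_vec b)))"
      by (simp flip: lin_eq_lin_extend[OF based_complexD(1)[OF S]])
    also have "\<dots> = 0"
      by (simp add: based_complexD(4)[OF S b] lin_zero[OF lin_extend_lin])
    finally have "\<exists>y. y \<in> span_on {b'\<in>\<Phi> b. dg' b' = int (Suc n) + 1} \<and> d' y = ?z"
      by (intro aug_acyclicD[OF acyc[OF b] z]) auto
    then have "\<exists>y. P (Suc n) (\<psi> (Suc n)) b y" unfolding P_def by (simp add: add.commute)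
    from someI_ex[OF this] show ?case unfolding \<psi>Suc .
  qed
  \<comment> \<open>Each stage of the recursion is a function on all basis elements that is
    meaningful in its own degree; the degree of \<open>b\<close> selects the stage.\<close>
  define f where "f = lin_extend (\<lambda>b. \<psi> (nat (dg b)) b)"
  have "f (basis_vec b) \<in> span_on {b'\<in>\<Phi> b. dg' b' = dg b} \<and>
    d' (f (basis_vec b)) = f (d (basis_vec b)) \<and> (dg b = 0 \<longrightarrow> coeff_sum (f (basis_vec b)) = 1)"
    if b: "b \<in> S" for b
  proof (cases "dg b = 0")
    case True
    from 0[OF b] obtain v where v: "\<psi> 0 b = basis_vec v" "v \<in> \<Phi> b" "dg' v = 0" by blast
    have "d' (\<psi> 0 b) = 0"
      by (rule based_complex_boundary_zero[OF S']) (use v sub[OF b] in auto)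
    moreover have "d (basis_vec b) = 0"
      by (rule based_complex_boundary_zero[OF S]) (use b True in auto)
    ultimately show ?thesis
      using v True by (simp add: f_def lin_zero[OF lin_extend_lin])
  next
    case False
    then obtain n where n: "dg b = int (Suc n)"
      using based_complexD(2)[OF S b] by (metis nat_0_le not0_implies_Suc of_nat_0)
    have "f (d (basis_vec b)) = lin_extend (\<psi> n) (d (basis_vec b))"
      unfolding f_def
    proof (rule lin_extend_cong)
      fix b' assume "b' \<in> Poly_Mapping.keys (d (basis_vec b))"
      then have "dg b' = int n"
        using n based_complexD(3)[OF S b] by (auto simp: span_on_iff)
      then show "\<psi> (nat (dg b')) b' = \<psi> n b'" by simp
    qed
    moreover have "nat (dg b) = Suc n" using n by simp
    ultimately show ?thesis
      using step[OF b n] n unfolding P_def by (simp add: f_def)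
  qed
  then show ?thesis
    unfolding f_def using lin_extend_lin by blast
qed

text \<open>The same recursion, now solving d' y = f b - g b - h (d b). The right side is a cycle in
  \<open>\<Phi> b\<close>; in degree 0 it is f b - g b, which bounds because the augmentations
  agree.\<close>

lemma acyclic_carrier_homotopy:
  fixes d :: "('c \<Rightarrow>\<^sub>0 'k::field) \<Rightarrow> ('c \<Rightarrow>\<^sub>0 'k)" and d' :: "('d \<Rightarrow>\<^sub>0 'k) \<Rightarrow> ('d \<Rightarrow>\<^sub>0 'k)"
  assumes S: "based_complex S dg d" and S': "based_complex S' dg' d'"
    and sub: "\<And>b. b \<in> S \<Longrightarrow> \<Phi> b \<subseteq> S'"
    and acyc: "\<And>b. b \<in> S \<Longrightarrow> aug_acyclic dg' d' (\<Phi> b)"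
    and mono: "\<And>b b'. b \<in> S \<Longrightarrow> b' \<in> Poly_Mapping.keys (d (basis_vec b)) \<Longrightarrow> \<Phi> b' \<subseteq> \<Phi> b"
    and lin: "lin f" "lin g"
    and f: "\<And>b. b \<in> S \<Longrightarrow> f (basis_vec b) \<in> span_on {b'\<in>\<Phi> b. dg' b' = dg b}"
    and g: "\<And>b. b \<in> S \<Longrightarrow> g (basis_vec b) \<in> span_on {b'\<in>\<Phi> b. dg' b' = dg b}"
    and df: "\<And>b. b \<in> S \<Longrightarrow> d' (f (basis_vec b)) = f (d (basis_vec b))"
    and dg: "\<And>b. b \<in> S \<Longrightarrow> d' (g (basis_vec b)) = g (d (basis_vec b))"
    and aug: "\<And>b. b \<in> S \<Longrightarrow> dg b = 0 \<Longrightarrow> coeff_sum (f (basis_vec b)) = coeff_sum (g (basis_vec b))"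
  shows "\<exists>h. lin h \<and> (\<forall>b\<in>S. h (basis_vec b) \<in> span_on {b'\<in>\<Phi> b. dg' b' = dg b + 1} \<and>
    d' (h (basis_vec b)) + h (d (basis_vec b)) = f (basis_vec b) - g (basis_vec b))"
proof -
  define u where "u b = f (basis_vec b) - g (basis_vec b)" for b
  define P where "P n \<phi> b y \<longleftrightarrow> y \<in> span_on {b'\<in>\<Phi> b. dg' b' = int n + 1} \<and>
    d' y = u b - lin_extend \<phi> (d (basis_vec b))" for n \<phi> b y
  \<comment> \<open>shifted by one: the value at \<open>Suc n\<close> is the homotopy in degree \<open>n\<close>\<close>
  define \<psi> where "\<psi> = rec_nat (\<lambda>b. 0) (\<lambda>n \<phi> b. SOME y. P n \<phi> b y)"
  have \<psi>0: "\<psi> 0 b = 0" and \<psi>Suc: "\<psi> (Suc n) b = (SOME y. P n (\<psi> n) b y)" for n b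
    by (simp_all add: \<psi>_def)
  note lin' = based_complexD(1)[OF S'] and lind = based_complexD(1)[OF S]
  have u: "u b \<in> span_on {b'\<in>\<Phi> b. dg' b' = dg b}" if "b \<in> S" for b
    unfolding u_def using f g that by (intro free.subspace_diff subspace_span_on) auto
  have du: "d' (u b) = lin_extend u (d (basis_vec b))" if "b \<in> S" for b
  proof -
    have "lin (\<lambda>x. f x - g x)" by (rule linI) (simp_all add: lin_add[OF lin(1)] lin_add[OF lin(2)]
          lin_scale[OF lin(1)] lin_scale[OF lin(2)] free.scale_right_diff_distrib)
    from lin_eq_lin_extend[OF this, of "d (basis_vec b)"] show ?thesis
      by (simp add: u_def[abs_def] lin_diff[OF lin'] df dg that)
  qed
  have step: "b \<in> S \<Longrightarrow> dg b = int n \<Longrightarrow> P n (\<psi> n) b (\<psi> (Suc n) b)" for n b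
  proof (induction n arbitrary: b)
    case 0
    have "d' (u b) = 0"
      by (rule based_complex_boundary_zero[OF S' span_on_mono[OF _ u[OF 0(1)]]]) (use 0 sub[OF 0(1)] in auto)
    moreover have "coeff_sum (u b) = 0"
      using aug 0 by (simp add: u_def coeff_sum_diff)
    ultimately have "\<exists>y. y \<in> span_on {b'\<in>\<Phi> b. dg' b' = dg b + 1} \<and> d' y = u b"
      by (intro aug_acyclicD[OF acyc[OF 0(1)] u[OF 0(1)]]) (use 0 in auto)
    moreover have "d (basis_vec b) = 0"
      by (rule based_complex_boundary_zero[OF S]) (use 0 in auto)
    ultimately have "\<exists>y. P 0 (\<psi> 0) b y" using 0 unfolding P_def
      by (simp add: lin_zero[OF lin_extend_lin])
    from someI_ex[OF this] show ?case unfolding \<psi>Suc .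
  next
    case (Suc n)
    note b = Suc.prems(1)
    let ?z = "u b - lin_extend (\<psi> (Suc n)) (d (basis_vec b))"
    have keys: "b' \<in> S \<and> dg b' = int n \<and> \<Phi> b' \<subseteq> \<Phi> b" if "b' \<in> Poly_Mapping.keys (d (basis_vec b))" for b'
      using that Suc.prems(2) based_complexD(3)[OF S b] mono[OF b that] by (auto simp: span_on_iff)
    have z: "?z \<in> span_on {b'\<in>\<Phi> b. dg' b' = int (Suc n)}"
    proof (intro free.subspace_diff subspace_span_on lin_extend_in_subspace)
      fix b' assume b': "b' \<in> Poly_Mapping.keys (d (basis_vec b))"
      then show "\<psi> (Suc n) b' \<in> span_on {b' \<in> \<Phi> b. dg' b' = int (Suc n)}"
        using Suc.IH[of b'] keys[OF b'] unfolding P_def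
        by (auto intro: span_on_mono[rotated] simp: add.commute)
    qed (use u[OF b] Suc.prems in auto)
    \<comment> \<open>One degree lower d' h = u - h d. Applied to d b, the last term meets d (d b) =
      0, so d' of the subtracted chain equals d' of \<open>u b\<close>.\<close>
    have "d' (lin_extend (\<psi> (Suc n)) (d (basis_vec b)))
        = lin_extend (\<lambda>b'. u b' - lin_extend (\<psi> n) (d (basis_vec b'))) (d (basis_vec b))"
      unfolding lin_lin_extend[OF lin']
      by (rule lin_extend_cong) (use Suc.IH keys in \<open>auto simp: P_def\<close>)
    also have "\<dots> = lin_extend u (d (basis_vec b))
        - lin_extend (\<lambda>b'. lin_extend (\<psi> n) (d (basis_vec b'))) (d (basis_vec b))"
      by (simp add: lin_extend_def free.scale_right_diff_distrib sum_subtractf)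
    also have "lin_extend (\<lambda>b'. lin_extend (\<psi> n) (d (basis_vec b'))) (d (basis_vec b))
        = lin_extend (\<psi> n) (lin_extend (\<lambda>b'. d (basis_vec b')) (d (basis_vec b)))"
      by (simp add: lin_lin_extend)
    also have "\<dots> = lin_extend (\<psi> n) (d (d (basis_vec b)))"
      by (simp flip: lin_eq_lin_extend[OF lind])
    also have "\<dots> = 0"
      by (simp add: based_complexD(4)[OF S b] lin_zero[OF lin_extend_lin])
    finally have "d' ?z = 0"
      by (simp add: lin_diff[OF lin'] du[OF b])
    then have "\<exists>y. y \<in> span_on {b'\<in>\<Phi> b. dg' b' = int (Suc n) + 1} \<and> d' y = ?z"
      by (intro aug_acyclicD[OF acyc[OF b] z]) auto
    then have "\<exists>y. P (Suc n) (\<psi> (Suc n)) b y" unfolding P_def .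
    from someI_ex[OF this] show ?case unfolding \<psi>Suc .
  qed
  define h where "h = lin_extend (\<lambda>b. \<psi> (Suc (nat (dg b))) b)"
  have "h (basis_vec b) \<in> span_on {b'\<in>\<Phi> b. dg' b' = dg b + 1} \<and>
    d' (h (basis_vec b)) + h (d (basis_vec b)) = f (basis_vec b) - g (basis_vec b)"
    if b: "b \<in> S" for b
  proof -
    obtain n where n: "dg b = int n"
      using based_complexD(2)[OF S b] nonneg_int_cases by blast
    have "h (d (basis_vec b)) = lin_extend (\<psi> n) (d (basis_vec b))"
      unfolding h_def
    proof (rule lin_extend_cong)
      fix b' assume b': "b' \<in> Poly_Mapping.keys (d (basis_vec b))"
      then have "dg b' = int n - 1" "b' \<in> S"
        using n based_complexD(3)[OF S b] by (auto simp: span_on_iff)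
      then have "Suc (nat (dg b')) = n" using based_complexD(2)[OF S, of b'] by linarith
      then show "\<psi> (Suc (nat (dg b'))) b' = \<psi> n b'" by simp
    qed
    then show ?thesis
      using step[OF b n] n unfolding P_def u_def by (simp add: h_def)
  qed
  then show ?thesis
    unfolding h_def using lin_extend_lin by blast
qed

section \<open>Double complexes over a simplex\<close>

definition face_sign :: "'v::linorder set \<Rightarrow> 'v \<Rightarrow> 'k::field" where
  "face_sign \<sigma> v = (-1) ^ card {w \<in> \<sigma>. w < v}"

text \<open>Projection to the column over \<open>\<tau>\<close>, a left inverse of
  \<open>at_simplex \<tau>\<close>.\<close>

definition slice :: "'v set \<Rightarrow> ('v set \<times> 'b set \<Rightarrow>\<^sub>0 'k::field) \<Rightarrow> ('b set \<Rightarrow>\<^sub>0 'k)" where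
  "slice \<tau> x = Poly_Mapping.map_key (Pair \<tau>) x"

lemma lookup_slice [simp]: "Poly_Mapping.lookup (slice \<tau> x) t = Poly_Mapping.lookup x (\<tau>, t)"
  by (simp add: slice_def map_key.rep_eq inj_on_def)

lemma lin_slice [simp]: "lin (slice \<tau>)"
  by (rule linI) (auto intro!: poly_mapping_eqI simp: Poly_Mapping.lookup_add)

lemma lin_at_simplex [simp]: "lin (at_simplex \<sigma>)"
  by (simp add: at_simplex_def)

lemma at_simplex_basis [simp]: "at_simplex \<sigma> (basis_vec t) = basis_vec (\<sigma>, t)"
  by (simp add: at_simplex_def)

lemma lookup_at_simplex: "Poly_Mapping.lookup (at_simplex \<sigma> z) (\<tau>, t) = (if \<sigma> = \<tau> then Poly_Mapping.lookup z t else 0)"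
proof -
  have "Poly_Mapping.lookup (at_simplex \<sigma> z) (\<tau>, t)
      = (\<Sum>s\<in>Poly_Mapping.keys z. if s = t then (if \<sigma> = \<tau> then Poly_Mapping.lookup z s else 0) else 0)"
    unfolding at_simplex_def lin_extend_def Poly_Mapping.lookup_sum
    by (rule sum.cong) (auto simp: Poly_Mapping.lookup_single when_def)
  then show ?thesis by (simp add: in_keys_iff)
qed

lemma keys_at_simplex: "Poly_Mapping.keys (at_simplex \<sigma> z) = Pair \<sigma> ` Poly_Mapping.keys z"
proof -
  have "b \<in> Poly_Mapping.keys (at_simplex \<sigma> z) \<longleftrightarrow> b \<in> Pair \<sigma> ` Poly_Mapping.keys z" for b
    by (cases b) (auto simp: in_keys_iff lookup_at_simplex)
  then show ?thesis by blast
qed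

lemma slice_at_simplex: "slice \<tau> (at_simplex \<sigma> z) = (if \<sigma> = \<tau> then z else 0)"
  by (rule poly_mapping_eqI) (simp add: lookup_at_simplex)

lemma slice_basis: "slice \<tau> (basis_vec (\<sigma>, t)) = (if \<sigma> = \<tau> then basis_vec t else 0)"
  using slice_at_simplex[of \<tau> \<sigma> "basis_vec t"] by simp

lemma coeff_sum_at_simplex: "coeff_sum (at_simplex \<sigma> z) = coeff_sum z"
  using coeff_sum_lin[OF lin_at_simplex, of z \<sigma> 1] by simp

text \<open>The value of the total carrier on one cell over \<open>\<sigma>\<close>: a column with
  basis \<open>A \<tau>\<close> for every nonempty face, vertical degree \<open>dm\<close>, vertical
  differential \<open>bd\<close> and horizontal maps \<open>ps\<close>. \<open>d\<close> is the
  differential of the ambient total complex, so it is described on \<open>\<Phi>\<close>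
  only.\<close>

locale simplex_double_complex =
  fixes \<sigma> :: "'v::linorder set" and A :: "'v set \<Rightarrow> 'b set set" and dm :: "'v set \<Rightarrow> 'b set \<Rightarrow> int"
    and bd :: "'v set \<Rightarrow> ('b set \<Rightarrow>\<^sub>0 'k::field) \<Rightarrow> ('b set \<Rightarrow>\<^sub>0 'k)"
    and ps :: "'v set \<Rightarrow> 'v set \<Rightarrow> ('b set \<Rightarrow>\<^sub>0 'k) \<Rightarrow> ('b set \<Rightarrow>\<^sub>0 'k)"
    and dg :: "'v set \<times> 'b set \<Rightarrow> int"
    and d :: "('v set \<times> 'b set \<Rightarrow>\<^sub>0 'k) \<Rightarrow> ('v set \<times> 'b set \<Rightarrow>\<^sub>0 'k)"
    and \<Phi> :: "('v set \<times> 'b set) set"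
  assumes \<Phi>_def: "\<Phi> = {(\<tau>, t). \<tau> \<subseteq> \<sigma> \<and> \<tau> \<noteq> {} \<and> t \<in> A \<tau>}"
    and fin: "finite \<sigma>" and ne: "\<sigma> \<noteq> {}"
    and lin_bd: "lin (bd \<tau>)" and lin_ps: "lin (ps \<rho> \<tau>)" and lin_d: "lin d"
    and dg: "(\<tau>, t) \<in> \<Phi> \<Longrightarrow> dg (\<tau>, t) = int (card \<tau>) - 1 + dm \<tau> t"
    and dm: "(\<tau>, t) \<in> \<Phi> \<Longrightarrow> 0 \<le> dm \<tau> t"
    and acyc: "\<tau> \<subseteq> \<sigma> \<Longrightarrow> \<tau> \<noteq> {} \<Longrightarrow> aug_acyclic (dm \<tau>) (bd \<tau>) (A \<tau>)"
    and bd_aug: "(\<tau>, t) \<in> \<Phi> \<Longrightarrow> dm \<tau> t = 1 \<Longrightarrow> coeff_sum (bd \<tau> (basis_vec t)) = 0"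
    and bd_zero: "(\<tau>, t) \<in> \<Phi> \<Longrightarrow> dm \<tau> t = 0 \<Longrightarrow> bd \<tau> (basis_vec t) = 0"
    and ps_aug: "(\<tau>, t) \<in> \<Phi> \<Longrightarrow> \<rho> \<subseteq> \<tau> \<Longrightarrow> \<rho> \<noteq> {} \<Longrightarrow> dm \<tau> t = 0 \<Longrightarrow>
      coeff_sum (ps \<rho> \<tau> (basis_vec t)) = 1"
    and d_basis: "(\<tau>, t) \<in> \<Phi> \<Longrightarrow> d (basis_vec (\<tau>, t)) =
      lin_scale ((-1) ^ (card \<tau> - 1)) (at_simplex \<tau> (bd \<tau> (basis_vec t))) +
      (\<Sum>v | v \<in> \<tau> \<and> \<tau> - {v} \<noteq> {}. lin_scale (face_sign \<tau> v)
        (at_simplex (\<tau> - {v}) (ps (\<tau> - {v}) \<tau> (basis_vec t))))"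
    and d_span: "b \<in> \<Phi> \<Longrightarrow> d (basis_vec b) \<in>
      span_on {b' \<in> \<Phi>. dg b' = dg b - 1 \<and> card (fst b') \<le> card (fst b)}"
    and d_d: "b \<in> \<Phi> \<Longrightarrow> d (d (basis_vec b)) = 0"
    and d_aug: "b \<in> \<Phi> \<Longrightarrow> dg b = 1 \<Longrightarrow> coeff_sum (d (basis_vec b)) = 0"
begin

text \<open>Filtered by number of vertices instead of dimension, so that index 0 gives the zero
  space and can start the induction.\<close>

definition "Fil p n = span_on {b \<in> \<Phi>. dg b = n \<and> card (fst b) \<le> p}"

lemma Fil_span: "x \<in> Fil p n \<Longrightarrow> x \<in> span_on \<Phi>"
  unfolding Fil_def by (rule span_on_mono) auto

lemma finite_simplex: "\<tau> \<subseteq> \<sigma> \<Longrightarrow> finite \<tau>"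
  using fin finite_subset by blast

lemma d_Fil: "x \<in> Fil p n \<Longrightarrow> d x \<in> Fil p (n - 1)"
  unfolding Fil_def
proof (rule lin_in_subspace[OF lin_d subspace_span_on])
  fix b assume "b \<in> {b \<in> \<Phi>. dg b = n \<and> card (fst b) \<le> p}"
  then show "d (basis_vec b) \<in> span_on {b \<in> \<Phi>. dg b = n - 1 \<and> card (fst b) \<le> p}"
    using d_span[of b] by (auto intro: span_on_mono[rotated])
qed

lemma d_d_zero: "x \<in> span_on \<Phi> \<Longrightarrow> d (d x) = 0"
  using lin_zero_on[OF lin_compose[OF lin_d lin_d]] d_d by blast

lemma d_coeff_sum: "x \<in> Fil p 1 \<Longrightarrow> coeff_sum (d x) = 0"
  using coeff_sum_lin[OF lin_d, of x 0] d_aug unfolding Fil_def span_on_iff by auto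

lemma slice_span: "x \<in> Fil p n \<Longrightarrow> \<tau> \<subseteq> \<sigma> \<Longrightarrow> \<tau> \<noteq> {} \<Longrightarrow> slice \<tau> x \<in> span_on {t \<in> A \<tau>. dm \<tau> t = n + 1 - int (card \<tau>)}"
  unfolding Fil_def span_on_iff
proof (rule subsetI)
  fix t assume *: "Poly_Mapping.keys x \<subseteq> {b \<in> \<Phi>. dg b = n \<and> card (fst b) \<le> p}" "t \<in> Poly_Mapping.keys (slice \<tau> x)"
  then have "(\<tau>, t) \<in> \<Phi>" "dg (\<tau>, t) = n" by (auto simp: in_keys_iff)
  then show "t \<in> {t \<in> A \<tau>. dm \<tau> t = n + 1 - int (card \<tau>)}"
    using dg[of \<tau> t] by (auto simp: \<Phi>_def)
qed

lemma slice_zero: "x \<in> Fil p n \<Longrightarrow> p < card \<tau> \<Longrightarrow> slice \<tau> x = 0"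
  unfolding Fil_def span_on_iff by (rule poly_mapping_eqI) (force simp: in_keys_iff)

text \<open>Read from the target: the component over \<open>\<rho>\<close> receives the vertical
  boundary of its own column and horizontal contributions from the cofaces of \<open>\<rho>\<close>
  inside \<open>\<sigma>\<close>.\<close>

lemma slice_d:
  assumes x: "x \<in> span_on \<Phi>" and \<rho>: "\<rho> \<subseteq> \<sigma>" "\<rho> \<noteq> {}"
  shows "slice \<rho> (d x) = lin_scale ((-1) ^ (card \<rho> - 1)) (bd \<rho> (slice \<rho> x)) +
    (\<Sum>v\<in>\<sigma> - \<rho>. lin_scale (face_sign (insert v \<rho>) v) (ps \<rho> (insert v \<rho>) (slice (insert v \<rho>) x)))"
proof (rule lin_eqI[where f = "\<lambda>x. slice \<rho> (d x)" and g = "\<lambda>x. lin_scale ((-1) ^ (card \<rho> - 1)) (bd \<rho> (slice \<rho> x)) +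
    (\<Sum>v\<in>\<sigma> - \<rho>. lin_scale (face_sign (insert v \<rho>) v) (ps \<rho> (insert v \<rho>) (slice (insert v \<rho>) x)))"])
  show "lin (\<lambda>x. slice \<rho> (d x))" by (rule lin_compose[OF lin_d lin_slice])
  show "lin (\<lambda>x. lin_scale ((-1) ^ (card \<rho> - 1)) (bd \<rho> (slice \<rho> x)) +
    (\<Sum>v\<in>\<sigma> - \<rho>. lin_scale (face_sign (insert v \<rho>) v) (ps \<rho> (insert v \<rho>) (slice (insert v \<rho>) x))))"
    by (rule linI)
      (simp_all add: lin_add[OF lin_slice] lin_add[OF lin_bd] lin_add[OF lin_ps] lin_scale[OF lin_slice]
        lin_scale[OF lin_bd] lin_scale[OF lin_ps] free.scale_right_distrib sum.distrib free.scale_sum_right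
        algebra_simps)
  fix b assume "b \<in> Poly_Mapping.keys x"
  then have b: "b \<in> \<Phi>" using x by (auto simp: span_on_iff)
  obtain \<tau> t where bt: "b = (\<tau>, t)" by (cases b)
  then have \<tau>: "(\<tau>, t) \<in> \<Phi>" "\<tau> \<subseteq> \<sigma>" "\<tau> \<noteq> {}" using b by (auto simp: \<Phi>_def)
  have ft: "finite \<tau>" by (rule finite_simplex[OF \<tau>(2)])
  let ?f = "\<lambda>v. lin_scale (face_sign \<tau> v) (ps \<rho> \<tau> (basis_vec t))"
  have "slice \<rho> (d (basis_vec b)) = lin_scale ((-1) ^ (card \<tau> - 1)) (if \<tau> = \<rho> then bd \<tau> (basis_vec t) else 0) +
      (\<Sum>v | v \<in> \<tau> \<and> \<tau> - {v} \<noteq> {}. if \<tau> - {v} = \<rho> then ?f v else 0)"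
    unfolding bt d_basis[OF \<tau>(1)]
    by (simp add: lin_add[OF lin_slice] lin_scale[OF lin_slice] lin_sum[OF lin_slice]
        slice_at_simplex if_distrib[of "lin_scale _"] cong: if_cong)
  also have "(\<Sum>v | v \<in> \<tau> \<and> \<tau> - {v} \<noteq> {}. if \<tau> - {v} = \<rho> then ?f v else 0)
      = (\<Sum>v | v \<in> \<tau> \<and> \<tau> - {v} = \<rho>. ?f v)"
  proof -
    have "(\<Sum>v | v \<in> \<tau> \<and> \<tau> - {v} \<noteq> {}. if \<tau> - {v} = \<rho> then ?f v else 0)
        = sum ?f {v \<in> {v. v \<in> \<tau> \<and> \<tau> - {v} \<noteq> {}}. \<tau> - {v} = \<rho>}"
      by (rule sum.inter_filter[symmetric]) (use ft in simp)
    also have "{v \<in> {v. v \<in> \<tau> \<and> \<tau> - {v} \<noteq> {}}. \<tau> - {v} = \<rho>} = {v. v \<in> \<tau> \<and> \<tau> - {v} = \<rho>}"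
      using \<rho>(2) by auto
    finally show ?thesis .
  qed
  \<comment> \<open>For fixed \<open>\<rho>\<close>, omitting v from \<open>\<tau>\<close> to get
    \<open>\<rho>\<close> is the same as adding v to \<open>\<rho>\<close> to get
    \<open>\<tau>\<close>; this trades faces for cofaces.\<close>
  also have "{v. v \<in> \<tau> \<and> \<tau> - {v} = \<rho>} = {v \<in> \<sigma> - \<rho>. insert v \<rho> = \<tau>}"
    using \<tau>(2) by auto
  also have "sum ?f {v \<in> \<sigma> - \<rho>. insert v \<rho> = \<tau>} = (\<Sum>v\<in>\<sigma> - \<rho>. if insert v \<rho> = \<tau> then ?f v else 0)"
    by (rule sum.inter_filter) (use fin in simp)
  also have "\<dots> = (\<Sum>v\<in>\<sigma> - \<rho>. lin_scale (face_sign (insert v \<rho>) v)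
      (ps \<rho> (insert v \<rho>) (slice (insert v \<rho>) (basis_vec b))))"
    unfolding bt by (rule sum.cong) (auto simp: slice_basis lin_zero[OF lin_ps])
  finally show "slice \<rho> (d (basis_vec b)) = lin_scale ((-1) ^ (card \<rho> - 1)) (bd \<rho> (slice \<rho> (basis_vec b))) +
    (\<Sum>v\<in>\<sigma> - \<rho>. lin_scale (face_sign (insert v \<rho>) v) (ps \<rho> (insert v \<rho>) (slice (insert v \<rho>) (basis_vec b))))"
    unfolding bt by (simp add: slice_basis lin_zero[OF lin_bd])
qed

lemma slice_d_top:
  assumes x: "x \<in> Fil p n" and \<tau>: "\<tau> \<subseteq> \<sigma>" "card \<tau> = p" "0 < p"
  shows "slice \<tau> (d x) = lin_scale ((-1) ^ (p - 1)) (bd \<tau> (slice \<tau> x))"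
proof -
  have "\<tau> \<noteq> {}" using \<tau> by auto
  have "slice (insert v \<tau>) x = 0" if "v \<in> \<sigma> - \<tau>" for v
    by (rule slice_zero[OF x]) (use \<open>v \<in> \<sigma> - \<tau>\<close> \<tau> finite_simplex[OF \<tau>(1)] in simp)
  then show ?thesis
    using slice_d[OF Fil_span[OF x] \<tau>(1) \<open>\<tau> \<noteq> {}\<close>] \<tau>(2) by (simp add: lin_zero[OF lin_ps])
qed

definition "top_simplices p = {\<tau>. \<tau> \<subseteq> \<sigma> \<and> card \<tau> = p}"

lemma finite_top [simp]: "finite (top_simplices p)"
  unfolding top_simplices_def using fin by simp

lemma slice_sum_at:
  "slice \<tau> (\<Sum>\<rho>\<in>top_simplices p. at_simplex \<rho> (y \<rho>)) = (if \<tau> \<in> top_simplices p then y \<tau> else 0)"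
proof -
  have "slice \<tau> (\<Sum>\<rho>\<in>top_simplices p. at_simplex \<rho> (y \<rho>)) = (\<Sum>\<rho>\<in>top_simplices p. if \<rho> = \<tau> then y \<rho> else 0)"
    unfolding lin_sum[OF lin_slice] slice_at_simplex by simp
  then show ?thesis by simp
qed

lemma Fil_sum_at:
  assumes "0 < p" "\<And>\<tau>. \<tau> \<in> top_simplices p \<Longrightarrow> y \<tau> \<in> span_on {t \<in> A \<tau>. dm \<tau> t = n + 1 - int p}"
  shows "(\<Sum>\<tau>\<in>top_simplices p. at_simplex \<tau> (y \<tau>)) \<in> Fil p n"
  unfolding Fil_def
proof (rule free.subspace_sum[OF subspace_span_on])
  fix \<tau> assume \<tau>: "\<tau> \<in> top_simplices p"
  then have "\<tau> \<noteq> {}" "\<tau> \<subseteq> \<sigma>" "card \<tau> = p" using assms(1) by (auto simp: top_simplices_def)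
  then show "at_simplex \<tau> (y \<tau>) \<in> span_on {b \<in> \<Phi>. dg b = n \<and> card (fst b) \<le> p}"
    using assms(2)[OF \<tau>] dg[of \<tau>] unfolding span_on_iff keys_at_simplex by (auto simp: \<Phi>_def)
qed

text \<open>Nothing of higher filtration maps into the top columns, so there a cycle is a vertical
  cycle and bounds in its acyclic column. Subtracting the boundary of these chains clears the
  columns with p + 1 vertices. \<open>aug\<close> is the extra condition in vertical degree 0, which
  in these columns means n = p.\<close>

lemma kill_top:
  assumes x: "x \<in> Fil (Suc p) n" and dx: "d x = 0"
    and aug: "\<And>\<tau>. \<tau> \<in> top_simplices (Suc p) \<Longrightarrow> n = int p \<Longrightarrow> coeff_sum (slice \<tau> x) = 0"
  shows "\<exists>y\<in>Fil (Suc p) (n + 1). x - d y \<in> Fil p n"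
proof -
  \<comment> \<open>The sign of the vertical differential over simplices with p + 1 vertices. It is
    its own inverse and is compensated in \<open>y'\<close>.\<close>
  define s :: 'k where "s = (-1) ^ p"
  have ss: "s * s = 1" by (simp add: s_def flip: power_mult_distrib)
  have "\<exists>y. y \<in> span_on {t \<in> A \<tau>. dm \<tau> t = n + 2 - int (Suc p)} \<and> bd \<tau> y = slice \<tau> x"
    if \<tau>: "\<tau> \<in> top_simplices (Suc p)" for \<tau>
  proof -
    have t: "\<tau> \<subseteq> \<sigma>" "card \<tau> = Suc p" "\<tau> \<noteq> {}" using \<tau> by (auto simp: top_simplices_def)
    have c: "slice \<tau> x \<in> span_on {t \<in> A \<tau>. dm \<tau> t = n - int p}"
      using slice_span[OF x t(1,3)] t(2) by simp
    have "lin_scale s (bd \<tau> (slice \<tau> x)) = 0"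
      using slice_d_top[OF x t(1,2)] dx by (simp add: s_def lin_zero[OF lin_slice])
    then have "lin_scale s (lin_scale s (bd \<tau> (slice \<tau> x))) = 0" by simp
    then have b: "bd \<tau> (slice \<tau> x) = 0" by (simp only: free.scale_scale ss free.scale_one)
    show ?thesis
    proof (cases "0 \<le> n - int p")
      case True
      have "\<exists>y. y \<in> span_on {t \<in> A \<tau>. dm \<tau> t = n - int p + 1} \<and> bd \<tau> y = slice \<tau> x"
        by (rule aug_acyclicD[OF acyc[OF t(1,3)] c b _ True]) (use aug[OF \<tau>] in simp)
      moreover have "n + 2 - int (Suc p) = n - int p + 1" by simp
      ultimately show ?thesis by presburger
    next
      case False
      have "dm \<tau> u \<noteq> n - int p" if u: "u \<in> A \<tau>" for u
        using dm[of \<tau> u] u t False by (auto simp: \<Phi>_def)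
      then have "{u \<in> A \<tau>. dm \<tau> u = n - int p} = {}" by blast
      then have "slice \<tau> x = 0" using c by (simp only: span_on_empty)
      then show ?thesis by (intro exI[of _ 0]) (simp add: free.subspace_0 lin_zero[OF lin_bd])
    qed
  qed
  then have "\<forall>\<tau>\<in>top_simplices (Suc p). \<exists>y. y \<in> span_on {t \<in> A \<tau>. dm \<tau> t = n + 2 - int (Suc p)} \<and> bd \<tau> y = slice \<tau> x"
    by (rule ballI)
  from bchoice[OF this] obtain y where "\<forall>\<tau>\<in>top_simplices (Suc p).
      y \<tau> \<in> span_on {t \<in> A \<tau>. dm \<tau> t = n + 2 - int (Suc p)} \<and> bd \<tau> (y \<tau>) = slice \<tau> x" ..
  note y = bspec[OF this]
  define y' where "y' = lin_scale s (\<Sum>\<tau>\<in>top_simplices (Suc p). at_simplex \<tau> (y \<tau>))"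
  have y': "y' \<in> Fil (Suc p) (n + 1)"
    unfolding y'_def using Fil_sum_at[of "Suc p" y "n + 1"] y
    by (simp add: Fil_def free.subspace_scale algebra_simps)
  have x': "x - d y' \<in> Fil (Suc p) n"
    using x d_Fil[OF y'] by (simp add: Fil_def free.subspace_diff)
  have "slice \<tau> (x - d y') = 0" if \<tau>: "\<tau> \<in> top_simplices (Suc p)" for \<tau>
  proof -
    have t: "\<tau> \<subseteq> \<sigma>" "card \<tau> = Suc p" using \<tau> by (auto simp: top_simplices_def)
    have "slice \<tau> y' = lin_scale s (y \<tau>)"
      unfolding y'_def using \<tau> by (simp add: lin_scale[OF lin_slice] slice_sum_at)
    then have "slice \<tau> (d y') = lin_scale s (lin_scale s (bd \<tau> (y \<tau>)))"
      using slice_d_top[OF y' t] by (simp add: s_def lin_scale[OF lin_bd])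
    then have "slice \<tau> (d y') = slice \<tau> x" using y[OF \<tau>] by (simp only: free.scale_scale ss free.scale_one)
    then show ?thesis by (simp add: lin_diff[OF lin_slice])
  qed
  then have "card (fst b) \<le> p" if b: "b \<in> Poly_Mapping.keys (x - d y')" for b
  proof -
    obtain \<tau> t where bt: "b = (\<tau>, t)" by (cases b)
    have "b \<in> \<Phi>" "card \<tau> \<le> Suc p" using x' b bt unfolding Fil_def span_on_iff by auto
    moreover have "\<tau> \<notin> top_simplices (Suc p)"
    proof
      assume "\<tau> \<in> top_simplices (Suc p)"
      then have "Poly_Mapping.lookup (slice \<tau> (x - d y')) t = 0"
        using \<open>\<And>\<tau>. \<tau> \<in> top_simplices (Suc p) \<Longrightarrow> slice \<tau> (x - d y') = 0\<close> by simp
      then show False using b bt by (simp add: in_keys_iff)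
    qed
    ultimately show ?thesis using bt by (auto simp: \<Phi>_def top_simplices_def)
  qed
  then have "x - d y' \<in> Fil p n" using x' unfolding Fil_def span_on_iff by blast
  then show ?thesis using y' by blast
qed

text \<open>
  In the bottom row the augmentations of the components form a cycle of the augmented simplicial
  chain complex of \<open>\<sigma>\<close>, which bounds its cone from the least vertex of \<open>\<sigma>\<close>.
\<close>

lemma face_sign_insert_least:
  assumes "finite \<tau>" "v0 < v" "v0 \<notin> \<tau>"
  shows "face_sign (insert v0 \<tau>) v = - (face_sign \<tau> v :: 'k)"
proof -
  have "{w \<in> insert v0 \<tau>. w < v} = insert v0 {w \<in> \<tau>. w < v}" using assms(2) by auto
  then show ?thesis using assms by (simp add: face_sign_def)
qed

lemma kill_augmentation:
  assumes x: "x \<in> Fil (Suc p) (int p)" and dx: "d x = 0" and aug: "p = 0 \<Longrightarrow> coeff_sum x = 0"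
  shows "\<exists>y\<in>Fil (Suc (Suc p)) (int p + 1). x - d y \<in> Fil (Suc p) (int p) \<and>
    (\<forall>\<tau>\<in>top_simplices (Suc p). coeff_sum (slice \<tau> (x - d y)) = 0)"
proof -
  define e where "e \<tau> = coeff_sum (slice \<tau> x)" for \<tau>
  define v0 where "v0 = Min \<sigma>"
  have v0: "v0 \<in> \<sigma>" "\<And>v. v \<in> \<sigma> \<Longrightarrow> v \<noteq> v0 \<Longrightarrow> v0 < v"
    using fin ne by (auto simp: v0_def less_le)
  have v0_least: "\<not> w < v0" if "w \<in> \<sigma>" for w
    using v0(2)[OF that] by (cases "w = v0") auto
  have sign_v0: "face_sign \<tau> v0 = (1 :: 'k)" if "\<tau> \<subseteq> \<sigma>" for \<tau>
  proof -
    have "{w \<in> \<tau>. w < v0} = {}" using v0_least that by blast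
    then show ?thesis unfolding face_sign_def by (simp only: card.empty power_0)
  qed
  \<comment> \<open>\<open>e\<close> is a simplicial chain with one coefficient for each face with p
    + 1 vertices; \<open>\<eta>\<close> is its cone with apex the least vertex.\<close>
  define \<eta> where "\<eta> \<tau> = (if v0 \<in> \<tau> then e (\<tau> - {v0}) else 0)" for \<tau>
  have "\<forall>\<tau>. \<exists>t. \<tau> \<subseteq> \<sigma> \<longrightarrow> \<tau> \<noteq> {} \<longrightarrow> t \<in> A \<tau> \<and> dm \<tau> t = 0"
    using acyc unfolding aug_acyclic_def by blast
  from choice[OF this] obtain vtx where "\<forall>\<tau>. \<tau> \<subseteq> \<sigma> \<longrightarrow> \<tau> \<noteq> {} \<longrightarrow> vtx \<tau> \<in> A \<tau> \<and> dm \<tau> (vtx \<tau>) = 0" ..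
  then have vtx: "vtx \<tau> \<in> A \<tau> \<and> dm \<tau> (vtx \<tau>) = 0" if "\<tau> \<subseteq> \<sigma>" "\<tau> \<noteq> {}" for \<tau>
    using that by simp
  \<comment> \<open>Lifts the cone to the double complex by placing each coefficient on some vertex
    of the column.\<close>
  define y where "y = (\<Sum>\<tau>\<in>top_simplices (Suc (Suc p)). at_simplex \<tau> (Poly_Mapping.single (vtx \<tau>) (\<eta> \<tau>)))"
  have y: "y \<in> Fil (Suc (Suc p)) (int p + 1)"
    unfolding y_def
  proof (rule Fil_sum_at)
    fix \<tau> assume "\<tau> \<in> top_simplices (Suc (Suc p))"
    then have "\<tau> \<subseteq> \<sigma>" "\<tau> \<noteq> {}" by (auto simp: top_simplices_def)
    from vtx[OF this] show "Poly_Mapping.single (vtx \<tau>) (\<eta> \<tau>) \<in> span_on {t \<in> A \<tau>. dm \<tau> t = int p + 1 + 1 - int (Suc (Suc p))}"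
      by (intro single_in_span_on) simp
  qed simp
  \<comment> \<open>Apply the augmentation to the component of d x = 0 over \<open>\<rho>\<close>:
    vertical boundaries have augmentation zero and horizontal maps preserve it, which leaves the
    simplicial cycle condition for \<open>e\<close>.\<close>
  have cyc: "(\<Sum>v\<in>\<sigma> - \<rho>. face_sign (insert v \<rho>) v * e (insert v \<rho>)) = 0"
    if \<rho>: "\<rho> \<subseteq> \<sigma>" "\<rho> \<noteq> {}" "card \<rho> = p" for \<rho>
  proof -
    have c: "slice \<rho> x \<in> span_on {t \<in> A \<rho>. dm \<rho> t = 1}"
      using slice_span[OF x \<rho>(1,2)] \<rho>(3) by simp
    have "coeff_sum (bd \<rho> (slice \<rho> x)) = coeff_sum (slice \<rho> x) * 0"
      by (rule coeff_sum_lin[OF lin_bd]) (use c \<rho> bd_aug[of \<rho>] in \<open>auto simp: span_on_iff \<Phi>_def\<close>)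
    moreover have "coeff_sum (ps \<rho> (insert v \<rho>) (slice (insert v \<rho>) x)) = e (insert v \<rho>)" if v: "v \<in> \<sigma> - \<rho>" for v
    proof -
      have iv: "insert v \<rho> \<subseteq> \<sigma>" "insert v \<rho> \<noteq> {}" "card (insert v \<rho>) = Suc p"
        using v \<rho> finite_simplex[OF \<rho>(1)] by auto
      have ci: "slice (insert v \<rho>) x \<in> span_on {t \<in> A (insert v \<rho>). dm (insert v \<rho>) t = 0}"
        using slice_span[OF x iv(1,2)] iv(3) by simp
      have "coeff_sum (ps \<rho> (insert v \<rho>) (slice (insert v \<rho>) x)) = coeff_sum (slice (insert v \<rho>) x) * 1"
      proof (rule coeff_sum_lin[OF lin_ps])
        fix t assume "t \<in> Poly_Mapping.keys (slice (insert v \<rho>) x)"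
        then have "t \<in> A (insert v \<rho>)" "dm (insert v \<rho>) t = 0" using ci by (auto simp: span_on_iff)
        then show "coeff_sum (ps \<rho> (insert v \<rho>) (basis_vec t)) = 1"
          using ps_aug[of "insert v \<rho>" t \<rho>] iv \<rho>(2) by (auto simp: \<Phi>_def)
      qed
      then show ?thesis by (simp add: e_def)
    qed
    ultimately have "coeff_sum (slice \<rho> (d x)) = (\<Sum>v\<in>\<sigma> - \<rho>. face_sign (insert v \<rho>) v * e (insert v \<rho>))"
      unfolding slice_d[OF Fil_span[OF x] \<rho>(1,2)]
      by (simp add: coeff_sum_add coeff_sum_scale coeff_sum_sum)
    then show ?thesis by (simp add: dx lin_zero[OF lin_slice])
  qed
  \<comment> \<open>The empty face has no column, so for p = 0 the cycle condition there is supplied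
    by the hypothesis on \<open>coeff_sum x\<close>.\<close>
  have aug0: "(\<Sum>v\<in>\<sigma>. e {v}) = 0" if p: "p = 0"
  proof -
    have "coeff_sum x = (\<Sum>v\<in>\<sigma>. e {v})"
    proof -
      have "x = (\<Sum>\<tau>\<in>top_simplices 1. at_simplex \<tau> (slice \<tau> x))"
      proof (rule poly_mapping_eqI)
        fix b :: "'v set \<times> 'b set"
        obtain \<tau> t where bt: "b = (\<tau>, t)" by (cases b)
        have "\<tau> \<in> top_simplices 1" if k: "b \<in> Poly_Mapping.keys x"
        proof -
          have "b \<in> \<Phi>" "card (fst b) \<le> 1" using x k p by (auto simp: Fil_def span_on_iff)
          moreover from this bt have "\<tau> \<subseteq> \<sigma>" "\<tau> \<noteq> {}" "card \<tau> \<le> 1" by (auto simp: \<Phi>_def)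
          moreover from this have "card \<tau> > 0" using finite_simplex[of \<tau>] by (simp add: card_gt_0_iff)
          ultimately show ?thesis by (simp add: top_simplices_def)
        qed
        moreover have "Poly_Mapping.lookup (\<Sum>\<tau>\<in>top_simplices 1. at_simplex \<tau> (slice \<tau> x)) b
            = Poly_Mapping.lookup (slice \<tau> (\<Sum>\<tau>\<in>top_simplices 1. at_simplex \<tau> (slice \<tau> x))) t"
          by (simp add: bt)
        ultimately show "Poly_Mapping.lookup x b = Poly_Mapping.lookup (\<Sum>\<tau>\<in>top_simplices 1. at_simplex \<tau> (slice \<tau> x)) b"
          unfolding slice_sum_at by (auto simp: bt in_keys_iff)
      qed
      then have "coeff_sum x = (\<Sum>\<tau>\<in>top_simplices 1. e \<tau>)"
        by (metis (no_types, lifting) coeff_sum_at_simplex coeff_sum_sum e_def sum.cong)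
      also have "top_simplices 1 = (\<lambda>v. {v}) ` \<sigma>"
        by (auto simp: top_simplices_def card_1_singleton_iff)
      also have "(\<Sum>\<tau>\<in>(\<lambda>v. {v}) ` \<sigma>. e \<tau>) = (\<Sum>v\<in>\<sigma>. e {v})"
        by (subst sum.reindex) (auto simp: inj_on_def)
      finally show ?thesis .
    qed
    then show ?thesis using aug p by simp
  qed
  have main: "(\<Sum>v\<in>\<sigma> - \<tau>. face_sign (insert v \<tau>) v * \<eta> (insert v \<tau>)) = e \<tau>"
    if \<tau>: "\<tau> \<in> top_simplices (Suc p)" for \<tau>
  proof -
    have t: "\<tau> \<subseteq> \<sigma>" "card \<tau> = Suc p" "finite \<tau>" using \<tau> finite_simplex by (auto simp: top_simplices_def)
    show ?thesis
    proof (cases "v0 \<in> \<tau>")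
      \<comment> \<open>Without the apex in \<open>\<tau>\<close>, only the coface obtained by
        adding the apex has a nonzero coefficient, and that coefficient is
        \<open>e \<tau>\<close>.\<close>
      case False
      have "(\<Sum>v\<in>\<sigma> - \<tau>. face_sign (insert v \<tau>) v * \<eta> (insert v \<tau>))
          = (\<Sum>v\<in>\<sigma> - \<tau>. if v = v0 then face_sign (insert v0 \<tau>) v0 * e \<tau> else 0)"
        by (rule sum.cong) (use False in \<open>auto simp: \<eta>_def\<close>)
      also have "\<dots> = face_sign (insert v0 \<tau>) v0 * e \<tau>" using fin v0(1) False by simp
      also have "face_sign (insert v0 \<tau>) v0 = (1 :: 'k)" by (rule sign_v0) (use v0(1) t(1) in simp)
      finally show ?thesis by simp
    next
      \<comment> \<open>With the apex in \<open>\<tau>\<close>, the cycle condition at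
        \<open>\<tau> - {v0}\<close> expresses the sum over the remaining cofaces through
        \<open>e \<tau>\<close>. The apex lies below every other vertex and so reverses each
        sign.\<close>
      case True
      let ?\<rho> = "\<tau> - {v0}"
      have ins: "insert v0 ?\<rho> = \<tau>" using True by auto
      have \<rho>: "?\<rho> \<subseteq> \<sigma>" "card ?\<rho> = p" "finite ?\<rho>" "v0 \<notin> ?\<rho>" using t True by auto
      have dif: "\<sigma> - ?\<rho> = insert v0 (\<sigma> - \<tau>)" using v0(1) by auto
      have "(\<Sum>v\<in>\<sigma> - \<tau>. face_sign (insert v \<tau>) v * \<eta> (insert v \<tau>))
          = (\<Sum>v\<in>\<sigma> - \<tau>. - (face_sign (insert v ?\<rho>) v * e (insert v ?\<rho>)))"
      proof (rule sum.cong)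
        fix v assume v: "v \<in> \<sigma> - \<tau>"
        then have vv: "v0 < v" "v \<noteq> v0" using v0(2)[of v] True by auto
        have i1: "insert v \<tau> = insert v0 (insert v ?\<rho>)" using True by auto
        have i2: "insert v \<tau> - {v0} = insert v ?\<rho>" using vv by auto
        have "face_sign (insert v \<tau>) v = - (face_sign (insert v ?\<rho>) v :: 'k)"
          unfolding i1 by (rule face_sign_insert_least) (use vv \<rho> in auto)
        moreover have "\<eta> (insert v \<tau>) = e (insert v ?\<rho>)" using True i2 by (simp add: \<eta>_def)
        ultimately show "face_sign (insert v \<tau>) v * \<eta> (insert v \<tau>) = - (face_sign (insert v ?\<rho>) v * e (insert v ?\<rho>))"
          by simp
      qed simp
      also have "\<dots> = - (\<Sum>v\<in>\<sigma> - \<tau>. face_sign (insert v ?\<rho>) v * e (insert v ?\<rho>))" by (rule sum_negf)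
      also have "\<dots> = e \<tau>"
      proof (cases "p = 0")
        case True
        then have r: "?\<rho> = {}" using \<rho> by simp
        have "face_sign {v} v = (1 :: 'k)" for v :: 'v
        proof -
          have "{w \<in> {v}. w < v} = {}" by auto
          then show ?thesis unfolding face_sign_def by (simp only: card.empty power_0)
        qed
        then have "(\<Sum>v\<in>\<sigma> - \<tau>. face_sign (insert v ?\<rho>) v * e (insert v ?\<rho>)) = (\<Sum>v\<in>\<sigma> - \<tau>. e {v})"
          unfolding r by simp
        moreover have "(\<Sum>v\<in>\<sigma>. e {v}) = e {v0} + (\<Sum>v\<in>\<sigma> - {v0}. e {v})"
          using fin v0(1) by (rule sum.remove)
        moreover have "\<tau> = {v0}" using ins r by simp
        ultimately show ?thesis using aug0[OF True] by (simp add: add_eq_0_iff)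
      next
        case False
        then have "?\<rho> \<noteq> {}" using \<rho>(2) by (metis card.empty)
        from cyc[OF \<rho>(1) this \<rho>(2)]
        have "face_sign \<tau> v0 * e \<tau> + (\<Sum>v\<in>\<sigma> - \<tau>. face_sign (insert v ?\<rho>) v * e (insert v ?\<rho>)) = 0"
          unfolding dif using fin True ins by simp
        moreover have "face_sign \<tau> v0 = (1 :: 'k)" by (rule sign_v0[OF t(1)])
        ultimately show ?thesis by (simp add: add_eq_0_iff2)
      qed
      finally show ?thesis .
    qed
  qed
  have slice_dy: "slice \<tau> (d y) = (\<Sum>v\<in>\<sigma> - \<tau>. lin_scale (face_sign (insert v \<tau>) v)
      (ps \<tau> (insert v \<tau>) (Poly_Mapping.single (vtx (insert v \<tau>)) (\<eta> (insert v \<tau>)))))"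
    if \<tau>: "\<tau> \<in> top_simplices (Suc p)" for \<tau>
  proof -
    have t: "\<tau> \<subseteq> \<sigma>" "card \<tau> = Suc p" "finite \<tau>" "\<tau> \<noteq> {}" using \<tau> finite_simplex by (auto simp: top_simplices_def)
    have c0: "slice \<tau> y = 0" unfolding y_def slice_sum_at using t by (simp add: top_simplices_def)
    have "slice (insert v \<tau>) y = Poly_Mapping.single (vtx (insert v \<tau>)) (\<eta> (insert v \<tau>))" if v: "v \<in> \<sigma> - \<tau>" for v
      unfolding y_def slice_sum_at using t v by (simp add: top_simplices_def)
    then show ?thesis
      unfolding slice_d[OF Fil_span[OF y] t(1,4)] c0 by (simp add: lin_zero[OF lin_bd])
  qed
  have aug_dy: "coeff_sum (slice \<tau> (d y)) = e \<tau>" if \<tau>: "\<tau> \<in> top_simplices (Suc p)" for \<tau>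
  proof -
    have t: "\<tau> \<subseteq> \<sigma>" "\<tau> \<noteq> {}" using \<tau> by (auto simp: top_simplices_def)
    have "coeff_sum (ps \<tau> (insert v \<tau>) (Poly_Mapping.single (vtx (insert v \<tau>)) (\<eta> (insert v \<tau>)))) = \<eta> (insert v \<tau>)"
      if v: "v \<in> \<sigma> - \<tau>" for v
    proof -
      have iv: "insert v \<tau> \<subseteq> \<sigma>" using v t by auto
      have "coeff_sum (ps \<tau> (insert v \<tau>) (basis_vec (vtx (insert v \<tau>)))) = 1"
        using vtx[OF iv] t iv by (intro ps_aug) (auto simp: \<Phi>_def)
      moreover have "Poly_Mapping.single (vtx (insert v \<tau>)) (\<eta> (insert v \<tau>))
          = lin_scale (\<eta> (insert v \<tau>)) (basis_vec (vtx (insert v \<tau>)))" by (simp only: scale_basis)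
      ultimately show ?thesis
        by (simp only: lin_scale[OF lin_ps] coeff_sum_scale mult_1_right)
    qed
    then show ?thesis
      unfolding slice_dy[OF \<tau>] using main[OF \<tau>] by (simp add: coeff_sum_sum coeff_sum_scale)
  qed
  have x': "x - d y \<in> Fil (Suc (Suc p)) (int p)"
    using x d_Fil[OF y] unfolding Fil_def
    by (intro free.subspace_diff subspace_span_on) (auto intro: span_on_mono[rotated])
  moreover have "Poly_Mapping.keys y \<subseteq> {b \<in> \<Phi>. dm (fst b) (snd b) = 0 \<and> card (fst b) = Suc (Suc p)}"
  proof
    fix b assume b: "b \<in> Poly_Mapping.keys y"
    obtain \<tau> t where bt: "b = (\<tau>, t)" by (cases b)
    have "Poly_Mapping.lookup (slice \<tau> y) t \<noteq> 0" using b by (simp add: bt in_keys_iff)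
    then have "\<tau> \<in> top_simplices (Suc (Suc p))" unfolding y_def slice_sum_at by (auto split: if_splits)
    moreover have "b \<in> \<Phi>" "dg b = int p + 1" using b y by (auto simp: Fil_def span_on_iff)
    ultimately show "b \<in> {b \<in> \<Phi>. dm (fst b) (snd b) = 0 \<and> card (fst b) = Suc (Suc p)}"
      using dg[of \<tau> t] by (auto simp: bt top_simplices_def)
  qed
  \<comment> \<open>\<open>y\<close> occupies columns with p + 2 vertices, but it consists of
    vertices, whose vertical boundary is zero; so d y does not reach these columns and the
    filtration of \<open>x\<close> is not raised.\<close>
  have "slice \<tau> (d y) = 0" if \<tau>: "\<tau> \<in> top_simplices (Suc (Suc p))" for \<tau>
  proof -
    have t: "\<tau> \<subseteq> \<sigma>" "card \<tau> = Suc (Suc p)" "\<tau> \<noteq> {}" using \<tau> by (auto simp: top_simplices_def)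
    have "slice \<tau> y = Poly_Mapping.single (vtx \<tau>) (\<eta> \<tau>)"
      unfolding y_def slice_sum_at if_P[OF \<tau>] ..
    also have "\<dots> = lin_scale (\<eta> \<tau>) (basis_vec (vtx \<tau>))" by (simp only: scale_basis)
    finally have "bd \<tau> (slice \<tau> y) = lin_scale (\<eta> \<tau>) (bd \<tau> (basis_vec (vtx \<tau>)))"
      by (simp only: lin_scale[OF lin_bd])
    moreover have "bd \<tau> (basis_vec (vtx \<tau>)) = 0"
      by (rule bd_zero) (use vtx[OF t(1,3)] t in \<open>simp_all add: \<Phi>_def\<close>)
    ultimately have "bd \<tau> (slice \<tau> y) = 0" by simp
    then show ?thesis using slice_d_top[OF y t(1,2)] by simp
  qed
  then have "card (fst b) \<le> Suc p" if b: "b \<in> Poly_Mapping.keys (x - d y)" for b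
  proof -
    obtain \<tau> t where bt: "b = (\<tau>, t)" by (cases b)
    have bP: "b \<in> \<Phi>" "card \<tau> \<le> Suc (Suc p)" using x' b bt unfolding Fil_def span_on_iff by auto
    have "\<tau> \<notin> top_simplices (Suc (Suc p))"
    proof
      assume \<tau>: "\<tau> \<in> top_simplices (Suc (Suc p))"
      then have "slice \<tau> (x - d y) = 0"
        using \<open>\<And>\<tau>. \<tau> \<in> top_simplices (Suc (Suc p)) \<Longrightarrow> slice \<tau> (d y) = 0\<close> slice_zero[OF x, of \<tau>]
        by (simp add: lin_diff[OF lin_slice] top_simplices_def)
      then have "Poly_Mapping.lookup (slice \<tau> (x - d y)) t = 0" by simp
      then show False using b bt by (simp add: in_keys_iff)
    qed
    then show ?thesis using bP bt by (auto simp: \<Phi>_def top_simplices_def)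
  qed
  ultimately have "x - d y \<in> Fil (Suc p) (int p)" unfolding Fil_def span_on_iff by blast
  moreover have "coeff_sum (slice \<tau> (x - d y)) = 0" if "\<tau> \<in> top_simplices (Suc p)" for \<tau>
    using aug_dy[OF that] by (simp add: lin_diff[OF lin_slice] coeff_sum_diff e_def)
  ultimately show ?thesis using y by blast
qed

text \<open>Induction on the filtration index of a cycle, removing its top columns. Away from
  vertical degree 0 this is \<open>kill_top\<close>; in vertical degree 0 the augmentations of the
  top columns have to be made zero beforehand.\<close>

theorem total_acyclic: "aug_acyclic dg d \<Phi>"
proof -
  have span: "\<exists>y\<in>span_on {b \<in> \<Phi>. dg b = n + 1}. d y = x"
    if "x \<in> Fil p n" "d x = 0" "n = 0 \<Longrightarrow> coeff_sum x = 0" for p n x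
    using that
  proof (induction p arbitrary: x)
    case 0
    have "{b \<in> \<Phi>. dg b = n \<and> card (fst b) \<le> 0} = {}"
      using finite_simplex by (auto simp: \<Phi>_def)
    then have "x = 0" using 0(1) unfolding Fil_def by (metis span_on_empty)
    then show ?case by (intro bexI[of _ 0]) (simp_all add: lin_zero[OF lin_d] free.subspace_0)
  next
    case (Suc p)
    \<comment> \<open>\<open>q\<close> is left free because the chain used for the correction may
      have higher filtration than the cycle itself.\<close>
    have red: ?case if y: "y \<in> Fil q (n + 1)" "x - d y \<in> Fil p n" for y q
    proof -
      have "d (x - d y) = 0"
        using Suc.prems(2) d_d_zero[OF Fil_span[OF y(1)]] by (simp add: lin_diff[OF lin_d])
      moreover have "coeff_sum (x - d y) = 0" if n: "n = 0"
        using Suc.prems(3)[OF n] d_coeff_sum[of y q] y(1) n by (simp add: coeff_sum_diff)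
      ultimately obtain y' where y': "y' \<in> span_on {b \<in> \<Phi>. dg b = n + 1}" "d y' = x - d y"
        using Suc.IH[OF y(2)] by blast
      have "y \<in> span_on {b \<in> \<Phi>. dg b = n + 1}"
        using y(1) unfolding Fil_def by (rule span_on_mono[rotated]) auto
      then have "y' + y \<in> span_on {b \<in> \<Phi>. dg b = n + 1}"
        using y'(1) by (simp add: free.subspace_add)
      moreover have "d (y' + y) = x" using y'(2) by (simp add: lin_add[OF lin_d])
      ultimately show ?thesis by blast
    qed
    show ?case
    proof (cases "n = int p")
      case False
      then obtain y where "y \<in> Fil (Suc p) (n + 1)" "x - d y \<in> Fil p n"
        using kill_top[OF Suc.prems(1,2)] by blast
      then show ?thesis by (rule red)
    next
      case True
      \<comment> \<open>Here the top columns are in vertical degree 0, where only chains of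
        augmentation zero bound. The correction comes from columns one simplicial dimension
        higher.\<close>
      obtain y where y: "y \<in> Fil (Suc (Suc p)) (n + 1)" "x - d y \<in> Fil (Suc p) n"
        "\<forall>\<tau>\<in>top_simplices (Suc p). coeff_sum (slice \<tau> (x - d y)) = 0"
        using kill_augmentation[of x p] Suc.prems True by auto
      have "d (x - d y) = 0"
        using Suc.prems(2) d_d_zero[OF Fil_span[OF y(1)]] by (simp add: lin_diff[OF lin_d])
      then obtain z where z: "z \<in> Fil (Suc p) (n + 1)" "x - d y - d z \<in> Fil p n"
        using kill_top[OF y(2)] y(3) by blast
      have "y + z \<in> Fil (Suc (Suc p)) (n + 1)"
        using y(1) z(1) unfolding Fil_def
        by (intro free.subspace_add subspace_span_on) (auto intro: span_on_mono[rotated])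
      moreover have "x - d (y + z) \<in> Fil p n" using z(2) by (simp add: lin_add[OF lin_d] algebra_simps)
      ultimately show ?thesis by (rule red)
    qed
  qed
  show ?thesis
    unfolding aug_acyclic_def
  proof (intro conjI allI ballI impI)
    obtain v where v: "v \<in> \<sigma>" using ne by blast
    then obtain t where "t \<in> A {v}" "dm {v} t = 0"
      using acyc[of "{v}"] unfolding aug_acyclic_def by auto
    then have "({v}, t) \<in> \<Phi>" "dg ({v}, t) = 0" using v dg[of "{v}" t] by (auto simp: \<Phi>_def)
    then show "\<exists>v\<in>\<Phi>. dg v = 0" by blast
  next
    fix n x assume x: "x \<in> span_on {b \<in> \<Phi>. dg b = n}" "d x = 0" "n = 0 \<longrightarrow> coeff_sum x = 0"
    have "card (fst b) \<le> card \<sigma>" if "b \<in> \<Phi>" for b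
      using that fin by (auto simp: \<Phi>_def intro: card_mono)
    then have "x \<in> Fil (card \<sigma>) n" using x(1) unfolding Fil_def span_on_iff by blast
    then show "\<exists>y\<in>span_on {b \<in> \<Phi>. dg b = n + 1}. d y = x" using span x by blast
  qed
qed

end

section \<open>Subquotients\<close>

lemma cring_field_ring: "cring (field_ring :: 'k::field ring)"
proof (rule cringI)
  show "abelian_group (field_ring :: 'k ring)"
  proof (rule abelian_groupI)
    fix x :: 'k
    show "\<exists>y\<in>carrier field_ring. y \<oplus>\<^bsub>field_ring\<^esub> x = \<zero>\<^bsub>field_ring\<^esub>"
      by (rule bexI[of _ "- x"]) (simp_all add: field_ring_def)
  qed (auto simp: field_ring_def)
  show "Group.comm_monoid (field_ring :: 'k ring)"
    by (rule comm_monoidI) (auto simp: field_ring_def)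
qed (auto simp: field_ring_def algebra_simps)

lemma carrier_field_ring [simp]: "carrier field_ring = UNIV"
  by (simp add: field_ring_def)

lemma coset_map_constant:
  assumes "x \<in> X" "\<And>z. z \<in> X \<Longrightarrow> B +>\<^bsub>N\<^esub> f z = C"
  shows "coset_map N B f X = C"
  unfolding coset_map_def using assms by blast

context
  fixes M :: "('k::field, 'e) module" and B :: "'e set"
  assumes M: "Module.module field_ring M" and B: "submodule B field_ring M"
begin

interpretation M: Module.module field_ring M by (rule M)

interpretation abelian_subgroup B M
  by (rule abelian_subgroupI3)
    (simp_all add: additive_subgroup.intro submodule.axioms(1)[OF B] M.abelian_group_axioms)

lemma coset_self: "x \<in> carrier M \<Longrightarrow> x \<in> B +>\<^bsub>M\<^esub> x"
  by (rule a_rcos_self)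

lemma coset_eqI: "x \<in> carrier M \<Longrightarrow> y \<in> B +>\<^bsub>M\<^esub> x \<Longrightarrow> B +>\<^bsub>M\<^esub> y = B +>\<^bsub>M\<^esub> x"
  using a_repr_independence' by blast

lemma coset_eq_iff:
  assumes "x \<in> carrier M" "y \<in> carrier M"
  shows "B +>\<^bsub>M\<^esub> x = B +>\<^bsub>M\<^esub> y \<longleftrightarrow> x \<ominus>\<^bsub>M\<^esub> y \<in> B"
  using a_rcos_module[of y x] assms coset_self coset_eqI by (metis a_minus_def)

lemma coset_zero: "B +>\<^bsub>M\<^esub> \<zero>\<^bsub>M\<^esub> = B"
  by (simp add: a_rcos_const)

lemma coset_add:
  "x \<in> carrier M \<Longrightarrow> y \<in> carrier M \<Longrightarrow> (B +>\<^bsub>M\<^esub> x) <+>\<^bsub>M\<^esub> (B +>\<^bsub>M\<^esub> y) = B +>\<^bsub>M\<^esub> (x \<oplus>\<^bsub>M\<^esub> y)"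
  by (rule a_rcos_sum)

text \<open>Scalar multiplication in \<open>subquotient\<close> is a union over representatives; all
  members of that union coincide because \<open>B\<close> is closed under scalars.\<close>

lemma coset_smult:
  assumes x: "x \<in> carrier M"
  shows "(\<Union>z\<in>B +>\<^bsub>M\<^esub> x. B +>\<^bsub>M\<^esub> (k \<odot>\<^bsub>M\<^esub> z)) = B +>\<^bsub>M\<^esub> (k \<odot>\<^bsub>M\<^esub> x)"
proof -
  have "B +>\<^bsub>M\<^esub> (k \<odot>\<^bsub>M\<^esub> z) = B +>\<^bsub>M\<^esub> (k \<odot>\<^bsub>M\<^esub> x)" if z: "z \<in> B +>\<^bsub>M\<^esub> x" for z
  proof -
    have zc: "z \<in> carrier M" using a_elemrcos_carrier[OF x z] .
    have "z \<ominus>\<^bsub>M\<^esub> x \<in> B" using coset_eq_iff[OF zc x] coset_eqI[OF x z] by simp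
    then have "k \<odot>\<^bsub>M\<^esub> (z \<ominus>\<^bsub>M\<^esub> x) \<in> B" using submodule.smult_closed[OF B] by simp
    also have "k \<odot>\<^bsub>M\<^esub> (z \<ominus>\<^bsub>M\<^esub> x) = k \<odot>\<^bsub>M\<^esub> z \<ominus>\<^bsub>M\<^esub> k \<odot>\<^bsub>M\<^esub> x"
      using x zc by (simp add: a_minus_def M.smult_r_distr M.smult_r_minus)
    finally show ?thesis using x zc by (simp add: coset_eq_iff)
  qed
  then show ?thesis using coset_self[OF x] by blast
qed

context
  fixes Z :: "'e set"
  assumes Z: "submodule Z field_ring M" and BZ: "B \<subseteq> Z"
begin

private lemma Z_carrier: "x \<in> Z \<Longrightarrow> x \<in> carrier M"
  using M.submoduleE(1)[OF Z] by blast

lemma subquotient_carrier: "carrier (subquotient M Z B) = (\<lambda>x. B +>\<^bsub>M\<^esub> x) ` Z"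
  by (simp add: subquotient_def)

lemma subquotient_zero: "zero (subquotient M Z B) = B +>\<^bsub>M\<^esub> \<zero>\<^bsub>M\<^esub>"
  by (simp add: subquotient_def coset_zero)

lemma subquotient_add: "x \<in> Z \<Longrightarrow> y \<in> Z \<Longrightarrow>
    (B +>\<^bsub>M\<^esub> x) \<oplus>\<^bsub>subquotient M Z B\<^esub> (B +>\<^bsub>M\<^esub> y) = B +>\<^bsub>M\<^esub> (x \<oplus>\<^bsub>M\<^esub> y)"
  by (simp add: subquotient_def coset_add Z_carrier)

lemma subquotient_smult: "x \<in> Z \<Longrightarrow>
    k \<odot>\<^bsub>subquotient M Z B\<^esub> (B +>\<^bsub>M\<^esub> x) = B +>\<^bsub>M\<^esub> (k \<odot>\<^bsub>M\<^esub> x)"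
  by (simp add: subquotient_def coset_smult Z_carrier)

lemma subquotient_module: "Module.module field_ring (subquotient M Z B)"
proof -
  note Zc = M.submoduleE[OF Z] Z_carrier
  have z0: "\<zero>\<^bsub>M\<^esub> \<in> Z" using subgroup.one_closed[OF submodule.axioms(1)[OF Z]] by simp
  note simps = subquotient_carrier subquotient_zero subquotient_add subquotient_smult Zc z0
  show ?thesis
  proof (rule moduleI)
    show "abelian_group (subquotient M Z B)"
    proof (rule abelian_groupI)
      fix x assume "x \<in> carrier (subquotient M Z B)"
      then obtain z where z: "z \<in> Z" "x = B +>\<^bsub>M\<^esub> z" by (auto simp: subquotient_carrier)
      show "\<exists>y\<in>carrier (subquotient M Z B). y \<oplus>\<^bsub>subquotient M Z B\<^esub> x = \<zero>\<^bsub>subquotient M Z B\<^esub>"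
        by (rule bexI[of _ "B +>\<^bsub>M\<^esub> (\<ominus>\<^bsub>M\<^esub> z)"]) (use z in \<open>auto simp: simps M.l_neg\<close>)
    qed (auto simp: simps M.a_assoc, auto simp: M.a_comm Z_carrier)
  qed (auto simp: simps cring_field_ring M.smult_l_distr M.smult_r_distr M.smult_assoc1)
qed

end

end

lemma lin_id: "lin id"
  by (rule linI) simp_all

lemma free_module_module: "Module.module field_ring (free_module S :: ('k::field, 'c \<Rightarrow>\<^sub>0 'k) module)"
proof (rule moduleI)
  show "abelian_group (free_module S :: ('k, 'c \<Rightarrow>\<^sub>0 'k) module)"
  proof (rule abelian_groupI)
    fix x :: "'c \<Rightarrow>\<^sub>0 'k" assume "x \<in> carrier (free_module S)"
    then show "\<exists>y\<in>carrier (free_module S). y \<oplus>\<^bsub>free_module S\<^esub> x = \<zero>\<^bsub>free_module S\<^esub>"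
      by (intro bexI[of _ "- x"]) (auto simp: free_module_def free.subspace_neg)
  qed (auto simp: free_module_def free.subspace_add free.subspace_0 algebra_simps)
qed (simp_all add: cring_field_ring,
    auto simp: free_module_def free.subspace_scale field_ring_def
      free.scale_left_distrib free.scale_right_distrib)

lemma free_module_simps [simp]:
  "carrier (free_module S) = span_on S" "x \<oplus>\<^bsub>free_module S\<^esub> y = x + y"
  "\<zero>\<^bsub>free_module S\<^esub> = 0" "k \<odot>\<^bsub>free_module S\<^esub> x = lin_scale k x"
  by (simp_all add: free_module_def)

lemma free_module_neg:
  fixes x :: "'c \<Rightarrow>\<^sub>0 'k::field"
  assumes "x \<in> span_on S" shows "\<ominus>\<^bsub>free_module S\<^esub> x = - x"
proof -
  interpret Module.module field_ring "free_module S :: ('k, 'c \<Rightarrow>\<^sub>0 'k) module" by (rule free_module_module)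
  show ?thesis
    by (rule minus_equality) (use assms in \<open>auto simp: free.subspace_neg\<close>)
qed

lemma free_submodule:
  fixes V :: "('c \<Rightarrow>\<^sub>0 'k::field) set"
  assumes "free.subspace V" "V \<subseteq> span_on S"
  shows "submodule V field_ring (free_module S)"
proof -
  interpret Module.module field_ring "free_module S :: ('k, 'c \<Rightarrow>\<^sub>0 'k) module" by (rule free_module_module)
  show ?thesis
    by (rule submoduleI) (use assms in \<open>auto simp: free.subspace_0 free.subspace_add
          free.subspace_scale free_module_neg free.subspace_neg subset_iff\<close>)
qed

text \<open>The coset of \<open>B\<close> in any \<open>free_module S\<close>; it does not mention
  \<open>S\<close>, so cosets taken in different ambient spaces can be compared.\<close>

definition cl :: "('c \<Rightarrow>\<^sub>0 'k::field) set \<Rightarrow> ('c \<Rightarrow>\<^sub>0 'k) \<Rightarrow> ('c \<Rightarrow>\<^sub>0 'k) set" where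
  "cl B x = (\<lambda>b. b + x) ` B"

lemma coset_free_module: "B +>\<^bsub>free_module S\<^esub> x = cl B x"
  by (auto simp: a_r_coset_def' cl_def)

lemma in_cl_iff: "y \<in> cl B x \<longleftrightarrow> y - x \<in> B"
  unfolding cl_def image_iff by (metis add_diff_cancel_right' diff_add_cancel)

lemma cl_eq_iff: "free.subspace B \<Longrightarrow> cl B x = cl B y \<longleftrightarrow> x - y \<in> B"
proof -
  assume B: "free.subspace B"
  have "cl B x = cl B y" if "x - y \<in> B"
  proof -
    have "z - x \<in> B \<longleftrightarrow> z - y \<in> B" for z
      using free.subspace_add[OF B _ that, of "z - x"] free.subspace_diff[OF B _ that, of "z - y"] by auto
    then show ?thesis by (auto simp: in_cl_iff)
  qed
  moreover have "x - y \<in> B" if "cl B x = cl B y"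
    using that free.subspace_0[OF B] in_cl_iff[of x B x] in_cl_iff[of x B y] by simp
  ultimately show ?thesis by blast
qed

lemma coset_map_cl:
  assumes "lin f" "free.subspace B" "free.subspace B'" "\<And>b. b \<in> B \<Longrightarrow> f b \<in> B'"
  shows "coset_map (free_module S) B' f (cl B x) = cl B' (f x)"
proof (rule coset_map_constant)
  show "x \<in> cl B x" using free.subspace_0[OF assms(2)] by (simp add: in_cl_iff)
  show "B' +>\<^bsub>free_module S\<^esub> f z = cl B' (f x)" if "z \<in> cl B x" for z
    using that assms(4)[of "z - x"]
    by (simp add: coset_free_module cl_eq_iff assms(3) in_cl_iff lin_diff[OF assms(1)])
qed

section \<open>The spectral sequence of a filtered complex\<close>

locale filtered_complex =
  fixes S :: "'c set" and dg fil :: "'c \<Rightarrow> int" and d :: "('c \<Rightarrow>\<^sub>0 'k::field) \<Rightarrow> ('c \<Rightarrow>\<^sub>0 'k)"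
  assumes lin_d: "lin d"
    and d_basis: "b \<in> S \<Longrightarrow> d (basis_vec b) \<in> filt_part S dg fil (fil b) (dg b - 1)"
    and d_d_basis: "b \<in> S \<Longrightarrow> d (d (basis_vec b)) = 0"

text \<open>
  \<open>ZZ\<close> and \<open>BB\<close> are \<^const>\<open>ss_Z\<close> and \<^const>\<open>ss_B\<close> indexed by the total degree \<open>n = p + q\<close>.
\<close>

definition ZZ :: "'c set \<Rightarrow> ('c \<Rightarrow> int) \<Rightarrow> ('c \<Rightarrow> int) \<Rightarrow> (('c \<Rightarrow>\<^sub>0 'k) \<Rightarrow> ('c \<Rightarrow>\<^sub>0 'k))
    \<Rightarrow> int \<Rightarrow> int \<Rightarrow> int \<Rightarrow> ('c \<Rightarrow>\<^sub>0 'k::field) set" where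
  "ZZ S dg fil d r p n = {x \<in> filt_part S dg fil p n. d x \<in> filt_part S dg fil (p - r) (n - 1)}"

definition BB :: "'c set \<Rightarrow> ('c \<Rightarrow> int) \<Rightarrow> ('c \<Rightarrow> int) \<Rightarrow> (('c \<Rightarrow>\<^sub>0 'k) \<Rightarrow> ('c \<Rightarrow>\<^sub>0 'k))
    \<Rightarrow> int \<Rightarrow> int \<Rightarrow> int \<Rightarrow> ('c \<Rightarrow>\<^sub>0 'k::field) set" where
  "BB S dg fil d r p n =
    {y + d z | y z. y \<in> ZZ S dg fil d (r - 1) (p - 1) n \<and> z \<in> ZZ S dg fil d (r - 1) (p + r - 1) (n + 1)}"

lemma ss_Z_eq: "ss_Z S dg fil d r p q = ZZ S dg fil d r p (p + q)"
  by (simp add: ss_Z_def ZZ_def)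

lemma ss_B_eq: "ss_B S dg fil d r p q = BB S dg fil d r p (p + q)"
proof -
  have "p + r - 1 + (q - r + 2) = p + q + 1" "p - 1 + (q + 1) = p + q" by simp_all
  then show ?thesis unfolding ss_B_def BB_def ss_Z_eq by presburger
qed

lemma subspace_filt_part [simp]: "free.subspace (filt_part S dg fil p n)"
  by (simp add: filt_part_def)

lemma filt_part_mono: "p \<le> p' \<Longrightarrow> x \<in> filt_part S dg fil p n \<Longrightarrow> x \<in> filt_part S dg fil p' n"
  unfolding filt_part_def by (rule span_on_mono) auto

lemma filt_part_span: "x \<in> filt_part S dg fil p n \<Longrightarrow> x \<in> span_on S"
  unfolding filt_part_def by (rule span_on_mono) auto

context filtered_complex
begin

abbreviation "F \<equiv> filt_part S dg fil"
abbreviation "Z \<equiv> ZZ S dg fil d"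
abbreviation "B \<equiv> BB S dg fil d"
abbreviation "E \<equiv> filtered_spec_seq S dg fil d"

lemma d_d: "x \<in> span_on S \<Longrightarrow> d (d x) = 0"
  using lin_zero_on[OF lin_compose[OF lin_d lin_d]] d_d_basis by blast

lemma d_filt_part: "x \<in> F p n \<Longrightarrow> d x \<in> F p (n - 1)"
  unfolding filt_part_def[of S dg fil p n]
  by (rule lin_in_subspace[OF lin_d subspace_filt_part])
    (use d_basis in \<open>auto intro: filt_part_mono\<close>)

lemma Z_iff: "x \<in> Z r p n \<longleftrightarrow> x \<in> F p n \<and> d x \<in> F (p - r) (n - 1)"
  by (simp add: ZZ_def)

lemma Z_F: "x \<in> Z r p n \<Longrightarrow> x \<in> F p n" "x \<in> Z r p n \<Longrightarrow> d x \<in> F (p - r) (n - 1)"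
  by (simp_all add: Z_iff)

lemma Z_span: "x \<in> Z r p n \<Longrightarrow> x \<in> span_on S"
  using Z_F(1) filt_part_span by blast

lemma B_iff: "x \<in> B r p n \<longleftrightarrow> (\<exists>y\<in>Z (r - 1) (p - 1) n. \<exists>z\<in>Z (r - 1) (p + r - 1) (n + 1). x = y + d z)"
  unfolding BB_def by blast

lemma subspace_Z [simp]: "free.subspace (Z r p n)"
  by (rule free.subspaceI)
    (auto simp: Z_iff lin_zero[OF lin_d] lin_add[OF lin_d] lin_scale[OF lin_d]
      free.subspace_0 free.subspace_add free.subspace_scale)

lemma subspace_B [simp]: "free.subspace (B r p n)"
proof (rule free.subspaceI)
  show "0 \<in> B r p n"
    unfolding B_iff by (rule bexI[of _ 0], rule bexI[of _ 0]) (auto simp: free.subspace_0 lin_zero[OF lin_d])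
next
  fix x x' assume "x \<in> B r p n" "x' \<in> B r p n"
  then obtain y z y' z' where *: "x = y + d z" "x' = y' + d z'"
    "y \<in> Z (r - 1) (p - 1) n" "z \<in> Z (r - 1) (p + r - 1) (n + 1)"
    "y' \<in> Z (r - 1) (p - 1) n" "z' \<in> Z (r - 1) (p + r - 1) (n + 1)" unfolding B_iff by blast
  then show "x + x' \<in> B r p n"
    unfolding B_iff
    by (intro bexI[of _ "y + y'"] bexI[of _ "z + z'"]) (auto simp: lin_add[OF lin_d] free.subspace_add)
next
  fix k x assume "x \<in> B r p n"
  then obtain y z where *: "x = y + d z"
    "y \<in> Z (r - 1) (p - 1) n" "z \<in> Z (r - 1) (p + r - 1) (n + 1)" unfolding B_iff by blast
  then show "lin_scale k x \<in> B r p n"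
    unfolding B_iff
    by (intro bexI[of _ "lin_scale k y"] bexI[of _ "lin_scale k z"])
      (auto simp: lin_scale[OF lin_d] free.subspace_scale free.scale_right_distrib)
qed

text \<open>A boundary is a cycle, so membership in \<open>Z r\<close> is only a question of its own
  filtration, for every \<open>r\<close>.\<close>

lemma d_in_Z:
  assumes "w \<in> F p' (n + 1)" "d w \<in> F p n" shows "d w \<in> Z r p n"
  using assms d_d[OF filt_part_span[OF assms(1)]] by (simp add: Z_iff free.subspace_0)

lemma B_subset_Z:
  assumes "x \<in> B r p n" "r \<ge> 0" shows "x \<in> Z r p n"
proof -
  obtain y z where *: "x = y + d z"
    "y \<in> Z (r - 1) (p - 1) n" "z \<in> Z (r - 1) (p + r - 1) (n + 1)" using assms unfolding B_iff by blast
  have "y \<in> Z r p n" using *(2) assms(2) by (auto simp: Z_iff intro: filt_part_mono[of "p - 1"])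
  moreover have "d z \<in> Z r p n" by (rule d_in_Z[of _ "p + r - 1"]) (use *(3) in \<open>auto simp: Z_iff\<close>)
  ultimately show ?thesis unfolding *(1) by (simp add: free.subspace_add)
qed

lemma d_Z: "x \<in> Z r p n \<Longrightarrow> d x \<in> Z r (p - r) (n - 1)"
  by (rule d_in_Z[of _ p]) (auto simp: Z_iff)

lemma d_B:
  assumes "x \<in> B r p n" shows "d x \<in> B r (p - r) (n - 1)"
proof -
  obtain y z where *: "x = y + d z"
    "y \<in> Z (r - 1) (p - 1) n" "z \<in> Z (r - 1) (p + r - 1) (n + 1)" using assms unfolding B_iff by blast
  then have "d x = 0 + d y" by (simp add: lin_add[OF lin_d] d_d Z_span[OF *(3)])
  then show ?thesis unfolding B_iff
    using *(2) by (intro bexI[of _ 0] bexI[of _ y]) (auto simp: free.subspace_0)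
qed

lemma page_eq: "page E r p q = subquotient (free_module S) (Z (int r) p (p + q)) (B (int r) p (p + q))"
  by (simp add: filtered_spec_seq_def ss_Z_eq ss_B_eq)

lemma Z_submodule: "submodule (Z r p n) field_ring (free_module S)"
  by (rule free_submodule) (auto intro: Z_span)

lemma B_submodule: "r \<ge> 0 \<Longrightarrow> submodule (B r p n) field_ring (free_module S)"
  by (rule free_submodule) (auto intro: Z_span[OF B_subset_Z])

lemma page_module: "Module.module field_ring (page E r p q)"
  unfolding page_eq
  by (rule subquotient_module[OF free_module_module B_submodule Z_submodule]) (auto intro: B_subset_Z)

lemma page_carrier: "carrier (page E r p q) = cl (B (int r) p (p + q)) ` Z (int r) p (p + q)"
  unfolding page_eq by (simp add: subquotient_def coset_free_module)

lemma page_carrierI: "x \<in> Z (int r) p (p + q) \<Longrightarrow> cl (B (int r) p (p + q)) x \<in> carrier (page E r p q)"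
  by (simp add: page_carrier)

lemma page_zero: "\<zero>\<^bsub>page E r p q\<^esub> = cl (B (int r) p (p + q)) 0"
  by (simp add: page_eq subquotient_def cl_def)

lemma page_add: "x \<in> Z (int r) p (p + q) \<Longrightarrow> y \<in> Z (int r) p (p + q) \<Longrightarrow>
  cl (B (int r) p (p + q)) x \<oplus>\<^bsub>page E r p q\<^esub> cl (B (int r) p (p + q)) y = cl (B (int r) p (p + q)) (x + y)"
  using subquotient_add[OF free_module_module B_submodule Z_submodule, of "int r" p "p + q" "int r" p "p + q" x y]
  unfolding page_eq by (simp add: coset_free_module B_subset_Z subset_iff)

lemma page_smult: "x \<in> Z (int r) p (p + q) \<Longrightarrow>
  k \<odot>\<^bsub>page E r p q\<^esub> cl (B (int r) p (p + q)) x = cl (B (int r) p (p + q)) (lin_scale k x)"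
  using subquotient_smult[OF free_module_module B_submodule Z_submodule, of "int r" p "p + q" "int r" p "p + q" x k]
  unfolding page_eq by (simp add: coset_free_module B_subset_Z subset_iff)

lemma page_neg:
  assumes x: "x \<in> Z (int r) p (p + q)"
  shows "\<ominus>\<^bsub>page E r p q\<^esub> cl (B (int r) p (p + q)) x = cl (B (int r) p (p + q)) (- x)"
proof -
  interpret Module.module field_ring "page E r p q" by (rule page_module)
  show ?thesis
    by (rule minus_equality) (use x in \<open>auto simp: page_add page_carrierI page_zero free.subspace_neg\<close>)
qed

lemma diff_cl:
  assumes "p' = p - int r" "q' = q + int r - 1"
  shows "diff E r p q (cl (B (int r) p (p + q)) x) = cl (B (int r) p' (p' + q')) (d x)"
proof -
  have n: "p' + q' = p + q - 1" using assms by simp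
  have "coset_map (free_module S) (B (int r) p' (p' + q')) d (cl (B (int r) p (p + q)) x)
     = cl (B (int r) p' (p' + q')) (d x)"
    by (rule coset_map_cl[OF lin_d]) (use d_B[of _ "int r" p "p + q", folded n] assms(1) in auto)
  then show ?thesis using assms by (simp add: filtered_spec_seq_def ss_B_eq)
qed

lemma Z_Suc_subset: "x \<in> Z (r + 1) p n \<Longrightarrow> x \<in> Z r p n"
  by (auto simp: Z_iff intro: filt_part_mono[of "p - (r + 1)"])

lemma Z_pred_in_B: "u \<in> Z (r - 1) (p - 1) n \<Longrightarrow> u \<in> B r p n"
  unfolding B_iff by (rule bexI[of _ u], rule bexI[of _ 0]) (auto simp: free.subspace_0 lin_zero[OF lin_d])

lemma d_Z_Suc_in_B:
  assumes "x \<in> Z (r + 1) p n" shows "d x \<in> B r (p - r) (n - 1)"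
proof (rule Z_pred_in_B)
  have "d x \<in> F (p - r - 1) (n - 1)" using assms by (simp add: Z_iff algebra_simps)
  then show "d x \<in> Z (r - 1) (p - r - 1) (n - 1)"
    using d_d[OF Z_span[OF assms]] by (simp add: Z_iff free.subspace_0)
qed

text \<open>Write d x = y + d u with \<open>y\<close> in filtration p - r - 1 and \<open>u\<close>
  in filtration p - 1. Subtracting \<open>u\<close> changes \<open>x\<close> only inside
  \<open>B r\<close> and leaves the boundary \<open>y\<close>, which is low enough for the next
  page.\<close>

lemma cycle_representative:
  assumes x: "x \<in> Z r p n" and dx: "d x \<in> B r (p - r) (n - 1)"
  shows "\<exists>x'\<in>Z (r + 1) p n. x - x' \<in> B r p n"
proof -
  obtain y u where *: "d x = y + d u" "y \<in> Z (r - 1) (p - r - 1) (n - 1)" "u \<in> Z (r - 1) (p - 1) n"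
    using dx unfolding B_iff by auto
  have "u \<in> F p n" using *(3) by (auto simp: Z_iff intro: filt_part_mono[of "p - 1"])
  then have "x - u \<in> Z (r + 1) p n"
    using x *(1,2) by (auto simp: Z_iff lin_diff[OF lin_d] free.subspace_diff algebra_simps)
  then show ?thesis using Z_pred_in_B[OF *(3)] by (intro bexI[of _ "x - u"]) simp_all
qed

text \<open>The boundaries of page r together with \<open>B r\<close> make up
  \<open>B (r + 1)\<close>. From left to right, y = u - d (w + z) has the same boundary as
  \<open>u\<close>, which lies in filtration p - r - 1, so \<open>y\<close> qualifies for the next
  page. From right to left, the condition on \<open>y\<close> only weakens.\<close>

lemma B_Suc_iff:
  assumes u: "u \<in> Z (r + 1) p n"
  shows "(\<exists>w\<in>Z r (p + r) (n + 1). u - d w \<in> B r p n) \<longleftrightarrow> u \<in> B (r + 1) p n"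
proof
  assume "\<exists>w\<in>Z r (p + r) (n + 1). u - d w \<in> B r p n"
  then obtain w y z where *: "w \<in> Z r (p + r) (n + 1)" "u - d w = y + d z"
    "y \<in> Z (r - 1) (p - 1) n" "z \<in> Z (r - 1) (p + r - 1) (n + 1)" unfolding B_iff by blast
  have "z \<in> Z r (p + r) (n + 1)"
    using *(4) by (auto simp: Z_iff intro: filt_part_mono[of "p + r - 1"])
  then have wz: "w + z \<in> Z r (p + r) (n + 1)" using *(1) by (simp add: free.subspace_add)
  have u_eq: "u = y + d (w + z)" using *(2) by (simp add: lin_add[OF lin_d] algebra_simps)
  then have "d y = d u"
    using d_d[OF Z_span[OF wz]] by (simp add: lin_add[OF lin_d])
  then have "y \<in> Z r (p - 1) n" using *(3) u by (auto simp: Z_iff algebra_simps)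
  then show "u \<in> B (r + 1) p n"
    unfolding B_iff by (intro bexI[of _ y] bexI[of _ "w + z"]) (use u_eq wz in auto)
next
  assume "u \<in> B (r + 1) p n"
  then obtain y z where *: "u = y + d z" "y \<in> Z r (p - 1) n" "z \<in> Z r (p + r) (n + 1)"
    unfolding B_iff by auto
  have "y \<in> B r p n"
    by (rule Z_pred_in_B) (use *(2) Z_Suc_subset[of y "r - 1"] in simp)
  then show "\<exists>w\<in>Z r (p + r) (n + 1). u - d w \<in> B r p n"
    using * by (intro bexI[of _ z]) auto
qed

lemma page_cycles_eq: "page_cycles E r p q = cl (B (int r) p (p + q)) ` Z (int r + 1) p (p + q)"
proof -
  let ?p = "p - int r" and ?q = "q + int r - 1"
  have [simp]: "?p + ?q = p + q - 1" by simp
  have zero: "diff E r p q (cl (B (int r) p (p + q)) x) = \<zero>\<^bsub>page E r ?p ?q\<^esub>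
      \<longleftrightarrow> d x \<in> B (int r) (p - int r) (p + q - 1)" for x
    by (simp add: diff_cl page_zero cl_eq_iff)
  show ?thesis
  proof (intro Set.set_eqI iffI)
    fix c assume "c \<in> page_cycles E r p q"
    then obtain x where x: "x \<in> Z (int r) p (p + q)" "c = cl (B (int r) p (p + q)) x"
      "d x \<in> B (int r) (p - int r) (p + q - 1)"
      unfolding page_cycles_def page_carrier using zero by auto
    from cycle_representative[OF x(1,3)] show "c \<in> cl (B (int r) p (p + q)) ` Z (int r + 1) p (p + q)"
      using x(2) by (auto simp: cl_eq_iff image_iff)
  next
    fix c assume "c \<in> cl (B (int r) p (p + q)) ` Z (int r + 1) p (p + q)"
    then obtain x where x: "x \<in> Z (int r + 1) p (p + q)" "c = cl (B (int r) p (p + q)) x" by blast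
    then show "c \<in> page_cycles E r p q"
      unfolding page_cycles_def using zero d_Z_Suc_in_B[OF x(1)] Z_Suc_subset[OF x(1)] page_carrierI by auto
  qed
qed

lemma page_boundaries_eq:
  "page_boundaries E r p q = (\<lambda>w. cl (B (int r) p (p + q)) (d w)) ` Z (int r) (p + int r) (p + q + 1)"
proof -
  have *: "p + int r + (q - int r + 1) = p + q + 1" by simp
  have "diff E r (p + int r) (q - int r + 1) (cl (B (int r) (p + int r) (p + q + 1)) w)
      = cl (B (int r) p (p + q)) (d w)" for w
    using diff_cl[of p "p + int r" r q "q - int r + 1" w] by (simp only: *)
  then show ?thesis
    unfolding page_boundaries_def page_carrier * image_image by simp
qed

lemma d_boundary: "w \<in> Z r (p + r) (n + 1) \<Longrightarrow> d w \<in> Z r p n"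
  using d_Z[of w r "p + r" "n + 1"] by simp

lemma d_boundary_Suc: "w \<in> Z r (p + r) (n + 1) \<Longrightarrow> d w \<in> Z (r + 1) p n"
  using d_in_Z[of w "p + r" n p] by (auto simp: Z_iff)

lemma page_boundaries_submodule: "submodule (page_boundaries E r p q) field_ring (page E r p q)"
proof -
  interpret P: Module.module field_ring "page E r p q" by (rule page_module)
  have d0: "d 0 = 0" and d_neg: "- d w = d (- w)" and d_add: "d w + d w' = d (w + w')"
    and d_scale: "lin_scale k (d w) = d (lin_scale k w)" for w w' k
    by (simp_all add: lin_zero[OF lin_d] lin_neg[OF lin_d] lin_add[OF lin_d] lin_scale[OF lin_d])
  show ?thesis
  proof (rule P.submoduleI)
    show "\<zero>\<^bsub>page E r p q\<^esub> \<in> page_boundaries E r p q"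
      unfolding page_boundaries_eq page_zero by (rule image_eqI[of _ _ 0]) (auto simp: d0 free.subspace_0)
  qed (auto simp: page_boundaries_eq page_neg page_add page_smult page_carrierI d_boundary
      d_neg d_add d_scale intro!: imageI free.subspace_neg free.subspace_add free.subspace_scale)
qed

lemma page_cycles_submodule: "submodule (page_cycles E r p q) field_ring (page E r p q)"
proof -
  interpret P: Module.module field_ring "page E r p q" by (rule page_module)
  show ?thesis
  proof (rule P.submoduleI)
    show "\<zero>\<^bsub>page E r p q\<^esub> \<in> page_cycles E r p q"
      unfolding page_cycles_eq page_zero by (rule imageI) (auto simp: free.subspace_0)
  qed (auto simp: page_cycles_eq page_neg page_add page_smult page_carrierI Z_Suc_subset
      intro!: imageI free.subspace_neg free.subspace_add free.subspace_scale)
qed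

lemma page_boundaries_subset_cycles: "page_boundaries E r p q \<subseteq> page_cycles E r p q"
  unfolding page_boundaries_eq page_cycles_eq by (auto intro!: imageI d_boundary_Suc)

text \<open>A coset of cosets: the class in the homology of page r determined by an element of
  \<open>Z (r + 1)\<close>. By \<open>page_homology_carrier\<close> all homology classes arise in
  this way.\<close>

definition hcl :: "nat \<Rightarrow> int \<Rightarrow> int \<Rightarrow> ('c \<Rightarrow>\<^sub>0 'k) \<Rightarrow> ('c \<Rightarrow>\<^sub>0 'k) set set" where
  "hcl r p q x = page_boundaries E r p q +>\<^bsub>page E r p q\<^esub> cl (B (int r) p (p + q)) x"

lemma page_homology_carrier: "carrier (page_homology E r p q) = hcl r p q ` Z (int r + 1) p (p + q)"
  by (simp add: page_homology_def subquotient_def page_cycles_eq hcl_def image_image)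

lemma page_homology_add: "x \<in> Z (int r + 1) p (p + q) \<Longrightarrow> y \<in> Z (int r + 1) p (p + q) \<Longrightarrow>
  hcl r p q x \<oplus>\<^bsub>page_homology E r p q\<^esub> hcl r p q y = hcl r p q (x + y)"
  unfolding page_homology_def hcl_def
  by (subst subquotient_add[OF page_module page_boundaries_submodule page_cycles_submodule page_boundaries_subset_cycles])
    (auto simp: page_cycles_eq page_add Z_Suc_subset)

lemma page_homology_smult: "x \<in> Z (int r + 1) p (p + q) \<Longrightarrow>
  k \<odot>\<^bsub>page_homology E r p q\<^esub> hcl r p q x = hcl r p q (lin_scale k x)"
  unfolding page_homology_def hcl_def
  by (subst subquotient_smult[OF page_module page_boundaries_submodule page_cycles_submodule page_boundaries_subset_cycles])
    (auto simp: page_cycles_eq page_smult Z_Suc_subset)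

lemma hcl_eq_iff:
  assumes x: "x \<in> Z (int r + 1) p (p + q)" and y: "y \<in> Z (int r + 1) p (p + q)"
  shows "hcl r p q x = hcl r p q y \<longleftrightarrow> x - y \<in> B (int r + 1) p (p + q)"
proof -
  note Zs = Z_Suc_subset[OF x] Z_Suc_subset[OF y]
  have "hcl r p q x = hcl r p q y \<longleftrightarrow> cl (B (int r) p (p + q)) (x - y) \<in> page_boundaries E r p q"
    unfolding hcl_def using Zs
    by (simp add: coset_eq_iff[OF page_module page_boundaries_submodule] page_carrierI
        a_minus_def page_neg page_add free.subspace_neg)
  also have "\<dots> \<longleftrightarrow> (\<exists>w\<in>Z (int r) (p + int r) (p + q + 1). x - y - d w \<in> B (int r) p (p + q))"
    unfolding page_boundaries_eq by (auto simp: image_iff cl_eq_iff)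
  also have "\<dots> \<longleftrightarrow> x - y \<in> B (int r + 1) p (p + q)"
    by (rule B_Suc_iff) (use x y in \<open>simp add: free.subspace_diff\<close>)
  finally show ?thesis .
qed

text \<open>\<open>hiso\<close> works with the union of a homology class, cut down to
  \<open>Z (r + 1)\<close>. That set is already a single coset of \<open>B (r + 1)\<close>, which
  makes \<open>hiso\<close> computable on representatives.\<close>

lemma Union_hcl:
  assumes x: "x \<in> Z (int r + 1) p (p + q)"
  shows "\<Union>(hcl r p q x) \<inter> Z (int r + 1) p (p + q) = cl (B (int r + 1) p (p + q)) x"
proof (rule Set.set_eqI)
  fix y
  note Zx = Z_Suc_subset[OF x]
  have "\<Union>(hcl r p q x) = (\<Union>w\<in>Z (int r) (p + int r) (p + q + 1). cl (B (int r) p (p + q)) (d w + x))"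
    unfolding hcl_def a_r_coset_def' page_boundaries_eq using Zx by (auto simp: page_add d_boundary)
  then have mem: "y \<in> \<Union>(hcl r p q x) \<longleftrightarrow>
      (\<exists>w\<in>Z (int r) (p + int r) (p + q + 1). y - x - d w \<in> B (int r) p (p + q))"
    by (simp add: in_cl_iff algebra_simps)
  show "y \<in> \<Union>(hcl r p q x) \<inter> Z (int r + 1) p (p + q) \<longleftrightarrow> y \<in> cl (B (int r + 1) p (p + q)) x"
  proof (cases "y \<in> Z (int r + 1) p (p + q)")
    case True
    then have "y - x \<in> Z (int r + 1) p (p + q)" using x by (simp add: free.subspace_diff)
    from B_Suc_iff[OF this] show ?thesis using True mem by (simp add: in_cl_iff)
  next
    case False
    have "y \<notin> cl (B (int r + 1) p (p + q)) x"
    proof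
      assume "y \<in> cl (B (int r + 1) p (p + q)) x"
      then have "y - x \<in> Z (int r + 1) p (p + q)" by (simp add: in_cl_iff B_subset_Z)
      from free.subspace_add[OF subspace_Z this x] show False using False by simp
    qed
    then show ?thesis using False by blast
  qed
qed

lemma hiso_hcl:
  assumes "x \<in> Z (int r + 1) p (p + q)"
  shows "hiso E r p q (hcl r p q x) = cl (B (int r + 1) p (p + q)) x"
  using coset_map_cl[of id "B (int r + 1) p (p + q)" "B (int r + 1) p (p + q)" S x]
  by (simp add: filtered_spec_seq_def ss_Z_eq ss_B_eq Union_hcl[OF assms] lin_id)

lemma int_Suc': "int (Suc r) = int r + 1"
  by simp

theorem filtered_spectral_sequence: "spectral_sequence E"
  unfolding spectral_sequence_def
proof (intro allI conjI ballI)
  fix r p q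
  let ?p = "p - int r" and ?q = "q + int r - 1"
  have pq: "?p + ?q = p + q - 1" by simp
  show "Module.module field_ring (page E r p q)" by (rule page_module)
  have diff: "diff E r p q (cl (B (int r) p (p + q)) x) = cl (B (int r) ?p (p + q - 1)) (d x)" for x
    unfolding pq[symmetric] by (rule diff_cl) simp_all
  have dZ: "d x \<in> Z (int r) ?p (?p + ?q)" if "x \<in> Z (int r) p (p + q)" for x
    using d_Z[OF that] unfolding pq .
  have padd: "cl (B (int r) ?p (p + q - 1)) u \<oplus>\<^bsub>page E r ?p ?q\<^esub> cl (B (int r) ?p (p + q - 1)) v
      = cl (B (int r) ?p (p + q - 1)) (u + v)"
    if "u \<in> Z (int r) ?p (?p + ?q)" "v \<in> Z (int r) ?p (?p + ?q)" for u v
    using page_add[OF that] unfolding pq .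
  have psmult: "k \<odot>\<^bsub>page E r ?p ?q\<^esub> cl (B (int r) ?p (p + q - 1)) u
      = cl (B (int r) ?p (p + q - 1)) (lin_scale k u)"
    if "u \<in> Z (int r) ?p (?p + ?q)" for u k
    using page_smult[OF that] unfolding pq .
  have pcar: "cl (B (int r) ?p (p + q - 1)) u \<in> carrier (page E r ?p ?q)"
    if "u \<in> Z (int r) ?p (?p + ?q)" for u
    using page_carrierI[OF that] unfolding pq .
  show "linear_map (page E r p q) (page E r ?p ?q) (diff E r p q)"
    unfolding linear_map_def
  proof (intro conjI ballI allI)
    show "diff E r p q \<in> carrier (page E r p q) \<rightarrow> carrier (page E r ?p ?q)"
      unfolding page_carrier[of r p] using diff pcar dZ by auto
    show "diff E r p q (X \<oplus>\<^bsub>page E r p q\<^esub> Y) = diff E r p q X \<oplus>\<^bsub>page E r ?p ?q\<^esub> diff E r p q Y"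
      if "X \<in> carrier (page E r p q)" "Y \<in> carrier (page E r p q)" for X Y
    proof -
      obtain x y where *: "x \<in> Z (int r) p (p + q)" "X = cl (B (int r) p (p + q)) x"
        "y \<in> Z (int r) p (p + q)" "Y = cl (B (int r) p (p + q)) y"
        using \<open>X \<in> _\<close> \<open>Y \<in> _\<close> unfolding page_carrier by blast
      then show ?thesis
        by (simp only: page_add diff padd dZ lin_add[OF lin_d])
    qed
    show "diff E r p q (k \<odot>\<^bsub>page E r p q\<^esub> X) = k \<odot>\<^bsub>page E r ?p ?q\<^esub> diff E r p q X"
      if "X \<in> carrier (page E r p q)" for k X
    proof -
      obtain x where *: "x \<in> Z (int r) p (p + q)" "X = cl (B (int r) p (p + q)) x"
        using \<open>X \<in> _\<close> unfolding page_carrier by blast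
      then show ?thesis
        by (simp only: page_smult diff psmult dZ lin_scale[OF lin_d])
    qed
  qed
  show "diff E r ?p ?q (diff E r p q c) = \<zero>\<^bsub>page E r (p - 2 * int r) (q + 2 * int r - 2)\<^esub>"
    if "c \<in> carrier (page E r p q)" for c
  proof -
    obtain x where x: "x \<in> Z (int r) p (p + q)" "c = cl (B (int r) p (p + q)) x"
      using \<open>c \<in> _\<close> unfolding page_carrier by blast
    have "diff E r ?p ?q (cl (B (int r) ?p (?p + ?q)) (d x))
        = cl (B (int r) (p - 2 * int r) ((p - 2 * int r) + (q + 2 * int r - 2))) (d (d x))"
      by (rule diff_cl) simp_all
    then show ?thesis
      using x(2) d_d[OF Z_span[OF x(1)]] diff[of x] by (simp only: pq page_zero)
  qed
  show "linear_iso (page_homology E r p q) (page E (Suc r) p q) (hiso E r p q)"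
    unfolding linear_iso_def linear_map_def
  proof (intro conjI ballI allI)
    have car: "carrier (page E (Suc r) p q) = cl (B (int r + 1) p (p + q)) ` Z (int r + 1) p (p + q)"
      unfolding page_carrier int_Suc' ..
    show "hiso E r p q \<in> carrier (page_homology E r p q) \<rightarrow> carrier (page E (Suc r) p q)"
      unfolding car page_homology_carrier by (auto simp: hiso_hcl)
    show "bij_betw (hiso E r p q) (carrier (page_homology E r p q)) (carrier (page E (Suc r) p q))"
      unfolding bij_betw_def car page_homology_carrier
      by (auto simp: inj_on_def hiso_hcl hcl_eq_iff cl_eq_iff image_image cong: image_cong)
    show "hiso E r p q (X \<oplus>\<^bsub>page_homology E r p q\<^esub> Y)
        = hiso E r p q X \<oplus>\<^bsub>page E (Suc r) p q\<^esub> hiso E r p q Y"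
      if "X \<in> carrier (page_homology E r p q)" "Y \<in> carrier (page_homology E r p q)" for X Y
    proof -
      obtain x y where *: "x \<in> Z (int r + 1) p (p + q)" "X = hcl r p q x"
        "y \<in> Z (int r + 1) p (p + q)" "Y = hcl r p q y"
        using \<open>X \<in> _\<close> \<open>Y \<in> _\<close> unfolding page_homology_carrier by blast
      then show ?thesis
        using page_add[of x "Suc r" p q y] unfolding int_Suc'
        by (simp add: page_homology_add hiso_hcl free.subspace_add)
    qed
    show "hiso E r p q (k \<odot>\<^bsub>page_homology E r p q\<^esub> X) = k \<odot>\<^bsub>page E (Suc r) p q\<^esub> hiso E r p q X"
      if "X \<in> carrier (page_homology E r p q)" for k X
    proof -
      obtain x where *: "x \<in> Z (int r + 1) p (p + q)" "X = hcl r p q x"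
        using \<open>X \<in> _\<close> unfolding page_homology_carrier by blast
      then show ?thesis
        using page_smult[of x "Suc r" p q k] unfolding int_Suc'
        by (simp add: page_homology_smult hiso_hcl free.subspace_scale)
    qed
  qed
qed

end

subsection \<open>Morphisms induced by filtered chain maps\<close>

definition filtered_map where
  "filtered_map S dg fil d S' dg' fil' d' f \<longleftrightarrow> lin f \<and>
    (\<forall>b\<in>S. f (basis_vec b) \<in> filt_part S' dg' fil' (fil b) (dg b) \<and>
      d' (f (basis_vec b)) = f (d (basis_vec b)))"

abbreviation ss_map where
  "ss_map S' dg' fil' d' f \<equiv>
    (\<lambda>r p q. coset_map (free_module S') (ss_B S' dg' fil' d' (int r) p q) f)"

context
  fixes S :: "'c set" and dg fil :: "'c \<Rightarrow> int" and d :: "('c \<Rightarrow>\<^sub>0 'k::field) \<Rightarrow> ('c \<Rightarrow>\<^sub>0 'k)"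
    and S' :: "'d set" and dg' fil' :: "'d \<Rightarrow> int" and d' :: "('d \<Rightarrow>\<^sub>0 'k) \<Rightarrow> ('d \<Rightarrow>\<^sub>0 'k)"
  assumes C: "filtered_complex S dg fil d" and C': "filtered_complex S' dg' fil' d'"
begin

interpretation X: filtered_complex S dg fil d by (rule C)
interpretation Y: filtered_complex S' dg' fil' d' by (rule C')

lemma filtered_map_filt_part:
  assumes f: "filtered_map S dg fil d S' dg' fil' d' f" and x: "x \<in> X.F p n"
  shows "f x \<in> Y.F p n"
proof (rule lin_in_subspace[of f _ _ "{b \<in> S. dg b = n \<and> fil b \<le> p}"])
  show "x \<in> span_on {b \<in> S. dg b = n \<and> fil b \<le> p}" using x by (simp add: filt_part_def)
qed (use f in \<open>auto simp: filtered_map_def intro: filt_part_mono\<close>)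

lemma filtered_map_commute:
  assumes f: "filtered_map S dg fil d S' dg' fil' d' f" and x: "x \<in> span_on S"
  shows "d' (f x) = f (d x)"
proof (rule lin_eqI[where f = "\<lambda>x. d' (f x)" and g = "\<lambda>x. f (d x)"])
  show "lin (\<lambda>x. d' (f x))" "lin (\<lambda>x. f (d x))"
    using f X.lin_d Y.lin_d by (auto simp: filtered_map_def intro: lin_compose)
qed (use f x in \<open>auto simp: filtered_map_def span_on_iff\<close>)

lemma filtered_map_Z:
  assumes f: "filtered_map S dg fil d S' dg' fil' d' f" and x: "x \<in> X.Z r p n"
  shows "f x \<in> Y.Z r p n"
  using x filtered_map_filt_part[OF f] filtered_map_commute[OF f X.Z_span[OF x]]
  by (simp add: X.Z_iff Y.Z_iff)

lemma filtered_map_B: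
  assumes f: "filtered_map S dg fil d S' dg' fil' d' f" and x: "x \<in> X.B r p n"
  shows "f x \<in> Y.B r p n"
proof -
  obtain y z where *: "x = y + d z"
    "y \<in> X.Z (r - 1) (p - 1) n" "z \<in> X.Z (r - 1) (p + r - 1) (n + 1)" using x unfolding X.B_iff by blast
  have linf: "lin f" using f by (simp add: filtered_map_def)
  have "f x = f y + d' (f z)"
    using filtered_map_commute[OF f X.Z_span[OF *(3)]] *(1) by (simp add: lin_add[OF linf])
  then show ?thesis
    unfolding Y.B_iff using filtered_map_Z[OF f *(2)] filtered_map_Z[OF f *(3)] by blast
qed

lemma ss_map_cl:
  assumes f: "filtered_map S dg fil d S' dg' fil' d' f"
  shows "ss_map S' dg' fil' d' f r p q (cl (X.B (int r) p (p + q)) x) = cl (Y.B (int r) p (p + q)) (f x)"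
  unfolding ss_B_eq
  by (rule coset_map_cl) (use f filtered_map_B[OF f] in \<open>auto simp: filtered_map_def\<close>)

theorem ss_map_morphism:
  assumes f: "filtered_map S dg fil d S' dg' fil' d' f"
  shows "ss_morphism n X.E Y.E (ss_map S' dg' fil' d' f)"
  unfolding ss_morphism_def linear_map_def
proof (intro allI impI conjI ballI)
  fix r p q
  let ?f = "ss_map S' dg' fil' d' f"
  note map = ss_map_cl[OF f]
  have linf: "lin f" using f by (simp add: filtered_map_def)
  show "?f r p q \<in> carrier (page X.E r p q) \<rightarrow> carrier (page Y.E r p q)"
    unfolding X.page_carrier Y.page_carrier using filtered_map_Z[OF f] map by auto
  show "?f r p q (x \<oplus>\<^bsub>page X.E r p q\<^esub> y) = ?f r p q x \<oplus>\<^bsub>page Y.E r p q\<^esub> ?f r p q y"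
    if x: "x \<in> carrier (page X.E r p q)" and y: "y \<in> carrier (page X.E r p q)" for x y
  proof -
    obtain u v where *: "u \<in> X.Z (int r) p (p + q)" "x = cl (X.B (int r) p (p + q)) u"
      "v \<in> X.Z (int r) p (p + q)" "y = cl (X.B (int r) p (p + q)) v"
      using x y unfolding X.page_carrier by blast
    then show ?thesis
      by (simp only: X.page_add Y.page_add map filtered_map_Z[OF f] lin_add[OF linf])
  qed
  show "?f r p q (k \<odot>\<^bsub>page X.E r p q\<^esub> x) = k \<odot>\<^bsub>page Y.E r p q\<^esub> ?f r p q x"
    if x: "x \<in> carrier (page X.E r p q)" for k x
  proof -
    obtain u where *: "u \<in> X.Z (int r) p (p + q)" "x = cl (X.B (int r) p (p + q)) u"
      using x unfolding X.page_carrier by blast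
    then show ?thesis
      by (simp only: X.page_smult Y.page_smult map filtered_map_Z[OF f] lin_scale[OF linf])
  qed
  show "?f r (p - int r) (q + int r - 1) (diff X.E r p q x) = diff Y.E r p q (?f r p q x)"
    if x: "x \<in> carrier (page X.E r p q)" for x
  proof -
    obtain u where *: "u \<in> X.Z (int r) p (p + q)" "x = cl (X.B (int r) p (p + q)) u"
      using x unfolding X.page_carrier by blast
    then show ?thesis
      by (simp only: X.diff_cl[OF refl refl] Y.diff_cl[OF refl refl] map
          filtered_map_commute[OF f X.Z_span[OF *(1)]])
  qed
  show "?f (Suc r) p q (hiso X.E r p q x)
      = hiso Y.E r p q (coset_map (page Y.E r p q) (page_boundaries Y.E r p q) (?f r p q) x)"
    if x: "x \<in> carrier (page_homology X.E r p q)" for x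
  proof -
    obtain u where u: "u \<in> X.Z (int r + 1) p (p + q)" "x = X.hcl r p q u"
      using x unfolding X.page_homology_carrier by blast
    have uZ: "u \<in> X.Z (int r) p (p + q)" by (rule X.Z_Suc_subset[OF u(1)])
    have fu: "f u \<in> Y.Z (int r + 1) p (p + q)" "f u \<in> Y.Z (int r) p (p + q)"
      using filtered_map_Z[OF f] u(1) uZ by blast+
    have "coset_map (page Y.E r p q) (page_boundaries Y.E r p q) (?f r p q) x = Y.hcl r p q (f u)"
    proof (rule coset_map_constant)
      show "cl (X.B (int r) p (p + q)) u \<in> x"
        unfolding u(2) X.hcl_def
        by (rule coset_self[OF X.page_module X.page_boundaries_submodule]) (rule X.page_carrierI[OF uZ])
    next
      \<comment> \<open>A general member of the homology class is the class of d w + u. Its image is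
        the class of d' (f w) + f u, which differs from that of f u by a page boundary.\<close>
      fix c assume "c \<in> x"
      then obtain w where w: "w \<in> X.Z (int r) (p + int r) (p + q + 1)"
        "c = cl (X.B (int r) p (p + q)) (d w + u)"
        unfolding u(2) X.hcl_def a_r_coset_def' X.page_boundaries_eq using uZ
        by (auto simp: X.page_add X.d_boundary)
      have fw: "f w \<in> Y.Z (int r) (p + int r) (p + q + 1)" by (rule filtered_map_Z[OF f w(1)])
      have "?f r p q c = cl (Y.B (int r) p (p + q)) (d' (f w) + f u)"
        unfolding w(2) map by (simp add: lin_add[OF linf] filtered_map_commute[OF f X.Z_span[OF w(1)]])
      also have "\<dots> = cl (Y.B (int r) p (p + q)) (d' (f w)) \<oplus>\<^bsub>page Y.E r p q\<^esub> cl (Y.B (int r) p (p + q)) (f u)"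
        using Y.d_boundary[OF fw] fu(2) by (simp add: Y.page_add)
      finally have "?f r p q c \<in> page_boundaries Y.E r p q +>\<^bsub>page Y.E r p q\<^esub> cl (Y.B (int r) p (p + q)) (f u)"
        unfolding a_r_coset_def' Y.page_boundaries_eq using fw by auto
      then show "page_boundaries Y.E r p q +>\<^bsub>page Y.E r p q\<^esub> ?f r p q c = Y.hcl r p q (f u)"
        unfolding Y.hcl_def
        by (intro coset_eqI[OF Y.page_module Y.page_boundaries_submodule] Y.page_carrierI fu)
    qed
    then show ?thesis
      using ss_map_cl[OF f, of "Suc r" p q u] unfolding X.int_Suc' u(2)
      by (simp only: X.hiso_hcl[OF u(1)] Y.hiso_hcl[OF fu(1)])
  qed
qed

text \<open>
  For \<open>x \<in> Z\<^sup>r\<^sub>p\<close> the difference \<open>f x - g x = h (d x) + d (h x)\<close> has \<open>h (d x) \<in> Z\<^sup>r\<^sup>-\<^sup>1\<^sub>p\<^sub>-\<^sub>1\<close> and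
  \<open>h x \<in> Z\<^sup>r\<^sup>-\<^sup>1\<^sub>p\<^sub>+\<^sub>r\<^sub>-\<^sub>1\<close>, provided that \<open>r \<ge> 1\<close>.
\<close>

lemma ss_map_homotopic:
  assumes f: "filtered_map S dg fil d S' dg' fil' d' f" and g: "filtered_map S dg fil d S' dg' fil' d' g"
    and h: "lin h" "\<And>b. b \<in> S \<Longrightarrow> h (basis_vec b) \<in> Y.F (fil b) (dg b + 1)"
      "\<And>b. b \<in> S \<Longrightarrow> d' (h (basis_vec b)) + h (d (basis_vec b)) = f (basis_vec b) - g (basis_vec b)"
    and r: "1 \<le> r" and c: "c \<in> carrier (page X.E r p q)"
  shows "ss_map S' dg' fil' d' f r p q c = ss_map S' dg' fil' d' g r p q c"
proof -
  obtain x where x: "x \<in> X.Z (int r) p (p + q)" "c = cl (X.B (int r) p (p + q)) x"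
    using c unfolding X.page_carrier by blast
  define n where "n = p + q"
  have linf: "lin f" "lin g" using f g by (simp_all add: filtered_map_def)
  have hF: "h y \<in> Y.F p' (m + 1)" if "y \<in> X.F p' m" for y p' m
  proof (rule lin_in_subspace[OF h(1), of _ _ "{b \<in> S. dg b = m \<and> fil b \<le> p'}"])
    show "y \<in> span_on {b \<in> S. dg b = m \<and> fil b \<le> p'}" using that by (simp add: filt_part_def)
  qed (use h(2) in \<open>auto intro: filt_part_mono\<close>)
  have dh: "d' (h y) + h (d y) = f y - g y" if "y \<in> span_on S" for y
  proof (rule lin_eqI[where f = "\<lambda>y. d' (h y) + h (d y)" and g = "\<lambda>y. f y - g y"])
    show "lin (\<lambda>y. d' (h y) + h (d y))" "lin (\<lambda>y. f y - g y)"
      by (rule linI; simp add: lin_add[OF linf(1)] lin_add[OF linf(2)] lin_add[OF h(1)]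
          lin_add[OF X.lin_d] lin_add[OF Y.lin_d] lin_scale[OF linf(1)] lin_scale[OF linf(2)]
          lin_scale[OF h(1)] lin_scale[OF X.lin_d] lin_scale[OF Y.lin_d]
          free.scale_right_distrib free.scale_right_diff_distrib)+
  qed (use h(3) that in \<open>auto simp: span_on_iff\<close>)
  have xF: "x \<in> X.F p n" "d x \<in> X.F (p - int r) (n - 1)"
    using x(1) by (simp_all add: X.Z_iff n_def)
  have dx: "d x \<in> span_on S" by (rule filt_part_span[OF xF(2)])
  have hx: "h x \<in> Y.F p (n + 1)" and hdx: "h (d x) \<in> Y.F (p - int r) n"
    using hF[OF xF(1)] hF[OF xF(2)] by simp_all
  have d1: "d' (h x) \<in> Y.F p n" using Y.d_filt_part[OF hx] by simp
  have "d' (h (d x)) = f (d x) - g (d x)"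
    using dh[OF dx] X.d_d[OF X.Z_span[OF x(1)]] by (simp add: lin_zero[OF h(1)])
  also have "\<dots> \<in> Y.F (p - int r) (n - 1)"
    by (intro free.subspace_diff subspace_filt_part filtered_map_filt_part[OF f] filtered_map_filt_part[OF g] xF)
  finally have "h (d x) \<in> Y.Z (int r - 1) (p - 1) n"
    using hdx r by (auto simp: Y.Z_iff intro: filt_part_mono[of "p - int r"])
  moreover have "h x \<in> Y.Z (int r - 1) (p + int r - 1) (n + 1)"
    using hx d1 r by (auto simp: Y.Z_iff intro: filt_part_mono[of p])
  ultimately have "h (d x) + d' (h x) \<in> Y.B (int r) p n"
    unfolding Y.B_iff by blast
  then have "f x - g x \<in> Y.B (int r) p (p + q)"
    using dh[OF X.Z_span[OF x(1)]] by (simp add: n_def add.commute)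
  then show ?thesis
    unfolding x(2) ss_map_cl[OF f] ss_map_cl[OF g] by (simp add: cl_eq_iff)
qed

end

lemma filtered_map_comp:
  assumes C: "filtered_complex S dg fil d" "filtered_complex S' dg' fil' d'" "filtered_complex S'' dg'' fil'' d''"
    and f: "filtered_map S dg fil d S' dg' fil' d' f" and g: "filtered_map S' dg' fil' d' S'' dg'' fil'' d'' g"
  shows "filtered_map S dg fil d S'' dg'' fil'' d'' (\<lambda>x. g (f x))"
  unfolding filtered_map_def
proof (intro conjI ballI)
  show "lin (\<lambda>x. g (f x))" using f g by (auto simp: filtered_map_def intro: lin_compose)
  fix b assume b: "b \<in> S"
  then have fb: "f (basis_vec b) \<in> filt_part S' dg' fil' (fil b) (dg b)"
    using f by (simp add: filtered_map_def)
  show "g (f (basis_vec b)) \<in> filt_part S'' dg'' fil'' (fil b) (dg b)"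
    by (rule filtered_map_filt_part[OF C(2,3) g fb])
  show "d'' (g (f (basis_vec b))) = g (f (d (basis_vec b)))"
    using filtered_map_commute[OF C(2,3) g filt_part_span[OF fb]] f b by (simp add: filtered_map_def)
qed

lemma ss_map_comp:
  assumes C: "filtered_complex S dg fil d" "filtered_complex S' dg' fil' d'" "filtered_complex S'' dg'' fil'' d''"
    and f: "filtered_map S dg fil d S' dg' fil' d' f" and g: "filtered_map S' dg' fil' d' S'' dg'' fil'' d'' g"
    and c: "c \<in> carrier (page (filtered_spec_seq S dg fil d) r p q)"
  shows "ss_map S'' dg'' fil'' d'' g r p q (ss_map S' dg' fil' d' f r p q c)
    = ss_map S'' dg'' fil'' d'' (\<lambda>x. g (f x)) r p q c"
  using c unfolding filtered_complex.page_carrier[OF C(1)]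
  by (auto simp only: ss_map_cl[OF C(1,2) f] ss_map_cl[OF C(2,3) g] ss_map_cl[OF C(1,3) filtered_map_comp[OF C f g]])

lemma ss_map_id:
  assumes C: "filtered_complex S dg fil d"
    and f: "\<And>b. b \<in> S \<Longrightarrow> f (basis_vec b) = basis_vec b" and lf: "lin f"
    and c: "c \<in> carrier (page (filtered_spec_seq S dg fil d) r p q)"
  shows "ss_map S dg fil d f r p q c = c"
proof -
  have fx: "f x = x" if "x \<in> span_on S" for x
    using lin_eqI[OF lf lin_id, of x] that f by (auto simp: span_on_iff)
  have "filtered_map S dg fil d S dg fil d f"
    unfolding filtered_map_def
  proof (intro conjI ballI lf)
    fix b assume b: "b \<in> S"
    show "f (basis_vec b) \<in> filt_part S dg fil (fil b) (dg b)"
      using b f by (simp add: filt_part_def)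
    show "d (f (basis_vec b)) = f (d (basis_vec b))"
      using b f fx filt_part_span[OF filtered_complex.d_basis[OF C b]] by simp
  qed
  then show ?thesis
    using c fx filtered_complex.Z_span[OF C] unfolding filtered_complex.page_carrier[OF C]
    by (auto simp only: ss_map_cl[OF C C])
qed

section \<open>Acyclic subcomplexes\<close>

lemma skeleton_negative: "p < 0 \<Longrightarrow> skeleton X p = {}"
  by (auto simp: skeleton_def)

abbreviation point_simplex :: "'a \<Rightarrow> (nat \<Rightarrow> real) \<Rightarrow> 'a" where
  "point_simplex x \<equiv> restrict (\<lambda>_. x) (standard_simplex 0)"

lemma singular_simplex_point: "x \<in> topspace W \<Longrightarrow> singular_simplex 0 W (point_simplex x)"
  by (auto simp: singular_simplex_def)

lemma relcycle_point: "x \<in> topspace W \<Longrightarrow> singular_relcycle 0 W {} (frag_of (point_simplex x))"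
  by (simp add: chain_boundary_def singular_simplex_point singular_chain_of singular_cycle)

lemma hom_induced_point:
  assumes "continuous_map W Z f" "x \<in> topspace W"
  shows "hom_induced 0 W {} Z {} f (homologous_rel_set 0 W {} (frag_of (point_simplex x)))
    = homologous_rel_set 0 Z {} (frag_of (point_simplex (f x)))"
proof -
  have "simplex_map 0 f (point_simplex x) = point_simplex (f x)"
    unfolding simplex_map_def by (rule ext) (simp add: restrict_def)
  then show ?thesis
    using hom_induced_chain_map[of W Z f "{}" "{}" 0, OF assms(1) _ relcycle_point[OF assms(2)]] by simp
qed

text \<open>The normalisation of orientations in dimension 0 enters here: the basis element is the
  class of the point itself, with a definite sign.\<close>

lemma (in regular_complex) zero_cell_class:
  assumes e: "{x} \<in> cells X" "cell_dim X {x} = 0"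
  shows "cell_class X {x} = homologous_rel_set 0 (skeleton_top X 0) {} (frag_of (point_simplex x))"
proof -
  have cl: "cell_closure X {x} = {x}" "x \<in> topspace T" using zero_cell[OF e] by auto
  have or: "orientation X {x} = homologous_rel_set 0 (subtopology T {x}) {} (frag_of (point_simplex x))"
    using orientation_spec(2)[OF e] cl(1) by simp
  have "{x} \<subseteq> skeleton X 0" using cell_in_skeleton[OF e(1), of 0] e(2) by simp
  then have "continuous_map (subtopology T {x}) (skeleton_top X 0) id" by (rule continuous_inclusion)
  from hom_induced_point[OF this, of x] show ?thesis
    using cl(2) by (simp add: cell_class_def e(2) cl(1) or skeleton_negative)
qed

text \<open>Points are compared through constant simplices, which every map carries to constant
  simplices; hence the coefficient is exactly 1 and augmentations are preserved.\<close>

lemma cell_push_zero_cell: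
  assumes X: "regular_cw X" "regular_cw Y" and f: "skeletal X Y f" and e: "e \<in> cells X" "cell_dim X e = 0"
  shows "\<exists>t\<in>cells_of_dim Y 0. cell_push X Y f e = basis_vec t"
proof -
  interpret X: regular_complex X by unfold_locales (rule X)
  interpret Y: regular_complex Y by unfold_locales (rule X)
  obtain x where x: "x \<in> topspace (space X)" "e = {x}" using X.zero_cell[OF e] by blast
  have xs: "x \<in> skeleton X 0" using X.cell_in_skeleton[OF e(1), of 0] e(2) x by simp
  then have "f x \<in> skeleton Y 0" using skeletal_Pi[OF f] by blast
  then obtain t where t: "t \<in> cells Y" "cell_dim Y t = 0" "f x \<in> t" unfolding skeleton_def by auto
  then have tx: "t = {f x}" using Y.zero_cell[OF t(1,2)] by auto
  have t0: "t \<in> cells_of_dim Y 0" using t by (simp add: cells_of_dim_def)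
  have "push X Y f 0 (cell_class X e) = cell_class Y t"
    using X.zero_cell_class[of x] Y.zero_cell_class[of "f x"] e t(1,2) x tx xs
      hom_induced_point[OF skeletal_continuous[OF f, of 0], of x]
    by (simp add: push_def skeleton_negative)
  then have "map_degree X Y f e s = (if s = t then 1 else 0)" for s
    using Y.coord_class[of t 0 s] t0 e by (simp add: map_degree_eq[of X e 0] Y.E_def)
  then have "cell_push X Y f e = int_chain (cells_of_dim Y 0) (\<lambda>s. if s = t then 1 else 0)"
    unfolding cell_push_eq e(2) of_nat_0 by presburger
  then have "cell_push X Y f e = basis_vec t" using t0 by (simp add: int_chain_delta)
  then show ?thesis using t0 by blast
qed

text \<open>Collapse to a point. The induced map from H_0 of the 0-skeleton to the integers takes
  every vertex to 1, so it computes the sum of coordinates. It factors through H_0 of the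
  1-skeleton, where the boundary of an edge vanishes by exactness.\<close>

lemma coeff_sum_cell_boundary:
  assumes X: "regular_cw X" and e: "e \<in> cells X" "cell_dim X e = 1"
  shows "coeff_sum (cell_boundary X e :: 'a set \<Rightarrow>\<^sub>0 'k::field) = 0"
proof -
  interpret X: regular_complex X by unfold_locales (rule X)
  define P where "P = discrete_topology {()}"
  define Q where "Q = homology_group 0 P"
  define \<gamma> where "\<gamma> = homologous_rel_set 0 P {} (frag_of (point_simplex ()))"
  have top: "() \<in> topspace P" by (simp add: P_def)
  have "path_connected_space P"
    using path_connectedin_singleton[of P "()"] top unfolding path_connectedin_def P_def
    by (simp add: subtopology_topspace)
  then have iso: "pow Q \<gamma> \<in> iso integer_group Q"
    unfolding Q_def \<gamma>_def by (rule iso_integer_zeroth_homology_group) (rule singular_simplex_point[OF top])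
  define \<psi> where "\<psi> = inv_into (carrier integer_group) (pow Q \<gamma> :: int \<Rightarrow> _)"
  have \<psi>: "\<psi> \<in> iso Q integer_group"
    unfolding \<psi>_def by (rule group.iso_set_sym[OF group_integer_group iso])
  have \<psi>hom: "\<psi> \<in> hom Q integer_group" using \<psi> by (simp add: iso_def)
  interpret Q: group Q by (simp add: Q_def)
  have \<gamma>c: "\<gamma> \<in> carrier Q"
    unfolding Q_def \<gamma>_def using relcycle_point[OF top] by (simp add: carrier_relative_homology_group_0)
  have \<psi>\<gamma>: "\<psi> \<gamma> = 1"
  proof -
    have "inj_on (pow Q \<gamma>) (UNIV :: int set)" using iso by (simp add: iso_def bij_betw_def)
    then have "\<psi> (\<gamma> [^]\<^bsub>Q\<^esub> (1::int)) = 1" unfolding \<psi>_def by (simp add: inv_into_f_f)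
    then show ?thesis using Q.int_pow_1[OF \<gamma>c] by simp
  qed
  define c where "c = hom_induced 0 (skeleton_top X 0) {} P {} (\<lambda>_. ())"
  have cg: "cell_group X 0 = homology_group 0 (skeleton_top X 0)"
    by (simp add: cell_group_def skeleton_negative)
  have "(\<lambda>z. \<psi> (c z)) \<in> hom (cell_group X 0) integer_group"
    using hom_compose[OF hom_induced_hom \<psi>hom[unfolded Q_def]] unfolding cg c_def by (simp add: o_def)
  then have \<kappa>: "(\<lambda>z. \<psi> (c z)) \<in> hom (cell_group X 0) integer_group" .
  have cls: "\<psi> (c (cell_class X t)) = 1" if t: "t \<in> cells_of_dim X 0" for t
  proof -
    have tc: "t \<in> cells X" "cell_dim X t = 0" using t by (simp_all add: cells_of_dim_def)
    then obtain x where x: "t = {x}" using X.zero_cell by blast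
    have xs: "x \<in> topspace (skeleton_top X 0)"
      using X.cell_in_skeleton[OF tc(1), of 0] X.cell_subset[OF tc(1)] tc(2) x by simp
    have "continuous_map (skeleton_top X 0) P (\<lambda>_. ())" by (simp add: P_def)
    from hom_induced_point[OF this xs] show ?thesis
      using X.zero_cell_class[of x] tc x \<psi>\<gamma> by (simp add: c_def \<gamma>_def)
  qed
  let ?W = "skeleton_top X 1"
  define b where "b = hom_boundary 1 ?W (skeleton X 0) (cell_class X e)"
  have sub: "subtopology ?W (skeleton X 0) = skeleton_top X 0" by (rule X.skeleton_top_skeleton) simp
  have b: "bdry X 1 (cell_class X e) = b"
    unfolding bdry_def b_def by (simp add: skeleton_negative hom_relboundary_empty)
  have bc: "b \<in> carrier (cell_group X 0)"
    unfolding cg b_def using hom_boundary_carrier[of 1 ?W "skeleton X 0"] sub by simp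
  have ec: "cell_class X e \<in> carrier (relative_homology_group 1 ?W (skeleton X 0))"
    using X.cell_class_carrier'[OF e(1), of 1] e(2) by (simp add: cell_group_def)
  have "b \<in> hom_boundary 1 ?W (skeleton X 0) ` carrier (relative_homology_group 1 ?W (skeleton X 0))"
    unfolding b_def using ec by (rule imageI)
  also have "\<dots> = kernel (homology_group 0 (skeleton_top X 0)) (homology_group 0 ?W)
      (hom_induced 0 (skeleton_top X 0) {} ?W {} id)"
    using homology_exactness_axiom_2[of 1 ?W "skeleton X 0"] unfolding sub by simp
  finally have ker: "hom_induced 0 (skeleton_top X 0) {} ?W {} id b = \<one>\<^bsub>homology_group 0 ?W\<^esub>"
    by (simp add: kernel_def)
  have "c b = hom_induced 0 ?W {} P {} (\<lambda>_. ()) (hom_induced 0 (skeleton_top X 0) {} ?W {} id b)"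
    unfolding c_def
    by (subst hom_induced_compose'[OF X.continuous_inclusion[OF X.skeleton_mono]]) (auto simp: P_def o_def)
  also have "\<dots> = \<one>\<^bsub>Q\<^esub>"
    unfolding ker Q_def using hom_one[OF hom_induced_hom] by simp
  finally have "\<psi> (c b) = 0"
    using hom_one[OF \<psi>hom Q.group_axioms group_integer_group] by simp
  moreover have "\<psi> (c b) = (\<Sum>t\<in>cells_of_dim X 0. cell_coord X 0 b t)"
    unfolding coord_hom_expansion[OF X \<kappa> bc] by (rule sum.cong) (simp_all add: cls)
  moreover have "cell_coord X 0 b t = incidence X e t" for t
    using e(2) by (simp add: incidence_eq[of X e 1] b)
  ultimately have "(\<Sum>t\<in>cells_of_dim X 0. incidence X e t) = 0" by simp
  then show ?thesis unfolding cell_boundary_eq e(2) by (simp add: coeff_sum_int_chain)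
qed

text \<open>In a cell of least dimension the frontier is empty, since it would be covered by cells
  of the subcomplex of smaller dimension. Then the closed ball equals the open ball, which is
  impossible in positive dimension.\<close>

lemma (in regular_complex) subcomplex_has_vertex:
  assumes S: "subcomplex X S" "S \<noteq> {}"
  shows "\<exists>v\<in>S. cell_dim X v = 0"
proof -
  obtain e0 where "e0 \<in> S" using S(2) by blast
  then obtain e where e: "e \<in> S" "\<And>e'. e' \<in> S \<Longrightarrow> cell_dim X e \<le> cell_dim X e'"
    using ex_has_least_nat[of "\<lambda>e. e \<in> S" e0 "cell_dim X"] by blast
  have ec: "e \<in> cells X" "cell_closure X e \<subseteq> \<Union>S" using S(1) e(1) unfolding subcomplex_def by blast+
  have "cell_closure X e - e = {}"
  proof (rule ccontr)
    assume "cell_closure X e - e \<noteq> {}"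
    then obtain x where x: "x \<in> cell_closure X e" "x \<in> skeleton X (int (cell_dim X e) - 1)"
      using cell_frontier[OF ec(1)] by blast
    obtain s where s: "s \<in> S" "x \<in> s" using x(1) ec(2) by blast
    obtain s' where s': "s' \<in> cells X" "int (cell_dim X s') \<le> int (cell_dim X e) - 1" "x \<in> s'"
      using x(2) unfolding skeleton_def by blast
    have "s \<in> cells X" using S(1) s(1) unfolding subcomplex_def by blast
    then have "s = s'" using disjoint[of s s'] s(2) s'(1,3) by blast
    then show False using e(2)[OF s(1)] s'(2) by simp
  qed
  then have cl: "cell_closure X e = e" using cell_subset_closure[OF ec(1)] by blast
  obtain h where h: "homeomorphic_map (closed_ball (cell_dim X e)) (subtopology T (cell_closure X e)) h"
    "h ` open_ball (cell_dim X e) = e" using cell_map[OF ec(1)] by blast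
  have "h ` unit_ball (cell_dim X e) = e"
    using homeomorphic_imp_surjective_map[OF h(1)] closure_subset[of e] cl by (simp add: inf.absorb2)
  moreover have inj: "inj_on h (unit_ball (cell_dim X e))"
    using homeomorphic_imp_injective_map[OF h(1)] by simp
  ultimately have eq: "unit_ball (cell_dim X e) = open_ball (cell_dim X e)"
    using inj_on_image_eq_iff[OF inj order_refl open_ball_subset] h(2) by simp
  have "cell_dim X e = 0"
  proof (rule ccontr)
    assume n: "cell_dim X e \<noteq> 0"
    \<comment> \<open>A point of the unit sphere, which exists as soon as the dimension is
      positive.\<close>
    define u :: "nat \<Rightarrow> real" where "u = (\<lambda>i. if i = 0 then 1 else 0)"
    have "(\<Sum>i<cell_dim X e. (u i)\<^sup>2) = (\<Sum>i<cell_dim X e. if i = 0 then 1 else 0)"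
      by (rule sum.cong) (auto simp: u_def)
    also have "\<dots> = 1" using n by simp
    finally have "nrm (cell_dim X e) u = 1" by (simp add: nrm_def)
    then have "u \<in> unit_ball (cell_dim X e)" "u \<notin> open_ball (cell_dim X e)"
      using n by (auto simp: unit_ball_def open_ball_eq u_def)
    then show False using eq by simp
  qed
  then show ?thesis using e(1) by blast
qed

text \<open>In positive degrees both notions say that cycles bound. In degree 0 the hypothesis is an
  unspecified isomorphism of H_0 with the field: it makes H_0 one-dimensional, and the class of a
  vertex is nonzero since its augmentation is 1 while boundaries have augmentation 0. Hence every
  cycle is homologous to a multiple of that vertex.\<close>

lemma acyclic_subcomplex_aug_acyclic:
  fixes X :: "'a cw"
  assumes X: "normal_cw X" and S: "acyclic_subcomplex TYPE('k::field) X S"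
  shows "aug_acyclic (\<lambda>c. int (cell_dim X c)) (cellular_boundary X :: ('a set \<Rightarrow>\<^sub>0 'k) \<Rightarrow> _) S"
proof -
  interpret X: regular_complex X by unfold_locales (use X normal_cw_def in blast)
  let ?d = "cellular_boundary X :: ('a set \<Rightarrow>\<^sub>0 'k) \<Rightarrow> ('a set \<Rightarrow>\<^sub>0 'k)"
  have lind: "lin ?d" by (simp add: cellular_boundary_def)
  have sub: "subcomplex X S" "S \<noteq> {}" using S by (simp_all add: acyclic_subcomplex_def)
  have dim: "S \<inter> cells_of_dim X n = {c \<in> S. int (cell_dim X c) = n}" for n
    using sub(1) by (auto simp: subcomplex_def cells_of_dim_def)
  define B where "B n = ?d ` span_on {c \<in> S. int (cell_dim X c) = n + 1}" for n
  define Z where "Z n = {x \<in> span_on {c \<in> S. int (cell_dim X c) = n}. ?d x = 0}" for n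
  have H: "subcomplex_homology X S n = subquotient (free_module {c \<in> S. int (cell_dim X c) = n}) (Z n) (B n)" for n
    by (simp add: subcomplex_homology_def B_def Z_def dim)
  have B: "free.subspace (B n)" for n
    unfolding B_def by (rule module_hom.subspace_image[OF lind]) simp
  have self: "x \<in> cl (B n) x" for x n by (simp add: in_cl_iff free.subspace_0[OF B])
  have car: "carrier (subcomplex_homology X S n :: ('k, ('a set \<Rightarrow>\<^sub>0 'k) set) module) = cl (B n) ` Z n" for n
    unfolding H by (simp add: subquotient_def coset_free_module)
  obtain v where v: "v \<in> S" "cell_dim X v = 0" using X.subcomplex_has_vertex[OF sub] by blast
  have solve: "x \<in> B n" if x: "x \<in> Z n" and n: "0 \<le> n" and aug: "n = 0 \<Longrightarrow> coeff_sum x = 0" for x n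
  proof (cases "n = 0")
    case False
    then have "cl (B n) ` Z n = {zero (subcomplex_homology X S n :: ('k, ('a set \<Rightarrow>\<^sub>0 'k) set) module)}"
      using S n unfolding acyclic_subcomplex_def car[symmetric] by simp
    also have "zero (subcomplex_homology X S n :: ('k, ('a set \<Rightarrow>\<^sub>0 'k) set) module) = B n"
      unfolding H by (simp add: subquotient_def)
    finally have "cl (B n) x = B n" using x by blast
    then show ?thesis using self[of x n] by simp
  next
    case True
    obtain h where h: "linear_iso (subcomplex_homology X S 0 :: ('k, ('a set \<Rightarrow>\<^sub>0 'k) set) module)
        (field_module :: ('k, 'k) module) h"
      using S unfolding acyclic_subcomplex_def by blast
    have smult: "k \<odot>\<^bsub>subcomplex_homology X S 0\<^esub> (cl (B 0) x) = cl (B 0) (lin_scale k x)" for k x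
    proof -
      have "cl (B 0) (lin_scale k z) = cl (B 0) (lin_scale k x)" if z: "z \<in> cl (B 0) x" for z
        using free.subspace_scale[OF B, of "z - x" 0 k] z
        by (simp add: in_cl_iff cl_eq_iff[OF B] free.scale_right_diff_distrib)
      then have "(\<Union>z\<in>cl (B 0) x. cl (B 0) (lin_scale k z)) = cl (B 0) (lin_scale k x)"
        using self[of x 0] by blast
      then show ?thesis unfolding H by (simp add: subquotient_def coset_free_module)
    qed
    have hs: "h (cl (B 0) (lin_scale k x)) = k * h (cl (B 0) x)" if x: "x \<in> Z 0" for k x
      using h x unfolding linear_iso_def linear_map_def car smult[symmetric]
      by (simp add: field_module_def)
    have inj: "inj_on h (cl (B 0) ` Z 0)" using h unfolding linear_iso_def car bij_betw_def by blast
    have Z0: "lin_scale k x \<in> Z 0" if x: "x \<in> Z 0" for k x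
      using x by (simp add: Z_def free.subspace_scale module_hom.scale[OF lind])
    have cycle: "?d (basis_vec v) = 0"
    proof -
      have "cells_of_dim X (- 1) = {}" by (auto simp: cells_of_dim_def)
      then show ?thesis using v(2) by (simp add: cellular_boundary_def cell_boundary_def)
    qed
    have vZ: "basis_vec v \<in> Z 0" using v cycle by (simp add: Z_def)
    have B0: "coeff_sum y = 0" if y: "y \<in> B 0" for y
    proof -
      obtain w where w: "w \<in> span_on {c \<in> S. int (cell_dim X c) = 1}" "y = ?d w" using y by (auto simp: B_def)
      have "coeff_sum (?d w) = coeff_sum w * 0"
      proof (rule coeff_sum_lin[OF lind])
        fix c assume "c \<in> Poly_Mapping.keys w"
        then have "c \<in> cells X" "cell_dim X c = 1" using w(1) sub(1) by (auto simp: span_on_iff subcomplex_def)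
        then show "coeff_sum (?d (basis_vec c)) = 0"
          using coeff_sum_cell_boundary[OF X.regular] by (simp add: cellular_boundary_def)
      qed
      then show ?thesis using w(2) by simp
    qed
    have hv: "h (cl (B 0) (basis_vec v)) \<noteq> 0"
    proof
      assume "h (cl (B 0) (basis_vec v)) = 0"
      then have "h (cl (B 0) (lin_scale 0 (basis_vec v))) = h (cl (B 0) (basis_vec v))"
        unfolding hs[OF vZ] by simp
      then have "cl (B 0) (lin_scale 0 (basis_vec v)) = cl (B 0) (basis_vec v)"
        by (rule inj_onD[OF inj]) (use Z0[OF vZ] vZ in blast)+
      then have "lin_scale 0 (basis_vec v) - basis_vec v \<in> B 0" by (simp only: cl_eq_iff[OF B])
      from B0[OF this] show False
        using coeff_sum_diff[of 0 "basis_vec v :: 'a set \<Rightarrow>\<^sub>0 'k"] by simp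
    qed
    \<comment> \<open>With this scalar, k times the vertex is homologous to \<open>x\<close>;
      comparing augmentations then forces k = 0.\<close>
    define k where "k = h (cl (B 0) x) / h (cl (B 0) (basis_vec v))"
    have xZ: "x \<in> Z 0" using x True by simp
    have "h (cl (B 0) (lin_scale k (basis_vec v))) = h (cl (B 0) x)"
      unfolding hs[OF vZ] using hv by (simp add: k_def)
    then have "cl (B 0) (lin_scale k (basis_vec v)) = cl (B 0) x"
      by (rule inj_onD[OF inj]) (use Z0[OF vZ] xZ in blast)+
    then have B': "lin_scale k (basis_vec v) - x \<in> B 0" by (simp only: cl_eq_iff[OF B])
    have "k = 0" using B0[OF B'] aug[OF True] by (simp add: coeff_sum_diff coeff_sum_scale)
    then have "- x \<in> B 0" using B' by simp
    then show ?thesis using free.subspace_neg[OF B] True by fastforce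
  qed
  show ?thesis
    unfolding aug_acyclic_def
  proof (intro conjI allI impI ballI)
    show "\<exists>v\<in>S. int (cell_dim X v) = 0" using v by auto
    fix n x assume "0 \<le> n" "x \<in> span_on {b \<in> S. int (cell_dim X b) = n}" "?d x = 0" "n = 0 \<longrightarrow> coeff_sum x = 0"
    then have "x \<in> B n" by (intro solve) (auto simp: Z_def)
    then show "\<exists>y\<in>span_on {b \<in> S. int (cell_dim X b) = n + 1}. ?d y = x" unfolding B_def by blast
  qed
qed

section \<open>The total complex of a diagram\<close>

lemma lin_cellular_boundary [simp]: "lin (cellular_boundary X)"
  and lin_cellular_map [simp]: "lin (cellular_map X Y f)"
  by (simp_all add: cellular_boundary_def cellular_map_def)

lemma cellular_boundary_basis [simp]: "cellular_boundary X (basis_vec c) = cell_boundary X c"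
  and cellular_map_basis [simp]: "cellular_map X Y f (basis_vec c) = cell_push X Y f c"
  by (simp_all add: cellular_boundary_def cellular_map_def)

lemma face_sign_swap:
  assumes "finite \<sigma>" "v \<in> \<sigma>" "w \<in> \<sigma>" "v < w"
  shows "face_sign \<sigma> w * face_sign (\<sigma> - {w}) v = - (face_sign \<sigma> v * face_sign (\<sigma> - {v}) w :: 'k::field)"
proof -
  have "{x \<in> \<sigma> - {w}. x < v} = {x \<in> \<sigma>. x < v}" using assms(4) by auto
  then have 1: "face_sign (\<sigma> - {w}) v = (face_sign \<sigma> v :: 'k)" by (simp add: face_sign_def)
  have "{x \<in> \<sigma>. x < w} = insert v {x \<in> \<sigma> - {v}. x < w}" using assms by auto
  then have 2: "face_sign \<sigma> w = - (face_sign (\<sigma> - {v}) w :: 'k)" using assms(1) by (simp add: face_sign_def)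
  show ?thesis unfolding 1 2 by simp
qed

text \<open>Removing v and then w gives the same face as removing w and then v, with the opposite
  sign. The condition that faces be nonempty depends only on the face that remains, so it respects
  this pairing.\<close>

lemma double_face_sum:
  fixes g :: "'v::linorder set \<Rightarrow> ('c \<Rightarrow>\<^sub>0 'k::field)"
  assumes fin: "finite \<sigma>"
  shows "(\<Sum>v | v \<in> \<sigma> \<and> \<sigma> - {v} \<noteq> {}. lin_scale (face_sign \<sigma> v)
    (\<Sum>w | w \<in> \<sigma> - {v} \<and> \<sigma> - {v} - {w} \<noteq> {}. lin_scale (face_sign (\<sigma> - {v}) w) (g (\<sigma> - {v} - {w})))) = 0"
proof -
  let ?V = "{v. v \<in> \<sigma> \<and> \<sigma> - {v} \<noteq> {}}" and ?W = "\<lambda>v. {w. w \<in> \<sigma> - {v} \<and> \<sigma> - {v} - {w} \<noteq> {}}"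
  define h where "h p = lin_scale (face_sign \<sigma> (fst p) * face_sign (\<sigma> - {fst p}) (snd p)) (g (\<sigma> - {fst p} - {snd p}))" for p
  \<comment> \<open>Nonemptiness of the twice reduced simplex, kept opaque so that its symmetry can
    be used and the double sum becomes a sum over pairs.\<close>
  define e where "e v w \<longleftrightarrow> \<sigma> - {v} - {w} \<noteq> {}" for v w
  have e_sym: "e v w = e w v" for v w
    unfolding e_def by (metis Diff_insert Diff_insert2)
  have e_left: "\<sigma> - {v} \<noteq> {}" if "e v w" for v w
    using that unfolding e_def by (metis empty_Diff)
  define P where "P = {p. fst p \<in> \<sigma> \<and> snd p \<in> \<sigma> \<and> fst p < snd p \<and> e (fst p) (snd p)}"
  define Q where "Q = {p. fst p \<in> \<sigma> \<and> snd p \<in> \<sigma> \<and> snd p < fst p \<and> e (fst p) (snd p)}"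
  have "P \<subseteq> \<sigma> \<times> \<sigma>" "Q \<subseteq> \<sigma> \<times> \<sigma>"
    by (simp_all add: P_def Q_def subset_iff)
  then have fP: "finite P" "finite Q"
    using finite_subset[OF _ finite_cartesian_product[OF fin fin]] by blast+
  have fV: "finite ?V" and fW: "finite (?W v)" for v
    using fin by simp_all
  have "(\<Sum>v\<in>?V. lin_scale (face_sign \<sigma> v) (\<Sum>w\<in>?W v. lin_scale (face_sign (\<sigma> - {v}) w) (g (\<sigma> - {v} - {w}))))
      = (\<Sum>v\<in>?V. \<Sum>w\<in>?W v. h (v, w))"
    by (simp add: h_def free.scale_sum_right)
  also have "\<dots> = (\<Sum>p\<in>Sigma ?V ?W. h p)"
    by (subst sum.Sigma) (simp_all only: fV fW case_prod_eta simp_thms ball_simps)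
  also have "Sigma ?V ?W = P \<union> Q"
  proof (rule Set.set_eqI)
    fix p :: "'v \<times> 'v"
    show "p \<in> Sigma ?V ?W \<longleftrightarrow> p \<in> P \<union> Q"
      unfolding P_def Q_def e_def[symmetric] mem_Sigma_iff[of "fst p" "snd p", simplified] mem_Collect_eq Un_iff
      using e_left[of "fst p" "snd p"] by (metis Diff_iff less_irrefl linorder_neqE singletonD singletonI)
  qed
  also have "sum h (P \<union> Q) = sum h P + sum h Q"
  proof (rule sum.union_disjoint[OF fP])
    show "P \<inter> Q = {}" unfolding P_def Q_def by (auto dest: less_asym)
  qed
  also have "sum h Q = sum (\<lambda>p. h (prod.swap p)) P"
  proof -
    have "p \<in> Q \<longleftrightarrow> prod.swap p \<in> P" for p
      unfolding P_def Q_def using e_sym[of "fst p" "snd p"] by auto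
    then have "Q = prod.swap ` P" by (metis Set.set_eqI image_iff swap_swap)
    then show ?thesis by (simp add: sum.reindex)
  qed
  also have "sum (\<lambda>p. h (prod.swap p)) P = sum (\<lambda>p. - h p) P"
  proof (rule sum.cong)
    fix p assume p: "p \<in> P"
    have "\<sigma> - {snd p} - {fst p} = \<sigma> - {fst p} - {snd p}" by blast
    then show "h (prod.swap p) = - h p"
      using face_sign_swap[OF fin, of "fst p" "snd p", where 'k = 'k] p
      by (simp add: h_def P_def)
  qed simp
  finally show ?thesis by (simp add: sum_negf)
qed

section \<open>Chain maps of a diagram and the differential of its total complex\<close>

locale diagram_over =
  fixes K :: "'v::linorder set set" and D :: "('v, 'a) diagram"
  assumes K: "simplicial_complex K" and D: "regular_diagram K D"
begin

lemma simplex: "\<sigma> \<in> K \<Longrightarrow> finite \<sigma>" "\<sigma> \<in> K \<Longrightarrow> \<sigma> \<noteq> {}"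
  using K unfolding simplicial_complex_def by simp_all

lemma face: "\<sigma> \<in> K \<Longrightarrow> \<tau> \<subseteq> \<sigma> \<Longrightarrow> \<tau> \<noteq> {} \<Longrightarrow> \<tau> \<in> K"
  by (rule bspec[OF K[unfolded simplicial_complex_def], THEN conjunct2, THEN conjunct2, rule_format])

lemma filtered: "\<sigma> \<in> K \<Longrightarrow> regularly_filtered_cw (dobj D \<sigma>)"
  using D unfolding regular_diagram_def by auto

lemma regular: "\<sigma> \<in> K \<Longrightarrow> regular_cw (dlevel D \<sigma> r)"
  and step_morphism: "\<sigma> \<in> K \<Longrightarrow> a \<le> b \<Longrightarrow> regular_morphism (dlevel D \<sigma> a) (dlevel D \<sigma> b) (step (dobj D \<sigma>) a b)"
  and step_id: "\<sigma> \<in> K \<Longrightarrow> x \<in> topspace (space (dlevel D \<sigma> r)) \<Longrightarrow> step (dobj D \<sigma>) r r x = x"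
  and step_step: "\<sigma> \<in> K \<Longrightarrow> a \<le> b \<Longrightarrow> b \<le> c \<Longrightarrow> x \<in> topspace (space (dlevel D \<sigma> a)) \<Longrightarrow>
    step (dobj D \<sigma>) b c (step (dobj D \<sigma>) a b x) = step (dobj D \<sigma>) a c x"
  using filtered[of \<sigma>] unfolding regularly_filtered_cw_def by auto

lemma normal: "\<sigma> \<in> K \<Longrightarrow> normal_cw (dlevel D \<sigma> r)"
  by (rule regular_morphism_id_normal[OF regular step_morphism[OF _ order_refl] step_id])

lemma dmap_filt: "\<sigma> \<in> K \<Longrightarrow> \<tau> \<subseteq> \<sigma> \<Longrightarrow> \<tau> \<noteq> {} \<Longrightarrow> filt_morphism (dobj D \<sigma>) (dobj D \<tau>) (dmap D \<tau> \<sigma>)"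
  using D face[of \<sigma> \<tau>] unfolding regular_diagram_def by auto

lemma dmap_morphism: "\<sigma> \<in> K \<Longrightarrow> \<tau> \<subseteq> \<sigma> \<Longrightarrow> \<tau> \<noteq> {} \<Longrightarrow>
    regular_morphism (dlevel D \<sigma> r) (dlevel D \<tau> r) (dmap D \<tau> \<sigma> r)"
  using dmap_filt[of \<sigma> \<tau>] unfolding filt_morphism_def by auto

lemma dmap_step: "\<sigma> \<in> K \<Longrightarrow> \<tau> \<subseteq> \<sigma> \<Longrightarrow> \<tau> \<noteq> {} \<Longrightarrow> a \<le> b \<Longrightarrow> x \<in> topspace (space (dlevel D \<sigma> a)) \<Longrightarrow>
    dmap D \<tau> \<sigma> b (step (dobj D \<sigma>) a b x) = step (dobj D \<tau>) a b (dmap D \<tau> \<sigma> a x)"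
  using dmap_filt[of \<sigma> \<tau>] unfolding filt_morphism_def by auto

lemma dmap_dmap: "\<sigma> \<in> K \<Longrightarrow> \<tau> \<subseteq> \<sigma> \<Longrightarrow> \<rho> \<subseteq> \<tau> \<Longrightarrow> \<rho> \<noteq> {} \<Longrightarrow> x \<in> topspace (space (dlevel D \<sigma> r)) \<Longrightarrow>
    dmap D \<rho> \<tau> r (dmap D \<tau> \<sigma> r x) = dmap D \<rho> \<sigma> r x"
proof -
  assume *: "\<sigma> \<in> K" "\<tau> \<subseteq> \<sigma>" "\<rho> \<subseteq> \<tau>" "\<rho> \<noteq> {}" "x \<in> topspace (space (dlevel D \<sigma> r))"
  have "\<tau> \<in> K" "\<rho> \<in> K" using face[of \<sigma> \<tau>] face[of \<sigma> \<rho>] * by auto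
  then show "dmap D \<rho> \<tau> r (dmap D \<tau> \<sigma> r x) = dmap D \<rho> \<sigma> r x"
    using D * unfolding regular_diagram_def by simp
qed

lemma dmap_id: "\<sigma> \<in> K \<Longrightarrow> x \<in> topspace (space (dlevel D \<sigma> r)) \<Longrightarrow> dmap D \<sigma> \<sigma> r x = x"
  using D unfolding regular_diagram_def by simp

abbreviation bdc where "bdc \<sigma> r \<equiv> cellular_boundary (dlevel D \<sigma> r)"
abbreviation pm where "pm \<tau> \<sigma> r \<equiv> cellular_map (dlevel D \<sigma> r) (dlevel D \<tau> r) (dmap D \<tau> \<sigma> r)"
abbreviation st where "st \<sigma> a b \<equiv> cellular_map (dlevel D \<sigma> a) (dlevel D \<sigma> b) (step (dobj D \<sigma>) a b)"
abbreviation "S \<equiv> double_basis K D"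

lemma in_S: "(\<sigma>, c) \<in> S r \<longleftrightarrow> \<sigma> \<in> K \<and> c \<in> cells (dlevel D \<sigma> r)"
  by (simp add: double_basis_def)

lemma bdc_pm: "\<sigma> \<in> K \<Longrightarrow> \<tau> \<subseteq> \<sigma> \<Longrightarrow> \<tau> \<noteq> {} \<Longrightarrow> c \<in> cells (dlevel D \<sigma> r) \<Longrightarrow>
    bdc \<tau> r (cell_push (dlevel D \<sigma> r) (dlevel D \<tau> r) (dmap D \<tau> \<sigma> r) c) =
      (pm \<tau> \<sigma> r (cell_boundary (dlevel D \<sigma> r) c) :: _ \<Rightarrow>\<^sub>0 'k::field)"
  by (rule cellular_boundary_push[OF regular regular[OF face] regular_morphism_skeletal[OF dmap_morphism]])

lemma pm_pm:
  assumes "\<sigma> \<in> K" "\<tau> \<subseteq> \<sigma>" "\<rho> \<subseteq> \<tau>" "\<rho> \<noteq> {}" "c \<in> cells (dlevel D \<sigma> r)"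
  shows "pm \<rho> \<tau> r (cell_push (dlevel D \<sigma> r) (dlevel D \<tau> r) (dmap D \<tau> \<sigma> r) c)
    = (cell_push (dlevel D \<sigma> r) (dlevel D \<rho> r) (dmap D \<rho> \<sigma> r) c :: _ \<Rightarrow>\<^sub>0 'k::field)"
proof -
  have \<tau>: "\<tau> \<noteq> {}" "\<tau> \<in> K" and \<rho>: "\<rho> \<in> K" using assms face[of \<sigma> \<tau>] face[of \<sigma> \<rho>] by auto
  have "pm \<rho> \<tau> r (cell_push (dlevel D \<sigma> r) (dlevel D \<tau> r) (dmap D \<tau> \<sigma> r) c)
      = (cell_push (dlevel D \<sigma> r) (dlevel D \<rho> r) (dmap D \<rho> \<tau> r \<circ> dmap D \<tau> \<sigma> r) c :: _ \<Rightarrow>\<^sub>0 'k)"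
    using assms \<tau> \<rho>
    by (intro cellular_map_push regular regular_morphism_skeletal dmap_morphism) auto
  also have "\<dots> = cell_push (dlevel D \<sigma> r) (dlevel D \<rho> r) (dmap D \<rho> \<sigma> r) c"
    by (rule cell_push_cong) (use dmap_dmap[OF assms(1-4)] in auto)
  finally show ?thesis .
qed

lemma bdc_st: "\<sigma> \<in> K \<Longrightarrow> a \<le> b \<Longrightarrow> c \<in> cells (dlevel D \<sigma> a) \<Longrightarrow>
    bdc \<sigma> b (cell_push (dlevel D \<sigma> a) (dlevel D \<sigma> b) (step (dobj D \<sigma>) a b) c) =
      (st \<sigma> a b (cell_boundary (dlevel D \<sigma> a) c) :: _ \<Rightarrow>\<^sub>0 'k::field)"
  by (rule cellular_boundary_push[OF regular regular regular_morphism_skeletal[OF step_morphism]])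

lemma pm_st:
  assumes "\<sigma> \<in> K" "\<tau> \<subseteq> \<sigma>" "\<tau> \<noteq> {}" "a \<le> b" "c \<in> cells (dlevel D \<sigma> a)"
  shows "pm \<tau> \<sigma> b (cell_push (dlevel D \<sigma> a) (dlevel D \<sigma> b) (step (dobj D \<sigma>) a b) c)
    = (st \<tau> a b (cell_push (dlevel D \<sigma> a) (dlevel D \<tau> a) (dmap D \<tau> \<sigma> a) c) :: _ \<Rightarrow>\<^sub>0 'k::field)"
proof -
  have \<tau>: "\<tau> \<in> K" using face[OF assms(1-3)] .
  have "pm \<tau> \<sigma> b (cell_push (dlevel D \<sigma> a) (dlevel D \<sigma> b) (step (dobj D \<sigma>) a b) c)
      = (cell_push (dlevel D \<sigma> a) (dlevel D \<tau> b) (dmap D \<tau> \<sigma> b \<circ> step (dobj D \<sigma>) a b) c :: _ \<Rightarrow>\<^sub>0 'k)"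
    using assms \<tau>
    by (intro cellular_map_push regular regular_morphism_skeletal dmap_morphism step_morphism) auto
  also have "\<dots> = cell_push (dlevel D \<sigma> a) (dlevel D \<tau> b) (step (dobj D \<tau>) a b \<circ> dmap D \<tau> \<sigma> a) c"
    by (rule cell_push_cong) (use dmap_step[OF assms(1-4)] in auto)
  also have "\<dots> = st \<tau> a b (cell_push (dlevel D \<sigma> a) (dlevel D \<tau> a) (dmap D \<tau> \<sigma> a) c)"
    using assms \<tau>
    by (intro cellular_map_push[symmetric] regular regular_morphism_skeletal dmap_morphism step_morphism) auto
  finally show ?thesis .
qed

lemma st_st:
  assumes "\<sigma> \<in> K" "a \<le> b" "b \<le> b'" "c \<in> cells (dlevel D \<sigma> a)"
  shows "st \<sigma> b b' (cell_push (dlevel D \<sigma> a) (dlevel D \<sigma> b) (step (dobj D \<sigma>) a b) c)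
    = cell_push (dlevel D \<sigma> a) (dlevel D \<sigma> b') (step (dobj D \<sigma>) a b') c"
proof -
  have "st \<sigma> b b' (cell_push (dlevel D \<sigma> a) (dlevel D \<sigma> b) (step (dobj D \<sigma>) a b) c)
      = cell_push (dlevel D \<sigma> a) (dlevel D \<sigma> b') (step (dobj D \<sigma>) b b' \<circ> step (dobj D \<sigma>) a b) c"
    using assms by (intro cellular_map_push regular regular_morphism_skeletal step_morphism) auto
  also have "\<dots> = cell_push (dlevel D \<sigma> a) (dlevel D \<sigma> b') (step (dobj D \<sigma>) a b') c"
    by (rule cell_push_cong) (use step_step[OF assms(1-3)] in auto)
  finally show ?thesis .
qed

lemma lin_total_boundary [simp]: "lin (total_boundary D r)"
  by (simp add: total_boundary_def)

lemma lin_total_step [simp]: "lin (total_step D a b)"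
  by (simp add: total_step_def)

lemma total_boundary_basis:
  "total_boundary D r (basis_vec (\<sigma>, c)) =
    lin_scale ((-1) ^ (card \<sigma> - 1)) (at_simplex \<sigma> (bdc \<sigma> r (basis_vec c))) +
    (\<Sum>v | v \<in> \<sigma> \<and> \<sigma> - {v} \<noteq> {}. lin_scale (face_sign \<sigma> v)
      (at_simplex (\<sigma> - {v}) (pm (\<sigma> - {v}) \<sigma> r (basis_vec c))))"
  by (simp add: total_boundary_def total_boundary_on_def face_sign_def)

lemma total_boundary_at:
  "total_boundary D r (at_simplex \<sigma> x) =
    lin_scale ((-1) ^ (card \<sigma> - 1)) (at_simplex \<sigma> (bdc \<sigma> r x)) +
    (\<Sum>v | v \<in> \<sigma> \<and> \<sigma> - {v} \<noteq> {}. lin_scale (face_sign \<sigma> v)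
      (at_simplex (\<sigma> - {v}) (pm (\<sigma> - {v}) \<sigma> r x)))"
proof (rule lin_eqI[where f = "\<lambda>x. total_boundary D r (at_simplex \<sigma> x)" and g = "\<lambda>x.
    lin_scale ((-1) ^ (card \<sigma> - 1)) (at_simplex \<sigma> (bdc \<sigma> r x)) +
    (\<Sum>v | v \<in> \<sigma> \<and> \<sigma> - {v} \<noteq> {}. lin_scale (face_sign \<sigma> v)
      (at_simplex (\<sigma> - {v}) (pm (\<sigma> - {v}) \<sigma> r x)))"])
  show "lin (\<lambda>x. total_boundary D r (at_simplex \<sigma> x))" by (rule lin_compose) simp_all
  show "lin (\<lambda>x. lin_scale ((-1) ^ (card \<sigma> - 1)) (at_simplex \<sigma> (bdc \<sigma> r x)) +
    (\<Sum>v | v \<in> \<sigma> \<and> \<sigma> - {v} \<noteq> {}. lin_scale (face_sign \<sigma> v)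
      (at_simplex (\<sigma> - {v}) (pm (\<sigma> - {v}) \<sigma> r x))))"
    by (rule linI)
      (simp_all add: lin_add[OF lin_at_simplex] lin_add[OF lin_cellular_boundary] lin_add[OF lin_cellular_map]
        lin_scale[OF lin_at_simplex] lin_scale[OF lin_cellular_boundary] lin_scale[OF lin_cellular_map]
        free.scale_right_distrib sum.distrib free.scale_sum_right algebra_simps)
qed (simp only: at_simplex_basis total_boundary_basis)

lemma total_step_at: "total_step D a b (at_simplex \<sigma> x) = at_simplex \<sigma> (st \<sigma> a b x)"
proof (rule lin_eqI[where f = "\<lambda>x. total_step D a b (at_simplex \<sigma> x)" and g = "\<lambda>x. at_simplex \<sigma> (st \<sigma> a b x)"])
  show "lin (\<lambda>x. total_step D a b (at_simplex \<sigma> x))" "lin (\<lambda>x. at_simplex \<sigma> (st \<sigma> a b x))"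
    by (rule lin_compose; simp)+
qed (simp add: total_step_def)

lemma total_step_basis: "total_step D a b (basis_vec (\<sigma>, c)) =
    at_simplex \<sigma> (cell_push (dlevel D \<sigma> a) (dlevel D \<sigma> b) (step (dobj D \<sigma>) a b) c)"
  by (simp add: total_step_def)

lemma total_boundary_total_boundary:
  assumes "(\<sigma>, c) \<in> S r"
  shows "total_boundary D r (total_boundary D r (basis_vec (\<sigma>, c)) :: _ \<Rightarrow>\<^sub>0 'k::field) = 0"
proof -
  have \<sigma>: "\<sigma> \<in> K" and c: "c \<in> cells (dlevel D \<sigma> r)" using assms by (simp_all add: in_S)
  let ?V = "{v. v \<in> \<sigma> \<and> \<sigma> - {v} \<noteq> {}}"
  let ?d = "total_boundary D r :: _ \<Rightarrow> ('v set \<times> 'a set \<Rightarrow>\<^sub>0 'k)"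
  define s :: 'k where "s = (-1) ^ (card \<sigma> - 1)"
  let ?b = "cell_boundary (dlevel D \<sigma> r) c :: 'a set \<Rightarrow>\<^sub>0 'k"
  let ?p = "\<lambda>v. cell_push (dlevel D \<sigma> r) (dlevel D (\<sigma> - {v}) r) (dmap D (\<sigma> - {v}) \<sigma> r) c :: 'a set \<Rightarrow>\<^sub>0 'k"
  let ?g = "\<lambda>\<rho>. at_simplex \<rho> (cell_push (dlevel D \<sigma> r) (dlevel D \<rho> r) (dmap D \<rho> \<sigma> r) c) :: 'v set \<times> 'a set \<Rightarrow>\<^sub>0 'k"
  have "?d (?d (basis_vec (\<sigma>, c))) = lin_scale s (?d (at_simplex \<sigma> ?b)) +
      (\<Sum>v\<in>?V. lin_scale (face_sign \<sigma> v) (?d (at_simplex (\<sigma> - {v}) (?p v))))"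
    unfolding total_boundary_basis s_def
    by (simp add: lin_add[OF lin_total_boundary] lin_scale[OF lin_total_boundary] lin_sum[OF lin_total_boundary])
  also have "?d (at_simplex \<sigma> ?b) = (\<Sum>v\<in>?V. lin_scale (face_sign \<sigma> v) (at_simplex (\<sigma> - {v}) (pm (\<sigma> - {v}) \<sigma> r ?b)))"
    unfolding total_boundary_at
    by (simp add: cellular_boundary_boundary[OF regular[OF \<sigma>] c] lin_zero[OF lin_at_simplex])
  also have "(\<Sum>v\<in>?V. lin_scale (face_sign \<sigma> v) (?d (at_simplex (\<sigma> - {v}) (?p v))))
     = (\<Sum>v\<in>?V. lin_scale (face_sign \<sigma> v) (lin_scale (- s) (at_simplex (\<sigma> - {v}) (pm (\<sigma> - {v}) \<sigma> r ?b)) +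
        (\<Sum>w | w \<in> \<sigma> - {v} \<and> \<sigma> - {v} - {w} \<noteq> {}. lin_scale (face_sign (\<sigma> - {v}) w) (?g (\<sigma> - {v} - {w})))))"
  proof (rule sum.cong[OF refl])
    fix v assume v: "v \<in> ?V"
    have c1: "card \<sigma> = Suc (card (\<sigma> - {v}))" using v card.remove[OF simplex(1)[OF \<sigma>], of v] by blast
    have "finite (\<sigma> - {v})" "\<sigma> - {v} \<noteq> {}" using v simplex(1)[OF \<sigma>] by blast+
    then have "card (\<sigma> - {v}) \<noteq> 0" by (metis card_eq_0_iff)
    then obtain m where m: "card (\<sigma> - {v}) = Suc m" using not0_implies_Suc by blast
    \<comment> \<open>A face has simplicial degree one less, which flips the sign of the vertical
      differential; this is why the two mixed terms cancel.\<close>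
    have sv: "(-1) ^ (card (\<sigma> - {v}) - 1) = - s"
      unfolding s_def c1 m by simp
    have "?d (at_simplex (\<sigma> - {v}) (?p v)) = lin_scale (- s) (at_simplex (\<sigma> - {v}) (pm (\<sigma> - {v}) \<sigma> r ?b)) +
        (\<Sum>w | w \<in> \<sigma> - {v} \<and> \<sigma> - {v} - {w} \<noteq> {}. lin_scale (face_sign (\<sigma> - {v}) w)
          (at_simplex (\<sigma> - {v} - {w}) (pm (\<sigma> - {v} - {w}) (\<sigma> - {v}) r (?p v))))"
      unfolding total_boundary_at sv using v bdc_pm[OF \<sigma> _ _ c, of "\<sigma> - {v}", where 'k = 'k] by simp
    also have "(\<Sum>w | w \<in> \<sigma> - {v} \<and> \<sigma> - {v} - {w} \<noteq> {}. lin_scale (face_sign (\<sigma> - {v}) w)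
          (at_simplex (\<sigma> - {v} - {w}) (pm (\<sigma> - {v} - {w}) (\<sigma> - {v}) r (?p v)))) =
        (\<Sum>w | w \<in> \<sigma> - {v} \<and> \<sigma> - {v} - {w} \<noteq> {}. lin_scale (face_sign (\<sigma> - {v}) w) (?g (\<sigma> - {v} - {w})))"
      by (intro sum.cong refl arg_cong[where f = "lin_scale _"] arg_cong[where f = "at_simplex _"] pm_pm[OF \<sigma> _ _ _ c]) auto
    finally show "lin_scale (face_sign \<sigma> v) (?d (at_simplex (\<sigma> - {v}) (?p v))) =
        lin_scale (face_sign \<sigma> v) (lin_scale (- s) (at_simplex (\<sigma> - {v}) (pm (\<sigma> - {v}) \<sigma> r ?b)) +
        (\<Sum>w | w \<in> \<sigma> - {v} \<and> \<sigma> - {v} - {w} \<noteq> {}. lin_scale (face_sign (\<sigma> - {v}) w) (?g (\<sigma> - {v} - {w}))))"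
      by simp
  qed
  also have "\<dots> = (\<Sum>v\<in>?V. lin_scale (- s) (lin_scale (face_sign \<sigma> v) (at_simplex (\<sigma> - {v}) (pm (\<sigma> - {v}) \<sigma> r ?b)))) +
      (\<Sum>v\<in>?V. lin_scale (face_sign \<sigma> v) (\<Sum>w | w \<in> \<sigma> - {v} \<and> \<sigma> - {v} - {w} \<noteq> {}.
        lin_scale (face_sign (\<sigma> - {v}) w) (?g (\<sigma> - {v} - {w}))))"
    by (simp add: free.scale_right_diff_distrib sum_subtractf sum_negf mult.commute)
  also have "(\<Sum>v\<in>?V. lin_scale (face_sign \<sigma> v) (\<Sum>w | w \<in> \<sigma> - {v} \<and> \<sigma> - {v} - {w} \<noteq> {}.
        lin_scale (face_sign (\<sigma> - {v}) w) (?g (\<sigma> - {v} - {w})))) = 0"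
    by (rule double_face_sum[OF simplex(1)[OF \<sigma>]])
  finally show ?thesis
    by (simp only: free.scale_sum_right[symmetric]) (simp flip: free.scale_left_distrib)
qed

text \<open>Records where the terms of the differential lie and not only their degree: monotonicity
  and closedness of carriers depend on the closed cell and on \<open>cell_image\<close>.\<close>

definition boundary_support :: "real \<Rightarrow> 'v set \<times> 'a set \<Rightarrow> ('v set \<times> 'a set) set" where
  "boundary_support r = (\<lambda>(\<sigma>, c).
    {(\<sigma>, t) | t. t \<in> cells_of_dim (dlevel D \<sigma> r) (int (cell_dim (dlevel D \<sigma> r) c) - 1) \<and>
       t \<subseteq> cell_closure (dlevel D \<sigma> r) c} \<union>
    {(\<tau>, t) | \<tau> t v. v \<in> \<sigma> \<and> \<tau> = \<sigma> - {v} \<and> \<tau> \<noteq> {} \<and>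
       t \<in> cells_of_dim (dlevel D \<tau> r) (int (cell_dim (dlevel D \<sigma> r) c)) \<and>
       t \<in> cell_image (dlevel D \<tau> r) (dmap D \<tau> \<sigma> r) c})"

lemma total_boundary_support:
  assumes b: "(\<sigma>, c) \<in> S r"
  shows "(total_boundary D r (basis_vec (\<sigma>, c)) :: _ \<Rightarrow>\<^sub>0 'k::field) \<in> span_on (boundary_support r (\<sigma>, c))"
  unfolding total_boundary_basis
proof (intro free.subspace_add free.subspace_sum free.subspace_scale subspace_span_on)
  have \<sigma>: "\<sigma> \<in> K" and c: "c \<in> cells (dlevel D \<sigma> r)" using b by (simp_all add: in_S)
  show "(at_simplex \<sigma> (bdc \<sigma> r (basis_vec c)) :: _ \<Rightarrow>\<^sub>0 'k) \<in> span_on (boundary_support r (\<sigma>, c))"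
    using keys_cell_boundary[OF normal[OF \<sigma>] c, where 'k = 'k]
    unfolding span_on_iff keys_at_simplex boundary_support_def by auto
  fix v assume v: "v \<in> {v. v \<in> \<sigma> \<and> \<sigma> - {v} \<noteq> {}}"
  then have "\<sigma> - {v} \<in> K" using face[OF \<sigma>] by auto
  from keys_cell_push[OF regular[OF \<sigma>] regular[OF this] dmap_morphism[OF \<sigma>] c, where 'k = 'k]
  show "(at_simplex (\<sigma> - {v}) (pm (\<sigma> - {v}) \<sigma> r (basis_vec c)) :: _ \<Rightarrow>\<^sub>0 'k) \<in> span_on (boundary_support r (\<sigma>, c))"
    using v unfolding span_on_iff keys_at_simplex boundary_support_def by fastforce
qed

lemma boundary_support_subset:
  assumes b: "(\<sigma>, c) \<in> S r" and b': "(\<tau>, t) \<in> boundary_support r (\<sigma>, c)"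
  shows "(\<tau>, t) \<in> S r" "total_deg D r (\<tau>, t) = total_deg D r (\<sigma>, c) - 1"
    "card \<tau> \<le> card \<sigma>" "\<tau> \<subseteq> \<sigma>" "\<tau> \<noteq> {}"
proof -
  have \<sigma>: "\<sigma> \<in> K" and c: "c \<in> cells (dlevel D \<sigma> r)" using b by (simp_all add: in_S)
  have "(\<tau>, t) \<in> S r \<and> total_deg D r (\<tau>, t) = total_deg D r (\<sigma>, c) - 1 \<and> card \<tau> \<le> card \<sigma> \<and> \<tau> \<subseteq> \<sigma> \<and> \<tau> \<noteq> {}"
  proof (cases "\<tau> = \<sigma>")
    case True
    then show ?thesis
      using b' \<sigma> simplex[OF \<sigma>] unfolding boundary_support_def
      by (auto simp: in_S cells_of_dim_def total_deg_def)
  next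
    case False
    then obtain v where v: "v \<in> \<sigma>" "\<tau> = \<sigma> - {v}" "\<tau> \<noteq> {}"
      "t \<in> cells_of_dim (dlevel D \<tau> r) (int (cell_dim (dlevel D \<sigma> r) c))"
      using b' unfolding boundary_support_def by auto
    have "\<tau> \<in> K" using face[OF \<sigma>, of \<tau>] v by blast
    moreover have "card \<sigma> = Suc (card \<tau>)" using v card.remove[OF simplex(1)[OF \<sigma>], of v] by simp
    ultimately show ?thesis using v by (auto simp: in_S cells_of_dim_def total_deg_def)
  qed
  then show "(\<tau>, t) \<in> S r" "total_deg D r (\<tau>, t) = total_deg D r (\<sigma>, c) - 1"
    "card \<tau> \<le> card \<sigma>" "\<tau> \<subseteq> \<sigma>" "\<tau> \<noteq> {}" by blast+
qed

lemma total_deg_nonneg: "(\<sigma>, c) \<in> S r \<Longrightarrow> 0 \<le> total_deg D r (\<sigma>, c)"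
proof -
  assume "(\<sigma>, c) \<in> S r"
  then have "card \<sigma> > 0" using simplex by (auto simp: in_S card_gt_0_iff)
  then show "0 \<le> total_deg D r (\<sigma>, c)" by (simp add: total_deg_def)
qed

lemma coeff_sum_cell_push:
  assumes "\<sigma> \<in> K" "\<tau> \<subseteq> \<sigma>" "\<tau> \<noteq> {}" "c \<in> cells (dlevel D \<sigma> r)" "cell_dim (dlevel D \<sigma> r) c = 0"
  shows "coeff_sum (cell_push (dlevel D \<sigma> r) (dlevel D \<tau> r) (dmap D \<tau> \<sigma> r) c) = (1 :: 'k::field)"
  using cell_push_zero_cell[OF regular[OF assms(1)] regular[OF face[OF assms(1-3)]]
      regular_morphism_skeletal[OF dmap_morphism[OF assms(1-3)]] assms(4,5), where 'c = 'k] by auto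

lemma cell_boundary_zero: "cell_dim X c = 0 \<Longrightarrow> cell_boundary X c = 0"
proof -
  assume "cell_dim X c = 0"
  moreover have "cells_of_dim X (- 1) = {}" by (auto simp: cells_of_dim_def)
  ultimately show "cell_boundary X c = 0" by (simp add: cell_boundary_def)
qed

text \<open>Total degree 1 occurs in two ways. An edge over a vertex has a cellular boundary of
  augmentation zero; a vertex over an edge is sent to one vertex over each end, with signs +1 and
  -1.\<close>

lemma total_boundary_coeff_sum:
  assumes b: "(\<sigma>, c) \<in> S r" "total_deg D r (\<sigma>, c) = 1"
  shows "coeff_sum (total_boundary D r (basis_vec (\<sigma>, c)) :: _ \<Rightarrow>\<^sub>0 'k::field) = 0"
proof -
  have \<sigma>: "\<sigma> \<in> K" and c: "c \<in> cells (dlevel D \<sigma> r)" using b by (simp_all add: in_S)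
  let ?V = "{v. v \<in> \<sigma> \<and> \<sigma> - {v} \<noteq> {}}" and ?X = "dlevel D \<sigma> r"
  let ?p = "\<lambda>v. cell_push ?X (dlevel D (\<sigma> - {v}) r) (dmap D (\<sigma> - {v}) \<sigma> r) c :: 'a set \<Rightarrow>\<^sub>0 'k"
  have fin: "finite \<sigma>" "card \<sigma> > 0" using simplex[OF \<sigma>] by (simp_all add: card_gt_0_iff)
  have sum: "coeff_sum (total_boundary D r (basis_vec (\<sigma>, c)) :: _ \<Rightarrow>\<^sub>0 'k) =
      (-1) ^ (card \<sigma> - 1) * coeff_sum (cell_boundary ?X c) + (\<Sum>v\<in>?V. face_sign \<sigma> v * coeff_sum (?p v))"
    unfolding total_boundary_basis
    by (simp add: coeff_sum_add coeff_sum_scale coeff_sum_sum coeff_sum_at_simplex)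
  have "card \<sigma> + cell_dim ?X c = 2" using b(2) fin by (simp add: total_deg_def)
  then consider "card \<sigma> = 1" "cell_dim ?X c = 1" | "card \<sigma> = 2" "cell_dim ?X c = 0" using fin by linarith
  then show ?thesis
  proof cases
    case 1
    then obtain v where "\<sigma> = {v}" using card_1_singletonE by blast
    then have V: "?V = {}" by auto
    show ?thesis unfolding sum V using coeff_sum_cell_boundary[OF regular[OF \<sigma>] c 1(2), where 'k = 'k] by simp
  next
    case 2
    then obtain x y where xy: "\<sigma> = {x, y}" "x < y"
      by (metis card_2_iff insert_commute linorder_neqE)
    have V: "?V = {x, y}" using xy by auto
    have e: "{w \<in> \<sigma>. w < x} = {}" "{w \<in> \<sigma>. w < y} = {x}" using xy by auto
    have sg: "face_sign \<sigma> x = (1 :: 'k)" "face_sign \<sigma> y = (- 1 :: 'k)" unfolding face_sign_def e by simp_all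
    have "coeff_sum (?p v) = 1" if "v \<in> ?V" for v
      by (rule coeff_sum_cell_push[OF \<sigma> _ _ c 2(2)]) (use that in auto)
    then have "(\<Sum>v\<in>?V. face_sign \<sigma> v * coeff_sum (?p v)) = (\<Sum>v\<in>?V. face_sign \<sigma> v)"
      by (intro sum.cong) auto
    also have "\<dots> = (0 :: 'k)" unfolding V using xy sg by simp
    finally show ?thesis unfolding sum by (simp add: cell_boundary_zero[OF 2(2)])
  qed
qed

theorem total_based_complex: "based_complex (S r) (total_deg D r) (total_boundary D r)"
  unfolding based_complex_def
proof (intro conjI ballI impI lin_total_boundary)
  fix b assume b: "b \<in> S r"
  obtain \<sigma> c where bc: "b = (\<sigma>, c)" by (cases b)
  note b' = b[unfolded bc]
  show "0 \<le> total_deg D r b" unfolding bc by (rule total_deg_nonneg[OF b'])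
  show "total_boundary D r (basis_vec b) \<in> span_on {b' \<in> S r. total_deg D r b' = total_deg D r b - 1}"
    unfolding bc by (rule span_on_mono[OF _ total_boundary_support[OF b']])
      (use boundary_support_subset[OF b'] in auto)
  show "total_boundary D r (total_boundary D r (basis_vec b)) = 0"
    unfolding bc by (rule total_boundary_total_boundary[OF b'])
  show "coeff_sum (total_boundary D r (basis_vec b)) = 0" if "total_deg D r b = 1"
    using total_boundary_coeff_sum[OF b'] that unfolding bc by simp
qed

theorem total_filtered_complex: "filtered_complex (S r) (total_deg D r) simplex_deg (total_boundary D r)"
proof
  fix b assume b: "b \<in> S r"
  obtain \<sigma> c where bc: "b = (\<sigma>, c)" by (cases b)
  note b' = b[unfolded bc]
  show "total_boundary D r (basis_vec b) \<in> filt_part (S r) (total_deg D r) simplex_deg (simplex_deg b) (total_deg D r b - 1)"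
    unfolding bc filt_part_def by (rule span_on_mono[OF _ total_boundary_support[OF b']])
      (auto simp: simplex_deg_def dest: boundary_support_subset(1-3)[OF b'])
  show "total_boundary D r (total_boundary D r (basis_vec b)) = 0"
    unfolding bc by (rule total_boundary_total_boundary[OF b'])
qed (simp_all add: lin_add[OF lin_total_boundary] lin_scale[OF lin_total_boundary])

lemma total_step_support:
  assumes "(\<sigma>, c) \<in> S a" "a \<le> b"
  shows "Poly_Mapping.keys (total_step D a b (basis_vec (\<sigma>, c)) :: _ \<Rightarrow>\<^sub>0 'k::field) \<subseteq>
    Pair \<sigma> ` (cells_of_dim (dlevel D \<sigma> b) (int (cell_dim (dlevel D \<sigma> a) c)) \<inter>
      cell_image (dlevel D \<sigma> b) (step (dobj D \<sigma>) a b) c)"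
  unfolding total_step_basis keys_at_simplex
  by (rule image_mono, rule keys_cell_push[OF regular regular step_morphism]) (use assms in \<open>auto simp: in_S\<close>)

lemma total_step_degree:
  assumes "(\<sigma>, c) \<in> S a" "a \<le> b"
  shows "(total_step D a b (basis_vec (\<sigma>, c)) :: _ \<Rightarrow>\<^sub>0 'k::field) \<in>
    span_on {b' \<in> S b. total_deg D b b' = total_deg D a (\<sigma>, c) \<and> fst b' = \<sigma>}"
  using total_step_support[OF assms, where 'k = 'k] assms(1) unfolding span_on_iff
  by (fastforce simp: in_S cells_of_dim_def total_deg_def)

lemma total_boundary_step:
  assumes "(\<sigma>, c) \<in> S a" "a \<le> b"
  shows "total_boundary D b (total_step D a b (basis_vec (\<sigma>, c))) =
    total_step D a b (total_boundary D a (basis_vec (\<sigma>, c)) :: _ \<Rightarrow>\<^sub>0 'k::field)"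
proof -
  have \<sigma>: "\<sigma> \<in> K" and c: "c \<in> cells (dlevel D \<sigma> a)" using assms by (simp_all add: in_S)
  have "total_step D a b (total_boundary D a (basis_vec (\<sigma>, c)) :: _ \<Rightarrow>\<^sub>0 'k) =
     lin_scale ((-1) ^ (card \<sigma> - 1)) (at_simplex \<sigma> (st \<sigma> a b (bdc \<sigma> a (basis_vec c)))) +
    (\<Sum>v | v \<in> \<sigma> \<and> \<sigma> - {v} \<noteq> {}. lin_scale (face_sign \<sigma> v)
      (at_simplex (\<sigma> - {v}) (st (\<sigma> - {v}) a b (pm (\<sigma> - {v}) \<sigma> a (basis_vec c)))))"
    unfolding total_boundary_basis
    by (simp add: lin_add[OF lin_total_step] lin_scale[OF lin_total_step] lin_sum[OF lin_total_step] total_step_at)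
  also have "\<dots> = lin_scale ((-1) ^ (card \<sigma> - 1)) (at_simplex \<sigma> (bdc \<sigma> b (st \<sigma> a b (basis_vec c)))) +
    (\<Sum>v | v \<in> \<sigma> \<and> \<sigma> - {v} \<noteq> {}. lin_scale (face_sign \<sigma> v)
      (at_simplex (\<sigma> - {v}) (pm (\<sigma> - {v}) \<sigma> b (st \<sigma> a b (basis_vec c)))))"
    using bdc_st[OF \<sigma> assms(2) c, where 'k = 'k] pm_st[OF \<sigma> _ _ assms(2) c, where 'k = 'k] by simp
  also have "\<dots> = total_boundary D b (at_simplex \<sigma> (st \<sigma> a b (basis_vec c)))"
    by (rule total_boundary_at[symmetric])
  finally show ?thesis by (simp add: total_step_basis)
qed

lemma coeff_sum_total_step:
  assumes "(\<sigma>, c) \<in> S a" "a \<le> b" "total_deg D a (\<sigma>, c) = 0"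
  shows "coeff_sum (total_step D a b (basis_vec (\<sigma>, c)) :: _ \<Rightarrow>\<^sub>0 'k::field) = 1"
proof -
  have \<sigma>: "\<sigma> \<in> K" and c: "c \<in> cells (dlevel D \<sigma> a)" using assms by (simp_all add: in_S)
  have "card \<sigma> > 0" using simplex[OF \<sigma>] by (simp add: card_gt_0_iff)
  then have "cell_dim (dlevel D \<sigma> a) c = 0" using assms(3) by (simp add: total_deg_def)
  from cell_push_zero_cell[OF regular[OF \<sigma>] regular[OF \<sigma>] regular_morphism_skeletal[OF step_morphism[OF \<sigma> assms(2)]] c this, where 'c = 'k]
  show ?thesis unfolding total_step_basis coeff_sum_at_simplex by auto
qed

lemma total_step_filtered_map:
  assumes "a \<le> b"
  shows "filtered_map (S a) (total_deg D a) simplex_deg (total_boundary D a)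
    (S b) (total_deg D b) simplex_deg (total_boundary D b) (total_step D a b)"
  unfolding filtered_map_def
proof (intro conjI ballI lin_total_step)
  fix x assume x: "x \<in> S a"
  obtain \<sigma> c where xc: "x = (\<sigma>, c)" by (cases x)
  show "total_step D a b (basis_vec x) \<in> filt_part (S b) (total_deg D b) simplex_deg (simplex_deg x) (total_deg D a x)"
    unfolding xc filt_part_def
    by (rule span_on_mono[OF _ total_step_degree[OF x[unfolded xc] assms]]) (auto simp: simplex_deg_def)
  show "total_boundary D b (total_step D a b (basis_vec x)) = total_step D a b (total_boundary D a (basis_vec x))"
    unfolding xc by (rule total_boundary_step[OF x[unfolded xc] assms])
qed

lemma total_step_total_step:
  assumes "(\<sigma>, c) \<in> S a" "a \<le> b" "b \<le> b'"
  shows "total_step D b b' (total_step D a b (basis_vec (\<sigma>, c))) = (total_step D a b' (basis_vec (\<sigma>, c)) :: _ \<Rightarrow>\<^sub>0 'k::field)"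
  unfolding total_step_basis total_step_at by (subst st_st) (use assms in \<open>auto simp: in_S\<close>)

theorem diagram_persistent: "persistent_spectral_sequence (diagram_spec_seq K D :: ('k::field, _) pers_spec_seq)"
  unfolding persistent_spectral_sequence_def
proof (intro conjI allI impI ballI)
  let ?A = "diagram_spec_seq K D :: ('k, ('v set \<times> 'a set \<Rightarrow>\<^sub>0 'k) set) pers_spec_seq"
  have at: "ss_at ?A a = filtered_spec_seq (S a) (total_deg D a) simplex_deg (total_boundary D a)" for a
    by (simp add: diagram_spec_seq_def)
  have step: "ss_step ?A a b = ss_map (S b) (total_deg D b) simplex_deg (total_boundary D b) (total_step D a b)" for a b
    by (simp add: diagram_spec_seq_def)
  note C = total_filtered_complex
  show "spectral_sequence (ss_at ?A a)" for a
    unfolding at by (rule filtered_complex.filtered_spectral_sequence[OF C])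
  show "ss_morphism 0 (ss_at ?A a) (ss_at ?A b) (ss_step ?A a b)" if "a \<le> b" for a b
    unfolding at step by (rule ss_map_morphism[OF C C total_step_filtered_map[OF that]])
  show "ss_step ?A a a r p q x = x" if "x \<in> carrier (page (ss_at ?A a) r p q)" for a r p q x
    using that unfolding at step
  proof (intro ss_map_id[OF C])
    fix b assume "b \<in> S a"
    then show "total_step D a a (basis_vec b) = basis_vec b"
      by (cases b) (auto simp: in_S total_step_basis cell_push_id[OF regular _ step_id])
  qed simp_all
  show "ss_step ?A b c r p q (ss_step ?A a b r p q x) = ss_step ?A a c r p q x"
    if ab: "a \<le> b" and bc: "b \<le> c" and x: "x \<in> carrier (page (ss_at ?A a) r p q)" for a b c r p q x
  proof -
    note f = total_step_filtered_map[OF ab] and g = total_step_filtered_map[OF bc]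
      and h = total_step_filtered_map[OF order_trans[OF ab bc]]
    note x = x[unfolded at]
    obtain z where z: "z \<in> ZZ (S a) (total_deg D a) simplex_deg (total_boundary D a) (int r) p (p + q)"
      "x = cl (BB (S a) (total_deg D a) simplex_deg (total_boundary D a) (int r) p (p + q)) z"
      using x unfolding filtered_complex.page_carrier[OF C] by blast
    have "total_step D b c (total_step D a b z) = total_step D a c z"
    proof (rule lin_eqI[where f = "\<lambda>z. total_step D b c (total_step D a b z)" and g = "total_step D a c"])
      show "lin (\<lambda>z. total_step D b c (total_step D a b z))" by (rule lin_compose) simp_all
      fix b' assume "b' \<in> Poly_Mapping.keys z"
      then have "b' \<in> S a" using filtered_complex.Z_span[OF C z(1)] by (auto simp: span_on_iff)
      then show "total_step D b c (total_step D a b (basis_vec b')) = total_step D a c (basis_vec b')"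
        by (cases b') (use total_step_total_step[OF _ ab bc] in simp)
    qed simp
    then show ?thesis
      unfolding step z(2) ss_map_cl[OF C C f] ss_map_cl[OF C C g] ss_map_cl[OF C C h] by simp
  qed
qed

end

section \<open>Carriers on total complexes\<close>

lemma cell_image_mono:
  assumes f: "continuous_map (space X) (space Y) f" and c: "c' \<subseteq> cell_closure X c"
  shows "cell_image Y f c' \<subseteq> cell_image Y f c"
proof -
  have "f ` c' \<subseteq> space Y closure_of (f ` c)"
    using c continuous_map_image_closure_subset[OF f, of c] by blast
  then have "space Y closure_of (f ` c') \<subseteq> space Y closure_of (f ` c)"
    by (rule closure_of_minimal) simp
  then show ?thesis unfolding cell_image_def by blast
qed

text \<open>Taking closures at the intermediate stage yields an inclusion, and since carriers are
  monotone that direction suffices.\<close>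

lemma cell_image_comp:
  assumes g: "continuous_map (space Y) (space Z) g" and t: "t \<in> cell_image Y f c"
  shows "cell_image Z g t \<subseteq> cell_image Z (g \<circ> f) c"
proof -
  have "t \<subseteq> cell_closure Y (f ` c)" using t by (simp add: cell_image_def)
  from cell_image_mono[OF g this] show ?thesis by (simp add: cell_image_def image_comp)
qed

lemma cell_image_cong: "(\<And>x. x \<in> c \<Longrightarrow> f x = g x) \<Longrightarrow> cell_image Y f c = cell_image Y g c"
  unfolding cell_image_def by (metis (no_types, lifting) image_cong)

lemma carrier_apply_mono: "A \<subseteq> B \<Longrightarrow> carrier_apply F A \<subseteq> carrier_apply F B"
  unfolding carrier_apply_def by blast

lemma in_carrier_apply: "s \<in> carrier_apply F A \<longleftrightarrow> (\<exists>t\<in>A. s \<in> F t)"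
  by (simp add: carrier_apply_def)

lemma regular_morphism_continuous: "regular_morphism X Y f \<Longrightarrow> continuous_map (space X) (space Y) f"
  by (simp add: regular_morphism_def)

lemma keys_lin:
  assumes "lin g" "s \<in> Poly_Mapping.keys (g y)"
  shows "\<exists>b\<in>Poly_Mapping.keys y. s \<in> Poly_Mapping.keys (g (basis_vec b))"
proof -
  let ?R = "\<Union>b\<in>Poly_Mapping.keys y. Poly_Mapping.keys (g (basis_vec b))"
  have "g y \<in> span_on ?R"
    by (rule lin_in_subspace[OF assms(1) subspace_span_on, of y "Poly_Mapping.keys y"]) (auto simp: span_on_iff)
  then show ?thesis using assms(2) by (auto simp: span_on_iff)
qed

section \<open>Composite structure maps of a diagram and the cells they reach\<close>

context diagram_over
begin

text \<open>The structure map from D(\<sigma>) at level a to D(\<tau>) at level b. By naturality it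
  does not matter whether the step or the diagram map comes first, and every composite met below
  reduces to such a map.\<close>

definition shifted_map :: "'v set \<Rightarrow> 'v set \<Rightarrow> real \<Rightarrow> real \<Rightarrow> 'a \<Rightarrow> 'a" where
  "shifted_map \<tau> \<sigma> a b = dmap D \<tau> \<sigma> b \<circ> step (dobj D \<sigma>) a b"

lemma cell_topspace: "\<sigma> \<in> K \<Longrightarrow> c \<in> cells (dlevel D \<sigma> r) \<Longrightarrow> x \<in> c \<Longrightarrow> x \<in> topspace (space (dlevel D \<sigma> r))"
  using regular[of \<sigma> r] unfolding regular_cw_def by blast

lemma step_topspace: "\<sigma> \<in> K \<Longrightarrow> a \<le> b \<Longrightarrow> x \<in> topspace (space (dlevel D \<sigma> a)) \<Longrightarrow>
    step (dobj D \<sigma>) a b x \<in> topspace (space (dlevel D \<sigma> b))"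
  using regular_morphism_continuous[OF step_morphism[of \<sigma> a b]] by (auto simp: continuous_map_def Pi_iff)

lemma shifted_map_continuous: "\<sigma> \<in> K \<Longrightarrow> \<tau> \<subseteq> \<sigma> \<Longrightarrow> \<tau> \<noteq> {} \<Longrightarrow> a \<le> b \<Longrightarrow>
    continuous_map (space (dlevel D \<sigma> a)) (space (dlevel D \<tau> b)) (shifted_map \<tau> \<sigma> a b)"
  unfolding shifted_map_def
  by (rule continuous_map_compose[OF regular_morphism_continuous[OF step_morphism] regular_morphism_continuous[OF dmap_morphism]])

lemma shifted_map_zero:
  assumes "\<sigma> \<in> K" "c \<in> cells (dlevel D \<sigma> a)"
  shows "cell_image Y (shifted_map \<tau> \<sigma> a a) c = cell_image Y (dmap D \<tau> \<sigma> a) c"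
  by (rule cell_image_cong) (simp add: shifted_map_def step_id[OF assms(1) cell_topspace[OF assms]])

text \<open>Composition with a diagram map on the source side; it gives monotonicity of the carrier
  along horizontal boundary terms.\<close>

lemma shifted_map_face:
  assumes "\<sigma> \<in> K" "\<rho> \<subseteq> \<sigma>" "\<tau> \<subseteq> \<rho>" "\<tau> \<noteq> {}" "a \<le> b" "c \<in> cells (dlevel D \<sigma> a)"
    and t: "t \<in> cell_image (dlevel D \<rho> a) (dmap D \<rho> \<sigma> a) c"
  shows "cell_image (dlevel D \<tau> b) (shifted_map \<tau> \<rho> a b) t \<subseteq> cell_image (dlevel D \<tau> b) (shifted_map \<tau> \<sigma> a b) c"
proof -
  have \<rho>: "\<rho> \<in> K" "\<rho> \<noteq> {}" using face[of \<sigma> \<rho>] assms by auto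
  have "cell_image (dlevel D \<tau> b) (shifted_map \<tau> \<rho> a b) t
      \<subseteq> cell_image (dlevel D \<tau> b) (shifted_map \<tau> \<rho> a b \<circ> dmap D \<rho> \<sigma> a) c"
    by (rule cell_image_comp[OF shifted_map_continuous[OF \<rho>(1) assms(3,4,5)] t])
  also have "\<dots> = cell_image (dlevel D \<tau> b) (shifted_map \<tau> \<sigma> a b) c"
  proof (rule cell_image_cong)
    fix x assume "x \<in> c"
    then have x: "x \<in> topspace (space (dlevel D \<sigma> a))" by (rule cell_topspace[OF assms(1,6)])
    show "(shifted_map \<tau> \<rho> a b \<circ> dmap D \<rho> \<sigma> a) x = shifted_map \<tau> \<sigma> a b x"
      using dmap_step[OF assms(1,2) \<rho>(2) assms(5) x]
        dmap_dmap[OF assms(1,2,3,4) step_topspace[OF assms(1,5) x]]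
      by (simp add: shifted_map_def)
  qed
  finally show ?thesis .
qed

text \<open>Composition with a diagram map on the target side; it is behind closedness of the
  carrier under the horizontal differential.\<close>

lemma dmap_shifted_map:
  assumes "\<sigma> \<in> K" "\<tau> \<subseteq> \<sigma>" "\<rho> \<subseteq> \<tau>" "\<rho> \<noteq> {}" "a \<le> b" "c \<in> cells (dlevel D \<sigma> a)"
    and t: "t \<in> cell_image (dlevel D \<tau> b) (shifted_map \<tau> \<sigma> a b) c"
  shows "cell_image (dlevel D \<rho> b) (dmap D \<rho> \<tau> b) t \<subseteq> cell_image (dlevel D \<rho> b) (shifted_map \<rho> \<sigma> a b) c"
proof -
  have \<tau>: "\<tau> \<in> K" using face[of \<sigma> \<tau>] assms by auto
  have "cell_image (dlevel D \<rho> b) (dmap D \<rho> \<tau> b) t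
      \<subseteq> cell_image (dlevel D \<rho> b) (dmap D \<rho> \<tau> b \<circ> shifted_map \<tau> \<sigma> a b) c"
    by (rule cell_image_comp[OF regular_morphism_continuous[OF dmap_morphism[OF \<tau> assms(3,4)]] t])
  also have "\<dots> = cell_image (dlevel D \<rho> b) (shifted_map \<rho> \<sigma> a b) c"
  proof (rule cell_image_cong)
    fix x assume "x \<in> c"
    then have x: "x \<in> topspace (space (dlevel D \<sigma> a))" by (rule cell_topspace[OF assms(1,6)])
    show "(dmap D \<rho> \<tau> b \<circ> shifted_map \<tau> \<sigma> a b) x = shifted_map \<rho> \<sigma> a b x"
      using dmap_dmap[OF assms(1,2,3,4) step_topspace[OF assms(1,5) x]] by (simp add: shifted_map_def)
  qed
  finally show ?thesis .
qed

text \<open>Target-side composition with a step, for a chain map followed by a structure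
  map.\<close>

lemma step_shifted_map:
  assumes "\<sigma> \<in> K" "\<tau> \<subseteq> \<sigma>" "\<tau> \<noteq> {}" "a \<le> b" "c \<in> cells (dlevel D \<sigma> a)"
    and t: "t \<in> cell_image (dlevel D \<tau> a) (shifted_map \<tau> \<sigma> a a) c"
  shows "cell_image (dlevel D \<tau> b) (step (dobj D \<tau>) a b) t \<subseteq> cell_image (dlevel D \<tau> b) (shifted_map \<tau> \<sigma> a b) c"
proof -
  have \<tau>: "\<tau> \<in> K" using face[of \<sigma> \<tau>] assms by auto
  have "cell_image (dlevel D \<tau> b) (step (dobj D \<tau>) a b) t
      \<subseteq> cell_image (dlevel D \<tau> b) (step (dobj D \<tau>) a b \<circ> shifted_map \<tau> \<sigma> a a) c"
    by (rule cell_image_comp[OF regular_morphism_continuous[OF step_morphism[OF \<tau> assms(4)]] t])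
  also have "\<dots> = cell_image (dlevel D \<tau> b) (shifted_map \<tau> \<sigma> a b) c"
  proof (rule cell_image_cong)
    fix x assume "x \<in> c"
    then have x: "x \<in> topspace (space (dlevel D \<sigma> a))" by (rule cell_topspace[OF assms(1,5)])
    show "(step (dobj D \<tau>) a b \<circ> shifted_map \<tau> \<sigma> a a) x = shifted_map \<tau> \<sigma> a b x"
      using dmap_step[OF assms(1-4) x] step_id[OF assms(1) x] by (simp add: shifted_map_def)
  qed
  finally show ?thesis .
qed

text \<open>Source-side composition with a step, for a structure map followed by a chain
  map.\<close>

lemma shifted_map_step:
  assumes "\<sigma> \<in> K" "\<tau> \<subseteq> \<sigma>" "\<tau> \<noteq> {}" "a \<le> b" "c \<in> cells (dlevel D \<sigma> a)"
    and t: "t \<in> cell_image (dlevel D \<sigma> b) (step (dobj D \<sigma>) a b) c"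
  shows "cell_image (dlevel D \<tau> b) (shifted_map \<tau> \<sigma> b b) t \<subseteq> cell_image (dlevel D \<tau> b) (shifted_map \<tau> \<sigma> a b) c"
proof -
  have "cell_image (dlevel D \<tau> b) (shifted_map \<tau> \<sigma> b b) t
      \<subseteq> cell_image (dlevel D \<tau> b) (shifted_map \<tau> \<sigma> b b \<circ> step (dobj D \<sigma>) a b) c"
    by (rule cell_image_comp[OF shifted_map_continuous[OF assms(1-3) order_refl] t])
  also have "\<dots> = cell_image (dlevel D \<tau> b) (shifted_map \<tau> \<sigma> a b) c"
  proof (rule cell_image_cong)
    fix x assume "x \<in> c"
    then have x: "x \<in> topspace (space (dlevel D \<sigma> a))" by (rule cell_topspace[OF assms(1,5)])
    show "(shifted_map \<tau> \<sigma> b b \<circ> step (dobj D \<sigma>) a b) x = shifted_map \<tau> \<sigma> a b x"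
      using step_id[OF assms(1) step_topspace[OF assms(1,4) x]] by (simp add: shifted_map_def)
  qed
  finally show ?thesis .
qed

end

section \<open>The total carrier and the chain maps that it carries\<close>

locale diagram_carrier = D: diagram_over K D + L: diagram_over K L
  for K :: "'v::linorder set set" and D :: "('v, 'a) diagram" and L :: "('v, 'b) diagram" +
  fixes k :: "'k::field itself" and \<epsilon> :: real and F :: "'v set \<Rightarrow> real \<Rightarrow> 'a set \<Rightarrow> 'b set set"
  assumes F: "eps_K_acyclic_carrier k \<epsilon> K D L F"
begin

text \<open>With a = b this is the carrier for the chain maps themselves; with a < b it contains
  both composites of the naturality square from level a to level b.\<close>

definition shifted_carrier :: "real \<Rightarrow> real \<Rightarrow> 'v set \<Rightarrow> 'v set \<Rightarrow> 'a set \<Rightarrow> 'b set set" where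
  "shifted_carrier a b \<tau> \<sigma> c = carrier_apply (F \<tau> b) (cell_image (dlevel D \<tau> b) (D.shifted_map \<tau> \<sigma> a b) c)"

definition total_carrier :: "real \<Rightarrow> real \<Rightarrow> 'v set \<times> 'a set \<Rightarrow> ('v set \<times> 'b set) set" where
  "total_carrier a b = (\<lambda>(\<sigma>, c). {(\<tau>, t). \<tau> \<subseteq> \<sigma> \<and> \<tau> \<noteq> {} \<and> t \<in> shifted_carrier a b \<tau> \<sigma> c})"

lemma in_total_carrier: "(\<tau>, t) \<in> total_carrier a b (\<sigma>, c) \<longleftrightarrow>
    \<tau> \<subseteq> \<sigma> \<and> \<tau> \<noteq> {} \<and> t \<in> shifted_carrier a b \<tau> \<sigma> c"
  by (simp add: total_carrier_def)

lemma in_shifted_carrier: "t \<in> shifted_carrier a b \<tau> \<sigma> c \<longleftrightarrow>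
    (\<exists>s\<in>cell_image (dlevel D \<tau> b) (D.shifted_map \<tau> \<sigma> a b) c. t \<in> F \<tau> b s)"
  by (simp add: shifted_carrier_def in_carrier_apply)

text \<open>The acyclicity clause of \<open>eps_K_acyclic_carrier\<close> for the shift r = b - a,
  whose composite map is \<open>shifted_map\<close>.\<close>

lemma shifted_carrier_acyclic:
  assumes "\<sigma> \<in> K" "\<tau> \<subseteq> \<sigma>" "\<tau> \<noteq> {}" "a \<le> b" "c \<in> cells (dlevel D \<sigma> a)"
  shows "acyclic_subcomplex TYPE('k) (dlevel L \<tau> (b + \<epsilon>)) (shifted_carrier a b \<tau> \<sigma> c)"
proof -
  have "\<tau> \<in> K" using D.face assms by blast
  moreover have "0 \<le> b - a" "a + (b - a) = b" using assms(4) by simp_all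
  ultimately have "acyclic_subcomplex k (dlevel L \<tau> (b + \<epsilon>)) (shifted_carrier a b \<tau> \<sigma> c)"
    using F assms(1,2,5) unfolding eps_K_acyclic_carrier_def shifted_carrier_def D.shifted_map_def
    by metis
  then show ?thesis by (simp add: acyclic_subcomplex_def)
qed

text \<open>Compatibility of \<open>F\<close> with the diagram maps moves a map of \<open>L\<close>
  after the carrier to a map of \<open>D\<close> before it.\<close>

lemma shifted_carrier_closed:
  assumes "\<sigma> \<in> K" "\<tau> \<subseteq> \<sigma>" "\<rho> \<subseteq> \<tau>" "\<rho> \<noteq> {}" "a \<le> b" "c \<in> cells (dlevel D \<sigma> a)"
    and t: "t \<in> shifted_carrier a b \<tau> \<sigma> c"
    and s: "s \<in> cell_image (dlevel L \<rho> (b + \<epsilon>)) (dmap L \<rho> \<tau> (b + \<epsilon>)) t"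
  shows "s \<in> shifted_carrier a b \<rho> \<sigma> c"
proof -
  have \<tau>\<rho>: "\<tau> \<in> K" "\<rho> \<in> K" using D.face[of \<sigma> \<tau>] D.face[of \<sigma> \<rho>] assms by auto
  obtain u where u: "u \<in> cell_image (dlevel D \<tau> b) (D.shifted_map \<tau> \<sigma> a b) c" "t \<in> F \<tau> b u"
    using t unfolding in_shifted_carrier by blast
  have uc: "u \<in> cells (dlevel D \<tau> b)" using u(1) by (simp add: cell_image_def)
  have "s \<in> subcomplex_image (dlevel L \<rho> (b + \<epsilon>)) (dmap L \<rho> \<tau> (b + \<epsilon>)) (F \<tau> b u)"
    using s u(2) unfolding subcomplex_image_def by blast
  then have "s \<in> carrier_apply (F \<rho> b) (cell_image (dlevel D \<rho> b) (dmap D \<rho> \<tau> b) u)"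
    using F \<tau>\<rho> assms(3) uc unfolding eps_K_acyclic_carrier_def by blast
  then show ?thesis
    using D.dmap_shifted_map[OF assms(1-6) u(1)] unfolding shifted_carrier_def
    by (meson carrier_apply_mono subsetD)
qed

lemma total_carrier_subset:
  assumes "x \<in> D.S a" "a \<le> b"
  shows "total_carrier a b x \<subseteq> L.S (b + \<epsilon>)"
proof
  fix y assume y: "y \<in> total_carrier a b x"
  obtain \<sigma> c \<tau> t where x: "x = (\<sigma>, c)" "y = (\<tau>, t)" by (cases x, cases y)
  have \<sigma>: "\<sigma> \<in> K" "c \<in> cells (dlevel D \<sigma> a)" using assms(1) by (simp_all add: x D.in_S)
  have \<tau>: "\<tau> \<subseteq> \<sigma>" "\<tau> \<noteq> {}" "t \<in> shifted_carrier a b \<tau> \<sigma> c" using y by (simp_all add: x in_total_carrier)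
  have "t \<in> cells (dlevel L \<tau> (b + \<epsilon>))"
    using shifted_carrier_acyclic[OF \<sigma>(1) \<tau>(1,2) assms(2) \<sigma>(2)] \<tau>(3)
    unfolding acyclic_subcomplex_def subcomplex_def by blast
  then show "y \<in> L.S (b + \<epsilon>)" using D.face[OF \<sigma>(1) \<tau>(1,2)] by (simp add: x L.in_S)
qed

lemma total_carrier_acyclic:
  assumes x: "x \<in> D.S a" and ab: "a \<le> b"
  shows "aug_acyclic (total_deg L (b + \<epsilon>))
    (total_boundary L (b + \<epsilon>) :: ('v set \<times> 'b set \<Rightarrow>\<^sub>0 'k) \<Rightarrow> _) (total_carrier a b x)"
proof -
  obtain \<sigma> c where xc: "x = (\<sigma>, c)" by (cases x)
  have \<sigma>: "\<sigma> \<in> K" and c: "c \<in> cells (dlevel D \<sigma> a)" using x by (simp_all add: xc D.in_S)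
  let ?r = "b + \<epsilon>" and ?A = "\<lambda>\<tau>. shifted_carrier a b \<tau> \<sigma> c"
  let ?\<Phi> = "{(\<tau>, t). \<tau> \<subseteq> \<sigma> \<and> \<tau> \<noteq> {} \<and> t \<in> ?A \<tau>}"
  have inS: "(\<tau>, t) \<in> L.S ?r" if "(\<tau>, t) \<in> ?\<Phi>" for \<tau> t
    using total_carrier_subset[OF x ab] that by (auto simp: xc total_carrier_def)
  have inK: "\<tau> \<in> K" "t \<in> cells (dlevel L \<tau> ?r)" if "(\<tau>, t) \<in> ?\<Phi>" for \<tau> t
    using inS[OF that] by (simp_all add: L.in_S)
  \<comment> \<open>The differential must not leave the value of the carrier, so that this value is
    a double complex of its own.\<close>
  have supp: "L.boundary_support ?r (\<tau>, t) \<subseteq> ?\<Phi>" if b: "(\<tau>, t) \<in> ?\<Phi>" for \<tau> t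
  proof
    fix y assume y: "y \<in> L.boundary_support ?r (\<tau>, t)"
    obtain \<rho> s where ys: "y = (\<rho>, s)" by (cases y)
    have t: "\<tau> \<subseteq> \<sigma>" "\<tau> \<noteq> {}" "t \<in> ?A \<tau>" using b by auto
    from y[unfolded ys L.boundary_support_def] consider
      "\<rho> = \<tau>" "s \<in> cells (dlevel L \<tau> ?r)" "s \<subseteq> cell_closure (dlevel L \<tau> ?r) t"
      | "\<rho> \<subseteq> \<tau>" "\<rho> \<noteq> {}" "s \<in> cell_image (dlevel L \<rho> ?r) (dmap L \<rho> \<tau> ?r) t"
      by (auto simp: cells_of_dim_def)
    then show "y \<in> ?\<Phi>"
    proof cases
      case 1
      \<comment> \<open>Vertical terms: the closed cell of \<open>t\<close> lies in the union of
        \<open>?A \<tau>\<close>, and since cells are nonempty and disjoint, a cell inside this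
        union is one of its members.\<close>
      have A: "subcomplex (dlevel L \<tau> ?r) (?A \<tau>)"
        using shifted_carrier_acyclic[OF \<sigma> t(1,2) ab c] by (simp add: acyclic_subcomplex_def)
      interpret R: regular_complex "dlevel L \<tau> ?r"
        by unfold_locales (rule L.regular[OF inK(1)[OF b]])
      have "s \<subseteq> \<Union>(?A \<tau>)" using A t(3) 1(3) unfolding subcomplex_def by blast
      moreover have "s \<noteq> {}" by (rule R.cell_nonempty[OF 1(2)])
      ultimately obtain s' where s': "s' \<in> ?A \<tau>" "s \<inter> s' \<noteq> {}" by blast
      have "s' \<in> cells (dlevel L \<tau> ?r)" using A s'(1) unfolding subcomplex_def by blast
      then have "s = s'" using R.disjoint[OF 1(2)] s'(2) by blast
      then show ?thesis using 1(1) s'(1) t by (simp add: ys)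
    next
      case 2
      then show ?thesis using shifted_carrier_closed[OF \<sigma> t(1) 2(1,2) ab c t(3)] t(1) by (auto simp: ys)
    qed
  qed
  have acyc: "aug_acyclic (\<lambda>t. int (cell_dim (dlevel L \<tau> ?r) t)) (L.bdc \<tau> ?r :: ('b set \<Rightarrow>\<^sub>0 'k) \<Rightarrow> _) (?A \<tau>)"
    if "\<tau> \<subseteq> \<sigma>" "\<tau> \<noteq> {}" for \<tau>
    by (rule acyclic_subcomplex_aug_acyclic[OF L.normal[OF D.face[OF \<sigma> that]] shifted_carrier_acyclic[OF \<sigma> that ab c]])
  have "simplex_double_complex \<sigma> ?A (\<lambda>\<tau> t. int (cell_dim (dlevel L \<tau> ?r) t)) (\<lambda>\<tau>. L.bdc \<tau> ?r :: ('b set \<Rightarrow>\<^sub>0 'k) \<Rightarrow> _)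
      (\<lambda>\<rho> \<tau>. L.pm \<rho> \<tau> ?r) (total_deg L ?r) (total_boundary L ?r) ?\<Phi>"
  proof (rule simplex_double_complex.intro)
    show "finite \<sigma>" "\<sigma> \<noteq> {}" using D.simplex[OF \<sigma>] by blast+
    show "aug_acyclic (\<lambda>t. int (cell_dim (dlevel L \<tau> ?r) t)) (L.bdc \<tau> ?r :: ('b set \<Rightarrow>\<^sub>0 'k) \<Rightarrow> _) (?A \<tau>)"
      if "\<tau> \<subseteq> \<sigma>" "\<tau> \<noteq> {}" for \<tau> by (rule acyc[OF that])
  next
    fix \<tau> t assume b: "(\<tau>, t) \<in> ?\<Phi>"
    show "total_deg L ?r (\<tau>, t) = int (card \<tau>) - 1 + int (cell_dim (dlevel L \<tau> ?r) t)"
      by (simp add: total_deg_def)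
    show "coeff_sum (L.bdc \<tau> ?r (basis_vec t) :: _ \<Rightarrow>\<^sub>0 'k) = 0" if "int (cell_dim (dlevel L \<tau> ?r) t) = 1"
      unfolding cellular_boundary_basis
      by (rule coeff_sum_cell_boundary[OF L.regular[OF inK(1)[OF b]] inK(2)[OF b]]) (use that in simp)
    show "(L.bdc \<tau> ?r (basis_vec t) :: _ \<Rightarrow>\<^sub>0 'k) = 0" if "int (cell_dim (dlevel L \<tau> ?r) t) = 0"
      unfolding cellular_boundary_basis by (rule L.cell_boundary_zero) (use that in simp)
    show "coeff_sum (L.pm \<rho> \<tau> ?r (basis_vec t) :: _ \<Rightarrow>\<^sub>0 'k) = 1"
      if "\<rho> \<subseteq> \<tau>" "\<rho> \<noteq> {}" "int (cell_dim (dlevel L \<tau> ?r) t) = 0" for \<rho>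
      unfolding cellular_map_basis
      by (rule L.coeff_sum_cell_push[OF inK(1)[OF b] that(1,2) inK(2)[OF b]]) (use that in simp)
  next
    fix y assume y: "y \<in> ?\<Phi>"
    obtain \<tau> t where yt: "y = (\<tau>, t)" by (cases y)
    note b = y[unfolded yt]
    show "(total_boundary L ?r (basis_vec y) :: _ \<Rightarrow>\<^sub>0 'k) \<in>
        span_on {b' \<in> ?\<Phi>. total_deg L ?r b' = total_deg L ?r y - 1 \<and> card (fst b') \<le> card (fst y)}"
      unfolding yt
    proof (rule span_on_mono[OF _ L.total_boundary_support[OF inS[OF b]]], rule subsetI)
      fix z assume z: "z \<in> L.boundary_support ?r (\<tau>, t)"
      show "z \<in> {b' \<in> ?\<Phi>. total_deg L ?r b' = total_deg L ?r (\<tau>, t) - 1 \<and> card (fst b') \<le> card (fst (\<tau>, t))}"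
        using subsetD[OF supp[OF b] z] L.boundary_support_subset(2,3)[OF inS[OF b], of "fst z" "snd z"] z by simp
    qed
    show "total_boundary L ?r (total_boundary L ?r (basis_vec y) :: _ \<Rightarrow>\<^sub>0 'k) = 0"
      unfolding yt by (rule L.total_boundary_total_boundary[OF inS[OF b]])
    show "coeff_sum (total_boundary L ?r (basis_vec y) :: _ \<Rightarrow>\<^sub>0 'k) = 0" if "total_deg L ?r y = 1"
      unfolding yt by (rule L.total_boundary_coeff_sum[OF inS[OF b] that[unfolded yt]])
  qed (simp_all only: refl lin_cellular_boundary lin_cellular_map L.lin_total_boundary of_nat_0_le_iff L.total_boundary_basis)
  then have "aug_acyclic (total_deg L ?r) (total_boundary L ?r :: ('v set \<times> 'b set \<Rightarrow>\<^sub>0 'k) \<Rightarrow> _) ?\<Phi>"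
    by (rule simplex_double_complex.total_acyclic)
  then show ?thesis by (simp add: xc total_carrier_def)
qed

lemma total_carrier_mono:
  assumes x: "x \<in> D.S a" and ab: "a \<le> b"
    and y: "y \<in> Poly_Mapping.keys (total_boundary D a (basis_vec x) :: _ \<Rightarrow>\<^sub>0 'k)"
  shows "total_carrier a b y \<subseteq> total_carrier a b x"
proof
  fix z assume z: "z \<in> total_carrier a b y"
  obtain \<sigma> c \<rho> t \<tau> u where eq: "x = (\<sigma>, c)" "y = (\<rho>, t)" "z = (\<tau>, u)" by (cases x, cases y, cases z)
  have \<sigma>: "\<sigma> \<in> K" and c: "c \<in> cells (dlevel D \<sigma> a)" using x by (simp_all add: eq D.in_S)
  have \<tau>: "\<tau> \<subseteq> \<rho>" "\<tau> \<noteq> {}" "u \<in> shifted_carrier a b \<tau> \<rho> t" using z by (simp_all add: eq in_total_carrier)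
  have supp: "(\<rho>, t) \<in> D.boundary_support a (\<sigma>, c)"
    using span_on_iff[THEN iffD1, OF D.total_boundary_support[OF x[unfolded eq]]] y unfolding eq by (rule subsetD)
  then consider "\<rho> = \<sigma>" "t \<subseteq> cell_closure (dlevel D \<sigma> a) c"
    | "\<rho> \<subseteq> \<sigma>" "t \<in> cell_image (dlevel D \<rho> a) (dmap D \<rho> \<sigma> a) c"
    unfolding D.boundary_support_def by auto
  then have "\<rho> \<subseteq> \<sigma> \<and> cell_image (dlevel D \<tau> b) (D.shifted_map \<tau> \<rho> a b) t
      \<subseteq> cell_image (dlevel D \<tau> b) (D.shifted_map \<tau> \<sigma> a b) c"
  proof cases
    case 1
    then show ?thesis
      using cell_image_mono[OF D.shifted_map_continuous[OF \<sigma> _ \<tau>(2) ab] 1(2)] \<tau>(1) by simp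
  next
    case 2
    then show ?thesis using D.shifted_map_face[OF \<sigma> 2(1) \<tau>(1,2) ab c 2(2)] by simp
  qed
  then show "z \<in> total_carrier a b x"
    using \<tau> unfolding eq in_total_carrier in_shifted_carrier by blast
qed

text \<open>Two levels are allowed so that composites with structure maps are covered. The
  augmentation clause is there because a homotopy can start only if augmentations agree in degree
  0.\<close>

definition carried :: "real \<Rightarrow> real \<Rightarrow> (('v set \<times> 'a set \<Rightarrow>\<^sub>0 'k) \<Rightarrow> ('v set \<times> 'b set \<Rightarrow>\<^sub>0 'k)) \<Rightarrow> bool" where
  "carried a b f \<longleftrightarrow> lin f \<and> (\<forall>x\<in>D.S a.
    f (basis_vec x) \<in> span_on {y \<in> total_carrier a b x. total_deg L (b + \<epsilon>) y = total_deg D a x} \<and>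
    total_boundary L (b + \<epsilon>) (f (basis_vec x)) = f (total_boundary D a (basis_vec x)) \<and>
    (total_deg D a x = 0 \<longrightarrow> coeff_sum (f (basis_vec x)) = 1))"

lemma carried_exists: "\<exists>f. carried a a f"
  unfolding carried_def
  by (rule acyclic_carrier_chain_map[OF D.total_based_complex L.total_based_complex])
    (use total_carrier_subset total_carrier_acyclic total_carrier_mono in auto)

lemma total_carrier_filt_part:
  assumes "x \<in> D.S a" "a \<le> b"
  shows "span_on {y \<in> total_carrier a b x. total_deg L (b + \<epsilon>) y = n}
    \<subseteq> filt_part (L.S (b + \<epsilon>)) (total_deg L (b + \<epsilon>)) simplex_deg (simplex_deg x) n"
proof
  fix z :: "'v set \<times> 'b set \<Rightarrow>\<^sub>0 'c" assume z: "z \<in> span_on {y \<in> total_carrier a b x. total_deg L (b + \<epsilon>) y = n}"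
  have "simplex_deg y \<le> simplex_deg x" if "y \<in> total_carrier a b x" for y
  proof -
    obtain \<sigma> c \<tau> t where eq: "x = (\<sigma>, c)" "y = (\<tau>, t)" by (cases x, cases y)
    have "finite \<sigma>" using D.simplex(1) assms(1) by (auto simp: eq D.in_S)
    moreover have "\<tau> \<subseteq> \<sigma>" using that by (simp add: eq in_total_carrier)
    ultimately have "card \<tau> \<le> card \<sigma>" by (rule card_mono)
    then show ?thesis by (simp add: eq simplex_deg_def)
  qed
  then show "z \<in> filt_part (L.S (b + \<epsilon>)) (total_deg L (b + \<epsilon>)) simplex_deg (simplex_deg x) n"
    unfolding filt_part_def using total_carrier_subset[OF assms]
    by (intro span_on_mono[OF _ z]) blast
qed

lemma carried_filtered_map:
  assumes "carried a b f" "a \<le> b"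
  shows "filtered_map (D.S a) (total_deg D a) simplex_deg (total_boundary D a)
    (L.S (b + \<epsilon>)) (total_deg L (b + \<epsilon>)) simplex_deg (total_boundary L (b + \<epsilon>)) f"
  using assms(1) total_carrier_filt_part[OF _ assms(2)] unfolding carried_def filtered_map_def by blast

lemma carried_ss_map_eq:
  assumes f: "carried a b f" and g: "carried a b g" and ab: "a \<le> b" and r: "1 \<le> r"
    and c: "c \<in> carrier (page (filtered_spec_seq (D.S a) (total_deg D a) simplex_deg (total_boundary D a)) r p q)"
  shows "ss_map (L.S (b + \<epsilon>)) (total_deg L (b + \<epsilon>)) simplex_deg (total_boundary L (b + \<epsilon>)) f r p q c
    = ss_map (L.S (b + \<epsilon>)) (total_deg L (b + \<epsilon>)) simplex_deg (total_boundary L (b + \<epsilon>)) g r p q c"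
proof -
  have "\<exists>h. lin h \<and> (\<forall>x\<in>D.S a. h (basis_vec x)
      \<in> span_on {y \<in> total_carrier a b x. total_deg L (b + \<epsilon>) y = total_deg D a x + 1} \<and>
      total_boundary L (b + \<epsilon>) (h (basis_vec x)) + h (total_boundary D a (basis_vec x))
        = f (basis_vec x) - g (basis_vec x))"
    by (rule acyclic_carrier_homotopy[OF D.total_based_complex L.total_based_complex])
      (use f g ab total_carrier_subset total_carrier_acyclic total_carrier_mono in \<open>auto simp: carried_def\<close>)
  then obtain h where h: "lin h" "\<And>x. x \<in> D.S a \<Longrightarrow> h (basis_vec x)
      \<in> span_on {y \<in> total_carrier a b x. total_deg L (b + \<epsilon>) y = total_deg D a x + 1}"
    "\<And>x. x \<in> D.S a \<Longrightarrow> total_boundary L (b + \<epsilon>) (h (basis_vec x)) + h (total_boundary D a (basis_vec x))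
        = f (basis_vec x) - g (basis_vec x)" by blast
  show ?thesis
    by (rule ss_map_homotopic[OF D.total_filtered_complex L.total_filtered_complex
          carried_filtered_map[OF f ab] carried_filtered_map[OF g ab] h(1) _ h(3) r c])
      (use h(2) total_carrier_filt_part[OF _ ab] in blast)+
qed

lemma carriedD:
  assumes "carried a b f"
  shows "lin f"
    and "x \<in> D.S a \<Longrightarrow> y \<in> Poly_Mapping.keys (f (basis_vec x)) \<Longrightarrow> y \<in> total_carrier a b x"
    and "x \<in> D.S a \<Longrightarrow> y \<in> Poly_Mapping.keys (f (basis_vec x)) \<Longrightarrow> total_deg L (b + \<epsilon>) y = total_deg D a x"
    and "x \<in> D.S a \<Longrightarrow> total_deg D a x = 0 \<Longrightarrow> coeff_sum (f (basis_vec x)) = 1"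
  using assms unfolding carried_def span_on_iff by auto

lemma carriedI:
  assumes f: "filtered_map (D.S a) (total_deg D a) simplex_deg (total_boundary D a)
      (L.S (b + \<epsilon>)) (total_deg L (b + \<epsilon>)) simplex_deg (total_boundary L (b + \<epsilon>)) f"
    and supp: "\<And>\<sigma> c \<tau> t. (\<sigma>, c) \<in> D.S a \<Longrightarrow> (\<tau>, t) \<in> Poly_Mapping.keys (f (basis_vec (\<sigma>, c))) \<Longrightarrow>
      \<tau> \<subseteq> \<sigma> \<and> \<tau> \<noteq> {} \<and> t \<in> shifted_carrier a b \<tau> \<sigma> c"
    and aug: "\<And>x. x \<in> D.S a \<Longrightarrow> total_deg D a x = 0 \<Longrightarrow> coeff_sum (f (basis_vec x)) = 1"
  shows "carried a b f"
  unfolding carried_def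
proof (intro conjI ballI impI)
  show "lin f" using f by (simp add: filtered_map_def)
  fix x assume x: "x \<in> D.S a"
  have fx: "f (basis_vec x) \<in> filt_part (L.S (b + \<epsilon>)) (total_deg L (b + \<epsilon>)) simplex_deg (simplex_deg x) (total_deg D a x)"
    and bd: "total_boundary L (b + \<epsilon>) (f (basis_vec x)) = f (total_boundary D a (basis_vec x))"
    using f x by (simp_all add: filtered_map_def)
  show "f (basis_vec x) \<in> span_on {y \<in> total_carrier a b x. total_deg L (b + \<epsilon>) y = total_deg D a x}"
    unfolding span_on_iff
  proof
    fix y assume y: "y \<in> Poly_Mapping.keys (f (basis_vec x))"
    obtain \<sigma> c \<tau> t where eq: "x = (\<sigma>, c)" "y = (\<tau>, t)" by (cases x, cases y)
    have "y \<in> total_carrier a b x"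
      using supp[OF x[unfolded eq] y[unfolded eq]] unfolding eq in_total_carrier .
    moreover have "total_deg L (b + \<epsilon>) y = total_deg D a x"
      using fx y unfolding filt_part_def span_on_iff by blast
    ultimately show "y \<in> {y \<in> total_carrier a b x. total_deg L (b + \<epsilon>) y = total_deg D a x}" by simp
  qed
  show "total_boundary L (b + \<epsilon>) (f (basis_vec x)) = f (total_boundary D a (basis_vec x))" by (rule bd)
  show "coeff_sum (f (basis_vec x)) = 1" if "total_deg D a x = 0" by (rule aug[OF x that])
qed

lemma carrier_step:
  assumes "\<tau> \<in> K" "a \<le> b" "u \<in> cells (dlevel D \<tau> a)" "t \<in> F \<tau> a u"
    and s: "s \<in> cell_image (dlevel L \<tau> (b + \<epsilon>)) (step (dobj L \<tau>) (a + \<epsilon>) (b + \<epsilon>)) t"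
  shows "s \<in> carrier_apply (F \<tau> b) (cell_image (dlevel D \<tau> b) (step (dobj D \<tau>) a b) u)"
proof -
  have "eps_acyclic_carrier k \<epsilon> (dobj D \<tau>) (dobj L \<tau>) (F \<tau>)"
    using F assms(1) unfolding eps_K_acyclic_carrier_def by simp
  then have "subcomplex_image (dlevel L \<tau> (b + \<epsilon>)) (step (dobj L \<tau>) (a + \<epsilon>) (b + \<epsilon>)) (F \<tau> a u)
      \<subseteq> carrier_apply (F \<tau> b) (cell_image (dlevel D \<tau> b) (step (dobj D \<tau>) a b) u)"
    using assms(2,3) unfolding eps_acyclic_carrier_def Let_def by simp
  moreover have "s \<in> subcomplex_image (dlevel L \<tau> (b + \<epsilon>)) (step (dobj L \<tau>) (a + \<epsilon>) (b + \<epsilon>)) (F \<tau> a u)"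
    using s assms(4) unfolding subcomplex_image_def by (rule UN_I[rotated])
  ultimately show ?thesis by (rule subsetD)
qed

text \<open>One side of the naturality square. Compatibility of \<open>F\<close> with the filtration
  turns the step in \<open>L\<close> after the chain map into a step in \<open>D\<close> before the
  carrier.\<close>

lemma carried_step:
  assumes f: "carried a a f" and ab: "a \<le> b"
  shows "carried a b (\<lambda>x. total_step L (a + \<epsilon>) (b + \<epsilon>) (f x))"
proof (rule carriedI)
  have ab': "a + \<epsilon> \<le> b + \<epsilon>" using ab by simp
  show "filtered_map (D.S a) (total_deg D a) simplex_deg (total_boundary D a)
      (L.S (b + \<epsilon>)) (total_deg L (b + \<epsilon>)) simplex_deg (total_boundary L (b + \<epsilon>))
      (\<lambda>x. total_step L (a + \<epsilon>) (b + \<epsilon>) (f x))"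
    by (rule filtered_map_comp[OF D.total_filtered_complex L.total_filtered_complex L.total_filtered_complex
          carried_filtered_map[OF f order_refl] L.total_step_filtered_map[OF ab']])
  have inS: "y \<in> L.S (a + \<epsilon>)" if "x \<in> D.S a" "y \<in> Poly_Mapping.keys (f (basis_vec x))" for x y
    by (rule subsetD[OF total_carrier_subset[OF that(1) order_refl] carriedD(2)[OF f that]])
  show "\<tau> \<subseteq> \<sigma> \<and> \<tau> \<noteq> {} \<and> t \<in> shifted_carrier a b \<tau> \<sigma> c"
    if x: "(\<sigma>, c) \<in> D.S a"
      and t: "(\<tau>, t) \<in> Poly_Mapping.keys (total_step L (a + \<epsilon>) (b + \<epsilon>) (f (basis_vec (\<sigma>, c))))" for \<sigma> c \<tau> t
  proof -
    have \<sigma>: "\<sigma> \<in> K" and c: "c \<in> cells (dlevel D \<sigma> a)" using x by (simp_all add: D.in_S)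
    obtain y where y: "y \<in> Poly_Mapping.keys (f (basis_vec (\<sigma>, c)))"
      "(\<tau>, t) \<in> Poly_Mapping.keys (total_step L (a + \<epsilon>) (b + \<epsilon>) (basis_vec y :: _ \<Rightarrow>\<^sub>0 'k))"
      using keys_lin[OF L.lin_total_step t] ..
    obtain \<rho> s where ys: "y = (\<rho>, s)" by (cases y)
    have \<rho>: "\<rho> \<subseteq> \<sigma>" "\<rho> \<noteq> {}" "s \<in> shifted_carrier a a \<rho> \<sigma> c"
      using carriedD(2)[OF f x y(1)] unfolding ys in_total_carrier by blast+
    have \<rho>K: "\<rho> \<in> K" by (rule D.face[OF \<sigma> \<rho>(1,2)])
    have \<tau>: "\<tau> = \<rho>" "t \<in> cell_image (dlevel L \<rho> (b + \<epsilon>)) (step (dobj L \<rho>) (a + \<epsilon>) (b + \<epsilon>)) s"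
      using subsetD[OF L.total_step_support[OF inS[OF x y(1), unfolded ys] ab'] y(2)[unfolded ys]] by auto
    obtain u where u: "u \<in> cell_image (dlevel D \<rho> a) (D.shifted_map \<rho> \<sigma> a a) c" "s \<in> F \<rho> a u"
      using \<rho>(3) unfolding in_shifted_carrier ..
    have uc: "u \<in> cells (dlevel D \<rho> a)" using u(1) by (simp add: cell_image_def)
    have "t \<in> shifted_carrier a b \<rho> \<sigma> c"
      unfolding shifted_carrier_def
      by (rule subsetD[OF carrier_apply_mono[OF D.step_shifted_map[OF \<sigma> \<rho>(1,2) ab c u(1)]]
            carrier_step[OF \<rho>K ab uc u(2) \<tau>(2)]])
    then show ?thesis using \<rho>(1,2) \<tau>(1) by simp
  qed
  show "coeff_sum (total_step L (a + \<epsilon>) (b + \<epsilon>) (f (basis_vec x))) = 1"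
    if x: "x \<in> D.S a" and deg: "total_deg D a x = 0" for x
  proof -
    have "coeff_sum (total_step L (a + \<epsilon>) (b + \<epsilon>) (f (basis_vec x))) = coeff_sum (f (basis_vec x)) * 1"
    proof (rule coeff_sum_lin[OF L.lin_total_step])
      fix y assume y: "y \<in> Poly_Mapping.keys (f (basis_vec x))"
      obtain \<rho> s where ys: "y = (\<rho>, s)" by (cases y)
      have "total_deg L (a + \<epsilon>) y = 0" using carriedD(3)[OF f x y] deg by simp
      then show "coeff_sum (total_step L (a + \<epsilon>) (b + \<epsilon>) (basis_vec y) :: _ \<Rightarrow>\<^sub>0 'k) = 1"
        unfolding ys by (rule L.coeff_sum_total_step[OF inS[OF x y, unfolded ys] ab'])
    qed
    then show ?thesis using carriedD(4)[OF f x deg] by simp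
  qed
qed

text \<open>The other side of the square: the step comes first, and functoriality of the structure
  maps places the result in the same carrier.\<close>

lemma step_carried:
  assumes f: "carried b b f" and ab: "a \<le> b"
  shows "carried a b (\<lambda>x. f (total_step D a b x))"
proof (rule carriedI)
  show "filtered_map (D.S a) (total_deg D a) simplex_deg (total_boundary D a)
      (L.S (b + \<epsilon>)) (total_deg L (b + \<epsilon>)) simplex_deg (total_boundary L (b + \<epsilon>))
      (\<lambda>x. f (total_step D a b x))"
    by (rule filtered_map_comp[OF D.total_filtered_complex D.total_filtered_complex L.total_filtered_complex
          D.total_step_filtered_map[OF ab] carried_filtered_map[OF f order_refl]])
  show "\<tau> \<subseteq> \<sigma> \<and> \<tau> \<noteq> {} \<and> t \<in> shifted_carrier a b \<tau> \<sigma> c"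
    if x: "(\<sigma>, c) \<in> D.S a"
      and t: "(\<tau>, t) \<in> Poly_Mapping.keys (f (total_step D a b (basis_vec (\<sigma>, c))))" for \<sigma> c \<tau> t
  proof -
    have \<sigma>: "\<sigma> \<in> K" and c: "c \<in> cells (dlevel D \<sigma> a)" using x by (simp_all add: D.in_S)
    obtain y where y: "y \<in> Poly_Mapping.keys (total_step D a b (basis_vec (\<sigma>, c)) :: _ \<Rightarrow>\<^sub>0 'k)"
      "(\<tau>, t) \<in> Poly_Mapping.keys (f (basis_vec y))"
      using keys_lin[OF carriedD(1)[OF f] t] ..
    obtain s where s: "y = (\<sigma>, s)" "s \<in> cell_image (dlevel D \<sigma> b) (step (dobj D \<sigma>) a b) c"
      using subsetD[OF D.total_step_support[OF x ab] y(1)] by blast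
    have "(\<sigma>, s) \<in> D.S b" using \<sigma> s(2) by (simp add: D.in_S cell_image_def)
    from carriedD(2)[OF f this y(2)[unfolded s(1)]]
    have \<tau>: "\<tau> \<subseteq> \<sigma>" "\<tau> \<noteq> {}" "t \<in> shifted_carrier b b \<tau> \<sigma> s" unfolding in_total_carrier by blast+
    have "t \<in> shifted_carrier a b \<tau> \<sigma> c"
      unfolding shifted_carrier_def
      by (rule subsetD[OF carrier_apply_mono[OF D.shifted_map_step[OF \<sigma> \<tau>(1,2) ab c s(2)]]
            \<tau>(3)[unfolded shifted_carrier_def]])
    then show ?thesis using \<tau> by simp
  qed
  show "coeff_sum (f (total_step D a b (basis_vec x))) = 1"
    if x: "x \<in> D.S a" and deg: "total_deg D a x = 0" for x
  proof -
    obtain \<sigma> c where xc: "x = (\<sigma>, c)" by (cases x)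
    note x' = x[unfolded xc]
    have "coeff_sum (f (total_step D a b (basis_vec (\<sigma>, c)))) =
        coeff_sum (total_step D a b (basis_vec (\<sigma>, c)) :: _ \<Rightarrow>\<^sub>0 'k) * 1"
    proof (rule coeff_sum_lin[OF carriedD(1)[OF f]])
      fix y assume "y \<in> Poly_Mapping.keys (total_step D a b (basis_vec (\<sigma>, c)) :: _ \<Rightarrow>\<^sub>0 'k)"
      from subsetD[OF span_on_iff[THEN iffD1, OF D.total_step_degree[OF x' ab]] this]
      have "y \<in> D.S b" "total_deg D b y = 0" using deg xc by simp_all
      then show "coeff_sum (f (basis_vec y)) = 1" by (rule carriedD(4)[OF f])
    qed
    then show ?thesis using D.coeff_sum_total_step[OF x' ab deg[unfolded xc], where 'k = 'k] by (simp add: xc)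
  qed
qed

lemma carried_pss_morphism:
  assumes f: "\<And>a. carried a a (f a)"
  shows "pss_morphism 1 (diagram_spec_seq K D) (pss_shift \<epsilon> (diagram_spec_seq K L))
    (\<lambda>a. ss_map (L.S (a + \<epsilon>)) (total_deg L (a + \<epsilon>)) simplex_deg (total_boundary L (a + \<epsilon>)) (f a))"
  unfolding pss_morphism_def pss_shift_def diagram_spec_seq_def
    pers_spec_seq.select_convs
proof (intro conjI allI impI ballI)
  note C = D.total_filtered_complex and C' = L.total_filtered_complex
  note fm = carried_filtered_map[OF f order_refl]
  show "ss_morphism 1 (filtered_spec_seq (D.S a) (total_deg D a) simplex_deg (total_boundary D a))
      (filtered_spec_seq (L.S (a + \<epsilon>)) (total_deg L (a + \<epsilon>)) simplex_deg (total_boundary L (a + \<epsilon>)))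
      (ss_map (L.S (a + \<epsilon>)) (total_deg L (a + \<epsilon>)) simplex_deg (total_boundary L (a + \<epsilon>)) (f a))" for a
    by (rule ss_map_morphism[OF C C' fm])
  fix a b :: real and r :: nat and p q :: int and x :: "('v set \<times> 'a set \<Rightarrow>\<^sub>0 'k) set"
  assume ab: "a \<le> b" and r: "1 \<le> r"
    and x: "x \<in> carrier (page (filtered_spec_seq (D.S a) (total_deg D a) simplex_deg (total_boundary D a)) r p q)"
  have ab': "a + \<epsilon> \<le> b + \<epsilon>" using ab by simp
  show "ss_map (L.S (b + \<epsilon>)) (total_deg L (b + \<epsilon>)) simplex_deg (total_boundary L (b + \<epsilon>)) (f b) r p q
      (ss_map (D.S b) (total_deg D b) simplex_deg (total_boundary D b) (total_step D a b) r p q x) =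
    ss_map (L.S (b + \<epsilon>)) (total_deg L (b + \<epsilon>)) simplex_deg (total_boundary L (b + \<epsilon>)) (total_step L (a + \<epsilon>) (b + \<epsilon>)) r p q
      (ss_map (L.S (a + \<epsilon>)) (total_deg L (a + \<epsilon>)) simplex_deg (total_boundary L (a + \<epsilon>)) (f a) r p q x)"
    unfolding ss_map_comp[OF C C C' D.total_step_filtered_map[OF ab] fm x]
      ss_map_comp[OF C C' C' fm L.total_step_filtered_map[OF ab'] x]
    by (rule carried_ss_map_eq[OF step_carried[OF f ab] carried_step[OF f ab] ab r x])
qed

end

text \<open>One half of the hypotheses, with a shift carrier on the first diagram only; the theorem
  uses it a second time with the diagrams and the carriers exchanged.\<close>

locale carrier_pair = F: diagram_carrier K D L k \<epsilon> F + G: diagram_carrier K L D k \<epsilon> G +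
    I: diagram_carrier K D D k "2 * \<epsilon>" I
  for K :: "'v::linorder set set" and D :: "('v, 'a) diagram" and L :: "('v, 'b) diagram"
    and k :: "'k::field itself" and \<epsilon> F G I +
  assumes eps: "0 \<le> \<epsilon>"
    and comp: "\<tau> \<in> K \<Longrightarrow> c \<in> cells (dlevel D \<tau> a) \<Longrightarrow> carrier_comp (G \<tau> (a + \<epsilon>)) (F \<tau> a) c \<subseteq> I \<tau> a c"
    and shift: "\<tau> \<in> K \<Longrightarrow> shift_carrier k (2 * \<epsilon>) (dobj D \<tau>) (I \<tau>)"
begin

lemma eps_eps: "a + \<epsilon> + \<epsilon> = a + 2 * \<epsilon>"
  by simp

text \<open>The hypothesis compares G after F with I over a single simplex, whereas the two chain
  maps may each pass to a smaller face. Both passages are first moved into \<open>D\<close>, after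
  which everything happens over the final face \<open>\<tau>\<close>.\<close>

lemma carried_comp:
  assumes f: "F.carried a a f" and g: "G.carried (a + \<epsilon>) (a + \<epsilon>) g"
  shows "I.carried a a (\<lambda>x. g (f x))"
proof (rule I.carriedI)
  show "filtered_map (F.D.S a) (total_deg D a) simplex_deg (total_boundary D a)
      (F.D.S (a + 2 * \<epsilon>)) (total_deg D (a + 2 * \<epsilon>)) simplex_deg (total_boundary D (a + 2 * \<epsilon>)) (\<lambda>x. g (f x))"
    by (rule filtered_map_comp[OF F.D.total_filtered_complex F.L.total_filtered_complex F.D.total_filtered_complex
          F.carried_filtered_map[OF f order_refl] G.carried_filtered_map[OF g order_refl, unfolded eps_eps]])
  have inS: "y \<in> F.L.S (a + \<epsilon>)" if "x \<in> F.D.S a" "y \<in> Poly_Mapping.keys (f (basis_vec x))" for x y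
    by (rule subsetD[OF F.total_carrier_subset[OF that(1) order_refl] F.carriedD(2)[OF f that]])
  show "\<tau> \<subseteq> \<sigma> \<and> \<tau> \<noteq> {} \<and> t \<in> I.shifted_carrier a a \<tau> \<sigma> c"
    if x: "(\<sigma>, c) \<in> F.D.S a" and t: "(\<tau>, t) \<in> Poly_Mapping.keys (g (f (basis_vec (\<sigma>, c))))" for \<sigma> c \<tau> t
  proof -
    have \<sigma>: "\<sigma> \<in> K" and c: "c \<in> cells (dlevel D \<sigma> a)" using x by (simp_all add: F.D.in_S)
    obtain y where y: "y \<in> Poly_Mapping.keys (f (basis_vec (\<sigma>, c)))" "(\<tau>, t) \<in> Poly_Mapping.keys (g (basis_vec y))"
      using keys_lin[OF G.carriedD(1)[OF g] t] ..
    obtain \<rho> s where ys: "y = (\<rho>, s)" by (cases y)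
    have \<rho>: "\<rho> \<subseteq> \<sigma>" "\<rho> \<noteq> {}" "s \<in> F.shifted_carrier a a \<rho> \<sigma> c"
      using F.carriedD(2)[OF f x y(1)] unfolding ys F.in_total_carrier by blast+
    have \<rho>s: "\<rho> \<in> K" "s \<in> cells (dlevel L \<rho> (a + \<epsilon>))"
      using inS[OF x y(1)] unfolding ys F.L.in_S by blast+
    have \<tau>: "\<tau> \<subseteq> \<rho>" "\<tau> \<noteq> {}" "t \<in> G.shifted_carrier (a + \<epsilon>) (a + \<epsilon>) \<tau> \<rho> s"
      using G.carriedD(2)[OF g inS[OF x y(1)] y(2)] unfolding ys G.in_total_carrier by blast+
    obtain v where v: "v \<in> cell_image (dlevel L \<tau> (a + \<epsilon>)) (dmap L \<tau> \<rho> (a + \<epsilon>)) s" "t \<in> G \<tau> (a + \<epsilon>) v"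
      using \<tau>(3) unfolding G.in_shifted_carrier F.L.shifted_map_zero[OF \<rho>s] ..
    \<comment> \<open>Passing from \<open>\<rho>\<close> to \<open>\<tau>\<close> in
      \<open>L\<close> is replaced by passing to \<open>\<tau>\<close> already in \<open>D\<close>,
      so that F and G are both evaluated over \<open>\<tau>\<close>.\<close>
    have "v \<in> F.shifted_carrier a a \<tau> \<sigma> c"
      by (rule F.shifted_carrier_closed[OF \<sigma> \<rho>(1) \<tau>(1,2) order_refl c \<rho>(3) v(1)])
    then obtain u where u: "u \<in> cell_image (dlevel D \<tau> a) (F.D.shifted_map \<tau> \<sigma> a a) c" "v \<in> F \<tau> a u"
      unfolding F.in_shifted_carrier ..
    have "t \<in> carrier_comp (G \<tau> (a + \<epsilon>)) (F \<tau> a) u"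
      unfolding carrier_comp_def carrier_apply_def using u(2) v(2) by (rule UN_I)
    moreover have "\<tau> \<in> K" by (rule F.D.face[OF \<rho>s(1) \<tau>(1,2)])
    moreover have "u \<in> cells (dlevel D \<tau> a)" using u(1) by (simp add: cell_image_def)
    ultimately have "t \<in> I \<tau> a u" using comp by blast
    then have "t \<in> I.shifted_carrier a a \<tau> \<sigma> c"
      unfolding I.in_shifted_carrier using u(1) by (rule bexI)
    then show ?thesis using \<rho>(1) \<tau>(1,2) by simp
  qed
  show "coeff_sum (g (f (basis_vec x))) = 1" if x: "x \<in> F.D.S a" and deg: "total_deg D a x = 0" for x
  proof -
    have "coeff_sum (g (f (basis_vec x))) = coeff_sum (f (basis_vec x)) * 1"
    proof (rule coeff_sum_lin[OF G.carriedD(1)[OF g]])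
      fix y assume y: "y \<in> Poly_Mapping.keys (f (basis_vec x))"
      have "total_deg L (a + \<epsilon>) y = 0" using F.carriedD(3)[OF f x y] deg by simp
      then show "coeff_sum (g (basis_vec y)) = 1" by (rule G.carriedD(4)[OF g inS[OF x y]])
    qed
    then show ?thesis using F.carriedD(4)[OF f x deg] by simp
  qed
qed

text \<open>The step keeps a cell over its simplex, so in the total carrier only the face
  \<open>\<tau> = \<sigma>\<close> is involved, and there the shift carrier contains its
  support.\<close>

lemma total_step_carried: "I.carried a a (total_step D a (a + 2 * \<epsilon>))"
proof (rule I.carriedI)
  have le: "a \<le> a + 2 * \<epsilon>" using eps by simp
  show "filtered_map (F.D.S a) (total_deg D a) simplex_deg (total_boundary D a)
      (F.D.S (a + 2 * \<epsilon>)) (total_deg D (a + 2 * \<epsilon>)) simplex_deg (total_boundary D (a + 2 * \<epsilon>))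
      (total_step D a (a + 2 * \<epsilon>))"
    by (rule F.D.total_step_filtered_map[OF le])
  show "\<tau> \<subseteq> \<sigma> \<and> \<tau> \<noteq> {} \<and> t \<in> I.shifted_carrier a a \<tau> \<sigma> c"
    if x: "(\<sigma>, c) \<in> F.D.S a"
      and t: "(\<tau>, t) \<in> Poly_Mapping.keys (total_step D a (a + 2 * \<epsilon>) (basis_vec (\<sigma>, c)) :: _ \<Rightarrow>\<^sub>0 'k)" for \<sigma> c \<tau> t
  proof -
    have \<sigma>: "\<sigma> \<in> K" and c: "c \<in> cells (dlevel D \<sigma> a)" using x by (simp_all add: F.D.in_S)
    let ?p = "cell_push (dlevel D \<sigma> a) (dlevel D \<sigma> (a + 2 * \<epsilon>)) (step (dobj D \<sigma>) a (a + 2 * \<epsilon>)) c :: _ \<Rightarrow>\<^sub>0 'k"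
    have \<tau>: "\<tau> = \<sigma>" "t \<in> Poly_Mapping.keys ?p"
      using t unfolding F.D.total_step_basis keys_at_simplex by auto
    have "carried_by (dlevel D \<sigma> a)
        (cellular_map (dlevel D \<sigma> a) (dlevel D \<sigma> (a + 2 * \<epsilon>)) (step (dobj D \<sigma>) a (a + 2 * \<epsilon>)) :: _ \<Rightarrow> (_ \<Rightarrow>\<^sub>0 'k)) (I \<sigma> a)"
      using shift[OF \<sigma>] unfolding shift_carrier_def by blast
    then have "Poly_Mapping.keys ?p \<subseteq> I \<sigma> a c"
      using c unfolding carried_by_def by (simp add: cellular_map_basis)
    with \<tau>(2) have tI: "t \<in> I \<sigma> a c" by blast
    have top: "c \<subseteq> topspace (space (dlevel D \<sigma> a))" using F.D.cell_topspace[OF \<sigma> c] by blast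
    \<comment> \<open>The carrier is a union over cells reached by the diagram map; \<open>c\<close>
      itself must be among them, which holds because that map is the identity on the points of
      \<open>c\<close>.\<close>
    have "dmap D \<sigma> \<sigma> a ` c = c" using F.D.dmap_id[OF \<sigma>] top by (simp add: subset_iff image_def)
    then have "c \<in> cell_image (dlevel D \<sigma> a) (F.D.shifted_map \<sigma> \<sigma> a a) c"
      unfolding F.D.shifted_map_zero[OF \<sigma> c] unfolding cell_image_def
      using c closure_of_subset[OF top] by simp
    with tI have "t \<in> I.shifted_carrier a a \<sigma> \<sigma> c" unfolding I.in_shifted_carrier by (rule bexI)
    then show ?thesis using \<tau>(1) F.D.simplex(2)[OF \<sigma>] by simp
  qed
  show "coeff_sum (total_step D a (a + 2 * \<epsilon>) (basis_vec x) :: _ \<Rightarrow>\<^sub>0 'k) = 1"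
    if x: "x \<in> F.D.S a" and deg: "total_deg D a x = 0" for x
    using F.D.coeff_sum_total_step[of "fst x" "snd x" a "a + 2 * \<epsilon>", where 'k = 'k] x deg le by simp
qed

lemma carried_comp_ss_map:
  assumes f: "F.carried a a f" and g: "G.carried (a + \<epsilon>) (a + \<epsilon>) g" and r: "1 \<le> r"
    and x: "x \<in> carrier (page (ss_at (diagram_spec_seq K D) a) r p q)"
  shows "ss_map (F.D.S (a + \<epsilon> + \<epsilon>)) (total_deg D (a + \<epsilon> + \<epsilon>)) simplex_deg (total_boundary D (a + \<epsilon> + \<epsilon>)) g r p q
      (ss_map (F.L.S (a + \<epsilon>)) (total_deg L (a + \<epsilon>)) simplex_deg (total_boundary L (a + \<epsilon>)) f r p q x)
    = ss_step (diagram_spec_seq K D) a (a + 2 * \<epsilon>) r p q x"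
proof -
  have x': "x \<in> carrier (page (filtered_spec_seq (F.D.S a) (total_deg D a) simplex_deg (total_boundary D a)) r p q)"
    using x by (simp add: diagram_spec_seq_def)
  have "ss_map (F.D.S (a + 2 * \<epsilon>)) (total_deg D (a + 2 * \<epsilon>)) simplex_deg (total_boundary D (a + 2 * \<epsilon>)) (\<lambda>x. g (f x)) r p q x
    = ss_map (F.D.S (a + 2 * \<epsilon>)) (total_deg D (a + 2 * \<epsilon>)) simplex_deg (total_boundary D (a + 2 * \<epsilon>)) (total_step D a (a + 2 * \<epsilon>)) r p q x"
    by (rule I.carried_ss_map_eq[OF carried_comp[OF f g] total_step_carried order_refl r x'])
  then show ?thesis
    unfolding eps_eps ss_map_comp[OF F.D.total_filtered_complex F.L.total_filtered_complex F.D.total_filtered_complex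
        F.carried_filtered_map[OF f order_refl] G.carried_filtered_map[OF g order_refl, unfolded eps_eps] x']
    by (simp add: diagram_spec_seq_def)
qed

end

theorem theorem6p5:
  fixes K :: "'v::linorder set set"
    and \<epsilon> :: real
    and D :: "('v, 'a) diagram"
    and L :: "('v, 'b) diagram"
    and F :: "'v set \<Rightarrow> real \<Rightarrow> 'a set \<Rightarrow> 'b set set"
    and G :: "'v set \<Rightarrow> real \<Rightarrow> 'b set \<Rightarrow> 'a set set"
    and I\<^sub>D :: "'v set \<Rightarrow> real \<Rightarrow> 'a set \<Rightarrow> 'a set set"
    and I\<^sub>L :: "'v set \<Rightarrow> real \<Rightarrow> 'b set \<Rightarrow> 'b set set"
  assumes "simplicial_complex K"
    and "\<epsilon> \<ge> 0"
    and "regular_diagram K D"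
    and "regular_diagram K L"
    and "eps_K_acyclic_carrier TYPE('k::field) \<epsilon> K D L F"
    and "eps_K_acyclic_carrier TYPE('k) \<epsilon> K L D G"
    and "shift_K_acyclic_carrier TYPE('k) (2 * \<epsilon>) K D I\<^sub>D"
    and "shift_K_acyclic_carrier TYPE('k) (2 * \<epsilon>) K L I\<^sub>L"
    and "\<And>\<tau> a c. \<tau> \<in> K \<Longrightarrow> c \<in> cells (dlevel D \<tau> a) \<Longrightarrow>
           carrier_comp (G \<tau> (a + \<epsilon>)) (F \<tau> a) c \<subseteq> I\<^sub>D \<tau> a c"
    and "\<And>\<tau> a c. \<tau> \<in> K \<Longrightarrow> c \<in> cells (dlevel L \<tau> a) \<Longrightarrow>
           carrier_comp (F \<tau> (a + \<epsilon>)) (G \<tau> a) c \<subseteq> I\<^sub>L \<tau> a c"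
  shows "interleaving_distance 1
           (diagram_spec_seq K D :: ('k, ('v set \<times> 'a set \<Rightarrow>\<^sub>0 'k) set) pers_spec_seq)
           (diagram_spec_seq K L :: ('k, ('v set \<times> 'b set \<Rightarrow>\<^sub>0 'k) set) pers_spec_seq)
         \<le> ereal \<epsilon>"
proof -
  let ?D = "diagram_spec_seq K D :: ('k, ('v set \<times> 'a set \<Rightarrow>\<^sub>0 'k) set) pers_spec_seq"
  let ?L = "diagram_spec_seq K L :: ('k, ('v set \<times> 'b set \<Rightarrow>\<^sub>0 'k) set) pers_spec_seq"
  have I: "eps_K_acyclic_carrier TYPE('k) (2 * \<epsilon>) K D D I\<^sub>D" "eps_K_acyclic_carrier TYPE('k) (2 * \<epsilon>) K L L I\<^sub>L"
    and sh: "\<tau> \<in> K \<Longrightarrow> shift_carrier TYPE('k) (2 * \<epsilon>) (dobj D \<tau>) (I\<^sub>D \<tau>)"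
      "\<tau> \<in> K \<Longrightarrow> shift_carrier TYPE('k) (2 * \<epsilon>) (dobj L \<tau>) (I\<^sub>L \<tau>)" for \<tau>
    using assms(7,8) unfolding shift_K_acyclic_carrier_def by blast+
  interpret P: carrier_pair K D L "TYPE('k)" \<epsilon> F G I\<^sub>D
    by unfold_locales (rule assms I sh; assumption?)+
  interpret Q: carrier_pair K L D "TYPE('k)" \<epsilon> G F I\<^sub>L
    by unfold_locales (rule assms I sh; assumption?)+
  \<comment> \<open>Chain maps are picked level by level without any coherence between levels;
    compatibility with the structure maps is recovered on the pages from 1 on.\<close>
  have "\<forall>a. \<exists>f. P.F.carried a a f" "\<forall>a. \<exists>g. P.G.carried a a g"
    using P.F.carried_exists P.G.carried_exists by blast+
  then obtain f g where f: "\<And>a. P.F.carried a a (f a)" and g: "\<And>a. P.G.carried a a (g a)"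
    unfolding choice_iff by blast
  define \<psi> where "\<psi> a = ss_map (P.F.L.S (a + \<epsilon>)) (total_deg L (a + \<epsilon>)) simplex_deg (total_boundary L (a + \<epsilon>)) (f a)" for a
  define \<phi> where "\<phi> a = ss_map (P.F.D.S (a + \<epsilon>)) (total_deg D (a + \<epsilon>)) simplex_deg (total_boundary D (a + \<epsilon>)) (g a)" for a
  have \<psi>: "pss_morphism 1 ?D (pss_shift \<epsilon> ?L) \<psi>"
    unfolding \<psi>_def by (rule P.F.carried_pss_morphism[OF f])
  have \<phi>: "pss_morphism 1 ?L (pss_shift \<epsilon> ?D) \<phi>"
    unfolding \<phi>_def by (rule P.G.carried_pss_morphism[OF g])
  have "\<phi> (a + \<epsilon>) r p q (\<psi> a r p q x) = ss_step ?D a (a + 2 * \<epsilon>) r p q x"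
    if "1 \<le> r" "x \<in> carrier (page (ss_at ?D a) r p q)" for a r p q x
    unfolding \<phi>_def \<psi>_def by (rule P.carried_comp_ss_map[OF f g that])
  moreover have "\<psi> (a + \<epsilon>) r p q (\<phi> a r p q x) = ss_step ?L a (a + 2 * \<epsilon>) r p q x"
    if "1 \<le> r" "x \<in> carrier (page (ss_at ?L a) r p q)" for a r p q x
    unfolding \<phi>_def \<psi>_def by (rule Q.carried_comp_ss_map[OF g f that])
  ultimately have "interleaved \<epsilon> 1 ?D ?L"
    unfolding interleaved_def using P.F.D.diagram_persistent P.F.L.diagram_persistent \<psi> \<phi> by blast
  then show ?thesis
    unfolding interleaving_distance_def by (intro Inf_lower CollectI exI[of _ \<epsilon>] conjI refl assms(2))
qed

end
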